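(* Fix $T>0$, and let $m\in\mathbb{N}$ and $h_1,\ldots,h_m\in\mathfrak{g}_{CM}$. Then there exist real random variables $\tilde z,\hat z\in L^{\infty-}=\bigcap_{p\ge1}L^p(\mathbb{P})$, depending on $h_1,\ldots,h_m$, such that for every Fréchet smooth function $f:G\to\mathbb{R}$ for which $f$ and all its right derivatives $\hat k_1\cdots\hat k_n f$ ($n\in\mathbb{N}$, $k_1,\ldots,k_n\in\mathfrak{g}_{CM}$) are polynomially bounded, \[ \mathbb{E}\big[(\tilde h_1\cdots\tilde h_m f)(\xi_T)\big]=\mathbb{E}[f(\xi_T)\tilde z]\quad\text{and}\quad \mathbb{E}\big[(\hat h_1\cdots\hat h_m f)(\xi_T)\big]=\mathbb{E}[f(\xi_T)\hat z]. \]
   Context: Setting. Let $(W,H,\mu)$ be an abstract Wiener space: $W$ is a real separable Banach space with Gaussian measure $\mu$ and Cameron-Martin space $H$. Let $\mathbf{C}$ be a finite-dimensional real inner product space and $\omega:W\times W\to\mathbf{C}$ a continuous skew-symmetric bilinear form. Let $\mathfrak{g}=W\times\mathbf{C}$ with Lie bracket $[(X_1,V_1),(X_2,V_2)]=(0,\omega(X_1,X_2))$, and let $G=W\times\mathbf{C}$ with group law $(w_1,c_1)\cdot(w_2,c_2)=(w_1+w_2,\,c_1+c_2+\tfrac12\omega(w_1,w_2))$ (identity $(0,0)$, inverse $g^{-1}=-g$); $G$ is a Heisenberg-like group. As Banach spaces $\mathfrak{g}=G$ carry the norm $\|(w,c)\|_{\mathfrak{g}}=\|w\|_W+\|c\|_{\mathbf{C}}$.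 Let $\mathfrak{g}_{CM}=H\times\mathbf{C}\subset\mathfrak{g}$ be the Cameron-Martin subalgebra, a Hilbert space with $\langle(A,a),(B,b)\rangle_{\mathfrak{g}_{CM}}=\langle A,B\rangle_H+\langle a,b\rangle_{\mathbf{C}}$. Brownian motion. Let $H_*=\{h\in H:\langle\cdot,h\rangle_H \text{ extends to a continuous linear functional on } W\}$. Let $\{(B_t,B^0_t)\}_{t\ge0}$ be a continuous $\mathfrak{g}$-valued Brownian motion on a probability space $(\Omega,\mathbb{P})$, with $\mathbb{E}[\langle(B_s,B^0_s),(A,a)\rangle_{\mathfrak{g}_{CM}}\langle(B_t,B^0_t),(C,c)\rangle_{\mathfrak{g}_{CM}}]=\langle(A,a),(C,c)\rangle_{\mathfrak{g}_{CM}}\min(s,t)$ for $A,C\in H_*$, $a,c\in\mathbf{C}$ (so $B$ and $B^0$ are independent). The Brownian motion on $G$ is $\xi_t=\big(B_t,\,B^0_t+\tfrac12\int_0^t\omega(B_s,dB_s)\big)$, where $\int_0^t\omega(B_s,dB_s)$ is the continuous Itô integral obtained as the limit (uniformly on $[0,T]$, in every $L^p$) of $\int_0^t\omega(P_nB_s,dP_nB_s)$, with $P_n$ finite-rank orthogonal projections of $H$ with ranges in $H_*$ (extended continuously to $W$) increasing to the identity of $H$. Vector fields. For $h\in\mathfrak{g}$ and $f:G\to\mathbb{R}$ Fréchet smooth, $(\hat hf)(g)=\frac{d}{d\varepsilon}\big|_{0}f(\varepsilon h\cdot g)$ (right invariant) and $(\tilde hf)(g)=\frac{d}{d\varepsilon}\big|_{0}f(g\cdot\varepsilon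 h)$ (left invariant). A function $F$ on a normed space $X$ is polynomially bounded if there are $K,M<\infty$ with $|F(x)|\le K(1+\|x\|_X)^M$ for all $x\in X$. *)

theory Defs
  imports "HOL-Probability.Probability"
begin

text \<open>
  The abstract Wiener space \<open>(W, H, \<mu>)\<close> is modelled by a type \<open>'w\<close> for \<open>W\<close>, a type \<open>'h\<close> for the
  Cameron-Martin space \<open>H\<close>, and the inclusion \<open>\<iota> :: 'h \<Rightarrow> 'w\<close>.  Thus the group \<open>G\<close> and the Lie
  algebra \<open>\<gg>\<close> are \<open>'w \<times> 'c\<close>, while the Hilbert space \<open>\<gg>\<^sub>C\<^sub>M\<close> is \<open>'h \<times> 'c\<close> with the inner product of
  the product type.
\<close>

section \<open>Abstract Wiener spaces\<close>

text \<open>Gaussian measures are centred and nondegenerate; the latter makes \<open>H\<close> dense in \<open>W\<close>.\<close>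

definition gaussian_measure :: "'a::real_normed_vector measure \<Rightarrow> bool" where
  "gaussian_measure \<nu> \<longleftrightarrow> prob_space \<nu> \<and> sets \<nu> = sets borel \<and>
     (\<forall>u :: 'a \<Rightarrow>\<^sub>L real. u \<noteq> 0 \<longrightarrow>
       (\<exists>\<sigma>>0. distributed \<nu> lborel (blinfun_apply u) (\<lambda>r. ennreal (normal_density 0 \<sigma> r))))"

text \<open>
  \<open>\<parallel>w\<parallel>\<^sub>H = sup {\<bar>u w\<bar> / sqrt (q u) | u \<in> W\<^sup>*, u \<noteq> 0}\<close> where \<open>q u = \<integral> u\<^sup>2 d\<mu>\<close>; the value is infinite exactly
  when \<open>w\<close> lies outside the Cameron-Martin space.
\<close>

definition cm_norm :: "'w::real_normed_vector measure \<Rightarrow> 'w \<Rightarrow> ennreal" where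
  "cm_norm \<mu> w =
     (SUP u\<in>{u :: 'w \<Rightarrow>\<^sub>L real. u \<noteq> 0}.
        ennreal (\<bar>blinfun_apply u w\<bar> / sqrt (\<integral>v. (blinfun_apply u v)\<^sup>2 \<partial>\<mu>)))"

definition abstract_wiener_space ::
  "('h::real_inner \<Rightarrow> 'w::real_normed_vector) \<Rightarrow> 'w measure \<Rightarrow> bool" where
  "abstract_wiener_space \<iota> \<mu> \<longleftrightarrow> gaussian_measure \<mu> \<and> linear \<iota> \<and>
     range \<iota> = {w. cm_norm \<mu> w < \<infinity>} \<and> (\<forall>h. cm_norm \<mu> (\<iota> h) = ennreal (norm h))"

definition H_star :: "('h::real_inner \<Rightarrow> 'w::real_normed_vector) \<Rightarrow> 'h set" where
  "H_star \<iota> = {h. \<exists>u :: 'w \<Rightarrow>\<^sub>L real. \<forall>k. u (\<iota> k) = inner k h}"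

text \<open>The continuous extension of \<open>\<langle>\<cdot>, h\<rangle>\<^sub>H\<close> to \<open>W\<close>, for \<open>h\<close> in \<open>H_star \<iota>\<close>; it is unique as \<open>H\<close> is
  dense in \<open>W\<close>.\<close>

definition cm_functional ::
  "('h::real_inner \<Rightarrow> 'w::real_normed_vector) \<Rightarrow> 'h \<Rightarrow> 'w \<Rightarrow>\<^sub>L real" where
  "cm_functional \<iota> h = (THE u :: 'w \<Rightarrow>\<^sub>L real. \<forall>k. u (\<iota> k) = inner k h)"

definition cm_projection :: "('h::real_inner \<Rightarrow> 'w::real_normed_vector) \<Rightarrow> ('h \<Rightarrow> 'h) \<Rightarrow> bool" where
  "cm_projection \<iota> p \<longleftrightarrow> linear p \<and> (\<forall>h. p (p h) = p h) \<and>
     (\<forall>h k. inner (p h) k = inner h (p k)) \<and>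
     (\<exists>E. finite E \<and> range p = span E) \<and> range p \<subseteq> H_star \<iota>"

text \<open>\<open>P n\<close> is the continuous extension to \<open>W\<close> of the projection \<open>p n\<close> of \<open>H\<close>.\<close>

definition cm_projection_sequence ::
  "('h::real_inner \<Rightarrow> 'w::real_normed_vector) \<Rightarrow> (nat \<Rightarrow> 'h \<Rightarrow> 'h) \<Rightarrow> (nat \<Rightarrow> 'w \<Rightarrow>\<^sub>L 'w) \<Rightarrow> bool" where
  "cm_projection_sequence \<iota> p P \<longleftrightarrow>
     (\<forall>n. cm_projection \<iota> (p n)) \<and> (\<forall>n. range (p n) \<subseteq> range (p (Suc n))) \<and>
     (\<forall>h. (\<lambda>n. p n h) \<longlonglongrightarrow> h) \<and> (\<forall>n h. P n (\<iota> h) = \<iota> (p n h))"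

section \<open>The Heisenberg-like group and its invariant vector fields\<close>

definition heis_mult ::
  "('w \<Rightarrow> 'w \<Rightarrow> 'c) \<Rightarrow> 'w \<times> 'c \<Rightarrow> 'w \<times> 'c \<Rightarrow> ('w::real_vector) \<times> ('c::real_vector)" where
  "heis_mult \<omega> g g' =
     (fst g + fst g', snd g + snd g' + (1/2) *\<^sub>R \<omega> (fst g) (fst g'))"

definition hat_field ::
  "('w \<Rightarrow> 'w \<Rightarrow> 'c) \<Rightarrow> 'w \<times> 'c \<Rightarrow> ('w \<times> 'c \<Rightarrow> real) \<Rightarrow>
     ('w::real_vector) \<times> ('c::real_vector) \<Rightarrow> real" where
  "hat_field \<omega> h f g = deriv (\<lambda>\<epsilon>. f (heis_mult \<omega> (\<epsilon> *\<^sub>R h) g)) 0"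

definition tilde_field ::
  "('w \<Rightarrow> 'w \<Rightarrow> 'c) \<Rightarrow> 'w \<times> 'c \<Rightarrow> ('w \<times> 'c \<Rightarrow> real) \<Rightarrow>
     ('w::real_vector) \<times> ('c::real_vector) \<Rightarrow> real" where
  "tilde_field \<omega> h f g = deriv (\<lambda>\<epsilon>. f (heis_mult \<omega> g (\<epsilon> *\<^sub>R h))) 0"

definition cm_embed :: "('h \<Rightarrow> 'w) \<Rightarrow> 'h \<times> 'c \<Rightarrow> 'w \<times> 'c" where
  "cm_embed \<iota> h = (\<iota> (fst h), snd h)"

text \<open>\<open>iter_hat \<omega> \<iota> [k\<^sub>1, \<dots>, k\<^sub>n] f\<close> applies the field of \<open>k\<^sub>n\<close> first and that of \<open>k\<^sub>1\<close> last.\<close>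

definition iter_hat ::
  "('w \<Rightarrow> 'w \<Rightarrow> 'c) \<Rightarrow> ('h \<Rightarrow> 'w) \<Rightarrow> ('h \<times> 'c) list \<Rightarrow> ('w \<times> 'c \<Rightarrow> real) \<Rightarrow>
     ('w::real_vector) \<times> ('c::real_vector) \<Rightarrow> real" where
  "iter_hat \<omega> \<iota> ks f = foldr (\<lambda>k. hat_field \<omega> (cm_embed \<iota> k)) ks f"

definition iter_tilde ::
  "('w \<Rightarrow> 'w \<Rightarrow> 'c) \<Rightarrow> ('h \<Rightarrow> 'w) \<Rightarrow> ('h \<times> 'c) list \<Rightarrow> ('w \<times> 'c \<Rightarrow> real) \<Rightarrow>
     ('w::real_vector) \<times> ('c::real_vector) \<Rightarrow> real" where
  "iter_tilde \<omega> \<iota> ks f = foldr (\<lambda>k. tilde_field \<omega> (cm_embed \<iota> k)) ks f"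

definition polynomially_bounded ::
  "(('w::real_normed_vector) \<times> ('c::real_normed_vector) \<Rightarrow> real) \<Rightarrow> bool" where
  "polynomially_bounded F \<longleftrightarrow>
     (\<exists>K M :: real. \<forall>g. \<bar>F g\<bar> \<le> K * (1 + (norm (fst g) + norm (snd g))) powr M)"

text \<open>
  The \<open>n\<close>-th Frechet derivative at \<open>x\<close> is a bounded \<open>n\<close>-linear form, represented by its values
  \<open>D n x [v\<^sub>1, \<dots>, v\<^sub>n]\<close> on lists of length \<open>n\<close>.  The last clause of \<open>frechet_smooth\<close> says that \<open>D (Suc n)\<close> is
  the Frechet derivative of \<open>D n\<close> with respect to the operator norm on bounded \<open>n\<close>-linear forms.
  The norm of the product type is equivalent to \<open>norm (fst g) + norm (snd g)\<close>, so that
  smoothness on \<open>'w \<times> 'c\<close> does not depend on this choice.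
\<close>

definition bounded_multilinear_form :: "nat \<Rightarrow> ('a::real_normed_vector list \<Rightarrow> real) \<Rightarrow> bool" where
  "bounded_multilinear_form n A \<longleftrightarrow>
     (\<forall>vs j. length vs = n \<and> j < n \<longrightarrow> linear (\<lambda>v. A (vs[j := v]))) \<and>
     (\<exists>K. \<forall>vs. length vs = n \<longrightarrow> \<bar>A vs\<bar> \<le> K * prod_list (map norm vs))"

definition frechet_smooth :: "('a::real_normed_vector \<Rightarrow> real) \<Rightarrow> bool" where
  "frechet_smooth f \<longleftrightarrow>
     (\<exists>D :: nat \<Rightarrow> 'a \<Rightarrow> 'a list \<Rightarrow> real.
        (\<forall>x. D 0 x [] = f x) \<and>
        (\<forall>n x. bounded_multilinear_form n (D n x)) \<and>
        (\<forall>n x. \<forall>e>0. \<exists>d>0. \<forall>y. norm (y - x) < d \<longrightarrow>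
           (\<forall>vs. length vs = n \<longrightarrow>
              \<bar>D n y vs - D n x vs - D (Suc n) x ((y - x) # vs)\<bar>
                \<le> e * norm (y - x) * prod_list (map norm vs))))"

section \<open>Brownian motion and the Ito integral\<close>

text \<open>\<open>X t x\<close> is the pair \<open>(B\<^sub>t, B\<^sup>0\<^sub>t)\<close> at the sample point \<open>x\<close>.\<close>

definition brownian_motion ::
  "'s measure \<Rightarrow> ('h::real_inner \<Rightarrow> 'w) \<Rightarrow>
     (real \<Rightarrow> 's \<Rightarrow> ('w::real_normed_vector) \<times> ('c::real_inner)) \<Rightarrow> bool" where
  "brownian_motion M \<iota> X \<longleftrightarrow>
     (\<forall>t\<ge>0. X t \<in> borel_measurable M) \<and>
     (\<forall>x\<in>space M. X 0 x = 0 \<and> continuous_on {0..} (\<lambda>t. X t x)) \<and>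
     (\<forall>(n::nat) \<tau>. 0 \<le> \<tau> 0 \<and> incseq \<tau> \<longrightarrow>
        prob_space.indep_vars M (\<lambda>_. borel) (\<lambda>j x. X (\<tau> (Suc j)) x - X (\<tau> j) x) {..<n}) \<and>
     (\<forall>s t. 0 \<le> s \<and> s < t \<longrightarrow> gaussian_measure (distr M borel (\<lambda>x. X t x - X s x))) \<and>
     (\<forall>A\<in>H_star \<iota>. \<forall>C\<in>H_star \<iota>. \<forall>a c. \<forall>s\<ge>0. \<forall>t\<ge>0.
        (\<integral>x. (cm_functional \<iota> A (fst (X s x)) + inner (snd (X s x)) a) *
              (cm_functional \<iota> C (fst (X t x)) + inner (snd (X t x)) c) \<partial>M)
          = inner (A, a) (C, c) * min s t)"

definition natural_filtration ::
  "'s measure \<Rightarrow> (real \<Rightarrow> 's \<Rightarrow> 'b::topological_space) \<Rightarrow> real \<Rightarrow> 's measure" where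
  "natural_filtration M X t =
     sigma (space M) {X r -` A \<inter> space M | r A. r \<in> {0..t} \<and> A \<in> sets borel}"

text \<open>
  The data \<open>n, \<tau>, \<eta>\<close> encode the simple process which equals \<open>\<eta> j\<close> on the interval
  \<open>(\<tau> j, \<tau> (j + 1)]\<close> for \<open>j < n\<close> and vanishes elsewhere.
\<close>

definition adapted_simple ::
  "'s measure \<Rightarrow> (real \<Rightarrow> 's measure) \<Rightarrow> nat \<Rightarrow> (nat \<Rightarrow> real) \<Rightarrow>
     (nat \<Rightarrow> 's \<Rightarrow> 'a::real_normed_vector) \<Rightarrow> bool" where
  "adapted_simple M F n \<tau> \<eta> \<longleftrightarrow> 0 \<le> \<tau> 0 \<and> incseq \<tau> \<and>
     (\<forall>j<n. \<eta> j \<in> borel_measurable (F (\<tau> j)) \<and> (\<exists>K. \<forall>x\<in>space M. norm (\<eta> j x) \<le> K))"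

definition simple_process ::
  "nat \<Rightarrow> (nat \<Rightarrow> real) \<Rightarrow> (nat \<Rightarrow> 's \<Rightarrow> 'a::real_vector) \<Rightarrow> real \<Rightarrow> 's \<Rightarrow> 'a" where
  "simple_process n \<tau> \<eta> s x = (\<Sum>j<n. indicator {\<tau> j<..\<tau> (Suc j)} s *\<^sub>R \<eta> j x)"

definition simple_integral ::
  "('a \<Rightarrow> 'b \<Rightarrow> 'c) \<Rightarrow> nat \<Rightarrow> (nat \<Rightarrow> real) \<Rightarrow> (nat \<Rightarrow> 's \<Rightarrow> 'a) \<Rightarrow> (real \<Rightarrow> 's \<Rightarrow> 'b::real_vector) \<Rightarrow>
     real \<Rightarrow> 's \<Rightarrow> 'c::real_vector" where
  "simple_integral b n \<tau> \<eta> Z t x =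
     (\<Sum>j<n. b (\<eta> j x) (Z (min t (\<tau> (Suc j))) x - Z (min t (\<tau> j)) x))"

text \<open>\<open>I t\<close> is the continuous Ito integral of \<open>b (Y s) (dZ s)\<close> over \<open>0 \<le> s \<le> t\<close>, as an \<open>L\<^sup>2\<close> limit of
  integrals of simple processes approximating \<open>Y\<close>; the integrator \<open>Z\<close> is meant to be Brownian in
  a finite-dimensional subspace.\<close>

definition ito_integral ::
  "'s measure \<Rightarrow> (real \<Rightarrow> 's measure) \<Rightarrow> ('a \<Rightarrow> 'b \<Rightarrow> 'c) \<Rightarrow> (real \<Rightarrow> 's \<Rightarrow> 'a::real_normed_vector) \<Rightarrow>
     (real \<Rightarrow> 's \<Rightarrow> 'b::real_normed_vector) \<Rightarrow> (real \<Rightarrow> 's \<Rightarrow> 'c::real_normed_vector) \<Rightarrow> bool" where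
  "ito_integral M F b Y Z I \<longleftrightarrow>
     (\<forall>t\<ge>0. I t \<in> borel_measurable M) \<and>
     (\<forall>x\<in>space M. continuous_on {0..} (\<lambda>t. I t x)) \<and>
     (\<forall>T>0. \<exists>n \<tau> \<eta>. (\<forall>k. adapted_simple M F (n k) (\<tau> k) (\<eta> k)) \<and>
        (\<lambda>k. \<integral>\<^sup>+x. (\<integral>\<^sup>+s\<in>{0..T}. ennreal ((norm (simple_process (n k) (\<tau> k) (\<eta> k) s x - Y s x))\<^sup>2)
               \<partial>lborel) \<partial>M) \<longlonglongrightarrow> 0 \<and>
        (\<forall>t\<in>{0..T}.
          (\<lambda>k. \<integral>\<^sup>+x. ennreal ((norm (simple_integral b (n k) (\<tau> k) (\<eta> k) Z t x - I t x))\<^sup>2) \<partial>M)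
            \<longlonglongrightarrow> 0))"

text \<open>\<open>I t\<close> is the integral of \<open>\<omega> (B\<^sub>s) (dB\<^sub>s)\<close> over \<open>0 \<le> s \<le> t\<close> for \<open>X = (B, B\<^sup>0)\<close>.  This limit does not
  depend on the sequence of projections.\<close>

definition wiener_ito_integral ::
  "'s measure \<Rightarrow> ('h::real_inner \<Rightarrow> 'w) \<Rightarrow> ('w \<Rightarrow> 'w \<Rightarrow> 'c) \<Rightarrow>
     (real \<Rightarrow> 's \<Rightarrow> ('w::real_normed_vector) \<times> ('c::real_normed_vector)) \<Rightarrow>
     (real \<Rightarrow> 's \<Rightarrow> 'c) \<Rightarrow> bool" where
  "wiener_ito_integral M \<iota> \<omega> X I \<longleftrightarrow>
     (\<forall>t\<ge>0. I t \<in> borel_measurable M) \<and>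
     (\<forall>x\<in>space M. continuous_on {0..} (\<lambda>t. I t x)) \<and>
     (\<exists>p P J. cm_projection_sequence \<iota> p P \<and>
        (\<forall>n. ito_integral M (natural_filtration M X) \<omega>
               (\<lambda>t x. P n (fst (X t x))) (\<lambda>t x. P n (fst (X t x))) (J n)) \<and>
        (\<forall>T>0. \<forall>r\<ge>1.
          (\<lambda>n. \<integral>\<^sup>+x. (SUP t\<in>{0..T}. ennreal (norm (J n t x - I t x) powr r)) \<partial>M) \<longlonglongrightarrow> 0))"

definition heis_brownian ::
  "(real \<Rightarrow> 's \<Rightarrow> 'w \<times> 'c) \<Rightarrow> (real \<Rightarrow> 's \<Rightarrow> 'c) \<Rightarrow> real \<Rightarrow> 's \<Rightarrow> 'w \<times> ('c::real_vector)" where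
  "heis_brownian X I t x = (fst (X t x), snd (X t x) + (1/2) *\<^sub>R I t x)"

definition in_all_Lp :: "'s measure \<Rightarrow> ('s \<Rightarrow> real) \<Rightarrow> bool" where
  "in_all_Lp M z \<longleftrightarrow> z \<in> borel_measurable M \<and> (\<forall>p\<ge>1. integrable M (\<lambda>x. \<bar>z x\<bar> powr p))"

end

theory Submission
  imports Defs "HOL-Probability.Probability"
begin

text \<open>
  Fix \<open>A\<close> in \<open>H\<close> and let \<open>\<Theta>\<close> be the normalised Gaussian variable paired with \<open>A\<close> at time \<open>T\<close>.  Removing from
  \<open>B\<^sub>t\<close> its projection \<open>t \<Theta> D\<close>, with \<open>D\<close> a multiple of \<open>A\<close>, leaves a process independent of \<open>\<Theta>\<close>.  As
  \<open>\<omega> D D = 0\<close>, the Riemann sums of the Ito integral are affine in \<open>\<Theta>\<close>, with a slope that is a Gaussian variable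
  orthogonal to \<open>\<Theta>\<close>; orthogonality lets both coefficients pass to the limit.  Thus \<open>f \<xi>\<close> is a function of \<open>\<Theta>\<close>
  and of independent data, and one-dimensional Gaussian integration by parts applies.  The resulting derivative is the
  right-invariant derivative of \<open>f\<close> along \<open>A\<close> plus central derivatives with Gaussian coefficients; central directions
  are treated in the same way.  All weights are polynomials in Gaussian variables, a class stable under the
  procedure, which can therefore be iterated.  A left-invariant field is a right-invariant one plus central
  fields whose coefficients are again Gaussian.
\<close>

subsection \<open>Norming functionals\<close>

text \<open>Two features of the setting shape the argument. The Ito integral is known only through
  limits: simple integrals with unspecified adapted integrands, then a sequence of projections. Such
  integrands need not be affine in \<Theta>, so they are first traded for left-point Riemann sums,
  by an isometry that tolerates overlapping intervals; one diagonal choice of projection and mesh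
  then serves all components. Moreover the weights must be fixed before \<open>f\<close>. Hence
  \<open>ibp\<close> asks for one weight that is good for all \<open>nice\<close> functions, and the
  iteration moves a weight through the outermost field first. Only right-invariant derivatives along
  H x C are bounded by hypothesis, so every derivative that appears is rewritten through them.
  Integrability needs moments of all orders of the norm of the endpoint: Fernique's argument for the
  Banach space part, and a Gronwall estimate, uniform in the mesh, for the stochastic
  integral.\<close>

definition sublinear :: "('a::real_vector \<Rightarrow> real) \<Rightarrow> bool" where
  "sublinear p \<longleftrightarrow> (\<forall>x y. p (x + y) \<le> p x + p y) \<and> (\<forall>c\<ge>0. \<forall>x. p (c *\<^sub>R x) = c * p x)"

lemma sublinearD:
  assumes "sublinear p"
  shows "p (x + y) \<le> p x + p y" "c \<ge> 0 \<Longrightarrow> p (c *\<^sub>R x) = c * p x" "p 0 = 0" "- p (- x) \<le> p x"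
proof -
  show *: "p (x + y) \<le> p x + p y" for x y using assms by (simp add: sublinear_def)
  show "c \<ge> 0 \<Longrightarrow> p (c *\<^sub>R x) = c * p x" for c x using assms by (simp add: sublinear_def)
  from this[of 0 0] show 0: "p 0 = 0" by simp
  show "- p (- x) \<le> p x" using *[of x "-x"] 0 by simp
qed

text \<open>Applied to a minimal \<open>p\<close>, the construction returns \<open>p\<close> itself, and this forces \<open>p\<close> to be additive.\<close>

lemma sublinear_shift:
  fixes p :: "'a::real_vector \<Rightarrow> real" and x :: 'a
  assumes p: "sublinear p"
  defines "q \<equiv> (\<lambda>z. INF t\<in>{0..}. p (z + t *\<^sub>R x) - t * p x)"
  shows "sublinear q" "q z \<le> p z" "q z \<le> p (z + x) - p x"
proof -
  note pD = sublinearD[OF p]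
  have bdd: "bdd_below ((\<lambda>t. p (z + t *\<^sub>R x) - t * p x) ` {0..})" for z
  \<comment> \<open>Subadditivity for t x = (z + t x) + (-z) gives t p(x) \<le> p(z + t x) + p(-z),
    so the infimum is finite.\<close>
  proof (rule bdd_belowI2[where m = "- p (- z)"])
    fix t :: real assume "t \<in> {0..}"
    then show "- p (- z) \<le> p (z + t *\<^sub>R x) - t * p x"
      using pD(1)[of "z + t *\<^sub>R x" "-z"] pD(2)[of t x] by simp
  qed
  have le: "q z \<le> p (z + t *\<^sub>R x) - t * p x" if "t \<ge> 0" for z t
    unfolding q_def using that by (intro cINF_lower[OF bdd]) auto
  show "q z \<le> p z" for z using le[of 0 z] by simp
  show "q z \<le> p (z + x) - p x" for z using le[of 1 z] by simp
  have ge: "r \<le> q z" if "\<And>t. t \<ge> 0 \<Longrightarrow> r \<le> p (z + t *\<^sub>R x) - t * p x" for r z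
    unfolding q_def using that by (intro cINF_greatest) auto
  have sub: "q (a + b) \<le> q a + q b" for a b
  proof -
    have "q (a + b) - (p (a + t *\<^sub>R x) - t * p x) \<le> q b" if t: "t \<ge> 0" for t
    proof (rule ge)
      fix s :: real assume s: "s \<ge> 0"
      have "q (a + b) \<le> p ((a + t *\<^sub>R x) + (b + s *\<^sub>R x)) - (t + s) * p x"
        using le[of "t + s" "a + b"] s t by (simp add: algebra_simps)
      then show "q (a + b) - (p (a + t *\<^sub>R x) - t * p x) \<le> p (b + s *\<^sub>R x) - s * p x"
        using pD(1)[of "a + t *\<^sub>R x" "b + s *\<^sub>R x"] by (simp add: algebra_simps)
    qed
    then have "q (a + b) - q b \<le> q a" by (intro ge) (auto simp: algebra_simps)
    then show ?thesis by simp
  qed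
  have q0: "q 0 = 0"
    using le[of 0 0] ge[of 0 0] pD by (auto simp: pD(2))
  have pos_le: "c * q z \<le> q (c *\<^sub>R z)" if "c > 0" for c z
  proof (rule ge)
    fix t :: real assume "t \<ge> 0"
    then have "q z \<le> p (z + (t / c) *\<^sub>R x) - (t / c) * p x" using that by (intro le) auto
    then have "c * q z \<le> c * p (z + (t / c) *\<^sub>R x) - t * p x"
      using that by (simp add: field_simps)
    also have "c * p (z + (t / c) *\<^sub>R x) = p (c *\<^sub>R z + t *\<^sub>R x)"
      using that pD(2)[of c "z + (t/c) *\<^sub>R x"] by (simp add: scaleR_add_right)
    finally show "c * q z \<le> p (c *\<^sub>R z + t *\<^sub>R x) - t * p x" .
  qed
  have "q (c *\<^sub>R z) = c * q z" if "c \<ge> 0" for c z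
  proof (cases "c = 0")
    case False
    with that have c: "c > 0" by simp
    from pos_le[of "1/c" "c *\<^sub>R z"] c have "q (c *\<^sub>R z) \<le> c * q z" by (simp add: field_simps)
    with pos_le[OF c, of z] show ?thesis by simp
  qed (simp add: q0)
  with sub show "sublinear q" by (auto simp: sublinear_def)
qed

lemma minimal_sublinear_linear:
  assumes q: "sublinear q" and min: "\<And>r. sublinear r \<Longrightarrow> (\<And>x. r x \<le> q x) \<Longrightarrow> r = q"
  shows "linear q"
proof -
  note qD = sublinearD[OF q]
  have add: "q (z + x) = q z + q x" for z x
  proof -
    have *: "(\<lambda>z. INF t\<in>{0..}. q (z + t *\<^sub>R x) - t * q x) = q"
      by (rule min) (rule sublinear_shift[OF q])+
    have "q z \<le> q (z + x) - q x" using sublinear_shift(3)[OF q, of z x] unfolding fun_cong[OF *] .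
    with qD(1)[of z x] show ?thesis by simp
  qed
  have neg: "q (- x) = - q x" for x using add[of "-x" x] qD(3) by simp
  show ?thesis
  proof (rule linearI)
    show "q (c *\<^sub>R x) = c *\<^sub>R q x" for c x
      using qD(2)[of c x] qD(2)[of "-c" x] neg[of "c *\<^sub>R x"] by (cases "c \<ge> 0") auto
  qed (rule add)
qed

text \<open>Hahn-Banach by way of minimal sublinear functionals: Zorn's lemma provides a minimal one
  below p, and minimality forces linearity.\<close>

lemma linear_below_sublinear:
  assumes p: "sublinear p"
  shows "\<exists>q. linear q \<and> (\<forall>x. q x \<le> p x)"
proof -
  define A where "A = {q. sublinear q \<and> (\<forall>x. q x \<le> p x)}"
  \<comment> \<open>The order is reversed: \<open>P q r\<close> says that r lies below q, so that a
    maximal element for Zorn is a minimal functional.\<close>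
  define P where "P = (\<lambda>(q::'a \<Rightarrow> real) r. \<forall>x. r x \<le> q x)"
  have "\<exists>m\<in>A. \<forall>a\<in>A. P m a \<longrightarrow> a = m"
  proof (rule predicate_Zorn)
    show "partial_order_on A (relation_of P A)"
      unfolding partial_order_on_def preorder_on_def refl_on_def trans_def antisym_def
          relation_of_def P_def by (auto intro!: ext order_antisym) (meson order_trans)
  next
    fix C assume C: "C \<in> Chains (relation_of P A)"
    show "\<exists>u\<in>A. \<forall>a\<in>C. P a u"
    proof (cases "C = {}")
      case True
      then show ?thesis using p by (auto simp: A_def)
    next
      case False
      have CA: "q \<in> A" if "q \<in> C" for q using C that by (auto simp: Chains_def relation_of_def)
      have chain: "P q r \<or> P r q" if "q \<in> C" "r \<in> C" for q r
        using C that by (auto simp: Chains_def relation_of_def)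
      define u where "u = (\<lambda>x. INF q\<in>C. q x)"
      have bdd: "bdd_below ((\<lambda>q. q x) ` C)" for x
      proof (rule bdd_belowI2[where m = "- p (- x)"])
        fix q assume "q \<in> C"
        then have "sublinear q" "q (-x) \<le> p (-x)" using CA by (auto simp: A_def)
        then show "- p (- x) \<le> q x" using sublinearD(4)[of q x] by simp
      qed
      have le: "u x \<le> q x" if "q \<in> C" for q x
        unfolding u_def using that by (intro cINF_lower[OF bdd]) auto
      have ge: "r \<le> u x" if "\<And>q. q \<in> C \<Longrightarrow> r \<le> q x" for r x
        unfolding u_def using that False by (intro cINF_greatest) auto
      \<comment> \<open>Of two members of a chain the smaller one serves for both arguments, which
        yields the mixed bound by q x + r y; the infimum is then taken over r and afterwards over
        q.\<close>
      have sub: "u (x + y) \<le> u x + u y" for x y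
      proof -
        have "u (x + y) \<le> q x + r y" if "q \<in> C" "r \<in> C" for q r
        proof -
          have "u (x + y) \<le> q x + q y" "u (x + y) \<le> r x + r y"
            using le[OF that(1), of "x + y"] le[OF that(2), of "x + y"] CA[OF that(1)] CA[OF that(2)]
              sublinearD(1)[of q x y] sublinearD(1)[of r x y]
            unfolding A_def mem_Collect_eq by linarith+
          then show ?thesis using chain[OF that] unfolding P_def by (smt (verit))
        qed
        then have *: "u (x + y) - q x \<le> r y" if "q \<in> C" "r \<in> C" for q r using that by (simp add: algebra_simps)
        have "u (x + y) - q x \<le> u y" if "q \<in> C" for q by (rule ge) (rule *[OF that])
        then have **: "u (x + y) - u y \<le> q x" if "q \<in> C" for q using that by (simp add: algebra_simps)
        have "u (x + y) - u y \<le> u x" by (rule ge) (rule **)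
        then show ?thesis by simp
      qed
      have u0: "u 0 = 0"
      proof -
        have "q 0 = 0" if "q \<in> C" for q using CA[OF that] by (auto simp: A_def sublinearD)
        then have "(\<lambda>q. q 0) ` C = {0}" using False by force
        then show ?thesis by (simp add: u_def)
      qed
      have pos_le: "c * u x \<le> u (c *\<^sub>R x)" if "c > 0" for c x
      proof (rule ge)
        fix q assume "q \<in> C"
        then show "c * u x \<le> q (c *\<^sub>R x)"
          using le[of q x] CA[of q] that by (auto simp: A_def sublinearD(2))
      qed
      have "u (c *\<^sub>R x) = c * u x" if "c \<ge> 0" for c x
      proof (cases "c = 0")
        case False
        with that have c: "c > 0" by simp
        from pos_le[of "1/c" "c *\<^sub>R x"] c have "u (c *\<^sub>R x) \<le> c * u x" by (simp add: field_simps)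
        with pos_le[OF c, of x] show ?thesis by simp
      qed (simp add: u0)
      moreover obtain q0 where "q0 \<in> C" using False by auto
      then have "u x \<le> p x" for x using le[of q0 x] CA[of q0] order_trans by (fastforce simp: A_def)
      ultimately have "u \<in> A" using sub by (auto simp: A_def sublinear_def)
      then show ?thesis using le by (auto simp: P_def)
    qed
  qed
  then obtain m where m: "m \<in> A" "\<And>a. a \<in> A \<Longrightarrow> P m a \<Longrightarrow> a = m" by blast
  have "linear m"
  proof (rule minimal_sublinear_linear)
    fix r assume "sublinear r" "\<And>x. r x \<le> m x"
    then show "r = m" using m(1) order_trans by (intro m(2)) (fastforce simp: A_def P_def)+
  qed (use m in \<open>auto simp: A_def\<close>)
  with m show ?thesis by (auto simp: A_def)
qed

text \<open>The shift of the norm by x stays below the norm but is at most -norm x at -x. Every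
  linear functional below the shift therefore attains the norm at x; this replaces the extension
  from a line in the usual argument.\<close>

lemma norming_functional:
  fixes x :: "'a::real_normed_vector"
  shows "\<exists>u :: 'a \<Rightarrow>\<^sub>L real. (\<forall>z. \<bar>u z\<bar> \<le> norm z) \<and> u x = norm x"
proof -
  have n: "sublinear (norm :: 'a \<Rightarrow> real)" by (auto simp: sublinear_def norm_triangle_ineq)
  from linear_below_sublinear[OF sublinear_shift(1)[OF n, of x]]
  obtain q where q: "linear q" "\<And>z. q z \<le> (INF t\<in>{0..}. norm (z + t *\<^sub>R x) - t * norm x)" by auto
  have le: "q z \<le> norm z" for z using q(2)[of z] sublinear_shift(2)[OF n, of z x] by linarith
  have abs: "\<bar>q z\<bar> \<le> norm z" for z
    using le[of z] le[of "-z"] linear_neg[OF q(1), of z] by auto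
  have "q (- x) \<le> - norm x" using q(2)[of "-x"] sublinear_shift(3)[OF n, of "-x" x] by simp
  then have "q x = norm x" using le[of x] linear_neg[OF q(1), of x] by simp
  moreover have "bounded_linear q"
    using q(1) abs by (auto simp: bounded_linear_def bounded_linear_axioms_def intro!: exI[of _ 1])
  ultimately show ?thesis using abs by (intro exI[of _ "Blinfun q"]) (simp add: bounded_linear_Blinfun_apply)
qed

lemma eq_if_functionals_eq:
  fixes x y :: "'a::real_normed_vector"
  assumes "\<And>u :: 'a \<Rightarrow>\<^sub>L real. u x = u y"
  shows "x = y"
proof -
  obtain u :: "'a \<Rightarrow>\<^sub>L real" where "u (x - y) = norm (x - y)" using norming_functional[of "x - y"] by auto
  then show ?thesis using assms[of u] by (simp add: blinfun.diff_right)
qed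

text \<open>By separability, countably many functionals determine the closed balls.\<close>

lemma borel_measurable_if_functionals:
  fixes X :: "'s \<Rightarrow> 'a::{real_normed_vector, second_countable_topology}"
  assumes meas: "\<And>u :: 'a \<Rightarrow>\<^sub>L real. (\<lambda>s. u (X s)) \<in> borel_measurable N"
  shows "X \<in> borel_measurable N"
proof -
  obtain D :: "'a set" where D: "countable D" "\<And>U. open U \<Longrightarrow> U \<noteq> {} \<Longrightarrow> \<exists>d\<in>D. d \<in> U"
    using countable_dense_exists by blast
  have "D \<noteq> {}" using D(2)[of UNIV] by auto
  define v :: "'a \<Rightarrow> 'a \<Rightarrow>\<^sub>L real" where
    "v x = (SOME u :: 'a \<Rightarrow>\<^sub>L real. (\<forall>z. \<bar>u z\<bar> \<le> norm z) \<and> u x = norm x)" for x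
  have v: "\<bar>v x z\<bar> \<le> norm z" "v x x = norm x" for x z
    using someI_ex[OF norming_functional[of x]] by (auto simp: v_def)
  \<comment> \<open>Density makes the countable family v d, with d in D, norming: norm z exceeds v d
    z by at most twice the distance from z to d.\<close>
  have norm_le: "norm z \<le> r" if "\<And>d. d \<in> D \<Longrightarrow> v d z \<le> r" for z r
  proof (rule field_le_epsilon)
    fix e :: real assume "e > 0"
    then obtain d where d: "d \<in> D" "d \<in> ball z (e/2)" using D(2)[of "ball z (e/2)"] by auto
    have "norm z \<le> norm d + norm (z - d)" by (metis add.commute diff_add_cancel norm_triangle_ineq)
    moreover have "norm d = v d z - v d (z - d)" by (simp add: blinfun.diff_right v)
    moreover have "- v d (z - d) \<le> norm (z - d)" using v(1)[of d "z - d"] by simp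
    ultimately have "norm z \<le> v d z + 2 * norm (z - d)" by simp
    also have "\<dots> \<le> r + e" using that[OF d(1)] d(2) by (simp add: dist_norm)
    finally show "norm z \<le> r + e" .
  qed
  have cball: "X -` cball a r \<inter> space N \<in> sets N" for a r
  proof -
    have "X -` cball a r \<inter> space N = {s \<in> space N. \<forall>d\<in>D. v d (X s) - v d a \<le> r}"
    proof (intro equalityI subsetI CollectI conjI ballI)
      fix s d assume "s \<in> X -` cball a r \<inter> space N"
      then show "v d (X s) - v d a \<le> r"
        using v(1)[of d "X s - a"] by (auto simp: dist_norm blinfun.diff_right norm_minus_commute)
    next
      fix s assume "s \<in> {s \<in> space N. \<forall>d\<in>D. v d (X s) - v d a \<le> r}"
      then show "s \<in> X -` cball a r \<inter> space N"
        using norm_le[of "X s - a" r] by (auto simp: dist_norm blinfun.diff_right norm_minus_commute)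
    qed auto
    also have "\<dots> \<in> sets N" using D(1) meas by measurable
    finally show ?thesis .
  qed
  show ?thesis
  proof (rule borel_measurableI)
    fix S :: "'a set" assume S: "open S"
    define I where "I = {(d, n) \<in> D \<times> (UNIV :: nat set). cball d (1 / Suc n) \<subseteq> S}"
    have "S = (\<Union>(d, n)\<in>I. cball d (1 / Suc n))"
    proof (intro equalityI subsetI)
      fix x assume "x \<in> S"
      then obtain e where e: "e > 0" "ball x e \<subseteq> S" using S open_contains_ball by blast
      obtain n where n: "1 / real (Suc n) < e / 2"
        using reals_Archimedean[of "e/2"] e(1) by (auto simp: field_simps)
      obtain d where d: "d \<in> D" "d \<in> ball x (1 / Suc n)" using D(2)[of "ball x (1 / Suc n)"] by force
      have "cball d (1 / Suc n) \<subseteq> S"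
      proof
        fix y assume "y \<in> cball d (1 / Suc n)"
        then have "dist x y < e" using d(2) n dist_triangle[of x y d] by auto
        then show "y \<in> S" using e by auto
      qed
      then have "(d, n) \<in> I" "x \<in> cball d (1 / Suc n)" using d by (auto simp: I_def dist_commute)
      then show "x \<in> (\<Union>(d, n)\<in>I. cball d (1 / Suc n))" by blast
    qed (auto simp: I_def)
    then have "X -` S \<inter> space N = (\<Union>(d, n)\<in>I. X -` cball d (1 / Suc n) \<inter> space N)" by auto
    moreover have "countable I" using D(1) by (rule countable_subset[rotated, OF countable_SIGMA]) (auto simp: I_def)
    ultimately show "X -` S \<inter> space N \<in> sets N" using cball by (auto intro!: sets.countable_UN')
  qed
qed

subsection \<open>Hilbert spaces\<close>

text \<open>The representing vector minimises norm(x)^2 - 2 \<phi>(x). The parallelogram law makes a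
  minimising sequence Cauchy, and stationarity at its limit k in each direction h is the identity
  \<phi> h = inner h k.\<close>

lemma Riesz_representation:
  fixes \<phi> :: "'h::{real_inner,complete_space} \<Rightarrow> real"
  assumes "bounded_linear \<phi>"
  shows "\<exists>k. \<forall>h. \<phi> h = inner h k"
proof -
  interpret bounded_linear \<phi> by fact
  obtain K where K: "\<And>x. \<bar>\<phi> x\<bar> \<le> norm x * K" "K > 0" using pos_bounded by auto
  define J where "J = (\<lambda>x. (norm x)\<^sup>2 - 2 * \<phi> x)"
  have Jge: "- K\<^sup>2 \<le> J x" for x
  proof -
    have "\<phi> x \<le> norm x * K" using K(1)[of x] by linarith
    moreover have "0 \<le> (norm x - K)\<^sup>2" by simp
    ultimately show ?thesis by (simp add: J_def power2_diff algebra_simps power2_eq_square)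
  qed
  define m where "m = Inf (range J)"
  have bdd: "bdd_below (range J)" using Jge by (intro bdd_belowI2)
  have mle: "m \<le> J x" for x unfolding m_def by (rule cInf_lower) (auto simp: bdd)
  have "\<exists>x. J x < m + 1 / Suc n" for n
    using cInf_lessD[of "range J" "m + 1 / Suc n"] by (auto simp: m_def)
  then obtain x where x: "\<And>n::nat. J (x n) < m + 1 / Suc n" by metis
  have par: "(norm (a - b))\<^sup>2 \<le> 2 * (J a + J b) - 4 * m" for a b
  proof -
    have "(norm (a - b))\<^sup>2 = 2 * (J a + J b) - 4 * J ((1/2) *\<^sub>R (a + b))"
      by (simp add: J_def scaleR add power2_norm_eq_inner inner_add inner_diff inner_commute algebra_simps)
    then show ?thesis using mle[of "(1/2) *\<^sub>R (a + b)"] by linarith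
  qed
  have "Cauchy x"
  proof (rule metric_CauchyI)
    fix e :: real assume e: "e > 0"
    obtain N where N: "1 / real (Suc N) < e\<^sup>2 / 4" using reals_Archimedean[of "e\<^sup>2/4"] e by (auto simp: field_simps)
    show "\<exists>N. \<forall>i\<ge>N. \<forall>j\<ge>N. dist (x i) (x j) < e"
    proof (intro exI[of _ N] allI impI)
      fix i j assume "i \<ge> N" "j \<ge> N"
      then have "1 / real (Suc i) \<le> 1 / Suc N" "1 / real (Suc j) \<le> 1 / Suc N"
        by (auto simp: field_simps)
      then have "J (x i) < m + e\<^sup>2 / 4" "J (x j) < m + e\<^sup>2 / 4" using x[of i] x[of j] N by linarith+
      then have "(norm (x i - x j))\<^sup>2 < e\<^sup>2" using par[of "x i" "x j"] by (simp add: field_simps)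
      then show "dist (x i) (x j) < e" using e by (simp add: dist_norm power_less_imp_less_base)
    qed
  qed
  then obtain k where k: "x \<longlonglongrightarrow> k" using Cauchy_convergent convergent_def by blast
  have "(\<lambda>n. J (x n)) \<longlonglongrightarrow> J k" unfolding J_def by (intro tendsto_intros tendsto k)
  moreover have "(\<lambda>n. m + 1 / Suc n) \<longlonglongrightarrow> m + 0"
    by (intro tendsto_intros LIMSEQ_Suc[OF lim_1_over_n])
  ultimately have "J k \<le> m + 0" using x by (intro LIMSEQ_le) (auto intro!: exI[of _ 0] less_imp_le)
  then have Jk: "J k \<le> J y" for y using mle[of y] by simp
  have "\<phi> h = inner h k" for h
  proof -
    define D where "D = inner h k - \<phi> h"
    have ineq: "0 \<le> t\<^sup>2 * (norm h)\<^sup>2 + 2 * t * D" for t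
    proof -
      have "(norm (k + t *\<^sub>R h))\<^sup>2 = (norm k)\<^sup>2 + 2 * t * inner h k + t\<^sup>2 * (norm h)\<^sup>2"
        unfolding power2_norm_eq_inner inner_add inner_scaleR_left inner_scaleR_right power2_eq_square[of t]
        by (simp add: inner_commute algebra_simps)
      then show ?thesis using Jk[of "k + t *\<^sub>R h"] by (simp add: J_def D_def add scaleR algebra_simps)
    qed
    have "D = 0"
    proof (cases "h = 0")
      case True then show ?thesis by (simp add: D_def zero)
    next
      case False
      \<comment> \<open>The chosen t minimises the quadratic polynomial in \<open>ineq\<close>,
        whose minimum is -D^2 / norm(h)^2.\<close>
      have "0 \<le> - (D\<^sup>2 / (norm h)\<^sup>2)"
        using ineq[of "- D / (norm h)\<^sup>2"] False by (simp add: power2_eq_square field_simps)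
      then have "D\<^sup>2 / (norm h)\<^sup>2 \<le> 0" by simp
      then show ?thesis using False by (simp add: divide_le_0_iff)
    qed
    then show ?thesis by (simp add: D_def)
  qed
  then show ?thesis by blast
qed

lemma orthonormal_basis_of_span:
  fixes E :: "'a::real_inner set"
  assumes "finite E"
  shows "\<exists>B. finite B \<and> span B = span E \<and> (\<forall>b\<in>B. \<forall>c\<in>B. inner b c = (if b = c then 1 else 0))"
proof -
  obtain C where C: "finite C" "span C = span E" "pairwise orthogonal C"
    using basis_orthogonal[OF assms] by blast
  define B where "B = (\<lambda>c. c /\<^sub>R norm c) ` (C - {0})"
  have "span B = span E"
  proof -
    have "span B \<subseteq> span C" unfolding B_def by (intro span_minimal) (auto intro: span_mul[OF span_base])
    moreover have "c \<in> span B" if "c \<in> C" for c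
    proof (cases "c = 0")
      case False
      then have "c /\<^sub>R norm c \<in> span B" using that by (intro span_base) (auto simp: B_def)
      from span_mul[OF this, of "norm c"] show ?thesis using False by simp
    qed (simp add: span_zero)
    then have "span C \<subseteq> span B" by (intro span_minimal) auto
    ultimately show ?thesis using C by simp
  qed
  moreover have "inner b c = (if b = c then 1 else 0)" if bc: "b \<in> B" "c \<in> B" for b c
  proof -
    obtain b' c' where *: "b = b' /\<^sub>R norm b'" "c = c' /\<^sub>R norm c'" "b' \<in> C" "c' \<in> C" "b' \<noteq> 0" "c' \<noteq> 0"
      using bc by (auto simp: B_def)
    show ?thesis
    proof (cases "b' = c'")
      case True
      then show ?thesis using * by (simp add: power2_norm_eq_inner[symmetric] power2_eq_square)
    next
      case False
      then have o: "inner b' c' = 0" using C(3) * by (auto simp: pairwise_def orthogonal_def)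
      then have "inner b c = 0" using * by simp
      moreover have "b \<noteq> c"
      proof
        assume "b = c"
        then have "inner b b = 0" using \<open>inner b c = 0\<close> by simp
        then show False using * by simp
      qed
      ultimately show ?thesis by simp
    qed
  qed
  moreover have "finite B" using C by (simp add: B_def)
  ultimately show ?thesis by blast
qed

lemma orthonormal_expansion:
  fixes B :: "'a::real_inner set"
  assumes "finite B" "\<And>b c. b \<in> B \<Longrightarrow> c \<in> B \<Longrightarrow> inner b c = (if b = c then 1 else 0)" "x \<in> span B"
  shows "x = (\<Sum>b\<in>B. inner x b *\<^sub>R b)"
  using assms(3)
proof (induction rule: span_induct_alt)
  case base
  then show ?case by simp
next
  case (step c x y)
  have "(\<Sum>b\<in>B. inner (c *\<^sub>R x + y) b *\<^sub>R b) = c *\<^sub>R (\<Sum>b\<in>B. inner x b *\<^sub>R b) + (\<Sum>b\<in>B. inner y b *\<^sub>R b)"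
    by (simp add: inner_add scaleR_add_left sum.distrib scaleR_sum_right)
  also have "(\<Sum>b\<in>B. inner x b *\<^sub>R b) = (\<Sum>b\<in>B. if x = b then b else 0)"
    using step(1) assms(2) by (intro sum.cong) auto
  also have "\<dots> = x" using step(1) assms(1) by simp
  finally show ?case using step by simp
qed

subsection \<open>Laws determined by characteristic functions\<close>

text \<open>After division by the total mass the weights become probability densities, and the
  hypothesis says that Z1 and Z2 have equal characteristic functions under the reweighted measures;
  Levy uniqueness then applies. The total masses agree by the case s = 0.\<close>

lemma weighted_law_eq:
  fixes g1 Z1 :: "'a \<Rightarrow> real" and g2 Z2 :: "'b \<Rightarrow> real"
  assumes M1: "prob_space M1" and M2: "prob_space M2"
    and [measurable]: "g1 \<in> borel_measurable M1" "Z1 \<in> borel_measurable M1"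
      "g2 \<in> borel_measurable M2" "Z2 \<in> borel_measurable M2"
    and g1: "\<And>x. 0 \<le> g1 x \<and> g1 x \<le> K" and g2: "\<And>x. 0 \<le> g2 x \<and> g2 x \<le> K"
    and eq: "\<And>s. (CLINT x|M1. complex_of_real (g1 x) * iexp (s * Z1 x))
              = (CLINT x|M2. complex_of_real (g2 x) * iexp (s * Z2 x))"
    and A[measurable]: "A \<in> sets borel"
  shows "(\<integral>x. g1 x * indicator A (Z1 x) \<partial>M1) = (\<integral>x. g2 x * indicator A (Z2 x) \<partial>M2)"
proof -
  interpret M1: prob_space M1 by fact
  interpret M2: prob_space M2 by fact
  have i1: "integrable M1 g1" by (rule M1.integrable_const_bound[of _ K]) (use g1 in auto)
  have i2: "integrable M2 g2" by (rule M2.integrable_const_bound[of _ K]) (use g2 in auto)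
  define c where "c = (\<integral>x. g1 x \<partial>M1)"
  have "complex_of_real (\<integral>x. g1 x \<partial>M1) = complex_of_real (\<integral>x. g2 x \<partial>M2)"
    using eq[of 0] by simp
  then have c2: "c = (\<integral>x. g2 x \<partial>M2)" by (simp add: c_def)
  have c0: "c \<ge> 0" using g1 by (simp add: c_def)
  show ?thesis
  proof (cases "c = 0")
    case True
    then have "AE x in M1. g1 x = 0" "AE x in M2. g2 x = 0"
      using integral_nonneg_eq_0_iff_AE[OF i1] integral_nonneg_eq_0_iff_AE[OF i2] g1 g2 c2 c_def by auto
    then have "(\<integral>x. g1 x * indicator A (Z1 x) \<partial>M1) = 0" "(\<integral>x. g2 x * indicator A (Z2 x) \<partial>M2) = 0"
      by (auto intro!: integral_eq_zero_AE)
    then show ?thesis by simp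
  next
    case False
    with c0 have c: "c > 0" by simp
    define N1 where "N1 = density M1 (\<lambda>x. ennreal (g1 x / c))"
    define N2 where "N2 = density M2 (\<lambda>x. ennreal (g2 x / c))"
    have N1: "prob_space N1"
    proof (rule prob_spaceI)
      have "emeasure N1 (space N1) = (\<integral>\<^sup>+x. ennreal (g1 x / c) \<partial>M1)"
        by (auto simp: N1_def emeasure_density intro!: nn_integral_cong)
      also have "\<dots> = ennreal (\<integral>x. g1 x / c \<partial>M1)"
        using i1 g1 c by (intro nn_integral_eq_integral) auto
      finally show "emeasure N1 (space N1) = 1" using c by (simp add: c_def[symmetric])
    qed
    have N2: "prob_space N2"
    proof (rule prob_spaceI)
      have "emeasure N2 (space N2) = (\<integral>\<^sup>+x. ennreal (g2 x / c) \<partial>M2)"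
        by (auto simp: N2_def emeasure_density intro!: nn_integral_cong)
      also have "\<dots> = ennreal (\<integral>x. g2 x / c \<partial>M2)"
        using i2 g2 c by (intro nn_integral_eq_integral) auto
      finally show "emeasure N2 (space N2) = 1" using c by (simp add: c2[symmetric])
    qed
    interpret N1: prob_space N1 by fact
    interpret N2: prob_space N2 by fact
    have [measurable]: "Z1 \<in> borel_measurable N1" "Z2 \<in> borel_measurable N2"
      by (auto simp: N1_def N2_def)
    have "distr N1 borel Z1 = distr N2 borel Z2"
    proof (rule Levy_uniqueness)
      show "real_distribution (distr N1 borel Z1)" by simp
      show "real_distribution (distr N2 borel Z2)" by simp
      have "char (distr N1 borel Z1) s = (CLINT x|M1. complex_of_real (g1 x) * iexp (s * Z1 x)) / c" for s
      proof -
        have "char (distr N1 borel Z1) s = (CLINT x|M1. (g1 x / c) *\<^sub>R iexp (s * Z1 x))"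
          unfolding char_def using g1 c by (subst integral_distr) (auto simp: N1_def integral_density)
        also have "\<dots> = (CLINT x|M1. complex_of_real (g1 x) * iexp (s * Z1 x) / c)"
          by (rule Bochner_Integration.integral_cong) (auto simp: scaleR_conv_of_real)
        finally show ?thesis by simp
      qed
      moreover have "char (distr N2 borel Z2) s = (CLINT x|M2. complex_of_real (g2 x) * iexp (s * Z2 x)) / c" for s
      proof -
        have "char (distr N2 borel Z2) s = (CLINT x|M2. (g2 x / c) *\<^sub>R iexp (s * Z2 x))"
          unfolding char_def using g2 c by (subst integral_distr) (auto simp: N2_def integral_density)
        also have "\<dots> = (CLINT x|M2. complex_of_real (g2 x) * iexp (s * Z2 x) / c)"
          by (rule Bochner_Integration.integral_cong) (auto simp: scaleR_conv_of_real)
        finally show ?thesis by simp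
      qed
      ultimately show "char (distr N1 borel Z1) = char (distr N2 borel Z2)" using eq by auto
    qed
    moreover have "(\<integral>x. indicator A (Z1 x) \<partial>N1) = (\<integral>z. indicator A z \<partial>(distr N1 borel Z1) :: real)"
      by (rule integral_distr[symmetric]) auto
    moreover have "(\<integral>x. indicator A (Z2 x) \<partial>N2) = (\<integral>z. indicator A z \<partial>(distr N2 borel Z2) :: real)"
      by (rule integral_distr[symmetric]) auto
    ultimately have "(\<integral>x. indicator A (Z1 x) \<partial>N1) = (\<integral>x. indicator A (Z2 x) \<partial>N2 :: real)" by simp
    then have "(\<integral>x. (g1 x / c) * indicator A (Z1 x) \<partial>M1) = (\<integral>x. (g2 x / c) * indicator A (Z2 x) \<partial>M2)"
      using g1 g2 c by (simp add: N1_def N2_def integral_density del: integral_indicator)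
    then show ?thesis using c by simp
  qed
qed

text \<open>Uniqueness for joint laws is reduced to the real line by exchanging one exponential
  factor for an indicator at a time, while the remaining coordinates stay in the exponential. The
  mixed form of the statement is what the induction on J needs.\<close>

lemma joint_law_eq_aux:
  fixes Z1 :: "'i \<Rightarrow> 'a \<Rightarrow> real" and Z2 :: "'i \<Rightarrow> 'b \<Rightarrow> real"
  assumes M1: "prob_space M1" and M2: "prob_space M2" and K: "finite K"
    and meas: "\<And>i. i \<in> K \<Longrightarrow> Z1 i \<in> borel_measurable M1" "\<And>i. i \<in> K \<Longrightarrow> Z2 i \<in> borel_measurable M2"
    and char: "\<And>c. (CLINT x|M1. iexp (\<Sum>i\<in>K. c i * Z1 i x)) = (CLINT x|M2. iexp (\<Sum>i\<in>K. c i * Z2 i x))"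
    and J: "J \<subseteq> K" and A: "\<And>i. i \<in> J \<Longrightarrow> A i \<in> sets borel"
  shows "(CLINT x|M1. complex_of_real (\<Prod>i\<in>J. indicator (A i) (Z1 i x)) * iexp (\<Sum>i\<in>K. c i * Z1 i x))
    = (CLINT x|M2. complex_of_real (\<Prod>i\<in>J. indicator (A i) (Z2 i x)) * iexp (\<Sum>i\<in>K. c i * Z2 i x))"
proof -
  interpret M1: prob_space M1 by fact
  interpret M2: prob_space M2 by fact
  have "finite J" using J K finite_subset by blast
  then show ?thesis using J A
  proof (induction J arbitrary: c rule: finite_induct)
    case empty
    then show ?case using char by simp
  next
    case (insert j J)
    define h1 where "h1 x = (\<Prod>i\<in>J. indicator (A i) (Z1 i x) :: real)" for x
    define h2 where "h2 x = (\<Prod>i\<in>J. indicator (A i) (Z2 i x) :: real)" for x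
    define l1 where "l1 c x = (\<Sum>i\<in>K. c i * Z1 i x)" for c x
    define l2 where "l2 c x = (\<Sum>i\<in>K. c i * Z2 i x)" for c x
    have jK: "j \<in> K" and JK: "\<And>i. i \<in> J \<Longrightarrow> i \<in> K" using insert by auto
    have Aj[measurable]: "A j \<in> sets borel" using insert by auto
    have [measurable]: "Z1 j \<in> borel_measurable M1" "Z2 j \<in> borel_measurable M2"
      using jK meas by auto
    have [measurable]: "l1 c \<in> borel_measurable M1" "l2 c \<in> borel_measurable M2" for c
      unfolding l1_def l2_def using meas by (auto intro!: borel_measurable_sum)
    have hm[measurable]: "h1 \<in> borel_measurable M1" "h2 \<in> borel_measurable M2"
      unfolding h1_def h2_def using meas insert JK
      by (auto intro!: borel_measurable_prod measurable_compose[of _ _ borel "\<lambda>x. indicator _ x"] borel_measurable_indicator)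
    have h: "0 \<le> h1 x" "h1 x \<le> 1" "0 \<le> h2 y" "h2 y \<le> 1" for x y
      unfolding h1_def h2_def by (auto intro!: prod_nonneg prod_le_1)
    have IH: "(CLINT x|M1. complex_of_real (h1 x) * iexp (l1 c x)) = (CLINT x|M2. complex_of_real (h2 x) * iexp (l2 c x))" for c
      using insert.IH[of c] insert.prems by (auto simp: h1_def h2_def l1_def l2_def)
    have int1: "integrable M1 (\<lambda>x. complex_of_real (h1 x) * iexp (l1 c x))" for c
      by (rule M1.integrable_const_bound[of _ 1]) (use h in \<open>auto simp: norm_mult\<close>)
    have int2: "integrable M2 (\<lambda>x. complex_of_real (h2 x) * iexp (l2 c x))" for c
      by (rule M2.integrable_const_bound[of _ 1]) (use h in \<open>auto simp: norm_mult\<close>)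
    \<comment> \<open>Adding s to the j-th coefficient absorbs the factor with exponent s Z_j into
      the linear combination, so that the induction hypothesis covers it.\<close>
    define sh where "sh s c = (\<lambda>i. c i + (if i = j then s else 0))" for s :: real and c :: "'i \<Rightarrow> real"
    have sh1: "l1 (sh s c) x = s * Z1 j x + l1 c x" for s c x
    proof -
      have "l1 (sh s c) x = (\<Sum>i\<in>K. c i * Z1 i x + (if i = j then s * Z1 i x else 0))"
        unfolding l1_def sh_def by (intro sum.cong) (auto simp: algebra_simps)
      then show ?thesis using K jK by (simp add: sum.distrib l1_def)
    qed
    have sh2: "l2 (sh s c) x = s * Z2 j x + l2 c x" for s c x
    proof -
      have "l2 (sh s c) x = (\<Sum>i\<in>K. c i * Z2 i x + (if i = j then s * Z2 i x else 0))"
        unfolding l2_def sh_def by (intro sum.cong) (auto simp: algebra_simps)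
      then show ?thesis using K jK by (simp add: sum.distrib l2_def)
    qed
    have neg: "l1 (\<lambda>i. - c i) x = - l1 c x" "l2 (\<lambda>i. - c i) y = - l2 c y" for c x y
      by (auto simp: l1_def l2_def sum_negf)
    have zero: "l1 (\<lambda>i. 0) x = 0" "l2 (\<lambda>i. 0) y = 0" for x y by (auto simp: l1_def l2_def)
    have plain: "(\<integral>x. h1 x * indicator (A j) (Z1 j x) \<partial>M1) = (\<integral>x. h2 x * indicator (A j) (Z2 j x) \<partial>M2)"
    proof (rule weighted_law_eq[OF M1 M2, where K = 1])
      fix s
      show "(CLINT x|M1. complex_of_real (h1 x) * iexp (s * Z1 j x)) = (CLINT x|M2. complex_of_real (h2 x) * iexp (s * Z2 j x))"
        using IH[of "sh s (\<lambda>i. 0)"] by (simp add: sh1 sh2 zero)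
    qed (use h in auto)
    \<comment> \<open>The one-dimensional lemma wants nonnegative bounded weights, but the remaining
      exponential is complex. For unimodular w the function 1 + Re (w exp) lies between 0 and 2, and
      it is a combination of exponentials with coefficients c, -c and 0.\<close>
    have part: "(\<integral>x. (h1 x * (1 + Re (w * iexp (l1 c x)))) * indicator (A j) (Z1 j x) \<partial>M1)
        = (\<integral>x. (h2 x * (1 + Re (w * iexp (l2 c x)))) * indicator (A j) (Z2 j x) \<partial>M2)"
      if w: "norm w = 1" for w c
    proof (rule weighted_law_eq[OF M1 M2, where K = 2])
      have b: "\<bar>Re (w * iexp t)\<bar> \<le> 1" for t
        using abs_Re_le_cmod[of "w * iexp t"] w by (simp add: norm_mult)
      have *: "0 \<le> r * (1 + Re (w * iexp t)) \<and> r * (1 + Re (w * iexp t)) \<le> 2" if "0 \<le> r" "r \<le> 1" for r t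
      proof -
        have "0 \<le> 1 + Re (w * iexp t)" "1 + Re (w * iexp t) \<le> 2" using b[of t] by auto
        with that mult_mono[of r 1 "1 + Re (w * iexp t)" 2] show ?thesis by simp
      qed
      show "0 \<le> h1 x * (1 + Re (w * iexp (l1 c x))) \<and> h1 x * (1 + Re (w * iexp (l1 c x))) \<le> 2" for x
        using *[of "h1 x" "l1 c x"] h by simp
      show "0 \<le> h2 x * (1 + Re (w * iexp (l2 c x))) \<and> h2 x * (1 + Re (w * iexp (l2 c x))) \<le> 2" for x
        using *[of "h2 x" "l2 c x"] h by simp
      have Re_eq: "complex_of_real (Re (w * iexp t)) = (w * iexp t + cnj w * iexp (- t)) / 2" for t
        using complex_add_cnj[of "w * iexp t"] by (simp add: exp_cnj)
      have e1: "complex_of_real (r * (1 + Re (w * iexp t))) * iexp u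
          = complex_of_real r * iexp u + (w / 2) * (complex_of_real r * iexp (u + t)) + (cnj w / 2) * (complex_of_real r * iexp (u - t))" for r t u
      proof -
        have E: "iexp (u + t) = iexp u * iexp t" "iexp (u - t) = iexp u * iexp (- t)"
          by (simp_all add: exp_add[symmetric] algebra_simps)
        have ring: "r * (1 + (w * a + w' * b) / 2) * c = r * c + (w / 2) * (r * (c * a)) + (w' / 2) * (r * (c * b))"
          for r w w' a b c :: complex by (simp add: field_simps)
        show ?thesis unfolding of_real_mult[of r] of_real_add[of 1] of_real_1 Re_eq E by (rule ring)
      qed
      fix s
      have "(CLINT x|M1. complex_of_real (h1 x * (1 + Re (w * iexp (l1 c x)))) * iexp (s * Z1 j x))
        = (CLINT x|M1. complex_of_real (h1 x) * iexp (l1 (sh s (\<lambda>i. 0)) x)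
           + (w / 2) * (complex_of_real (h1 x) * iexp (l1 (sh s c) x))
           + (cnj w / 2) * (complex_of_real (h1 x) * iexp (l1 (sh s (\<lambda>i. - c i)) x)))"
        unfolding e1 sh1 neg zero add_0_right add_uminus_conv_diff ..
      also have "\<dots> = (CLINT x|M2. complex_of_real (h2 x) * iexp (l2 (sh s (\<lambda>i. 0)) x)
           + (w / 2) * (complex_of_real (h2 x) * iexp (l2 (sh s c) x))
           + (cnj w / 2) * (complex_of_real (h2 x) * iexp (l2 (sh s (\<lambda>i. - c i)) x)))"
        unfolding Bochner_Integration.integral_add[OF Bochner_Integration.integrable_add[OF int1 integrable_mult_right[OF int1]] integrable_mult_right[OF int1]]
          Bochner_Integration.integral_add[OF Bochner_Integration.integrable_add[OF int2 integrable_mult_right[OF int2]] integrable_mult_right[OF int2]]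
          Bochner_Integration.integral_add[OF int1 integrable_mult_right[OF int1]]
          Bochner_Integration.integral_add[OF int2 integrable_mult_right[OF int2]]
          integral_mult_right_zero IH ..
      also have "\<dots> = (CLINT x|M2. complex_of_real (h2 x * (1 + Re (w * iexp (l2 c x)))) * iexp (s * Z2 j x))"
        unfolding e1 sh2 neg zero add_0_right add_uminus_conv_diff ..
      finally show "(CLINT x|M1. complex_of_real (h1 x * (1 + Re (w * iexp (l1 c x)))) * iexp (s * Z1 j x)) =
         (CLINT x|M2. complex_of_real (h2 x * (1 + Re (w * iexp (l2 c x)))) * iexp (s * Z2 j x))" .
    qed measurable
    define q1 where "q1 x = h1 x * indicator (A j) (Z1 j x)" for x
    define q2 where "q2 x = h2 x * indicator (A j) (Z2 j x)" for x
    have [measurable]: "q1 \<in> borel_measurable M1" "q2 \<in> borel_measurable M2" by (auto simp: q1_def[abs_def] q2_def[abs_def])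
    have q: "\<bar>q1 x\<bar> \<le> 1" "\<bar>q2 y\<bar> \<le> 1" for x y using h by (auto simp: q1_def q2_def indicator_def)
    have iq: "integrable M1 q1" "integrable M2 q2"
      using q by (auto intro!: M1.integrable_const_bound[of _ 1] M2.integrable_const_bound[of _ 1])
    have iqe: "integrable M1 (\<lambda>x. complex_of_real (q1 x) * iexp (l1 c x))" "integrable M2 (\<lambda>x. complex_of_real (q2 x) * iexp (l2 c x))"
      using q by (auto intro!: M1.integrable_const_bound[of _ 1] M2.integrable_const_bound[of _ 1] simp: norm_mult)
    have Req: "Re (w * (CLINT x|M1. complex_of_real (q1 x) * iexp (l1 c x))) = Re (w * (CLINT x|M2. complex_of_real (q2 x) * iexp (l2 c x)))"
      if w: "norm w = 1" for w
    proof -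
      have b: "\<bar>q * Re (w * iexp t)\<bar> \<le> 1" if "\<bar>q\<bar> \<le> 1" for q t
      proof -
        have "\<bar>Re (w * iexp t)\<bar> \<le> 1"
          using abs_Re_le_cmod[of "w * iexp t"] w by (simp add: norm_mult)
        with that mult_mono[of "\<bar>q\<bar>" 1 "\<bar>Re (w * iexp t)\<bar>" 1] show ?thesis by (simp add: abs_mult)
      qed
      have r1: "integrable M1 (\<lambda>x. q1 x * Re (w * iexp (l1 c x)))"
        by (rule M1.integrable_const_bound[of _ 1]) (use b q in auto)
      have r2: "integrable M2 (\<lambda>x. q2 x * Re (w * iexp (l2 c x)))"
        by (rule M2.integrable_const_bound[of _ 1]) (use b q in auto)
      have Re_q: "Re (w * (complex_of_real q * iexp t)) = q * Re (w * iexp t)" for q t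
        by (metis Re_complex_of_real mult.left_commute Re_complex_of_real times_complex.simps(1) Im_complex_of_real mult_zero_left diff_zero)
      have "Re (w * (CLINT x|M1. complex_of_real (q1 x) * iexp (l1 c x)))
          = (\<integral>x. Re (w * (complex_of_real (q1 x) * iexp (l1 c x))) \<partial>M1)"
        unfolding integral_mult_right_zero[symmetric] integral_Re[OF integrable_mult_right[OF iqe(1)]] ..
      also have "\<dots> = (\<integral>x. q1 x * Re (w * iexp (l1 c x)) \<partial>M1)" unfolding Re_q ..
      also have "\<dots> = (\<integral>x. q1 x + q1 x * Re (w * iexp (l1 c x)) \<partial>M1) - (\<integral>x. q1 x \<partial>M1)"
        unfolding Bochner_Integration.integral_add[OF iq(1) r1] by simp
      also have "(\<integral>x. q1 x + q1 x * Re (w * iexp (l1 c x)) \<partial>M1) = (\<integral>x. (h1 x * (1 + Re (w * iexp (l1 c x)))) * indicator (A j) (Z1 j x) \<partial>M1)"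
        by (intro Bochner_Integration.integral_cong refl) (simp only: q1_def ring_distribs mult_1_right ac_simps)
      also have "\<dots> = (\<integral>x. (h2 x * (1 + Re (w * iexp (l2 c x)))) * indicator (A j) (Z2 j x) \<partial>M2)"
        by (rule part[OF that])
      also have "\<dots> = (\<integral>x. q2 x + q2 x * Re (w * iexp (l2 c x)) \<partial>M2)"
        by (intro Bochner_Integration.integral_cong refl) (simp only: q2_def ring_distribs mult_1_right ac_simps)
      also have "(\<integral>x. q1 x \<partial>M1) = (\<integral>x. q2 x \<partial>M2)" using plain by (simp add: q1_def q2_def)
      also have "(\<integral>x. q2 x + q2 x * Re (w * iexp (l2 c x)) \<partial>M2) - (\<integral>x. q2 x \<partial>M2) = (\<integral>x. q2 x * Re (w * iexp (l2 c x)) \<partial>M2)"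
        unfolding Bochner_Integration.integral_add[OF iq(2) r2] by simp
      also have "\<dots> = (\<integral>x. Re (w * (complex_of_real (q2 x) * iexp (l2 c x))) \<partial>M2)" unfolding Re_q ..
      also have "\<dots> = Re (w * (CLINT x|M2. complex_of_real (q2 x) * iexp (l2 c x)))"
        unfolding integral_mult_right_zero[symmetric] integral_Re[OF integrable_mult_right[OF iqe(2)]] ..
      finally show ?thesis .
    qed
    \<comment> \<open>The factor w = 1 recovers the real part and w = -i the imaginary part.\<close>
    have "(CLINT x|M1. complex_of_real (q1 x) * iexp (l1 c x)) = (CLINT x|M2. complex_of_real (q2 x) * iexp (l2 c x))"
      using Req[of 1] Req[of "- \<i>"] by (auto intro: complex_eqI)
    then show ?case using insert by (simp add: q1_def q2_def h1_def h2_def l1_def l2_def mult.commute)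
  qed
qed

lemma joint_law_eq:
  fixes Z1 :: "'i \<Rightarrow> 'a \<Rightarrow> real" and Z2 :: "'i \<Rightarrow> 'b \<Rightarrow> real"
  assumes M1: "prob_space M1" and M2: "prob_space M2" and K: "finite K"
    and meas: "\<And>i. i \<in> K \<Longrightarrow> Z1 i \<in> borel_measurable M1" "\<And>i. i \<in> K \<Longrightarrow> Z2 i \<in> borel_measurable M2"
    and char: "\<And>c. (CLINT x|M1. iexp (\<Sum>i\<in>K. c i * Z1 i x)) = (CLINT x|M2. iexp (\<Sum>i\<in>K. c i * Z2 i x))"
    and A: "\<And>i. i \<in> K \<Longrightarrow> A i \<in> sets borel"
  shows "measure M1 {x\<in>space M1. \<forall>i\<in>K. Z1 i x \<in> A i} = measure M2 {x\<in>space M2. \<forall>i\<in>K. Z2 i x \<in> A i}"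
proof -
  have *: "(CLINT x|N. complex_of_real (\<Prod>i\<in>K. indicator (A i) (Z i x)) * iexp (\<Sum>i\<in>K. 0 * Z i x))
      = measure N {x\<in>space N. \<forall>i\<in>K. Z i x \<in> A i}"
    if N: "prob_space N" and Z: "\<And>i. i \<in> K \<Longrightarrow> Z i \<in> borel_measurable N" for N and Z :: "'i \<Rightarrow> 'x \<Rightarrow> real"
  proof -
    interpret prob_space N by fact
    have "{x\<in>space N. \<forall>i\<in>K. Z i x \<in> A i} \<in> sets N"
      using K Z A by (intro sets.sets_Collect_finite_All) (auto intro: measurable_sets_Collect[of _ _ borel])
    have "(\<Prod>i\<in>K. indicator (A i) (Z i x)) = (indicator {x\<in>space N. \<forall>i\<in>K. Z i x \<in> A i} x :: real)"
      if "x \<in> space N" for x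
      using that K by (auto simp: indicator_def prod.neutral prod_zero)
    then have "(CLINT x|N. complex_of_real (\<Prod>i\<in>K. indicator (A i) (Z i x)) * iexp (\<Sum>i\<in>K. 0 * Z i x))
       = (CLINT x|N. complex_of_real (indicator {x\<in>space N. \<forall>i\<in>K. Z i x \<in> A i} x))"
      by (intro Bochner_Integration.integral_cong) (auto simp del: of_real_prod)
    also have "\<dots> = measure N {x\<in>space N. \<forall>i\<in>K. Z i x \<in> A i}"
      unfolding integral_complex_of_real
      using \<open>{x\<in>space N. \<forall>i\<in>K. Z i x \<in> A i} \<in> sets N\<close> by (simp add: Int_absorb2 subset_eq)
    finally show ?thesis .
  qed
  show ?thesis
    using joint_law_eq_aux[where J = K and c = "\<lambda>_. 0" and A = A, OF M1 M2 K meas char order_refl A]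
      *[OF M1 meas(1)] *[OF M2 meas(2)] by simp
qed

subsection \<open>Square integrable random variables\<close>

definition L2 :: "'a measure \<Rightarrow> ('a \<Rightarrow> real) \<Rightarrow> bool" where
  "L2 M Z \<longleftrightarrow> Z \<in> borel_measurable M \<and> integrable M (\<lambda>x. (Z x)\<^sup>2)"

lemma L2_measurable[measurable_dest]: "L2 M Z \<Longrightarrow> Z \<in> borel_measurable M"
  and L2_integrable: "L2 M Z \<Longrightarrow> integrable M (\<lambda>x. (Z x)\<^sup>2)"
  by (auto simp: L2_def)

lemma L2_mult_integrable:
  assumes "L2 M Z" "L2 M Y"
  shows "integrable M (\<lambda>x. Z x * Y x)"
proof (rule Bochner_Integration.integrable_bound)
  show "integrable M (\<lambda>x. (Z x)\<^sup>2 + (Y x)\<^sup>2)" using assms by (auto simp: L2_def)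
  show "AE x in M. norm (Z x * Y x) \<le> norm ((Z x)\<^sup>2 + (Y x)\<^sup>2)"
  proof (rule AE_I2)
    fix x
    define p where "p = \<bar>Z x\<bar> * \<bar>Y x\<bar>"
    have "2 * p \<le> (Z x)\<^sup>2 + (Y x)\<^sup>2" using sum_squares_bound[of "\<bar>Z x\<bar>" "\<bar>Y x\<bar>"] by (simp add: p_def)
    moreover have "0 \<le> p" by (simp add: p_def)
    ultimately have "p \<le> (Z x)\<^sup>2 + (Y x)\<^sup>2" by linarith
    then show "norm (Z x * Y x) \<le> norm ((Z x)\<^sup>2 + (Y x)\<^sup>2)" by (simp add: abs_mult p_def)
  qed
qed (use assms in \<open>auto simp: L2_def\<close>)

lemma L2_lin: "L2 M Z \<Longrightarrow> L2 M Y \<Longrightarrow> L2 M (\<lambda>x. a * Z x + b * Y x)"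
proof -
  assume *: "L2 M Z" "L2 M Y"
  have "(\<lambda>x. (a * Z x + b * Y x)\<^sup>2) = (\<lambda>x. (a\<^sup>2 * (Z x)\<^sup>2 + b\<^sup>2 * (Y x)\<^sup>2) + (2 * a * b) * (Z x * Y x))"
    by (auto simp: power2_eq_square algebra_simps)
  then have "integrable M (\<lambda>x. (a * Z x + b * Y x)\<^sup>2)"
    using * L2_mult_integrable[OF *] by (simp add: L2_def)
  with * show ?thesis by (auto simp: L2_def)
qed

lemma L2_cmult: "L2 M Z \<Longrightarrow> L2 M (\<lambda>x. a * Z x)"
  using L2_lin[of M Z Z a 0] by simp

lemma L2_add: "L2 M Z \<Longrightarrow> L2 M Y \<Longrightarrow> L2 M (\<lambda>x. Z x + Y x)"
  using L2_lin[of M Z Y 1 1] by simp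

lemma L2_diff: "L2 M Z \<Longrightarrow> L2 M Y \<Longrightarrow> L2 M (\<lambda>x. Z x - Y x)"
  using L2_lin[of M Z Y 1 "-1"] by simp

lemma L2_zero[simp]: "L2 M (\<lambda>x. 0)" by (simp add: L2_def)

lemma L2_sum: "(\<And>i. i \<in> I \<Longrightarrow> L2 M (f i)) \<Longrightarrow> L2 M (\<lambda>x. \<Sum>i\<in>I. f i x)"
  by (induction I rule: infinite_finite_induct) (auto intro: L2_add)

abbreviation (in prob_space) mean :: "('a \<Rightarrow> real) \<Rightarrow> real" (binder "\<E>" 10) where "mean \<equiv> expectation"

lemma (in prob_space) L2_const: "L2 M (\<lambda>x. c)" by (simp add: L2_def)

lemma (in prob_space) L2_integrable1:
  assumes "L2 M Z"
  shows "integrable M Z"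
  using L2_mult_integrable[OF assms L2_const[of 1]] by simp

lemma (in prob_space) L2_abs_expectation_le:
  assumes "L2 M Z"
  shows "(\<E> x. \<bar>Z x\<bar>)\<^sup>2 \<le> (\<E> x. (Z x)\<^sup>2)"
proof -
  have i: "integrable M (\<lambda>x. \<bar>Z x\<bar>)" "integrable M (\<lambda>x. \<bar>Z x\<bar>\<^sup>2)"
    using L2_integrable1[OF assms] L2_integrable[OF assms] by auto
  have "0 \<le> variance (\<lambda>x. \<bar>Z x\<bar>)" by (rule variance_positive)
  then show ?thesis unfolding variance_eq[OF i] by simp
qed

lemma L2_square_le:
  assumes "L2 M Z" "L2 M Y"
  shows "(\<integral>x. (Z x + Y x)\<^sup>2 \<partial>M) \<le> 2 * (\<integral>x. (Z x)\<^sup>2 \<partial>M) + 2 * (\<integral>x. (Y x)\<^sup>2 \<partial>M)"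
proof -
  have "(\<integral>x. (Z x + Y x)\<^sup>2 \<partial>M) \<le> (\<integral>x. 2 * (Z x)\<^sup>2 + 2 * (Y x)\<^sup>2 \<partial>M)"
  proof (rule integral_mono)
    show "(Z x + Y x)\<^sup>2 \<le> 2 * (Z x)\<^sup>2 + 2 * (Y x)\<^sup>2" for x
      using sum_squares_bound[of "Z x" "Y x"] by (simp add: power2_sum)
  qed (use L2_add[OF assms] assms in \<open>auto simp: L2_def\<close>)
  also have "\<dots> = 2 * (\<integral>x. (Z x)\<^sup>2 \<partial>M) + 2 * (\<integral>x. (Y x)\<^sup>2 \<partial>M)"
    using assms by (subst Bochner_Integration.integral_add) (auto simp: L2_def)
  finally show ?thesis .
qed

lemma L2_sum_square_le:
  assumes "finite I" "\<And>i. i \<in> I \<Longrightarrow> L2 M (f i)"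
  shows "(\<integral>x. (\<Sum>i\<in>I. f i x)\<^sup>2 \<partial>M) \<le> card I * (\<Sum>i\<in>I. (\<integral>x. (f i x)\<^sup>2 \<partial>M))"
proof -
  have "(\<integral>x. (\<Sum>i\<in>I. f i x)\<^sup>2 \<partial>M) \<le> (\<integral>x. card I * (\<Sum>i\<in>I. (f i x)\<^sup>2) \<partial>M)"
  proof (rule integral_mono)
    show "(\<Sum>i\<in>I. f i x)\<^sup>2 \<le> card I * (\<Sum>i\<in>I. (f i x)\<^sup>2)" for x
      using Cauchy_Schwarz_ineq_sum[of "\<lambda>_. 1" "\<lambda>i. f i x" I] by simp
  qed (use assms L2_sum[of I M f] in \<open>auto simp: L2_def\<close>)
  also have "\<dots> = card I * (\<Sum>i\<in>I. (\<integral>x. (f i x)\<^sup>2 \<partial>M))"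
    using assms by (subst integral_mult_right_zero, subst Bochner_Integration.integral_sum) (auto simp: L2_def)
  finally show ?thesis .
qed

text \<open>If the increments decay geometrically, a single integrable random variable \<open>D\<close> dominates them all;
  this yields convergence almost surely and in mean square at the same time.\<close>

lemma (in prob_space) L2_summable_limit:
  assumes Z: "\<And>n. L2 M (Z n)" and C: "\<And>n. (\<E> x. (Z (Suc n) x - Z n x)\<^sup>2) \<le> C * (1 / 8) ^ n"
  shows "\<exists>Y. L2 M Y \<and> (\<lambda>n. \<E> x. (Z n x - Y x)\<^sup>2) \<longlonglongrightarrow> 0 \<and> (AE x in M. (\<lambda>n. Z n x) \<longlonglongrightarrow> Y x)"
proof -
  have [measurable]: "Z n \<in> borel_measurable M" for n using Z by (auto simp: L2_def)
  \<comment> \<open>The factor 4^n is a compromise: the expectations still decay like 2^(-n), hence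
    D is integrable, while D \<ge> d n bounds the n-th increment by sqrt D times 2^(-n).\<close>
  define d where "d n x = (Z (Suc n) x - Z n x)\<^sup>2 * 4 ^ n" for n x
  have [measurable]: "d n \<in> borel_measurable M" for n unfolding d_def by measurable
  have d0: "0 \<le> d n x" for n x by (simp add: d_def)
  have dint: "integrable M (d n)" for n
    unfolding d_def using L2_diff[OF Z Z, of "Suc n" n] by (auto simp: L2_def)
  have dle: "(\<E> x. d n x) \<le> C * (1/2)^n" for n
  proof -
    have "(\<E> x. d n x) = (\<E> x. (Z (Suc n) x - Z n x)\<^sup>2) * 4 ^ n" by (simp add: d_def)
    also have "\<dots> \<le> (C * (1/8)^n) * 4^n" using C[of n] by (intro mult_right_mono) auto
    also have "\<dots> = C * (1/2)^n" by (simp add: power_mult_distrib[symmetric])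
    finally show ?thesis .
  qed
  have sd: "summable (\<lambda>n. \<E> x. d n x)"
  proof (rule summable_comparison_test')
    show "summable (\<lambda>n. C * (1/2)^n)" by (intro summable_mult summable_geometric) simp
    show "norm (\<E> x. d n x) \<le> C * (1/2)^n" for n
      using dle[of n] Bochner_Integration.integral_nonneg[of M "d n"] d0 by simp
  qed
  have AEs: "AE x in M. summable (\<lambda>n. d n x)"
  proof -
    have "(\<integral>\<^sup>+x. (\<Sum>n. ennreal (d n x)) \<partial>M) = (\<Sum>n. \<integral>\<^sup>+x. ennreal (d n x) \<partial>M)"
      by (rule nn_integral_suminf) measurable
    also have "\<dots> = (\<Sum>n. ennreal (\<E> x. d n x))"
      using dint d0 by (intro suminf_cong nn_integral_eq_integral) auto
    also have "\<dots> = ennreal (\<Sum>n. \<E> x. d n x)"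
      using sd d0 by (intro suminf_ennreal2) auto
    finally have "(\<integral>\<^sup>+x. (\<Sum>n. ennreal (d n x)) \<partial>M) \<noteq> \<infinity>" by simp
    then have "AE x in M. (\<Sum>n. ennreal (d n x)) \<noteq> \<infinity>" by (intro nn_integral_noteq_infinite) auto
    then show ?thesis by eventually_elim (use d0 in \<open>auto intro!: summable_suminf_not_top simp: top_ennreal_def\<close>)
  qed
  define D where "D x = (\<Sum>n. d n x)" for x
  have Dint: "integrable M D"
    unfolding D_def using AEs dint sd d0 by (intro integrable_suminf) (auto simp: eventually_mono)
  have inc: "\<bar>Z (Suc n) x - Z n x\<bar> \<le> sqrt (D x) * (1/2)^n" if "summable (\<lambda>n. d n x)" for n x
  proof -
    have "d n x \<le> D x" unfolding D_def using that d0 sum_le_suminf[OF that, of "{n}"] by auto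
    then have "sqrt (d n x) \<le> sqrt (D x)" by simp
    moreover have "d n x = (\<bar>Z (Suc n) x - Z n x\<bar> * 2^n)\<^sup>2"
    proof -
      have "(2^n)\<^sup>2 = (4::real)^n" by (simp add: power2_eq_square flip: power_mult_distrib)
      then show ?thesis by (simp add: d_def power_mult_distrib)
    qed
    then have "sqrt (d n x) = \<bar>Z (Suc n) x - Z n x\<bar> * 2^n" by simp
    ultimately have "\<bar>Z (Suc n) x - Z n x\<bar> * 2^n \<le> sqrt (D x)" by simp
    then show ?thesis by (simp add: power_divide pos_le_divide_eq)
  qed
  define Y where "Y x = Z 0 x + (\<Sum>n. Z (Suc n) x - Z n x)" for x
  have [measurable]: "Y \<in> borel_measurable M" unfolding Y_def by measurable
  have tail: "(\<lambda>n. Z n x) \<longlonglongrightarrow> Y x \<and> (\<forall>n. \<bar>Z n x - Y x\<bar> \<le> 2 * sqrt (D x) * (1/2)^n)" if s: "summable (\<lambda>n. d n x)" for x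
  proof -
    have sa: "summable (\<lambda>n. \<bar>Z (Suc n) x - Z n x\<bar>)"
    proof (rule summable_comparison_test')
      show "summable (\<lambda>n. sqrt (D x) * (1/2)^n)" by (intro summable_mult summable_geometric) simp
      show "norm \<bar>Z (Suc n) x - Z n x\<bar> \<le> sqrt (D x) * (1/2)^n" for n using inc[OF s] by simp
    qed
    then have ss: "summable (\<lambda>n. Z (Suc n) x - Z n x)" by (rule summable_rabs_cancel)
    have Yn: "Y x - Z n x = (\<Sum>k. Z (Suc (k + n)) x - Z (k + n) x)" for n
    proof -
      have "(\<Sum>k<n. Z (Suc k) x - Z k x) = Z n x - Z 0 x" by (rule sum_lessThan_telescope)
      then show ?thesis unfolding Y_def using suminf_split_initial_segment[OF ss, of n] by linarith
    qed
    have bd: "\<bar>Z n x - Y x\<bar> \<le> 2 * sqrt (D x) * (1/2)^n" for n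
    proof -
      have g: "summable (\<lambda>k. sqrt (D x) * (1/2)^(k+n) :: real)"
        unfolding power_add by (intro summable_mult summable_mult2 summable_geometric) simp
      have "\<bar>Y x - Z n x\<bar> \<le> (\<Sum>k. \<bar>Z (Suc (k + n)) x - Z (k + n) x\<bar>)"
        unfolding Yn by (rule summable_rabs[OF summable_ignore_initial_segment[OF sa, of n]])
      also have "\<dots> \<le> (\<Sum>k. sqrt (D x) * (1/2)^(k+n))"
        by (rule suminf_le[OF inc[OF s] summable_ignore_initial_segment[OF sa, of n] g])
      also have "\<dots> = (\<Sum>k. (sqrt (D x) * (1/2)^n) * (1/2)^k)" by (simp add: power_add mult_ac)
      also have "\<dots> = (sqrt (D x) * (1/2)^n) * (\<Sum>k. (1/2)^k)"
        by (intro suminf_mult summable_geometric) auto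
      also have "(\<Sum>k. (1/2)^k) = (2::real)" by (subst suminf_geometric) auto
      finally show ?thesis by (simp add: abs_minus_commute)
    qed
    have "(\<lambda>n. 2 * sqrt (D x) * (1/2)^n) \<longlonglongrightarrow> 2 * sqrt (D x) * 0"
      by (intro tendsto_intros LIMSEQ_power_zero) auto
    then have "(\<lambda>n. 2 * sqrt (D x) * (1/2)^n) \<longlonglongrightarrow> 0" by simp
    then have "(\<lambda>n. Z n x - Y x) \<longlonglongrightarrow> 0"
      by (rule Lim_null_comparison[rotated]) (use bd in auto)
    then have "(\<lambda>n. Z n x) \<longlonglongrightarrow> Y x" by (rule LIM_zero_cancel)
    with bd show ?thesis by auto
  qed
  have sq: "AE x in M. (Z n x - Y x)\<^sup>2 \<le> 4 * D x * (1/4)^n" for n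
    using AEs
  proof eventually_elim
    case (elim x)
    have D0: "D x \<ge> 0" unfolding D_def using elim d0 by (intro suminf_nonneg) auto
    have "\<bar>Z n x - Y x\<bar>\<^sup>2 \<le> (2 * sqrt (D x) * (1/2)^n)\<^sup>2" using tail[OF elim] by (intro power_mono) auto
    also have "\<dots> = 4 * D x * ((1/2)^n)\<^sup>2" using D0 by (simp add: power_mult_distrib)
    also have "((1/2)^n)\<^sup>2 = (1/4::real)^n" by (simp add: power2_eq_square flip: power_mult_distrib)
    finally show ?case by simp
  qed
  have LZY: "L2 M (\<lambda>x. Z n x - Y x)" for n
  proof -
    have "integrable M (\<lambda>x. (Z n x - Y x)\<^sup>2)"
    proof (rule Bochner_Integration.integrable_bound)
      show "integrable M (\<lambda>x. 4 * D x * (1/4)^n)" using Dint by simp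
      show "AE x in M. norm ((Z n x - Y x)\<^sup>2) \<le> norm (4 * D x * (1/4)^n)"
        using sq[of n] by eventually_elim (simp add: abs_of_nonneg order_trans[OF _ abs_ge_self])
    qed measurable
    then show ?thesis by (simp add: L2_def)
  qed
  have "L2 M Y" using L2_diff[OF Z[of 0] LZY[of 0]] by simp
  moreover have "(\<lambda>n. \<E> x. (Z n x - Y x)\<^sup>2) \<longlonglongrightarrow> 0"
  proof (rule Lim_null_comparison)
    show "\<forall>\<^sub>F n in sequentially. norm (\<E> x. (Z n x - Y x)\<^sup>2) \<le> (\<E> x. 4 * D x) * (1/4)^n"
    proof (rule always_eventually, rule allI)
      fix n
      have "(\<E> x. (Z n x - Y x)\<^sup>2) \<le> (\<E> x. 4 * D x * (1/4)^n)"
        using sq[of n] LZY[of n] Dint by (intro integral_mono_AE) (auto simp: L2_def)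
      then show "norm (\<E> x. (Z n x - Y x)\<^sup>2) \<le> (\<E> x. 4 * D x) * (1/4)^n" by simp
    qed
    have "(\<lambda>n. (\<E> x. 4 * D x) * (1/4)^n) \<longlonglongrightarrow> (\<E> x. 4 * D x) * 0"
      by (intro tendsto_intros LIMSEQ_power_zero) auto
    then show "(\<lambda>n. (\<E> x. 4 * D x) * (1/4)^n) \<longlonglongrightarrow> 0" by simp
  qed
  moreover have "AE x in M. (\<lambda>n. Z n x) \<longlonglongrightarrow> Y x"
    using AEs by eventually_elim (use tail in auto)
  ultimately show ?thesis by blast
qed

lemma (in prob_space) L2_Cauchy_limit:
  assumes Z: "\<And>n. L2 M (Z n)"
    and C: "\<And>e. e > 0 \<Longrightarrow> \<exists>N. \<forall>m\<ge>N. \<forall>n\<ge>N. (\<E> x. (Z m x - Z n x)\<^sup>2) < e"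
  shows "\<exists>Y. L2 M Y \<and> (\<lambda>n. \<E> x. (Z n x - Y x)\<^sup>2) \<longlonglongrightarrow> 0"
proof -
  obtain N where N: "\<And>k m n. m \<ge> N k \<Longrightarrow> n \<ge> N k \<Longrightarrow> (\<E> x. (Z m x - Z n x)\<^sup>2) < (1/8)^k"
  proof -
    have "\<exists>N. \<forall>m\<ge>N. \<forall>n\<ge>N. (\<E> x. (Z m x - Z n x)\<^sup>2) < (1/8)^k" for k by (rule C) simp
    then show thesis using that by metis
  qed
  \<comment> \<open>Partial sums dominate both N k and, at the next index, N k again, so that
    consecutive chosen terms are within the k-th tolerance.\<close>
  define r where "r k = (\<Sum>i\<le>k. N i)" for k
  have rN: "r k \<ge> N k" for k unfolding r_def by (rule member_le_sum) auto
  have rS: "r (Suc k) \<ge> N k" for k using rN[of k] by (simp add: r_def)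
  have "\<exists>Y. L2 M Y \<and> (\<lambda>n. \<E> x. (Z (r n) x - Y x)\<^sup>2) \<longlonglongrightarrow> 0 \<and> (AE x in M. (\<lambda>n. Z (r n) x) \<longlonglongrightarrow> Y x)"
    by (rule L2_summable_limit[where C = 1]) (use Z N rN rS in \<open>auto intro: less_imp_le\<close>)
  then obtain Y where Y: "L2 M Y" "(\<lambda>n. \<E> x. (Z (r n) x - Y x)\<^sup>2) \<longlonglongrightarrow> 0" by blast
  have "(\<lambda>n. \<E> x. (Z n x - Y x)\<^sup>2) \<longlonglongrightarrow> 0"
  proof (rule LIMSEQ_I)
    fix e :: real assume e: "e > 0"
    obtain k1 where k1: "\<And>k. k \<ge> k1 \<Longrightarrow> (\<E> x. (Z (r k) x - Y x)\<^sup>2) < e / 4"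
      using LIMSEQ_D[OF Y(2), of "e/4"] e by auto
    obtain k2 :: nat where k2: "(1/8)^k2 < e/4" using real_arch_pow_inv[of "e/4" "1/8"] e by auto
    define k where "k = max k1 k2"
    have "(1/8::real)^k \<le> (1/8)^k2" unfolding k_def by (intro power_decreasing) auto
    then have k3: "(1/8::real)^k < e/4" using k2 by (rule le_less_trans)
    have "norm ((\<E> x. (Z n x - Y x)\<^sup>2) - 0) < e" if "n \<ge> N k" for n
    proof -
      have "(\<E> x. ((Z n x - Z (r k) x) + (Z (r k) x - Y x))\<^sup>2)
         \<le> 2 * (\<E> x. (Z n x - Z (r k) x)\<^sup>2) + 2 * (\<E> x. (Z (r k) x - Y x)\<^sup>2)"
        by (intro L2_square_le L2_diff Z Y)
      also have "\<dots> < 2 * (e/4) + 2 * (e/4)"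
        using N[OF that rN[of k]] k3 k1[of k] by (auto simp: k_def intro!: add_strict_mono)
      finally show ?thesis by simp
    qed
    then show "\<exists>no. \<forall>n\<ge>no. norm ((\<E> x. (Z n x - Y x)\<^sup>2) - 0) < e" by blast
  qed
  with Y show ?thesis by blast
qed

lemma (in prob_space) L2_limit_AE_subseq:
  assumes Z: "\<And>n. L2 M (Z n)" and Y: "L2 M Y" and lim: "(\<lambda>n. \<E> x. (Z n x - Y x)\<^sup>2) \<longlonglongrightarrow> 0"
  shows "\<exists>r. strict_mono r \<and> (AE x in M. (\<lambda>n. Z (r n) x) \<longlonglongrightarrow> Y x)"
proof -
  have "(\<lambda>n. \<E> x. norm ((Z n x - Y x)\<^sup>2)) \<longlonglongrightarrow> 0" using lim by simp
  from tendsto_L1_AE_subseq[OF _ this]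
  obtain r where r: "strict_mono r" "AE x in M. (\<lambda>n. (Z (r n) x - Y x)\<^sup>2) \<longlonglongrightarrow> 0"
    using L2_integrable[OF L2_diff[OF Z Y]] by blast
  have "AE x in M. (\<lambda>n. Z (r n) x) \<longlonglongrightarrow> Y x"
    using r(2)
  proof eventually_elim
    case (elim x)
    then have "(\<lambda>n. sqrt ((Z (r n) x - Y x)\<^sup>2)) \<longlonglongrightarrow> sqrt 0" by (intro tendsto_intros)
    then have "(\<lambda>n. \<bar>Z (r n) x - Y x\<bar>) \<longlonglongrightarrow> 0" by simp
    then show ?case by (intro LIM_zero_cancel[where l = "Y x"]) (simp add: tendsto_rabs_zero_iff)
  qed
  with r(1) show ?thesis by blast
qed

lemma L2_Cauchy_Schwarz:
  assumes FG: "L2 M F" "L2 M G"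
  shows "(\<integral>x. F x * G x \<partial>M)\<^sup>2 \<le> (\<integral>x. (F x)\<^sup>2 \<partial>M) * (\<integral>x. (G x)\<^sup>2 \<partial>M)"
proof -
  have pos: "0 \<le> (\<integral>x. (F x)\<^sup>2 \<partial>M) + 2 * t * (\<integral>x. F x * G x \<partial>M) + t\<^sup>2 * (\<integral>x. (G x)\<^sup>2 \<partial>M)" for t
  proof -
    have "0 \<le> (\<integral>x. (F x + t * G x)\<^sup>2 \<partial>M)" by simp
    also have "\<dots> = (\<integral>x. ((F x)\<^sup>2 + (2 * t) * (F x * G x)) + t\<^sup>2 * (G x)\<^sup>2 \<partial>M)"
      by (intro Bochner_Integration.integral_cong) (auto simp: power2_eq_square algebra_simps)
    also have "\<dots> = (\<integral>x. (F x)\<^sup>2 \<partial>M) + 2 * t * (\<integral>x. F x * G x \<partial>M) + t\<^sup>2 * (\<integral>x. (G x)\<^sup>2 \<partial>M)"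
      unfolding Bochner_Integration.integral_add[OF Bochner_Integration.integrable_add[OF L2_integrable[OF FG(1)]
          integrable_mult_right[OF L2_mult_integrable[OF FG]]] integrable_mult_right[OF L2_integrable[OF FG(2)]]]
        Bochner_Integration.integral_add[OF L2_integrable[OF FG(1)] integrable_mult_right[OF L2_mult_integrable[OF FG]]]
        integral_mult_right_zero ..
    finally show ?thesis .
  qed
  define a b c where "a = (\<integral>x. (G x)\<^sup>2 \<partial>M)" and "b = (\<integral>x. F x * G x \<partial>M)" and "c = (\<integral>x. (F x)\<^sup>2 \<partial>M)"
  have "a \<ge> 0" by (simp add: a_def)
  have pos': "0 \<le> c + 2 * t * b + t\<^sup>2 * a" for t using pos[of t] by (simp add: a_def b_def c_def)
  show ?thesis unfolding a_def[symmetric] b_def[symmetric] c_def[symmetric]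
  \<comment> \<open>If a = 0 the polynomial is affine in t and nonnegative, so its slope vanishes;
    otherwise t = -b/a is its minimiser.\<close>
  proof (cases "a = 0")
    case True
    have "b = 0"
    proof (rule ccontr)
      assume "b \<noteq> 0"
      then have "2 * (- (c + 1) / (2 * b)) * b = - (c + 1)" by simp
      then show False using pos'[of "- (c + 1) / (2 * b)"] True by simp
    qed
    then show "b\<^sup>2 \<le> c * a" using True by simp
  next
    case False
    with \<open>a \<ge> 0\<close> have a: "a > 0" by simp
    have "0 \<le> (c + 2 * (- b / a) * b + (- b / a)\<^sup>2 * a) * a" using pos'[of "- b / a"] a by simp
    also have "\<dots> = c * a - b\<^sup>2" using a by (simp add: field_simps power2_eq_square)
    finally show "b\<^sup>2 \<le> c * a" by simp
  qed
qed

lemma (in prob_space) L2_limit_moments: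
  assumes Z: "\<And>n. L2 M (Z n)" and Y: "L2 M Y" and lim: "(\<lambda>n. \<E> x. (Z n x - Y x)\<^sup>2) \<longlonglongrightarrow> 0" and W: "L2 M W"
  shows "(\<lambda>n. \<E> x. Z n x * W x) \<longlonglongrightarrow> (\<E> x. Y x * W x)"
    and "(\<lambda>n. \<E> x. (Z n x)\<^sup>2) \<longlonglongrightarrow> (\<E> x. (Y x)\<^sup>2)"
    and "(\<lambda>n. \<E> x. \<bar>Z n x - Y x\<bar>) \<longlonglongrightarrow> 0"
proof -
  note d = L2_diff[OF Z Y]
  have null: "(\<lambda>n. \<E> x. (Z n x - Y x) * V x) \<longlonglongrightarrow> 0" if V: "L2 M V" for V
  proof -
    have *: "(\<lambda>n. (\<E> x. (Z n x - Y x)\<^sup>2) * (\<E> x. (V x)\<^sup>2)) \<longlonglongrightarrow> 0"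
      using lim by (rule tendsto_mult_left_zero)
    have "(\<lambda>n. (\<E> x. (Z n x - Y x) * V x)\<^sup>2) \<longlonglongrightarrow> 0"
    proof (rule tendsto_sandwich[OF _ _ tendsto_const *])
      show "\<forall>\<^sub>F n in sequentially. (\<E> x. (Z n x - Y x) * V x)\<^sup>2 \<le> (\<E> x. (Z n x - Y x)\<^sup>2) * (\<E> x. (V x)\<^sup>2)"
        by (intro always_eventually allI L2_Cauchy_Schwarz[OF d V])
    qed simp
    then have "(\<lambda>n. sqrt ((\<E> x. (Z n x - Y x) * V x)\<^sup>2)) \<longlonglongrightarrow> sqrt 0" by (intro tendsto_intros)
    then show ?thesis by (simp add: tendsto_rabs_zero_iff)
  qed
  have lin: "(\<lambda>n. \<E> x. Z n x * V x) \<longlonglongrightarrow> (\<E> x. Y x * V x)" if V: "L2 M V" for V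
  proof (rule LIM_zero_cancel)
    have "(\<E> x. (Z n x - Y x) * V x) = (\<E> x. Z n x * V x) - (\<E> x. Y x * V x)" for n
      using L2_mult_integrable[OF Z V] L2_mult_integrable[OF Y V] by (simp add: left_diff_distrib)
    with null[OF V] show "(\<lambda>n. (\<E> x. Z n x * V x) - (\<E> x. Y x * V x)) \<longlonglongrightarrow> 0" by simp
  qed
  show "(\<lambda>n. \<E> x. Z n x * W x) \<longlonglongrightarrow> (\<E> x. Y x * W x)" by (rule lin[OF W])
  have "(\<E> x. (Z n x)\<^sup>2) = (\<E> x. (Z n x - Y x)\<^sup>2) + 2 * (\<E> x. Z n x * Y x) - (\<E> x. (Y x)\<^sup>2)" for n
  proof -
    have "(\<E> x. (Z n x)\<^sup>2) = (\<E> x. ((Z n x - Y x)\<^sup>2 + 2 * (Z n x * Y x)) - (Y x)\<^sup>2)"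
      by (intro Bochner_Integration.integral_cong) (auto simp: power2_eq_square algebra_simps)
    then show ?thesis using L2_integrable[OF d[of n]] L2_integrable[OF Y] L2_mult_integrable[OF Z Y, of n] by simp
  qed
  moreover have "(\<lambda>n. (\<E> x. (Z n x - Y x)\<^sup>2) + 2 * (\<E> x. Z n x * Y x) - (\<E> x. (Y x)\<^sup>2)) \<longlonglongrightarrow>
     0 + 2 * (\<E> x. Y x * Y x) - (\<E> x. (Y x)\<^sup>2)" by (intro tendsto_intros lim lin Y)
  ultimately show "(\<lambda>n. \<E> x. (Z n x)\<^sup>2) \<longlonglongrightarrow> (\<E> x. (Y x)\<^sup>2)" by (simp add: power2_eq_square)
  have "(\<lambda>n. (\<E> x. \<bar>Z n x - Y x\<bar>)\<^sup>2) \<longlonglongrightarrow> 0"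
  proof (rule tendsto_sandwich[OF _ _ tendsto_const lim])
    show "\<forall>\<^sub>F n in sequentially. (\<E> x. \<bar>Z n x - Y x\<bar>)\<^sup>2 \<le> (\<E> x. (Z n x - Y x)\<^sup>2)"
      by (intro always_eventually allI L2_abs_expectation_le d)
  qed simp
  then have "(\<lambda>n. sqrt ((\<E> x. \<bar>Z n x - Y x\<bar>)\<^sup>2)) \<longlonglongrightarrow> sqrt 0" by (intro tendsto_intros)
  then show "(\<lambda>n. \<E> x. \<bar>Z n x - Y x\<bar>) \<longlonglongrightarrow> 0" by simp
qed

subsection \<open>Gaussian families\<close>

text \<open>A linear space of centred, jointly Gaussian variables. Closure under combinations is
  what turns the scalar condition on characteristic functions into a statement about joint
  laws.\<close>

definition gaussian_family :: "'a measure \<Rightarrow> ('a \<Rightarrow> real) set \<Rightarrow> bool" where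
  "gaussian_family M V \<longleftrightarrow> (\<lambda>x. 0) \<in> V \<and> (\<forall>Z\<in>V. \<forall>Y\<in>V. \<forall>a b. (\<lambda>x. a * Z x + b * Y x) \<in> V) \<and>
     (\<forall>Z\<in>V. L2 M Z \<and> (CLINT x|M. iexp (Z x)) = complex_of_real (exp (- (\<integral>x. (Z x)\<^sup>2 \<partial>M) / 2)))"

lemma gaussian_familyD:
  assumes "gaussian_family M V"
  shows "(\<lambda>x. 0) \<in> V"
    and "Z \<in> V \<Longrightarrow> Y \<in> V \<Longrightarrow> (\<lambda>x. a * Z x + b * Y x) \<in> V"
    and "Z \<in> V \<Longrightarrow> L2 M Z"
    and "Z \<in> V \<Longrightarrow> (CLINT x|M. iexp (Z x)) = complex_of_real (exp (- (\<integral>x. (Z x)\<^sup>2 \<partial>M) / 2))"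
  using assms by (auto simp: gaussian_family_def)

lemma gaussian_family_add: "gaussian_family M V \<Longrightarrow> Z \<in> V \<Longrightarrow> Y \<in> V \<Longrightarrow> (\<lambda>x. Z x + Y x) \<in> V"
  using gaussian_familyD(2)[of M V Z Y 1 1] by simp

lemma gaussian_family_cmult: "gaussian_family M V \<Longrightarrow> Z \<in> V \<Longrightarrow> (\<lambda>x. a * Z x) \<in> V"
  using gaussian_familyD(2)[of M V Z Z a 0] by simp

lemma gaussian_family_diff: "gaussian_family M V \<Longrightarrow> Z \<in> V \<Longrightarrow> Y \<in> V \<Longrightarrow> (\<lambda>x. Z x - Y x) \<in> V"
  using gaussian_familyD(2)[of M V Z Y 1 "-1"] by simp

lemma gaussian_family_sum:
  assumes "gaussian_family M V" "\<And>i. i \<in> I \<Longrightarrow> f i \<in> V"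
  shows "(\<lambda>x. \<Sum>i\<in>I. f i x) \<in> V"
  using assms(2)
proof (induction I rule: infinite_finite_induct)
  case (insert i I)
  then have "(\<lambda>x. f i x + (\<Sum>i\<in>I. f i x)) \<in> V" by (intro gaussian_family_add[OF assms(1)]) auto
  with insert show ?case by simp
qed (use gaussian_familyD(1)[OF assms(1)] in auto)

definition gen_sigma :: "'a measure \<Rightarrow> ('a \<Rightarrow> real) set \<Rightarrow> 'a measure" where
  "gen_sigma M S = sigma (space M) {Z -` A \<inter> space M | Z A. Z \<in> S \<and> A \<in> sets borel}"

lemma space_gen_sigma[simp]: "space (gen_sigma M S) = space M"
  unfolding gen_sigma_def by (rule space_measure_of) auto

lemma sets_gen_sigma: "sets (gen_sigma M S) = sigma_sets (space M) {Z -` A \<inter> space M | Z A. Z \<in> S \<and> A \<in> sets borel}"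
  unfolding gen_sigma_def by (rule sets_measure_of) auto

lemma measurable_gen_sigma: "Z \<in> S \<Longrightarrow> Z \<in> borel_measurable (gen_sigma M S)"
  by (rule measurableI) (auto simp: sets_gen_sigma)

lemma sets_gen_sigma_subset:
  assumes "S \<subseteq> borel_measurable M"
  shows "sets (gen_sigma M S) \<subseteq> sets M"
  unfolding sets_gen_sigma
  by (rule sets.sigma_sets_subset) (use assms in \<open>auto intro: measurable_sets\<close>)

lemma measurable_from_gen_sigma:
  assumes "S \<subseteq> borel_measurable M" "f \<in> measurable (gen_sigma M S) N"
  shows "f \<in> measurable M N"
proof (rule measurableI)
  show "x \<in> space M \<Longrightarrow> f x \<in> space N" for x using measurable_space[OF assms(2), of x] by simp
  show "A \<in> sets N \<Longrightarrow> f -` A \<inter> space M \<in> sets M" for A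
    using measurable_sets[OF assms(2), of A] sets_gen_sigma_subset[OF assms(1)] by auto
qed

text \<open>Orthogonality makes variances add, so the Gaussian characteristic function factorises.
  The product space on the right realises an independent pair with the same marginals.\<close>

lemma (in prob_space) gaussian_char_pair:
  assumes V: "gaussian_family M V" and Z: "Z \<in> V" and Y: "Y \<in> V" and orth: "(\<E> x. Z x * Y x) = 0"
  shows "(CLINT x|M. iexp (Z x + Y x)) = (CLINT p|(M \<Otimes>\<^sub>M M). iexp (Z (fst p) + Y (snd p)))"
proof -
  note L = gaussian_familyD(3)[OF V]
  have [measurable]: "Z \<in> borel_measurable M" "Y \<in> borel_measurable M" using L[OF Z] L[OF Y] by (auto simp: L2_def)
  interpret P: pair_prob_space M M by unfold_locales
  have "(\<E> x. (Z x + Y x)\<^sup>2) = (\<E> x. ((Z x)\<^sup>2 + 2 * (Z x * Y x)) + (Y x)\<^sup>2)"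
    by (intro Bochner_Integration.integral_cong) (auto simp: power2_eq_square algebra_simps)
  also have "\<dots> = (\<E> x. (Z x)\<^sup>2) + (\<E> x. (Y x)\<^sup>2)"
    unfolding Bochner_Integration.integral_add[OF Bochner_Integration.integrable_add[OF L2_integrable[OF L[OF Z]]
            integrable_mult_right[OF L2_mult_integrable[OF L[OF Z] L[OF Y]]]] L2_integrable[OF L[OF Y]]]
          Bochner_Integration.integral_add[OF L2_integrable[OF L[OF Z]] integrable_mult_right[OF L2_mult_integrable[OF L[OF Z] L[OF Y]]]]
          integral_mult_right_zero orth by simp
  finally have sq: "(\<E> x. (Z x + Y x)\<^sup>2) = (\<E> x. (Z x)\<^sup>2) + (\<E> x. (Y x)\<^sup>2)" .
  have int: "integrable (M \<Otimes>\<^sub>M M) (\<lambda>p. iexp (Z (fst p) + Y (snd p)))"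
    by (rule P.integrable_const_bound[of _ 1]) (auto simp del: of_real_add)
  have "(CLINT p|(M \<Otimes>\<^sub>M M). iexp (Z (fst p) + Y (snd p))) = (CLINT x|M. CLINT y|M. iexp (Z x + Y y))"
    using P.integral_fst'[OF int] by simp
  also have "\<dots> = (CLINT x|M. CLINT y|M. iexp (Z x) * iexp (Y y))"
    by (simp add: exp_add distrib_left)
  also have "\<dots> = (CLINT x|M. iexp (Z x)) * (CLINT y|M. iexp (Y y))"
    by simp
  also have "\<dots> = complex_of_real (exp (- (\<E> x. (Z x)\<^sup>2) / 2) * exp (- (\<E> x. (Y x)\<^sup>2) / 2))"
    unfolding gaussian_familyD(4)[OF V Z] gaussian_familyD(4)[OF V Y] by (rule of_real_mult[symmetric])
  also have "exp (- (\<E> x. (Z x)\<^sup>2) / 2) * exp (- (\<E> x. (Y x)\<^sup>2) / 2) = exp (- (\<E> x. (Z x + Y x)\<^sup>2) / 2)"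
    unfolding sq exp_add[symmetric] by (simp add: field_simps)
  also have "complex_of_real \<dots> = (CLINT x|M. iexp (Z x + Y x))"
    using gaussian_familyD(4)[OF V gaussian_family_add[OF V Z Y]] by simp
  finally show ?thesis by simp
qed

text \<open>For finitely many members of S the joint law with \<Theta> is compared with that of
  copies living on separate factors of a product space; the characteristic functions agree by
  \<open>gaussian_char_pair\<close>. Finite cylinder events form a pi-system, which extends
  independence to the generated sigma-algebra.\<close>

lemma (in prob_space) gaussian_orthogonal_indep:
  assumes V: "gaussian_family M V" and \<Theta>: "\<Theta> \<in> V" and S: "S \<subseteq> V"
    and orth: "\<And>Z. Z \<in> S \<Longrightarrow> (\<E> x. \<Theta> x * Z x) = 0"
  shows "indep_set (sigma_sets (space M) {\<Theta> -` A \<inter> space M | A. A \<in> sets borel}) (sets (gen_sigma M S))"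
proof -
  have L: "L2 M Z" if "Z \<in> V" for Z using gaussian_familyD(3)[OF V that] .
  have meas: "Z \<in> borel_measurable M" if "Z \<in> V" for Z using L[OF that] by (auto simp: L2_def)
  define E where "E = {{x\<in>space M. \<forall>Z\<in>J. Z x \<in> B Z} | J B. finite J \<and> J \<subseteq> S \<and> (\<forall>Z\<in>J. B Z \<in> sets borel)}"
  define G where "G = {\<Theta> -` A \<inter> space M | A. A \<in> sets borel}"
  have Eset: "{x\<in>space M. \<forall>Z\<in>J. Z x \<in> B Z} \<in> sets M" if "finite J" "J \<subseteq> S" "\<forall>Z\<in>J. B Z \<in> sets borel" for J B
  proof (rule sets.sets_Collect_finite_All[OF _ that(1)])
    fix Z assume "Z \<in> J"
    then have "Z -` B Z \<inter> space M \<in> sets M" using that S by (intro measurable_sets[OF meas]) auto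
    moreover have "Z -` B Z \<inter> space M = {x \<in> space M. Z x \<in> B Z}" by auto
    ultimately show "{x \<in> space M. Z x \<in> B Z} \<in> sets M" by simp
  qed
  have fin: "prob ((\<Theta> -` A \<inter> space M) \<inter> {x\<in>space M. \<forall>Z\<in>J. Z x \<in> B Z})
      = prob (\<Theta> -` A \<inter> space M) * prob {x\<in>space M. \<forall>Z\<in>J. Z x \<in> B Z}"
    if A: "A \<in> sets borel" and J: "finite J" "J \<subseteq> S" and B: "\<forall>Z\<in>J. B Z \<in> sets borel" for A J B
  proof -
    interpret P: pair_prob_space M M by unfold_locales
    \<comment> \<open>The index \<open>None\<close> stands for \<Theta>, which may otherwise
      coincide with a member of J.\<close>
    define Z1 where "Z1 i = (case i of None \<Rightarrow> \<Theta> | Some Z \<Rightarrow> Z)" for i :: "('a \<Rightarrow> real) option"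
    define Z2 where "Z2 i = (case i of None \<Rightarrow> (\<lambda>p. \<Theta> (fst p)) | Some Z \<Rightarrow> (\<lambda>p. Z (snd p)))" for i :: "('a \<Rightarrow> real) option"
    define K where "K = insert None (Some ` J)"
    define B' where "B' i = (case i of None \<Rightarrow> A | Some Z \<Rightarrow> B Z)" for i
    have JV: "J \<subseteq> V" using J S by blast
    have "prob {x\<in>space M. \<forall>i\<in>K. Z1 i x \<in> B' i} = measure (M \<Otimes>\<^sub>M M) {x\<in>space (M \<Otimes>\<^sub>M M). \<forall>i\<in>K. Z2 i x \<in> B' i}"
    proof (rule joint_law_eq)
      show "finite K" using J by (simp add: K_def)
      show "Z1 i \<in> borel_measurable M" if "i \<in> K" for i
        using that meas[OF \<Theta>] meas[OF subsetD[OF JV]] unfolding K_def Z1_def by fastforce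
      show "Z2 i \<in> borel_measurable (M \<Otimes>\<^sub>M M)" if "i \<in> K" for i
      proof (cases i)
        case None
        then show ?thesis using measurable_compose[OF measurable_fst meas[OF \<Theta>]] by (simp add: Z2_def)
      next
        case (Some Z)
        then have "Z \<in> V" using that JV by (auto simp: K_def)
        then show ?thesis using measurable_compose[OF measurable_snd meas[of Z]] Some by (simp add: Z2_def)
      qed
      show "B' i \<in> sets borel" if "i \<in> K" for i using that A B by (auto simp: K_def B'_def)
      fix c
      define Y where "Y x = (\<Sum>Z\<in>J. c (Some Z) * Z x)" for x
      have Y: "Y \<in> V" unfolding Y_def[abs_def]
        by (rule gaussian_family_sum[OF V]) (use JV in \<open>auto intro: gaussian_family_cmult[OF V]\<close>)
      have T: "(\<lambda>x. c None * \<Theta> x) \<in> V" by (rule gaussian_family_cmult[OF V \<Theta>])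
      have "(\<E> x. (c None * \<Theta> x) * Y x) = (\<E> x. (\<Sum>Z\<in>J. (c None * c (Some Z)) * (\<Theta> x * Z x)))"
        unfolding Y_def sum_distrib_left by (simp add: mult_ac)
      also have "\<dots> = (\<Sum>Z\<in>J. (\<E> x. (c None * c (Some Z)) * (\<Theta> x * Z x)))"
      proof (rule Bochner_Integration.integral_sum)
        fix Z assume "Z \<in> J"
        then have "L2 M Z" using JV L by auto
        then show "integrable M (\<lambda>x. (c None * c (Some Z)) * (\<Theta> x * Z x))"
          by (intro integrable_mult_right L2_mult_integrable L[OF \<Theta>])
      qed
      also have "\<dots> = 0"
      proof (rule sum.neutral, rule ballI)
        fix Z assume "Z \<in> J"
        then show "(\<E> x. (c None * c (Some Z)) * (\<Theta> x * Z x)) = 0" using orth[of Z] J by auto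
      qed
      finally have o: "(\<E> x. (c None * \<Theta> x) * Y x) = 0" .
      have s1: "(\<Sum>i\<in>K. c i * Z1 i x) = c None * \<Theta> x + Y x" for x
        unfolding K_def using J by (subst sum.insert) (auto simp: Z1_def Y_def sum.reindex)
      have s2: "(\<Sum>i\<in>K. c i * Z2 i p) = c None * \<Theta> (fst p) + Y (snd p)" for p
        unfolding K_def using J by (subst sum.insert) (auto simp: Z2_def Y_def sum.reindex)
      show "(CLINT x|M. iexp (\<Sum>i\<in>K. c i * Z1 i x)) = (CLINT x|M \<Otimes>\<^sub>M M. iexp (\<Sum>i\<in>K. c i * Z2 i x))"
        unfolding s1 s2 by (rule gaussian_char_pair[OF V T Y o])
    qed (intro prob_space_axioms P.prob_space_axioms)+
    moreover have "{x\<in>space M. \<forall>i\<in>K. Z1 i x \<in> B' i} = (\<Theta> -` A \<inter> space M) \<inter> {x\<in>space M. \<forall>Z\<in>J. Z x \<in> B Z}"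
      by (auto simp: K_def Z1_def B'_def)
    moreover have "{x\<in>space (M \<Otimes>\<^sub>M M). \<forall>i\<in>K. Z2 i x \<in> B' i} = (\<Theta> -` A \<inter> space M) \<times> {x\<in>space M. \<forall>Z\<in>J. Z x \<in> B Z}"
      by (auto simp: K_def Z2_def B'_def space_pair_measure)
    moreover have "measure (M \<Otimes>\<^sub>M M) ((\<Theta> -` A \<inter> space M) \<times> {x\<in>space M. \<forall>Z\<in>J. Z x \<in> B Z})
        = prob (\<Theta> -` A \<inter> space M) * prob {x\<in>space M. \<forall>Z\<in>J. Z x \<in> B Z}"
      using measurable_sets[OF meas[OF \<Theta>] A] Eset[OF J B]
      by (simp add: measure_def emeasure_pair_measure_Times enn2real_mult)
    ultimately show ?thesis by simp
  qed
  have "indep_set G E"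
    unfolding indep_set_def
  proof (rule indep_setsI)
    show "(case b of True \<Rightarrow> G | False \<Rightarrow> E) \<subseteq> events" for b
    proof (cases b)
      case True
      then show ?thesis using measurable_sets[OF meas[OF \<Theta>]] by (auto simp: G_def)
    next
      case False
      then show ?thesis unfolding E_def using Eset by auto
    qed
    fix A J assume J: "J \<noteq> {}" "J \<subseteq> UNIV" "finite J" and A: "\<forall>j\<in>J. A j \<in> (case j of True \<Rightarrow> G | False \<Rightarrow> E)"
    consider "J = {True}" | "J = {False}" | "J = {True, False}"
    proof -
      have "J = (if True \<in> J then {True} else {}) \<union> (if False \<in> J then {False} else {})"
        by (intro set_eqI, rename_tac b, case_tac b) auto
      then show thesis using J(1) that by (cases "True \<in> J"; cases "False \<in> J") auto
    qed
    then show "prob (\<Inter>j\<in>J. A j) = (\<Prod>j\<in>J. prob (A j))"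
    proof cases
      case 3
      then have "A True \<in> G" "A False \<in> E" using A by auto
      then have "prob (A True \<inter> A False) = prob (A True) * prob (A False)"
        unfolding G_def E_def by (auto simp: fin)
      with 3 show ?thesis by simp
    qed auto
  qed
  moreover have "Int_stable G"
  proof (rule Int_stableI)
    fix a b assume "a \<in> G" "b \<in> G"
    then obtain A B where "A \<in> sets borel" "B \<in> sets borel" "a = \<Theta> -` A \<inter> space M" "b = \<Theta> -` B \<inter> space M"
      by (auto simp: G_def)
    then show "a \<inter> b \<in> G" unfolding G_def by (intro CollectI exI[of _ "A \<inter> B"]) auto
  qed
  moreover have "Int_stable E"
  proof (rule Int_stableI)
    fix a b assume "a \<in> E" "b \<in> E"
    then obtain J1 B1 J2 B2 where 1: "finite J1" "J1 \<subseteq> S" "\<forall>Z\<in>J1. B1 Z \<in> sets borel" "a = {x\<in>space M. \<forall>Z\<in>J1. Z x \<in> B1 Z}"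
      and 2: "finite J2" "J2 \<subseteq> S" "\<forall>Z\<in>J2. B2 Z \<in> sets borel" "b = {x\<in>space M. \<forall>Z\<in>J2. Z x \<in> B2 Z}"
      unfolding E_def by blast
    have "a \<inter> b = {x\<in>space M. \<forall>Z\<in>J1 \<union> J2. Z x \<in> (if Z \<in> J1 then B1 Z else UNIV) \<inter> (if Z \<in> J2 then B2 Z else UNIV)}"
      unfolding 1 2 by auto
    moreover have "\<forall>Z\<in>J1 \<union> J2. (if Z \<in> J1 then B1 Z else UNIV) \<inter> (if Z \<in> J2 then B2 Z else UNIV) \<in> sets borel"
      using 1(3) 2(3) by auto
    ultimately show "a \<inter> b \<in> E" unfolding E_def using 1(1,2) 2(1,2)
      by (intro CollectI exI[of _ "J1 \<union> J2"] exI[of _ "\<lambda>Z. (if Z \<in> J1 then B1 Z else UNIV) \<inter> (if Z \<in> J2 then B2 Z else UNIV)"]) auto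
  qed
  ultimately have ind: "indep_set (sigma_sets (space M) G) (sigma_sets (space M) E)"
    by (rule indep_set_sigma_sets)
  have "{Z -` A \<inter> space M | Z A. Z \<in> S \<and> A \<in> sets borel} \<subseteq> E"
  proof
    fix a assume "a \<in> {Z -` A \<inter> space M | Z A. Z \<in> S \<and> A \<in> sets borel}"
    then obtain Z A where "Z \<in> S" "A \<in> sets borel" "a = Z -` A \<inter> space M" by auto
    then show "a \<in> E" unfolding E_def by (intro CollectI exI[of _ "{Z}"] exI[of _ "\<lambda>_. A"]) auto
  qed
  then have sub: "sets (gen_sigma M S) \<subseteq> sigma_sets (space M) E"
    unfolding sets_gen_sigma by (rule sigma_sets_mono')
  show ?thesis unfolding G_def[symmetric] indep_set_def
    by (rule indep_sets_mono_sets[OF ind[unfolded indep_set_def]]) (use sub in \<open>auto split: bool.split\<close>)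
qed

text \<open>Independence in the form required by Fubini: the second coordinate is the sample point
  itself, observed only through the sigma-algebra generated by S.\<close>

lemma (in prob_space) gaussian_orthogonal_product_law:
  assumes V: "gaussian_family M V" and \<Theta>: "\<Theta> \<in> V" and S: "S \<subseteq> V"
    and orth: "\<And>Z. Z \<in> S \<Longrightarrow> (\<E> x. \<Theta> x * Z x) = 0"
  shows "distr M borel \<Theta> \<Otimes>\<^sub>M distr M (gen_sigma M S) (\<lambda>x. x)
    = distr M (borel \<Otimes>\<^sub>M gen_sigma M S) (\<lambda>x. (\<Theta> x, x))"
proof -
  have SM: "S \<subseteq> borel_measurable M" using S gaussian_familyD(3)[OF V] by (auto simp: L2_def)
  have [measurable]: "\<Theta> \<in> borel_measurable M" using gaussian_familyD(3)[OF V \<Theta>] by (auto simp: L2_def)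
  have id[measurable]: "(\<lambda>x. x) \<in> measurable M (gen_sigma M S)"
    using sets_gen_sigma_subset[OF SM] sets.sets_into_space by (intro measurableI) (auto simp: Int_absorb2)
  note ind = gaussian_orthogonal_indep[OF V \<Theta> S orth]
  show ?thesis
  proof (rule pair_measure_eqI)
    show "sigma_finite_measure (distr M borel \<Theta>)" "sigma_finite_measure (distr M (gen_sigma M S) (\<lambda>x. x))"
      by (auto intro!: prob_space_imp_sigma_finite prob_space_distr)
    fix A B assume "A \<in> sets (distr M borel \<Theta>)" "B \<in> sets (distr M (gen_sigma M S) (\<lambda>x. x))"
    then have AB: "A \<in> sets borel" "B \<in> sets (gen_sigma M S)" by auto
    then have B: "B \<in> sets M" "B \<subseteq> space M" using sets_gen_sigma_subset[OF SM] sets.sets_into_space by auto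
    have A: "\<Theta> -` A \<inter> space M \<in> sets M" using AB by (intro measurable_sets) auto
    have "prob ((\<Theta> -` A \<inter> space M) \<inter> B) = prob (\<Theta> -` A \<inter> space M) * prob B"
      by (rule indep_setD[OF ind]) (use AB in auto)
    moreover have "(\<lambda>x. (\<Theta> x, x)) -` (A \<times> B) \<inter> space M = (\<Theta> -` A \<inter> space M) \<inter> B" using B by auto
    moreover have "(\<lambda>x. x) -` B \<inter> space M = B" using B by auto
    ultimately show "emeasure (distr M borel \<Theta>) A * emeasure (distr M (gen_sigma M S) (\<lambda>x. x)) B =
       emeasure (distr M (borel \<Otimes>\<^sub>M gen_sigma M S) (\<lambda>x. (\<Theta> x, x))) (A \<times> B)"
      using AB A B by (simp add: emeasure_distr emeasure_eq_measure ennreal_mult')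
  qed simp
qed

text \<open>A centred Gaussian law is determined by the variances of its functionals: these fix the
  characteristic function of every finite combination, hence the probabilities of cylinder sets,
  which form a generating pi-system.\<close>

lemma (in prob_space) gaussian_law_eq:
  fixes X1 X2 :: "'a \<Rightarrow> 'e::{real_normed_vector, second_countable_topology}"
  assumes V: "gaussian_family M V"
    and X: "\<And>\<phi> :: 'e \<Rightarrow>\<^sub>L real. (\<lambda>x. \<phi> (X1 x)) \<in> V" "\<And>\<phi> :: 'e \<Rightarrow>\<^sub>L real. (\<lambda>x. \<phi> (X2 x)) \<in> V"
    and eq: "\<And>\<phi> :: 'e \<Rightarrow>\<^sub>L real. (\<E> x. (\<phi> (X1 x))\<^sup>2) = (\<E> x. (\<phi> (X2 x))\<^sup>2)"
  shows "distr M borel X1 = distr M borel X2"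
proof -
  have meas: "Z \<in> borel_measurable M" if "Z \<in> V" for Z using gaussian_familyD(3)[OF V that] by (auto simp: L2_def)
  have [measurable]: "X1 \<in> borel_measurable M" "X2 \<in> borel_measurable M"
    by (rule borel_measurable_if_functionals, rule meas, rule X)+
  define E where "E = {{e. \<forall>\<phi>\<in>J. blinfun_apply \<phi> e \<in> B \<phi>} | (J :: ('e \<Rightarrow>\<^sub>L real) set) B. finite J \<and> (\<forall>\<phi>\<in>J. B \<phi> \<in> sets borel)}"
  have EE: "\<exists>(J :: ('e \<Rightarrow>\<^sub>L real) set) B. a = {e. \<forall>\<phi>\<in>J. blinfun_apply \<phi> e \<in> B \<phi>} \<and> finite J \<and> (\<forall>\<phi>\<in>J. B \<phi> \<in> sets borel)" if "a \<in> E" for a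
    using that unfolding E_def mem_Collect_eq .
  have Eb: "{e. \<forall>\<phi>\<in>J. blinfun_apply \<phi> e \<in> B \<phi>} \<in> sets borel" if "finite J" "\<forall>\<phi>\<in>J. B \<phi> \<in> sets borel"
    for J :: "('e \<Rightarrow>\<^sub>L real) set" and B
  proof -
    have "{e \<in> space borel. \<forall>\<phi>\<in>J. blinfun_apply \<phi> e \<in> B \<phi>} \<in> sets borel"
    proof (rule sets.sets_Collect_finite_All[OF _ that(1)])
      fix \<phi> assume "\<phi> \<in> J"
      show "{e \<in> space borel. blinfun_apply \<phi> e \<in> B \<phi>} \<in> sets borel"
      proof -
        have "blinfun_apply \<phi> \<in> borel_measurable borel"
          by (intro borel_measurable_continuous_onI linear_continuous_on blinfun.bounded_linear_right)
        from measurable_sets[OF this, of "B \<phi>"] that(2) \<open>\<phi> \<in> J\<close> show ?thesis by (simp add: vimage_def)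
      qed
    qed
    then show ?thesis by simp
  qed
  \<comment> \<open>The identity map is measurable for the cylinder sigma-algebra because all
    functionals are; this is where separability enters.\<close>
  have sets_eq: "sets borel = sigma_sets UNIV E"
  proof (rule antisym)
    have sp: "space (sigma UNIV E) = UNIV" "sets (sigma UNIV E) = sigma_sets UNIV E"
      by (auto intro: sets_measure_of space_measure_of)
    have "(\<lambda>e. e) \<in> borel_measurable (sigma UNIV E)"
    proof (rule borel_measurable_if_functionals)
      fix u :: "'e \<Rightarrow>\<^sub>L real"
      show "(\<lambda>e. u e) \<in> borel_measurable (sigma UNIV E)"
      proof (rule measurableI)
        fix A :: "real set" assume "A \<in> sets borel"
        then have "{e. \<forall>\<phi>\<in>{u}. blinfun_apply \<phi> e \<in> (\<lambda>_. A) \<phi>} \<in> E"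
          unfolding E_def by (intro CollectI exI[of _ "{u}"] exI[of _ "\<lambda>_. A"]) auto
        then have "{e. u e \<in> A} \<in> sigma_sets UNIV E" by (intro sigma_sets.Basic) simp
        then show "blinfun_apply u -` A \<inter> space (sigma UNIV E) \<in> sets (sigma UNIV E)"
          unfolding sp by (simp add: vimage_def)
      qed simp
    qed
    then show "sets borel \<subseteq> sigma_sets UNIV E"
      using measurable_sets[of "\<lambda>e. e" "sigma UNIV E" borel] by (auto simp: sp)
    have "E \<subseteq> sets borel" unfolding E_def using Eb by auto
    then show "sigma_sets UNIV E \<subseteq> sets borel" using sets.sigma_sets_subset[of E borel] by simp
  qed
  show ?thesis
  proof (rule measure_eqI_generator_eq[where E = E and \<Omega> = UNIV and A = "\<lambda>_. UNIV"])
    show "Int_stable E"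
    proof (rule Int_stableI)
      fix a b assume "a \<in> E" "b \<in> E"
      obtain J1 :: "('e \<Rightarrow>\<^sub>L real) set" and B1 where 1: "a = {x. \<forall>Z\<in>J1. blinfun_apply Z x \<in> B1 Z} \<and> finite J1 \<and> (\<forall>Z\<in>J1. B1 Z \<in> sets borel)"
        using EE[OF \<open>a \<in> E\<close>] by (elim exE)
      obtain J2 :: "('e \<Rightarrow>\<^sub>L real) set" and B2 where 2: "b = {x. \<forall>Z\<in>J2. blinfun_apply Z x \<in> B2 Z} \<and> finite J2 \<and> (\<forall>Z\<in>J2. B2 Z \<in> sets borel)"
        using EE[OF \<open>b \<in> E\<close>] by (elim exE)
      have "a \<inter> b = {x. \<forall>Z\<in>J1 \<union> J2. blinfun_apply Z x \<in> (if Z \<in> J1 then B1 Z else UNIV) \<inter> (if Z \<in> J2 then B2 Z else UNIV)}"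
        unfolding conjunct1[OF 1] conjunct1[OF 2] by auto
      moreover have "\<forall>Z\<in>J1 \<union> J2. (if Z \<in> J1 then B1 Z else UNIV) \<inter> (if Z \<in> J2 then B2 Z else UNIV) \<in> sets borel"
        using conjunct2[OF 1] conjunct2[OF 2] by auto
      ultimately show "a \<inter> b \<in> E" unfolding E_def using conjunct2[OF 1] conjunct2[OF 2]
        by (intro CollectI exI[of _ "J1 \<union> J2"] exI[of _ "\<lambda>Z. (if Z \<in> J1 then B1 Z else UNIV) \<inter> (if Z \<in> J2 then B2 Z else UNIV)"]) auto
    qed
    show "range (\<lambda>_. UNIV) \<subseteq> E" unfolding E_def by (auto intro!: exI[of _ "{}"])
    show "emeasure (distr M borel X1) UNIV \<noteq> \<infinity>" by (simp add: emeasure_distr emeasure_eq_measure)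
    fix a assume "a \<in> E"
    obtain J :: "('e \<Rightarrow>\<^sub>L real) set" and B where *: "a = {x. \<forall>Z\<in>J. blinfun_apply Z x \<in> B Z} \<and> finite J \<and> (\<forall>Z\<in>J. B Z \<in> sets borel)"
      using EE[OF \<open>a \<in> E\<close>] by (elim exE)
    then have a: "finite J" "\<forall>Z\<in>J. B Z \<in> sets borel" "a = {x. \<forall>Z\<in>J. blinfun_apply Z x \<in> B Z}" by simp_all
    have "prob {x\<in>space M. \<forall>\<phi>\<in>J. blinfun_apply \<phi> (X1 x) \<in> B \<phi>} = prob {x\<in>space M. \<forall>\<phi>\<in>J. blinfun_apply \<phi> (X2 x) \<in> B \<phi>}"
    proof (rule joint_law_eq[OF prob_space_axioms prob_space_axioms a(1)])
      fix c :: "('e \<Rightarrow>\<^sub>L real) \<Rightarrow> real"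
      define \<psi> where "\<psi> = (\<Sum>\<phi>\<in>J. c \<phi> *\<^sub>R \<phi>)"
      have "\<psi> e = (\<Sum>\<phi>\<in>J. c \<phi> * \<phi> e)" for e unfolding \<psi>_def by (simp add: blinfun.sum_left blinfun.scaleR_left)
      then show "(CLINT x|M. iexp (\<Sum>\<phi>\<in>J. c \<phi> * blinfun_apply \<phi> (X1 x))) = (CLINT x|M. iexp (\<Sum>\<phi>\<in>J. c \<phi> * blinfun_apply \<phi> (X2 x)))"
        using gaussian_familyD(4)[OF V X(1)[of \<psi>]] gaussian_familyD(4)[OF V X(2)[of \<psi>]] eq[of \<psi>] by simp
    qed (use a(2) meas[OF X(1)] meas[OF X(2)] in auto)
    moreover have "X1 -` a \<inter> space M = {x\<in>space M. \<forall>\<phi>\<in>J. blinfun_apply \<phi> (X1 x) \<in> B \<phi>}"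
      "X2 -` a \<inter> space M = {x\<in>space M. \<forall>\<phi>\<in>J. blinfun_apply \<phi> (X2 x) \<in> B \<phi>}" using a(3) by auto
    moreover have "a \<in> sets borel" using Eb[OF a(1,2)] a(3) by simp
    ultimately show "emeasure (distr M borel X1) a = emeasure (distr M borel X2) a"
      by (simp add: emeasure_distr emeasure_eq_measure)
  qed (auto simp: sets_eq)
qed

section \<open>Mean square closure of a Gaussian family\<close>

definition L2_closure :: "'a measure \<Rightarrow> ('a \<Rightarrow> real) set \<Rightarrow> ('a \<Rightarrow> real) set" where
  "L2_closure M V = {Z. L2 M Z \<and> (\<exists>f. (\<forall>n. f n \<in> V) \<and> (\<lambda>n. \<integral>x. (f n x - Z x)\<^sup>2 \<partial>M) \<longlonglongrightarrow> 0)}"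

lemma (in prob_space) L2_closure_superset:
  assumes "\<And>Z. Z \<in> V \<Longrightarrow> L2 M Z"
  shows "V \<subseteq> L2_closure M V"
proof
  fix Z assume "Z \<in> V"
  then show "Z \<in> L2_closure M V" using assms unfolding L2_closure_def by (intro CollectI conjI exI[of _ "\<lambda>_. Z"]) auto
qed

lemma (in prob_space) gaussian_family_closure:
  assumes V: "gaussian_family M V"
  shows "gaussian_family M (L2_closure M V)"
proof -
  note L = gaussian_familyD(3)[OF V]
  have "(\<lambda>x. 0) \<in> L2_closure M V" using L2_closure_superset[of V] L gaussian_familyD(1)[OF V] by blast
  moreover have "(\<lambda>x. a * Z x + b * Y x) \<in> L2_closure M V" if ZY: "Z \<in> L2_closure M V" "Y \<in> L2_closure M V" for Z Y a b
  proof -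
    obtain f g where f: "\<And>n. f n \<in> V" "(\<lambda>n. \<E> x. (f n x - Z x)\<^sup>2) \<longlonglongrightarrow> 0"
      and g: "\<And>n. g n \<in> V" "(\<lambda>n. \<E> x. (g n x - Y x)\<^sup>2) \<longlonglongrightarrow> 0"
      and LZ: "L2 M Z" and LY: "L2 M Y"
      using ZY unfolding L2_closure_def by blast
    have "(\<lambda>n. \<E> x. ((a * f n x + b * g n x) - (a * Z x + b * Y x))\<^sup>2) \<longlonglongrightarrow> 0"
    proof (rule tendsto_sandwich[OF _ _ tendsto_const])
      show "\<forall>\<^sub>F n in sequentially. (\<E> x. ((a * f n x + b * g n x) - (a * Z x + b * Y x))\<^sup>2)
        \<le> 2 * a\<^sup>2 * (\<E> x. (f n x - Z x)\<^sup>2) + 2 * b\<^sup>2 * (\<E> x. (g n x - Y x)\<^sup>2)"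
      proof (intro always_eventually allI)
        fix n
        have "(\<E> x. ((a * f n x + b * g n x) - (a * Z x + b * Y x))\<^sup>2)
          = (\<E> x. (a * (f n x - Z x) + b * (g n x - Y x))\<^sup>2)" by (simp add: algebra_simps)
        also have "\<dots> \<le> 2 * (\<E> x. (a * (f n x - Z x))\<^sup>2) + 2 * (\<E> x. (b * (g n x - Y x))\<^sup>2)"
          by (intro L2_square_le L2_cmult L2_diff L f(1) g(1) LZ LY)
        finally show "(\<E> x. ((a * f n x + b * g n x) - (a * Z x + b * Y x))\<^sup>2)
          \<le> 2 * a\<^sup>2 * (\<E> x. (f n x - Z x)\<^sup>2) + 2 * b\<^sup>2 * (\<E> x. (g n x - Y x)\<^sup>2)"
          by (simp add: power_mult_distrib)
      qed
      show "(\<lambda>n. 2 * a\<^sup>2 * (\<E> x. (f n x - Z x)\<^sup>2) + 2 * b\<^sup>2 * (\<E> x. (g n x - Y x)\<^sup>2)) \<longlonglongrightarrow> 0"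
        by (rule tendsto_eq_intros tendsto_mult_right_zero f(2) g(2) | simp)+
    qed simp
    moreover have "(\<lambda>x. a * f n x + b * g n x) \<in> V" for n by (rule gaussian_familyD(2)[OF V f(1) g(1)])
    ultimately show ?thesis unfolding L2_closure_def
      using L2_lin[OF LZ LY] by (intro CollectI conjI exI[of _ "\<lambda>n x. a * f n x + b * g n x"]) auto
  qed
  moreover have "(CLINT x|M. iexp (Z x)) = complex_of_real (exp (- (\<E> x. (Z x)\<^sup>2) / 2))" if Z: "Z \<in> L2_closure M V" for Z
  proof -
    obtain f where f: "\<And>n. f n \<in> V" "(\<lambda>n. \<E> x. (f n x - Z x)\<^sup>2) \<longlonglongrightarrow> 0" and LZ: "L2 M Z"
      using Z unfolding L2_closure_def by blast
    note mom = L2_limit_moments[OF L[OF f(1)] LZ f(2) LZ]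
    have [measurable]: "f n \<in> borel_measurable M" "Z \<in> borel_measurable M" for n
      using L[OF f(1), of n] LZ by (auto simp: L2_def)
    \<comment> \<open>Along an almost surely convergent subsequence the characteristic functions
      converge by bounded convergence, and the variances converge as well.\<close>
    obtain r where r: "strict_mono r" "AE x in M. (\<lambda>n. f (r n) x) \<longlonglongrightarrow> Z x"
      using L2_limit_AE_subseq[OF L[OF f(1)] LZ f(2)] by blast
    have "(\<lambda>n. CLINT x|M. iexp (f (r n) x)) \<longlonglongrightarrow> (CLINT x|M. iexp (Z x))"
    proof (rule integral_dominated_convergence[where w = "\<lambda>_. 1"])
      show "AE x in M. (\<lambda>n. iexp (f (r n) x)) \<longlonglongrightarrow> iexp (Z x)"
        using r(2) by eventually_elim (intro tendsto_intros)
    qed auto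
    moreover have "(\<lambda>n. CLINT x|M. iexp (f (r n) x)) \<longlonglongrightarrow> complex_of_real (exp (- (\<E> x. (Z x)\<^sup>2) / 2))"
      unfolding gaussian_familyD(4)[OF V f(1)]
      by (intro tendsto_intros LIMSEQ_subseq_LIMSEQ[OF mom(2) r(1), unfolded o_def]) auto
    ultimately show ?thesis by (rule LIMSEQ_unique)
  qed
  ultimately show ?thesis unfolding gaussian_family_def L2_closure_def by blast
qed

text \<open>The closure is closed: replacing each f n by an element of V within mean square distance
  1/(n+1) does not change the limit.\<close>

lemma (in prob_space) L2_closure_limit:
  assumes f: "\<And>n. f n \<in> L2_closure M V" and V: "\<And>Z. Z \<in> V \<Longrightarrow> L2 M Z" and Z: "L2 M Z"
    and lim: "(\<lambda>n. \<E> x. (f n x - Z x)\<^sup>2) \<longlonglongrightarrow> 0"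
  shows "Z \<in> L2_closure M V"
proof -
  have Lf: "L2 M (f n)" for n using f by (auto simp: L2_closure_def)
  have "\<exists>g. g \<in> V \<and> (\<E> x. (g x - f n x)\<^sup>2) < 1 / Suc n" for n
  proof -
    obtain h where h: "\<And>k. h k \<in> V" "(\<lambda>k. \<E> x. (h k x - f n x)\<^sup>2) \<longlonglongrightarrow> 0"
      using f[of n] unfolding L2_closure_def by blast
    obtain k where "\<forall>i\<ge>k. norm ((\<E> x. (h i x - f n x)\<^sup>2) - 0) < 1 / Suc n"
      using LIMSEQ_D[OF h(2), of "1 / Suc n"] by auto
    then have "(\<E> x. (h k x - f n x)\<^sup>2) < 1 / Suc n" by auto
    with h(1) show ?thesis by blast
  qed
  then obtain g where g: "\<And>n. g n \<in> V" "\<And>n. (\<E> x. (g n x - f n x)\<^sup>2) < 1 / Suc n" by metis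
  have "(\<lambda>n. \<E> x. (g n x - Z x)\<^sup>2) \<longlonglongrightarrow> 0"
  proof (rule tendsto_sandwich[OF _ _ tendsto_const])
    show "\<forall>\<^sub>F n in sequentially. (\<E> x. (g n x - Z x)\<^sup>2) \<le> 2 * (1 / Suc n) + 2 * (\<E> x. (f n x - Z x)\<^sup>2)"
    proof (intro always_eventually allI)
      fix n
      have "(\<E> x. ((g n x - f n x) + (f n x - Z x))\<^sup>2) \<le> 2 * (\<E> x. (g n x - f n x)\<^sup>2) + 2 * (\<E> x. (f n x - Z x)\<^sup>2)"
        by (intro L2_square_le L2_diff V[OF g(1)] Lf Z)
      then show "(\<E> x. (g n x - Z x)\<^sup>2) \<le> 2 * (1 / Suc n) + 2 * (\<E> x. (f n x - Z x)\<^sup>2)" using g(2)[of n] by simp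
    qed
    show "(\<lambda>n. 2 * (1 / Suc n) + 2 * (\<E> x. (f n x - Z x)\<^sup>2)) \<longlonglongrightarrow> 0"
      using tendsto_add[OF tendsto_mult_right_zero[OF LIMSEQ_Suc[OF lim_1_over_n], of 2] tendsto_mult_right_zero[OF lim, of 2]] by simp
  qed simp
  with g(1) Z show ?thesis unfolding L2_closure_def by blast
qed

subsection \<open>Random variables with finite moments\<close>

lemma powr_le_one_plus_power:
  fixes t :: real
  assumes "0 \<le> t" "0 \<le> p" "p \<le> real n"
  shows "t powr p \<le> 1 + t ^ n"
proof (cases "t \<le> 1")
  case True
  then have "t powr p \<le> 1 powr p" using assms by (intro powr_mono2) auto
  moreover have "0 \<le> t ^ n" using assms(1) by simp
  ultimately show ?thesis by simp
next
  case False
  then have "t powr p \<le> t powr real n" using assms by (intro powr_mono) auto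
  also have "\<dots> = t ^ n" using False by (intro powr_realpow) simp
  finally show ?thesis by simp
qed

text \<open>Natural exponents suffice, since t^p is at most 1 + t^n for larger n. All later moment
  estimates then work with ordinary powers.\<close>

lemma (in prob_space) in_all_Lp_iff:
  "in_all_Lp M z \<longleftrightarrow> z \<in> borel_measurable M \<and> (\<forall>n. integrable M (\<lambda>x. \<bar>z x\<bar> ^ n))"
proof (intro iffI conjI allI)
  assume z: "in_all_Lp M z"
  then show [measurable]: "z \<in> borel_measurable M" by (simp add: in_all_Lp_def)
  fix n :: nat
  have "integrable M (\<lambda>x. \<bar>z x\<bar> powr (real n + 1))" using z by (simp add: in_all_Lp_def)
  then have i: "integrable M (\<lambda>x. 1 + \<bar>z x\<bar> powr (real n + 1))" by simp
  show "integrable M (\<lambda>x. \<bar>z x\<bar> ^ n)"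
  proof (rule Bochner_Integration.integrable_bound[OF i])
    show "AE x in M. norm (\<bar>z x\<bar> ^ n) \<le> norm (1 + \<bar>z x\<bar> powr (real n + 1))"
    proof (rule AE_I2)
      fix x
      have "\<bar>z x\<bar> ^ n \<le> 1 + \<bar>z x\<bar> ^ (n + 1)"
      proof (cases "\<bar>z x\<bar> \<le> 1")
        case True
        then have "\<bar>z x\<bar> ^ n \<le> 1" by (intro power_le_one) auto
        then show ?thesis by (simp add: add_increasing2)
      next
        case False
        then have "\<bar>z x\<bar> ^ n \<le> \<bar>z x\<bar> ^ (n + 1)" by (intro power_increasing) auto
        then show ?thesis by simp
      qed
      moreover have "\<bar>z x\<bar> ^ (n + 1) = \<bar>z x\<bar> powr (real n + 1)"
      proof (cases "z x = 0")
        case False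
        then have "\<bar>z x\<bar> powr (real (Suc n)) = \<bar>z x\<bar> ^ Suc n" by (intro powr_realpow) simp
        then show ?thesis by (simp add: add.commute del: power_Suc)
      qed simp
      ultimately show "norm (\<bar>z x\<bar> ^ n) \<le> norm (1 + \<bar>z x\<bar> powr (real n + 1))"
        by (simp add: add_increasing)
    qed
  qed measurable
next
  assume z: "z \<in> borel_measurable M \<and> (\<forall>n. integrable M (\<lambda>x. \<bar>z x\<bar> ^ n))"
  then have [measurable]: "z \<in> borel_measurable M" by simp
  have "integrable M (\<lambda>x. \<bar>z x\<bar> powr p)" if p: "p \<ge> 1" for p
  proof -
    obtain n where n: "p \<le> real n" using real_arch_simple by blast
    have i: "integrable M (\<lambda>x. 1 + \<bar>z x\<bar> ^ n)" using z by simp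
    show ?thesis
    proof (rule Bochner_Integration.integrable_bound[OF i])
      show "AE x in M. norm (\<bar>z x\<bar> powr p) \<le> norm (1 + \<bar>z x\<bar> ^ n)"
        using powr_le_one_plus_power[of "\<bar>z x\<bar>" p n for x] n p by (auto intro!: AE_I2 simp: add_increasing)
    qed measurable
  qed
  then show "in_all_Lp M z" by (simp add: in_all_Lp_def)
qed

lemma (in prob_space) in_all_LpD:
  assumes "in_all_Lp M z"
  shows "z \<in> borel_measurable M" "integrable M (\<lambda>x. \<bar>z x\<bar> ^ n)" "integrable M z" "L2 M z"
proof -
  show m: "z \<in> borel_measurable M" and i: "integrable M (\<lambda>x. \<bar>z x\<bar> ^ n)" for n
    using assms unfolding in_all_Lp_iff by auto
  show "integrable M z" using i[of 1] m integrable_abs_iff[of z] by simp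
  show "L2 M z" using i[of 2] m by (simp add: L2_def)
qed

lemma (in prob_space) in_all_Lp_bound:
  assumes "in_all_Lp M z" "y \<in> borel_measurable M" "AE x in M. \<bar>y x\<bar> \<le> \<bar>z x\<bar>"
  shows "in_all_Lp M y"
  unfolding in_all_Lp_iff
proof (intro conjI allI)
  fix n
  show "integrable M (\<lambda>x. \<bar>y x\<bar> ^ n)"
    by (rule Bochner_Integration.integrable_bound[OF in_all_LpD(2)[OF assms(1), of n]])
       (use assms(2,3) in \<open>auto intro!: power_mono elim!: eventually_mono\<close>)
qed (rule assms(2))

lemma (in prob_space) in_all_Lp_const: "in_all_Lp M (\<lambda>x. c)"
  by (simp add: in_all_Lp_iff)

lemma (in prob_space) in_all_Lp_mult:
  assumes "in_all_Lp M z" "in_all_Lp M y"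
  shows "in_all_Lp M (\<lambda>x. z x * y x)"
  unfolding in_all_Lp_iff
proof (intro conjI allI)
  have [measurable]: "z \<in> borel_measurable M" "y \<in> borel_measurable M" using assms in_all_LpD by auto
  show "(\<lambda>x. z x * y x) \<in> borel_measurable M" by measurable
  fix n
  have "L2 M (\<lambda>x. \<bar>w x\<bar> ^ n)" if "in_all_Lp M w" for w
    using in_all_LpD(1)[OF that] in_all_LpD(2)[OF that, of "n * 2"] by (simp add: L2_def power_mult)
  from L2_mult_integrable[OF this this, OF assms] show "integrable M (\<lambda>x. \<bar>z x * y x\<bar> ^ n)"
    by (simp add: abs_mult power_mult_distrib)
qed

lemma (in prob_space) in_all_Lp_add:
  assumes "in_all_Lp M z" "in_all_Lp M y"
  shows "in_all_Lp M (\<lambda>x. z x + y x)"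
  unfolding in_all_Lp_iff
proof (intro conjI allI)
  have [measurable]: "z \<in> borel_measurable M" "y \<in> borel_measurable M" using assms in_all_LpD by auto
  show "(\<lambda>x. z x + y x) \<in> borel_measurable M" by measurable
  fix n
  have i: "integrable M (\<lambda>x. 2 ^ n * (\<bar>z x\<bar> ^ n + \<bar>y x\<bar> ^ n))"
    using in_all_LpD(2)[OF assms(1), of n] in_all_LpD(2)[OF assms(2), of n] by simp
  show "integrable M (\<lambda>x. \<bar>z x + y x\<bar> ^ n)"
  proof (rule Bochner_Integration.integrable_bound[OF i])
    show "AE x in M. norm (\<bar>z x + y x\<bar> ^ n) \<le> norm (2 ^ n * (\<bar>z x\<bar> ^ n + \<bar>y x\<bar> ^ n))"
    proof (rule AE_I2)
      fix x
      define m where "m = max \<bar>z x\<bar> \<bar>y x\<bar>"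
      have m0: "0 \<le> m" by (simp add: m_def)
      have "\<bar>z x + y x\<bar> \<le> 2 * m" unfolding m_def by linarith
      then have "\<bar>z x + y x\<bar> ^ n \<le> (2 * m) ^ n" by (intro power_mono) auto
      also have "\<dots> = 2 ^ n * m ^ n" by (rule power_mult_distrib)
      also have "m ^ n \<le> \<bar>z x\<bar> ^ n + \<bar>y x\<bar> ^ n" unfolding m_def by (cases "\<bar>z x\<bar> \<le> \<bar>y x\<bar>") (auto simp: max_def)
      finally show "norm (\<bar>z x + y x\<bar> ^ n) \<le> norm (2 ^ n * (\<bar>z x\<bar> ^ n + \<bar>y x\<bar> ^ n))" by simp
    qed
  qed measurable
qed

lemma (in prob_space) in_all_Lp_sum:
  "(\<And>i. i \<in> I \<Longrightarrow> in_all_Lp M (f i)) \<Longrightarrow> in_all_Lp M (\<lambda>x. \<Sum>i\<in>I. f i x)"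
  by (induction I rule: infinite_finite_induct) (auto intro: in_all_Lp_add in_all_Lp_const)

lemma (in prob_space) in_all_Lp_abs: "in_all_Lp M z \<Longrightarrow> in_all_Lp M (\<lambda>x. \<bar>z x\<bar>)"
  by (auto simp: in_all_Lp_iff)

lemma (in prob_space) in_all_Lp_power:
  "in_all_Lp M z \<Longrightarrow> in_all_Lp M (\<lambda>x. z x ^ n)"
  by (induction n) (auto intro: in_all_Lp_mult in_all_Lp_const)

section \<open>Moments of Gaussian variables and of Gaussian norms\<close>

lemma (in prob_space) gaussian_std_law:
  assumes V: "gaussian_family M V" and Z: "Z \<in> V" and var: "(\<E> x. (Z x)\<^sup>2) = 1"
  shows "distr M borel Z = std_normal_distribution"
proof (rule Levy_uniqueness[OF _ real_dist_normal_dist])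
  have [measurable]: "Z \<in> borel_measurable M" using gaussian_familyD(3)[OF V Z] by (simp add: L2_def)
  show "real_distribution (distr M borel Z)" by simp
  show "char (distr M borel Z) = char std_normal_distribution"
  proof
    fix t
    have "char (distr M borel Z) t = (CLINT x|M. iexp (t * Z x))"
      unfolding char_def by (subst integral_distr) auto
    also have "\<dots> = complex_of_real (exp (- (\<E> x. (t * Z x)\<^sup>2) / 2))"
      by (rule gaussian_familyD(4)[OF V gaussian_family_cmult[OF V Z]])
    also have "\<dots> = char std_normal_distribution t"
      by (simp add: char_std_normal_distribution power_mult_distrib var)
    finally show "char (distr M borel Z) t = char std_normal_distribution t" .
  qed
qed

lemma (in prob_space) gaussian_in_all_Lp:
  assumes V: "gaussian_family M V" and Z: "Z \<in> V"
  shows "in_all_Lp M Z"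
proof -
  have L: "L2 M Z" using gaussian_familyD(3)[OF V Z] .
  then have [measurable]: "Z \<in> borel_measurable M" by (simp add: L2_def)
  define s where "s = (\<E> x. (Z x)\<^sup>2)"
  show ?thesis
  proof (cases "s = 0")
    case True
    then have "AE x in M. (Z x)\<^sup>2 = 0"
      unfolding s_def using integral_nonneg_eq_0_iff_AE[OF L2_integrable[OF L]] by simp
    then show ?thesis by (intro in_all_Lp_bound[OF in_all_Lp_const[of 0]]) auto
  next
    case False
    then have s: "s > 0" unfolding s_def by (simp add: order_less_le)
    define Y where "Y x = (1 / sqrt s) * Z x" for x
    have Y: "Y \<in> V" unfolding Y_def[abs_def] by (rule gaussian_family_cmult[OF V Z])
    have "(\<E> x. (Y x)\<^sup>2) = 1" unfolding Y_def using s by (simp add: power_mult_distrib s_def power_divide)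
    note law = gaussian_std_law[OF V Y this]
    have [measurable]: "Y \<in> borel_measurable M" unfolding Y_def by measurable
    have "in_all_Lp M Y" unfolding in_all_Lp_iff
    proof (intro conjI allI)
      fix n
      have "integrable (distr M borel Y) (\<lambda>x. \<bar>x\<bar> ^ n)"
        unfolding law using integrable_std_normal_moment_abs[of n] by (subst integrable_density) auto
      then show "integrable M (\<lambda>x. \<bar>Y x\<bar> ^ n)" by (subst (asm) integrable_distr_eq) auto
    qed measurable
    from in_all_Lp_mult[OF in_all_Lp_const[of "sqrt s"] this] show ?thesis using s by (simp add: Y_def)
  qed
qed

text \<open>The tail inequality is Fernique's: it holds for the norm of a Gaussian vector, since the law of two
  independent copies is invariant under a rotation by forty-five degrees.\<close>

lemma (in prob_space) Fernique_moments:
  fixes N :: "'a \<Rightarrow> real"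
  assumes [measurable]: "N \<in> borel_measurable M" and N0: "\<And>x. 0 \<le> N x"
    and tail: "\<And>s t. 0 \<le> s \<Longrightarrow> prob {x\<in>space M. N x \<le> s} * prob {x\<in>space M. N x > t}
          \<le> (prob {x\<in>space M. N x > (t - s) / sqrt 2})\<^sup>2"
  shows "in_all_Lp M N"
proof -
  define g where "g t = prob {x\<in>space M. N x > t}" for t
  have "(\<lambda>n. measure M {x\<in>space M. N x > real n}) \<longlonglongrightarrow> measure M (\<Inter>n. {x\<in>space M. N x > real n})"
    by (rule finite_Lim_measure_decseq) (auto simp: decseq_def)
  also have "(\<Inter>n. {x\<in>space M. N x > real n}) = {}"
  proof -
    have "\<not> (\<forall>n. real n < N x)" for x using real_arch_simple[of "N x"] by (auto simp: not_less)
    then show ?thesis by auto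
  qed
  finally have "(\<lambda>n. g (real n)) \<longlonglongrightarrow> 0" by (simp add: g_def)
  then obtain n0 where n0: "\<And>n. n \<ge> n0 \<Longrightarrow> norm (g (real n) - 0) < 1/4" using LIMSEQ_D[of _ 0 "1/4"] by (metis zero_less_divide_1_iff zero_less_numeral)
  \<comment> \<open>At this level the tail is below 1/4 and P is at least 3/4, so the initial ratio
    g(s)/P is at most 1/3, below the 1/2 required for the iteration.\<close>
  define s where "s = real (Suc n0)"
  have s0: "s > 0" by (simp add: s_def)
  have gs: "g s < 1/4" using n0[of "Suc n0"] by (simp add: s_def)
  define P where "P = prob {x\<in>space M. N x \<le> s}"
  have "P = 1 - g s"
  proof -
    have "prob (space M - {x\<in>space M. N x > s}) = 1 - g s" unfolding g_def by (rule prob_compl) measurable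
    moreover have "space M - {x\<in>space M. N x > s} = {x\<in>space M. N x \<le> s}" by auto
    ultimately show ?thesis by (simp add: P_def)
  qed
  then have P: "P \<ge> 3/4" using gs by simp
  \<comment> \<open>The thresholds solve (t(n+1) - s) / sqrt 2 = t n, so the tail inequality links
    consecutive ones.\<close>
  define t where "t n = s * (\<Sum>i\<le>n. sqrt 2 ^ i)" for n
  have t0: "t 0 = s" by (simp add: t_def)
  have tS: "t (Suc n) = s + sqrt 2 * t n" for n
    unfolding t_def sum.atMost_Suc_shift by (simp add: sum_distrib_left algebra_simps)
  have tup: "t n \<le> s * 4 ^ n" for n
  proof (induction n)
    case (Suc n)
    have "sqrt 2 \<le> 2" by (rule real_le_lsqrt) auto
    have "t (Suc n) = s + sqrt 2 * t n" by (rule tS)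
    also have "\<dots> \<le> s * 4 ^ n + 2 * (s * 4 ^ n)"
      using Suc \<open>sqrt 2 \<le> 2\<close> s0 by (intro add_mono mult_mono) (auto simp: t_def intro!: sum_nonneg mult_nonneg_nonneg)
    also have "\<dots> \<le> s * 4 ^ Suc n" using s0 by simp
    finally show ?case .
  qed (simp add: t0)
  have tlow: "t n \<ge> s * real n" for n
  proof -
    have "(\<Sum>i\<le>n. (1::real)) \<le> (\<Sum>i\<le>n. sqrt 2 ^ i)" by (intro sum_mono one_le_power) auto
    then have "real n \<le> (\<Sum>i\<le>n. sqrt 2 ^ i)" by simp
    then show ?thesis unfolding t_def using s0 by (intro mult_left_mono) auto
  qed
  have tpos: "t n \<ge> 0" for n unfolding t_def using s0 by (auto intro!: mult_nonneg_nonneg sum_nonneg)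
  \<comment> \<open>Divided by P, the tail inequality says that each ratio is at most the square of
    the preceding one. The tails therefore decay doubly exponentially while t n grows at most like
    4^n, and every moment is finite.\<close>
  have q: "g (t n) / P \<le> (1/2) ^ (2 ^ n)" for n
  proof (induction n)
    case 0
    have "g s / P \<le> (1/4) / (3/4)" using gs P by (intro frac_le) auto
    then show ?case by (simp add: t0)
  next
    case (Suc n)
    have "P * g (t (Suc n)) \<le> (g (t n))\<^sup>2"
      using tail[of s "t (Suc n)"] s0 by (simp add: P_def g_def tS)
    then have "g (t (Suc n)) / P \<le> (g (t n) / P)\<^sup>2"
      using P by (simp add: field_simps power2_eq_square)
    also have "\<dots> \<le> ((1/2) ^ (2 ^ n))\<^sup>2" using Suc P by (intro power_mono) (auto simp: g_def)
    also have "\<dots> = (1/2) ^ (2 ^ Suc n)" by (simp add: power_mult[symmetric] mult.commute)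
    finally show ?case .
  qed
  have P1: "P \<le> 1" by (simp add: P_def)
  have gt: "g (t n) \<le> (1/2) ^ (2 ^ n)" for n
  proof -
    have "P * g (t n) \<le> g (t n)" using P P1 by (intro mult_left_le_one_le) (auto simp: g_def)
    then have "g (t n) \<le> g (t n) / P" using P by (simp add: pos_le_divide_eq mult.commute)
    with q[of n] show ?thesis by simp
  qed
  show ?thesis unfolding in_all_Lp_iff
  proof (intro conjI allI)
    fix p :: nat
    define a where "a n = (s * 4 ^ Suc n) ^ p * (1/2) ^ (2 ^ n)" for n :: nat
    have a0: "a n \<ge> 0" for n unfolding a_def using s0 by simp
    have "summable a"
    proof -
      obtain n1 where n1: "(4 ^ p :: real) * 2 < 2 ^ n1" using real_arch_pow[of 2 "4 ^ p * 2"] by auto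
      show ?thesis
      proof (rule summable_ratio_test[of "1/2" n1])
        fix n assume n: "n1 \<le> n"
        have e: "(1/2::real) ^ (2 ^ Suc n) = (1/2) ^ (2 ^ n) * (1/2) ^ (2 ^ n)"
          by (simp only: power_Suc[of 2] mult_2 power_add)
        have "a (Suc n) = a n * (4 ^ p * (1/2) ^ (2 ^ n))"
        proof -
          have "s * 4 ^ Suc (Suc n) = (s * 4 ^ Suc n) * 4" by simp
          then have "(s * 4 ^ Suc (Suc n)) ^ p = (s * 4 ^ Suc n) ^ p * 4 ^ p" by (simp only: power_mult_distrib)
          then show ?thesis unfolding a_def e by (simp only: mult_ac)
        qed
        also have "\<dots> \<le> a n * (1/2)"
        proof (rule mult_left_mono)
          have "n1 \<le> 2 ^ n" using n less_exp[of n] by linarith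
          then have "(1/2::real) ^ (2 ^ n) \<le> (1/2) ^ n1" by (intro power_decreasing) auto
          then have "4 ^ p * (1/2::real) ^ (2 ^ n) \<le> 4 ^ p * (1/2) ^ n1" by simp
          also have "\<dots> \<le> 1/2" using n1 by (simp add: power_divide field_simps)
          finally show "4 ^ p * (1/2::real) ^ (2 ^ n) \<le> 1/2" .
        qed (rule a0)
        finally show "norm (a (Suc n)) \<le> 1/2 * norm (a n)" using a0 by simp
      qed simp
    qed
    \<comment> \<open>If m is the first index with N x \<le> t m and m = k + 1, then N x exceeds t
      k, and the single summand of index k already dominates.\<close>
    have pw: "ennreal (N x ^ p) \<le> ennreal (s ^ p) + (\<Sum>n. ennreal ((s * 4 ^ Suc n) ^ p) * indicator {x\<in>space M. N x > t n} x)"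
      if x: "x \<in> space M" for x
    proof (cases "N x \<le> t 0")
      case True
      then have "N x ^ p \<le> s ^ p" using N0 t0 by (intro power_mono) auto
      then have "ennreal (N x ^ p) \<le> ennreal (s ^ p)" by (rule ennreal_leI)
      then show ?thesis by (rule add_increasing2[rotated]) simp
    next
      case False
      have ex: "\<exists>m. N x \<le> t m"
      proof -
        obtain m :: nat where "N x / s \<le> real m" using real_arch_simple by blast
        then have "N x \<le> s * real m" using s0 by (simp add: field_simps)
        with tlow[of m] show ?thesis by (intro exI[of _ m]) simp
      qed
      define m where "m = (LEAST m. N x \<le> t m)"
      have m: "N x \<le> t m" unfolding m_def using ex by (rule LeastI_ex)
      have "m \<noteq> 0" using False m by (auto intro: ccontr)
      then obtain k where k: "m = Suc k" by (cases m) auto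
      have "\<not> N x \<le> t k" using not_less_Least[of k "\<lambda>m. N x \<le> t m"] k by (simp add: m_def)
      then have ind: "indicator {x\<in>space M. N x > t k} x = (1::ennreal)" using x by simp
      have "N x ^ p \<le> (s * 4 ^ Suc k) ^ p" using N0 m tup[of m] k by (intro power_mono) auto
      then have "ennreal (N x ^ p) \<le> ennreal ((s * 4 ^ Suc k) ^ p) * indicator {x\<in>space M. N x > t k} x"
        unfolding ind by (simp add: ennreal_leI)
      also have "\<dots> \<le> (\<Sum>n. ennreal ((s * 4 ^ Suc n) ^ p) * indicator {x\<in>space M. N x > t n} x)"
      proof -
        define b where "b n = ennreal ((s * 4 ^ Suc n) ^ p) * indicator {x\<in>space M. N x > t n} x" for n
        have "b k \<le> (\<Sum>n. b n)" using sum_le_suminf[OF summableI, of "{k}" b] by simp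
        then show ?thesis by (simp only: b_def)
      qed
      finally show ?thesis by (rule add_increasing[rotated]) simp
    qed
    have "(\<integral>\<^sup>+x. ennreal (N x ^ p) \<partial>M) \<le> (\<integral>\<^sup>+x. ennreal (s ^ p) + (\<Sum>n. ennreal ((s * 4 ^ Suc n) ^ p) * indicator {x\<in>space M. N x > t n} x) \<partial>M)"
      by (rule nn_integral_mono) (rule pw)
    also have "\<dots> = ennreal (s ^ p) + (\<Sum>n. ennreal ((s * 4 ^ Suc n) ^ p) * emeasure M {x\<in>space M. N x > t n})"
      by (subst nn_integral_add, simp, measurable, subst nn_integral_suminf, measurable)
         (simp add: nn_integral_cmult emeasure_space_1)
    also have "\<dots> \<le> ennreal (s ^ p) + (\<Sum>n. ennreal (a n))"
    proof (intro add_left_mono suminf_le)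
      fix n
      have "ennreal ((s * 4 ^ Suc n) ^ p) * emeasure M {x\<in>space M. N x > t n} = ennreal ((s * 4 ^ Suc n) ^ p * g (t n))"
        using s0 by (subst ennreal_mult) (auto simp: g_def emeasure_eq_measure)
      also have "\<dots> \<le> ennreal (a n)" unfolding a_def using gt[of n] s0 by (intro ennreal_leI mult_left_mono) auto
      finally show "ennreal ((s * 4 ^ Suc n) ^ p) * emeasure M {x\<in>space M. N x > t n} \<le> ennreal (a n)" .
    qed auto
    also have "(\<Sum>n. ennreal (a n)) = ennreal (\<Sum>n. a n)" by (rule suminf_ennreal2[OF a0 \<open>summable a\<close>])
    also have "ennreal (s ^ p) + ennreal (\<Sum>n. a n) < \<infinity>" by simp
    finally have "(\<integral>\<^sup>+x. ennreal (N x ^ p) \<partial>M) < \<infinity>" .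
    then show "integrable M (\<lambda>x. \<bar>N x\<bar> ^ p)"
      using N0 by (intro integrableI_bounded) (auto simp: abs_of_nonneg)
  qed measurable
qed

subsection \<open>Gaussian integration by parts\<close>

lemma integrable_lim_at_top_zero:
  fixes G :: "real \<Rightarrow> real"
  assumes int: "integrable lborel G" and lim: "(G \<longlongrightarrow> L) at_top"
  shows "L = 0"
proof (rule ccontr)
  assume L: "L \<noteq> 0"
  then have "eventually (\<lambda>x. dist (G x) L < \<bar>L\<bar> / 2) at_top" by (intro tendstoD[OF lim]) simp
  then obtain a where a: "\<And>x. x \<ge> a \<Longrightarrow> dist (G x) L < \<bar>L\<bar> / 2" by (auto simp: eventually_at_top_linorder)
  have ge: "\<bar>L\<bar> / 2 \<le> \<bar>G x\<bar>" if "x \<ge> a" for x using a[OF that] unfolding dist_real_def by linarith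
  have bound: "real n * (\<bar>L\<bar> / 2) \<le> (\<integral>x. \<bar>G x\<bar> \<partial>lborel)" for n
  proof -
    have "(\<integral>x. indicator {a..a + real n} x * (\<bar>L\<bar> / 2) \<partial>lborel) \<le> (\<integral>x. \<bar>G x\<bar> \<partial>lborel)"
    proof (rule integral_mono)
      show "integrable lborel (\<lambda>x. indicator {a..a + real n} x * (\<bar>L\<bar> / 2))"
        by (intro integrable_mult_left integrable_real_indicator) auto
      show "indicator {a..a + real n} x * (\<bar>L\<bar> / 2) \<le> \<bar>G x\<bar>" for x
        using ge[of x] by (auto simp: indicator_def)
    qed (use int in simp)
    then show ?thesis by simp
  qed
  obtain n :: nat where "(\<integral>x. \<bar>G x\<bar> \<partial>lborel) / (\<bar>L\<bar> / 2) < real n" using reals_Archimedean2 by blast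
  then have "(\<integral>x. \<bar>G x\<bar> \<partial>lborel) < real n * (\<bar>L\<bar> / 2)" using L by (simp add: field_simps)
  with bound[of n] show False by simp
qed

text \<open>No decay of F is assumed. F(y) - F(-y) converges to the integral of f as y tends to
  infinity and is itself integrable, which forces the limit to be 0.\<close>

lemma integral_derivative_zero:
  fixes F f :: "real \<Rightarrow> real"
  assumes deriv: "\<And>x. (F has_real_derivative f x) (at x)" and cont: "continuous_on UNIV f"
    and intF: "integrable lborel F" and intf: "integrable lborel f"
  shows "(\<integral>x. f x \<partial>lborel) = 0"
proof (rule integrable_lim_at_top_zero)
  show "integrable lborel (\<lambda>y. F y - F (- y))"
    using intF lborel_integrable_real_affine[of F "-1" 0] by auto
  have "((\<lambda>y. \<integral>x. f x * indicator {- y..y} x \<partial>lborel) \<longlongrightarrow> (\<integral>x. f x \<partial>lborel)) at_top"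
  proof (rule integral_dominated_convergence_at_top)
    show "integrable lborel (\<lambda>x. norm (f x))" using intf by simp
    show "AE x in lborel. ((\<lambda>y. f x * indicator {- y..y} x) \<longlongrightarrow> f x) at_top"
    proof (rule AE_I2)
      fix x
      have "eventually (\<lambda>y. f x * indicator {- y..y} x = f x) at_top"
        using eventually_ge_at_top[of "\<bar>x\<bar>"] by eventually_elim (auto simp: indicator_def)
      then show "((\<lambda>y. f x * indicator {- y..y} x) \<longlongrightarrow> f x) at_top" by (rule tendsto_eventually)
    qed
    show "\<forall>\<^sub>F y in at_top. AE x in lborel. norm (f x * indicator {- y..y} x) \<le> norm (f x)"
      by (auto simp: indicator_def)
  qed (use intf in auto)
  moreover have "\<forall>\<^sub>F y in at_top. (\<integral>x. f x * indicator {- y..y} x \<partial>lborel) = F y - F (- y)"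
    using eventually_ge_at_top[of 0]
  proof eventually_elim
    case (elim y)
    then show ?case
      using deriv cont by (intro integral_FTC_Icc_real) (auto simp: continuous_on_eq_continuous_at)
  qed
  ultimately show "((\<lambda>y. F y - F (- y)) \<longlongrightarrow> (\<integral>x. f x \<partial>lborel)) at_top"
    by (rule Lim_transform_eventually)
qed

text \<open>Since the density \<gamma> has derivative -x \<gamma>, the difference of the two
  integrands is the derivative of the integrable function \<gamma> \<phi>; integrability alone
  removes the boundary terms.\<close>

lemma std_normal_integration_by_parts:
  fixes \<phi> \<phi>' :: "real \<Rightarrow> real"
  assumes deriv: "\<And>x. (\<phi> has_real_derivative \<phi>' x) (at x)" and cont: "continuous_on UNIV \<phi>'"
    and int: "integrable std_normal_distribution \<phi>" "integrable std_normal_distribution (\<lambda>x. x * \<phi> x)"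
      "integrable std_normal_distribution \<phi>'"
  shows "(\<integral>x. \<phi>' x \<partial>std_normal_distribution) = (\<integral>x. x * \<phi> x \<partial>std_normal_distribution)"
proof -
  have c1: "continuous_on UNIV \<phi>" using deriv by (intro DERIV_continuous_on) (auto intro: has_field_derivative_at_within)
  have [measurable]: "\<phi> \<in> borel_measurable borel" "\<phi>' \<in> borel_measurable borel"
    using c1 cont by (auto intro: borel_measurable_continuous_onI)
  define \<gamma> where "\<gamma> = std_normal_density"
  have d\<gamma>: "(\<gamma> has_real_derivative - x * \<gamma> x) (at x)" for x
    unfolding \<gamma>_def std_normal_density_def
    by (auto intro!: derivative_eq_intros simp: field_simps)
  have int': "integrable lborel (\<lambda>x. \<gamma> x * \<phi> x)" "integrable lborel (\<lambda>x. \<gamma> x * (x * \<phi> x))" "integrable lborel (\<lambda>x. \<gamma> x * \<phi>' x)"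
    using int by (auto simp: integrable_density \<gamma>_def)
  have "(\<integral>x. \<gamma> x * \<phi>' x - \<gamma> x * (x * \<phi> x) \<partial>lborel) = 0"
  proof (rule integral_derivative_zero)
    show "((\<lambda>x. \<gamma> x * \<phi> x) has_real_derivative \<gamma> x * \<phi>' x - \<gamma> x * (x * \<phi> x)) (at x)" for x
      using DERIV_mult[OF d\<gamma>[of x] deriv[of x]] by (simp add: algebra_simps)
    have "continuous_on UNIV \<gamma>" using d\<gamma> by (intro DERIV_continuous_on) (auto intro: has_field_derivative_at_within)
    then show "continuous_on UNIV (\<lambda>x. \<gamma> x * \<phi>' x - \<gamma> x * (x * \<phi> x))" by (intro continuous_intros cont c1)
  qed (intro int' Bochner_Integration.integrable_diff)+
  then have "(\<integral>x. \<gamma> x * \<phi>' x \<partial>lborel) = (\<integral>x. \<gamma> x * (x * \<phi> x) \<partial>lborel)"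
    using int' by simp
  then show ?thesis by (simp add: integral_density \<gamma>_def)
qed

text \<open>\<open>z'\<close> is the derivative of \<open>z\<close> with respect to \<open>\<Theta>\<close> when both are written, almost surely, as functions of
  \<open>\<Theta>\<close> and of data measurable with respect to \<open>G\<close>.\<close>

definition diff_along :: "'a measure \<Rightarrow> 'a measure \<Rightarrow> ('a \<Rightarrow> real) \<Rightarrow> ('a \<Rightarrow> real) \<Rightarrow> ('a \<Rightarrow> real) \<Rightarrow> bool" where
  "diff_along M G \<Theta> z z' \<longleftrightarrow> (\<exists>Z Z'. Z \<in> borel_measurable (borel \<Otimes>\<^sub>M G) \<and> Z' \<in> borel_measurable (borel \<Otimes>\<^sub>M G) \<and>
     (\<forall>x\<in>space M. \<forall>\<theta>. ((\<lambda>\<theta>. Z (\<theta>, x)) has_real_derivative Z' (\<theta>, x)) (at \<theta>)) \<and>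
     (\<forall>x\<in>space M. continuous_on UNIV (\<lambda>\<theta>. Z' (\<theta>, x))) \<and>
     (AE x in M. z x = Z (\<Theta> x, x) \<and> z' x = Z' (\<Theta> x, x)))"

lemma diff_along_const: "diff_along M G \<Theta> (\<lambda>x. c) (\<lambda>x. 0)"
  unfolding diff_along_def by (rule exI[of _ "\<lambda>_. c"], rule exI[of _ "\<lambda>_. 0"]) auto

lemma diff_along_affine:
  assumes "r \<in> borel_measurable G" "AE x in M. z x = r x + c * \<Theta> x"
  shows "diff_along M G \<Theta> z (\<lambda>x. c)"
  unfolding diff_along_def
proof (rule exI[of _ "\<lambda>p. r (snd p) + c * fst p"], rule exI[of _ "\<lambda>_. c"], intro conjI ballI allI)
  show "(\<lambda>p. r (snd p) + c * fst p) \<in> borel_measurable (borel \<Otimes>\<^sub>M G)" using assms(1) by measurable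
  show "AE x in M. z x = r (snd (\<Theta> x, x)) + c * fst (\<Theta> x, x) \<and> c = c" using assms(2) by simp
qed (auto intro!: derivative_eq_intros)

lemma diff_along_continuous_deriv:
  assumes "\<And>\<theta>::real. (f has_real_derivative f' \<theta>) (at \<theta>)"
  shows "continuous_on UNIV f"
  using assms by (intro DERIV_continuous_on) (auto intro: has_field_derivative_at_within)

lemma diff_along_add:
  assumes "diff_along M G \<Theta> z z'" "diff_along M G \<Theta> y y'"
  shows "diff_along M G \<Theta> (\<lambda>x. z x + y x) (\<lambda>x. z' x + y' x)"
proof -
  obtain Z Z' where Z: "Z \<in> borel_measurable (borel \<Otimes>\<^sub>M G)" "Z' \<in> borel_measurable (borel \<Otimes>\<^sub>M G)"
     "\<And>x \<theta>. x \<in> space M \<Longrightarrow> ((\<lambda>\<theta>. Z (\<theta>, x)) has_real_derivative Z' (\<theta>, x)) (at \<theta>)"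
     "\<And>x. x\<in>space M \<Longrightarrow> continuous_on UNIV (\<lambda>\<theta>. Z' (\<theta>, x))"
     "AE x in M. z x = Z (\<Theta> x, x) \<and> z' x = Z' (\<Theta> x, x)"
    using assms(1) unfolding diff_along_def by blast
  obtain Y Y' where Y: "Y \<in> borel_measurable (borel \<Otimes>\<^sub>M G)" "Y' \<in> borel_measurable (borel \<Otimes>\<^sub>M G)"
     "\<And>x \<theta>. x \<in> space M \<Longrightarrow> ((\<lambda>\<theta>. Y (\<theta>, x)) has_real_derivative Y' (\<theta>, x)) (at \<theta>)"
     "\<And>x. x\<in>space M \<Longrightarrow> continuous_on UNIV (\<lambda>\<theta>. Y' (\<theta>, x))"
     "AE x in M. y x = Y (\<Theta> x, x) \<and> y' x = Y' (\<Theta> x, x)"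
    using assms(2) unfolding diff_along_def by blast
  show ?thesis unfolding diff_along_def
  proof (rule exI[of _ "\<lambda>p. Z p + Y p"], rule exI[of _ "\<lambda>p. Z' p + Y' p"], intro conjI ballI allI)
    show "AE x in M. z x + y x = Z (\<Theta> x, x) + Y (\<Theta> x, x) \<and> z' x + y' x = Z' (\<Theta> x, x) + Y' (\<Theta> x, x)"
      using Z(5) Y(5) by eventually_elim simp
  qed (auto intro!: borel_measurable_add DERIV_add continuous_on_add Z(1-4) Y(1-4))
qed

lemma diff_along_mult:
  assumes "diff_along M G \<Theta> z z'" "diff_along M G \<Theta> y y'"
  shows "diff_along M G \<Theta> (\<lambda>x. z x * y x) (\<lambda>x. z' x * y x + z x * y' x)"
proof -
  obtain Z Z' where Z: "Z \<in> borel_measurable (borel \<Otimes>\<^sub>M G)" "Z' \<in> borel_measurable (borel \<Otimes>\<^sub>M G)"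
     "\<And>x \<theta>. x \<in> space M \<Longrightarrow> ((\<lambda>\<theta>. Z (\<theta>, x)) has_real_derivative Z' (\<theta>, x)) (at \<theta>)"
     "\<And>x. x\<in>space M \<Longrightarrow> continuous_on UNIV (\<lambda>\<theta>. Z' (\<theta>, x))"
     "AE x in M. z x = Z (\<Theta> x, x) \<and> z' x = Z' (\<Theta> x, x)"
    using assms(1) unfolding diff_along_def by blast
  obtain Y Y' where Y: "Y \<in> borel_measurable (borel \<Otimes>\<^sub>M G)" "Y' \<in> borel_measurable (borel \<Otimes>\<^sub>M G)"
     "\<And>x \<theta>. x \<in> space M \<Longrightarrow> ((\<lambda>\<theta>. Y (\<theta>, x)) has_real_derivative Y' (\<theta>, x)) (at \<theta>)"
     "\<And>x. x\<in>space M \<Longrightarrow> continuous_on UNIV (\<lambda>\<theta>. Y' (\<theta>, x))"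
     "AE x in M. y x = Y (\<Theta> x, x) \<and> y' x = Y' (\<Theta> x, x)"
    using assms(2) unfolding diff_along_def by blast
  show ?thesis unfolding diff_along_def
  proof (rule exI[of _ "\<lambda>p. Z p * Y p"], rule exI[of _ "\<lambda>p. Z' p * Y p + Z p * Y' p"], intro conjI ballI allI)
    show "AE x in M. z x * y x = Z (\<Theta> x, x) * Y (\<Theta> x, x) \<and> z' x * y x + z x * y' x =
        Z' (\<Theta> x, x) * Y (\<Theta> x, x) + Z (\<Theta> x, x) * Y' (\<Theta> x, x)"
      using Z(5) Y(5) by eventually_elim simp
    show "((\<lambda>\<theta>. Z (\<theta>, x) * Y (\<theta>, x)) has_real_derivative Z' (\<theta>, x) * Y (\<theta>, x) + Z (\<theta>, x) * Y' (\<theta>, x)) (at \<theta>)"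
      if "x \<in> space M" for x \<theta>
      using DERIV_mult[OF Z(3)[OF that] Y(3)[OF that]] by (simp add: mult.commute add.commute)
    show "continuous_on UNIV (\<lambda>\<theta>. Z' (\<theta>, x) * Y (\<theta>, x) + Z (\<theta>, x) * Y' (\<theta>, x))" if "x \<in> space M" for x
      by (intro continuous_on_add continuous_on_mult Z(4)[OF that] Y(4)[OF that]
          diff_along_continuous_deriv[OF Z(3)[OF that]] diff_along_continuous_deriv[OF Y(3)[OF that]])
  qed (intro borel_measurable_add borel_measurable_times Z(1,2) Y(1,2))+
qed

text \<open>Under the product law the data are frozen by Fubini, and the one-dimensional formula
  holds on almost every section, namely where the three sections involved are integrable.\<close>

lemma (in prob_space) integration_by_parts_along:
  assumes prod: "distr M borel \<Theta> \<Otimes>\<^sub>M distr M G (\<lambda>x. x) = distr M (borel \<Otimes>\<^sub>M G) (\<lambda>x. (\<Theta> x, x))"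
    and law: "distr M borel \<Theta> = std_normal_distribution"
    and \<Theta>[measurable]: "\<Theta> \<in> borel_measurable M" and id[measurable]: "(\<lambda>x. x) \<in> measurable M G" and sp: "space G = space M"
    and diff: "diff_along M G \<Theta> z z'"
    and [measurable]: "z \<in> borel_measurable M" "z' \<in> borel_measurable M"
    and int: "integrable M z" "integrable M z'" "integrable M (\<lambda>x. \<Theta> x * z x)"
  shows "(\<E> x. z' x) = (\<E> x. \<Theta> x * z x)"
proof -
  obtain Z Z' where Z[measurable]: "Z \<in> borel_measurable (borel \<Otimes>\<^sub>M G)" "Z' \<in> borel_measurable (borel \<Otimes>\<^sub>M G)"
    and d: "\<And>x \<theta>. x \<in> space M \<Longrightarrow> ((\<lambda>\<theta>. Z (\<theta>, x)) has_real_derivative Z' (\<theta>, x)) (at \<theta>)"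
    and c: "\<And>x. x\<in>space M \<Longrightarrow> continuous_on UNIV (\<lambda>\<theta>. Z' (\<theta>, x))"
    and ae: "AE x in M. z x = Z (\<Theta> x, x) \<and> z' x = Z' (\<Theta> x, x)"
    using diff unfolding diff_along_def by blast
  define N where "N = std_normal_distribution"
  define R where "R = distr M G (\<lambda>x. x)"
  define T where "T = distr M (borel \<Otimes>\<^sub>M G) (\<lambda>x. (\<Theta> x, x))"
  have prod': "N \<Otimes>\<^sub>M R = T" using prod law by (simp add: N_def R_def T_def)
  have setsN: "sets N = sets borel" by (simp add: N_def)
  have setsR: "sets R = sets G" by (simp add: R_def)
  interpret N: prob_space N unfolding N_def by (rule prob_space_normal_density) simp
  interpret R: prob_space R unfolding R_def by (rule prob_space_distr) measurable
  interpret P: pair_sigma_finite R N by unfold_locales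
  interpret Q: pair_sigma_finite N R by unfold_locales
  have intT: "integrable T F" "(\<integral>p. F p \<partial>T) = (\<E> x. f x)"
    if F: "F \<in> borel_measurable (borel \<Otimes>\<^sub>M G)" and ae: "AE x in M. f x = F (\<Theta> x, x)" and f: "integrable M f" for F :: "real \<times> 'a \<Rightarrow> real" and f
  proof -
    note [measurable] = F
    have [measurable]: "f \<in> borel_measurable M" using f by auto
    have "integrable M (\<lambda>x. F (\<Theta> x, x))"
      using f by (subst integrable_cong_AE[where g = f]) (use ae in \<open>auto elim!: eventually_mono\<close>)
    moreover have "(\<lambda>x. (\<Theta> x, x)) \<in> measurable M (borel \<Otimes>\<^sub>M G)" by measurable
    ultimately show "integrable T F" unfolding T_def using integrable_distr_eq[OF _ F] by blast
    show "(\<integral>p. F p \<partial>T) = (\<E> x. f x)" unfolding T_def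
    proof (subst integral_distr)
      show "(\<E> x. F (\<Theta> x, x)) = (\<E> x. f x)"
        by (rule integral_cong_AE) (use ae in \<open>auto elim!: eventually_mono\<close>)
    qed measurable
  qed
  have swap: "integrable (R \<Otimes>\<^sub>M N) (\<lambda>(x, \<theta>). F (\<theta>, x))" "(\<integral>p. F p \<partial>T) = (\<integral>x. (\<integral>\<theta>. F (\<theta>, x) \<partial>N) \<partial>R)"
    if F: "integrable T F" for F :: "real \<times> 'a \<Rightarrow> real"
  proof -
    have F': "integrable (N \<Otimes>\<^sub>M R) F" using F by (simp add: prod')
    show i: "integrable (R \<Otimes>\<^sub>M N) (\<lambda>(x, \<theta>). F (\<theta>, x))" by (rule Q.integrable_product_swap[OF F'])
    have "(\<integral>p. F p \<partial>T) = (\<integral>p. F p \<partial>(N \<Otimes>\<^sub>M R))" by (simp add: prod')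
    also have "\<dots> = (\<integral>p. (case p of (x, \<theta>) \<Rightarrow> F (\<theta>, x)) \<partial>(R \<Otimes>\<^sub>M N))"
      by (rule Q.integral_product_swap[symmetric]) (use F' in auto)
    also have "\<dots> = (\<integral>x. (\<integral>\<theta>. F (\<theta>, x) \<partial>N) \<partial>R)" using P.integral_fst'[OF i] by simp
    finally show "(\<integral>p. F p \<partial>T) = (\<integral>x. (\<integral>\<theta>. F (\<theta>, x) \<partial>N) \<partial>R)" .
  qed
  define Y where "Y p = fst p * Z p" for p
  have Ym[measurable]: "Y \<in> borel_measurable (borel \<Otimes>\<^sub>M G)" unfolding Y_def by measurable
  have aeZ: "AE x in M. z x = Z (\<Theta> x, x)" "AE x in M. z' x = Z' (\<Theta> x, x)" "AE x in M. \<Theta> x * z x = Y (\<Theta> x, x)"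
    using ae by (auto simp: Y_def elim!: eventually_mono)
  note TZ = intT[OF Z(1) aeZ(1) int(1)] and TZ' = intT[OF Z(2) aeZ(2) int(2)] and TY = intT[OF Ym aeZ(3) int(3)]
  have a1: "AE x in R. integrable N (\<lambda>\<theta>. Z (\<theta>, x))" using P.AE_integrable_fst'[OF swap(1)[OF TZ(1)]] by simp
  have a2: "AE x in R. integrable N (\<lambda>\<theta>. Z' (\<theta>, x))" using P.AE_integrable_fst'[OF swap(1)[OF TZ'(1)]] by simp
  have a3: "AE x in R. integrable N (\<lambda>\<theta>. Y (\<theta>, x))" using P.AE_integrable_fst'[OF swap(1)[OF TY(1)]] by simp
  have "(\<integral>x. (\<integral>\<theta>. Z' (\<theta>, x) \<partial>N) \<partial>R) = (\<integral>x. (\<integral>\<theta>. Y (\<theta>, x) \<partial>N) \<partial>R)"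
  proof (rule integral_cong_AE)
    show "(\<lambda>x. \<integral>\<theta>. Z' (\<theta>, x) \<partial>N) \<in> borel_measurable R"
      using P.integrable_fst'[OF swap(1)[OF TZ'(1)]] by (simp add: borel_measurable_integrable)
    show "(\<lambda>x. \<integral>\<theta>. Y (\<theta>, x) \<partial>N) \<in> borel_measurable R"
      using P.integrable_fst'[OF swap(1)[OF TY(1)]] by (simp add: borel_measurable_integrable)
    show "AE x in R. (\<integral>\<theta>. Z' (\<theta>, x) \<partial>N) = (\<integral>\<theta>. Y (\<theta>, x) \<partial>N)"
      using a1 a2 a3 AE_space
    proof eventually_elim
      case (elim x)
      then have x: "x \<in> space M" by (simp add: R_def sp)
      show ?case using std_normal_integration_by_parts[OF d[OF x] c[OF x]] elim by (simp add: N_def Y_def)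
    qed
  qed
  then show ?thesis using swap(2)[OF TZ'(1)] swap(2)[OF TY(1)] TZ'(2) TY(2) by simp
qed

subsection \<open>Gaussian measures and the Cameron-Martin space\<close>

lemma gaussian_measure_functional:
  fixes u :: "'a::real_normed_vector \<Rightarrow>\<^sub>L real"
  assumes \<nu>: "gaussian_measure \<nu>"
  shows "L2 \<nu> u" "(\<integral>w. u w \<partial>\<nu>) = 0"
    "(CLINT w|\<nu>. iexp (u w)) = complex_of_real (exp (- (\<integral>w. (u w)\<^sup>2 \<partial>\<nu>) / 2))"
    "u \<noteq> 0 \<Longrightarrow> (\<integral>w. (u w)\<^sup>2 \<partial>\<nu>) > 0"
proof -
  interpret prob_space \<nu> using \<nu> by (simp add: gaussian_measure_def)
  have main: "L2 \<nu> u \<and> (\<integral>w. u w \<partial>\<nu>) = 0 \<and> (\<integral>w. (u w)\<^sup>2 \<partial>\<nu>) > 0 \<and>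
     (CLINT w|\<nu>. iexp (u w)) = complex_of_real (exp (- (\<integral>w. (u w)\<^sup>2 \<partial>\<nu>) / 2))" if "u \<noteq> 0"
  proof -
    obtain \<sigma> where \<sigma>: "\<sigma> > 0" and D: "distributed \<nu> lborel (blinfun_apply u) (\<lambda>r. ennreal (normal_density 0 \<sigma> r))"
    proof -
      have "\<forall>u :: 'a \<Rightarrow>\<^sub>L real. u \<noteq> 0 \<longrightarrow>
         (\<exists>\<sigma>>0. distributed \<nu> lborel (blinfun_apply u) (\<lambda>r. ennreal (normal_density 0 \<sigma> r)))"
        using \<nu> by (simp add: gaussian_measure_def)
      from this[rule_format, OF \<open>u \<noteq> 0\<close>] show thesis using that by (elim exE conjE)
    qed
    have m[measurable]: "blinfun_apply u \<in> borel_measurable \<nu>" using distributed_measurable[OF D] by simp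
    have e: "(\<integral>w. u w \<partial>\<nu>) = 0" using normal_distributed_expectation[OF \<sigma> D] .
    have v: "(\<integral>w. (u w)\<^sup>2 \<partial>\<nu>) = \<sigma>\<^sup>2" using normal_distributed_variance[OF \<sigma> D] by (simp add: e)
    \<comment> \<open>A nonintegrable function has integral 0 by convention, whereas the integral is
      known to be the positive number \<sigma>^2.\<close>
    have i: "integrable \<nu> (\<lambda>w. (u w)\<^sup>2)"
    proof (rule ccontr)
      assume "\<not> ?thesis"
      then have "(\<integral>w. (u w)\<^sup>2 \<partial>\<nu>) = 0" by (rule not_integrable_integral_eq)
      with v \<sigma> show False by simp
    qed
    have D1: "distributed \<nu> lborel (\<lambda>w. u w / \<sigma>) (\<lambda>r. ennreal (std_normal_density r))"
      using D normal_standard_normal_convert[OF \<sigma>, of "blinfun_apply u" 0] by simp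
    have "(CLINT w|\<nu>. iexp (u w)) = (CLINT w|\<nu>. iexp (\<sigma> * (u w / \<sigma>)))" using \<sigma> by simp
    also have "\<dots> = (CLINT y|distr \<nu> lborel (\<lambda>w. u w / \<sigma>). iexp (\<sigma> * y))"
      by (rule integral_distr[symmetric]) auto
    also have "distr \<nu> lborel (\<lambda>w. u w / \<sigma>) = std_normal_distribution"
      using distributed_distr_eq_density[OF D1] by simp
    also have "(CLINT y|std_normal_distribution. iexp (\<sigma> * y)) = char std_normal_distribution \<sigma>"
      by (simp add: char_def)
    also have "\<dots> = complex_of_real (exp (- (\<integral>w. (u w)\<^sup>2 \<partial>\<nu>) / 2))"
      by (simp add: char_std_normal_distribution v)
    finally show ?thesis using e v i \<sigma> by (simp add: L2_def)
  qed
  have all: "L2 \<nu> u \<and> (\<integral>w. u w \<partial>\<nu>) = 0 \<and>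
     (CLINT w|\<nu>. iexp (u w)) = complex_of_real (exp (- (\<integral>w. (u w)\<^sup>2 \<partial>\<nu>) / 2))"
  proof (cases "u = 0")
    case True
    then have "blinfun_apply u = (\<lambda>_. 0)" by auto
    then show ?thesis by (simp add: prob_space)
  next
    case False
    from main[OF this] show ?thesis by (elim conjE) (intro conjI)
  qed
  show "L2 \<nu> u" by (rule conjunct1[OF all])
  show "(\<integral>w. u w \<partial>\<nu>) = 0" by (rule conjunct1[OF conjunct2[OF all]])
  show "(CLINT w|\<nu>. iexp (u w)) = complex_of_real (exp (- (\<integral>w. (u w)\<^sup>2 \<partial>\<nu>) / 2))"
    by (rule conjunct2[OF conjunct2[OF all]])
  show "u \<noteq> 0 \<Longrightarrow> (\<integral>w. (u w)\<^sup>2 \<partial>\<nu>) > 0" by (drule main) (elim conjE)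
qed

text \<open>The truncated means \<open>\<integral> v(w) w\<close> over \<open>norm w \<le> r\<close> lie in the Cameron-Martin space, and \<open>v\<close> does not vanish on
  all of them.\<close>

lemma cameron_martin_separates:
  fixes \<iota> :: "'h::real_inner \<Rightarrow> 'w::{banach, second_countable_topology}" and v :: "'w \<Rightarrow>\<^sub>L real"
  assumes aws: "abstract_wiener_space \<iota> \<mu>" and v: "\<And>h. v (\<iota> h) = 0"
  shows "v = 0"
proof (rule ccontr)
  assume nz: "v \<noteq> 0"
  have \<mu>: "gaussian_measure \<mu>" and ran: "range \<iota> = {w. cm_norm \<mu> w < \<infinity>}"
    using aws by (auto simp: abstract_wiener_space_def)
  interpret prob_space \<mu> using \<mu> by (simp add: gaussian_measure_def)
  have sets: "sets \<mu> = sets borel" using \<mu> by (simp add: gaussian_measure_def)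
  note G = gaussian_measure_functional[OF \<mu>]
  have mu[measurable]: "blinfun_apply u \<in> borel_measurable \<mu>" for u :: "'w \<Rightarrow>\<^sub>L real" using G(1) by (simp add: L2_def)
  have id[measurable]: "(\<lambda>w. w) \<in> borel_measurable \<mu>" using sets by (simp add: measurable_ident_sets)
  define f where "f n w = (indicator (cball 0 (real n)) w * v w) *\<^sub>R w" for n w
  have cb[measurable]: "cball (0 :: 'w) (real n) \<in> sets \<mu>" for n using sets by simp
  have fm: "f n \<in> borel_measurable \<mu>" for n
    unfolding f_def by (intro borel_measurable_scaleR borel_measurable_times borel_measurable_indicator cb mu id)
  have fi: "integrable \<mu> (f n)" for n
  proof (rule Bochner_Integration.integrable_bound[where f = "\<lambda>w. real n * v w"])
    show "integrable \<mu> (\<lambda>w. real n * v w)" using L2_integrable1[OF G(1)] by simp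
    have "\<bar>v w\<bar> * norm w \<le> real n * \<bar>v w\<bar>" if "norm w \<le> real n" for w
      using mult_left_mono[OF that, of "\<bar>v w\<bar>"] by (simp add: mult.commute)
    then show "AE w in \<mu>. norm (f n w) \<le> norm (real n * v w)"
      by (auto simp: f_def indicator_def abs_mult)
  qed (rule fm)
  define h where "h n = (\<integral>w. f n w \<partial>\<mu>)" for n
  have uh: "u (h n) = (\<integral>w. indicator (cball 0 (real n)) w * v w * u w \<partial>\<mu>)" for u :: "'w \<Rightarrow>\<^sub>L real" and n
  proof -
    have "u (h n) = (\<integral>w. u (f n w) \<partial>\<mu>)" unfolding h_def
      by (rule integral_bounded_linear[OF blinfun.bounded_linear_right fi, symmetric])
    then show ?thesis by (simp add: f_def blinfun.scaleR_right)
  qed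
  have Lv: "L2 \<mu> (\<lambda>w. indicator (cball 0 (real n)) w * v w)" for n
  proof -
    have "integrable \<mu> (\<lambda>w. (indicator (cball 0 (real n)) w * v w)\<^sup>2)"
      by (rule Bochner_Integration.integrable_bound[OF L2_integrable[OF G(1)[of v]]]) (auto simp: indicator_def)
    then show ?thesis by (simp add: L2_def)
  qed
  have le: "(\<integral>w. (indicator (cball 0 (real n)) w * v w)\<^sup>2 \<partial>\<mu>) \<le> (\<integral>w. (v w)\<^sup>2 \<partial>\<mu>)" for n
    by (rule integral_mono[OF L2_integrable[OF Lv] L2_integrable[OF G(1)]]) (simp add: indicator_def)
  \<comment> \<open>By Cauchy-Schwarz every functional u is at most the standard deviation of v
    times that of u at the truncated mean, so the Cameron-Martin norm is finite.\<close>
  have "cm_norm \<mu> (h n) \<le> ennreal (sqrt (\<integral>w. (v w)\<^sup>2 \<partial>\<mu>))" for n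
    unfolding cm_norm_def
  proof (rule SUP_least, rule ennreal_leI)
    fix u :: "'w \<Rightarrow>\<^sub>L real" assume "u \<in> {u. u \<noteq> 0}"
    then have pos: "(\<integral>w. (u w)\<^sup>2 \<partial>\<mu>) > 0" using G(4) by simp
    have "(u (h n))\<^sup>2 \<le> (\<integral>w. (indicator (cball 0 (real n)) w * v w)\<^sup>2 \<partial>\<mu>) * (\<integral>w. (u w)\<^sup>2 \<partial>\<mu>)"
      unfolding uh by (rule L2_Cauchy_Schwarz[OF Lv G(1)])
    also have "\<dots> \<le> (\<integral>w. (v w)\<^sup>2 \<partial>\<mu>) * (\<integral>w. (u w)\<^sup>2 \<partial>\<mu>)"
      using le pos by (intro mult_right_mono) auto
    finally have "sqrt ((u (h n))\<^sup>2) \<le> sqrt ((\<integral>w. (v w)\<^sup>2 \<partial>\<mu>) * (\<integral>w. (u w)\<^sup>2 \<partial>\<mu>))" by (rule real_sqrt_le_mono)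
    then have "\<bar>u (h n)\<bar> \<le> sqrt (\<integral>w. (v w)\<^sup>2 \<partial>\<mu>) * sqrt (\<integral>w. (u w)\<^sup>2 \<partial>\<mu>)" by (simp add: real_sqrt_mult)
    then show "\<bar>u (h n)\<bar> / sqrt (\<integral>w. (u w)\<^sup>2 \<partial>\<mu>) \<le> sqrt (\<integral>w. (v w)\<^sup>2 \<partial>\<mu>)"
      using pos by (simp add: pos_divide_le_eq)
  qed
  then have "cm_norm \<mu> (h n) < \<infinity>" for n by (rule le_less_trans) simp
  then have "h n \<in> range \<iota>" for n unfolding ran by simp
  then have "v (h n) = 0" for n using v by (metis imageE)
  \<comment> \<open>Since v (h n) is the integral of v^2 over the ball of radius n, its vanishing
    for all n makes v zero almost everywhere.\<close>
  then have z: "(\<integral>w. (indicator (cball 0 (real n)) w * v w)\<^sup>2 \<partial>\<mu>) = 0" for n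
  proof -
    have "(indicator (cball 0 (real n)) w * v w)\<^sup>2 = indicator (cball 0 (real n)) w * v w * v w" for w
      by (simp add: indicator_def power2_eq_square)
    then show ?thesis using \<open>v (h n) = 0\<close> unfolding uh by (simp only:)
  qed
  have "AE w in \<mu>. (indicator (cball 0 (real n)) w * v w)\<^sup>2 = 0" for n
    using integral_nonneg_eq_0_iff_AE[OF L2_integrable[OF Lv]] z by simp
  then have "AE w in \<mu>. \<forall>n::nat. (indicator (cball 0 (real n)) w * v w)\<^sup>2 = 0" by (simp only: AE_all_countable) simp
  then have "AE w in \<mu>. (v w)\<^sup>2 = 0"
  proof eventually_elim
    case (elim w)
    obtain n :: nat where "norm w \<le> real n" using real_arch_simple by blast
    then show ?case using elim[rule_format, of n] by (simp add: indicator_def)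
  qed
  then have "(\<integral>w. (v w)\<^sup>2 \<partial>\<mu>) = 0" by (rule integral_eq_zero_AE)
  with G(4)[OF nz] show False by simp
qed

subsection \<open>Brownian motion\<close>

locale wiener_bm = prob_space M for M :: "'s measure" +
  fixes \<iota> :: "'h::{real_inner,complete_space} \<Rightarrow> 'w::{banach,second_countable_topology}"
    and \<mu> :: "'w measure"
    and X :: "real \<Rightarrow> 's \<Rightarrow> 'w \<times> 'c::{real_inner,banach,second_countable_topology}"
  assumes aws: "abstract_wiener_space \<iota> \<mu>"
    and bm: "brownian_motion M \<iota> X"
begin

lemma \<mu>: "gaussian_measure \<mu>" and lin_\<iota>: "linear \<iota>"
  and cm: "cm_norm \<mu> (\<iota> h) = ennreal (norm h)"
  using aws by (auto simp: abstract_wiener_space_def)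

text \<open>The adjoint of the inclusion: the vector of H that represents the restriction of v to H.
  Covariances of functionals of B are inner products of these vectors.\<close>

definition rep :: "('w \<Rightarrow>\<^sub>L real) \<Rightarrow> 'h" where
  "rep v = (SOME k. \<forall>h. v (\<iota> h) = inner h k)"

lemma rep: "v (\<iota> h) = inner h (rep v)" for v :: "'w \<Rightarrow>\<^sub>L real"
proof -
  have "bounded_linear (\<lambda>h. v (\<iota> h))"
  proof (cases "v = 0")
    case False
    define s where "s = sqrt (\<integral>w. (v w)\<^sup>2 \<partial>\<mu>)"
    have s: "s > 0" using gaussian_measure_functional(4)[OF \<mu> False] by (simp add: s_def)
    have "\<bar>v (\<iota> h)\<bar> \<le> norm h * s" for h
    proof -
      have "ennreal (\<bar>v (\<iota> h)\<bar> / s) \<le> cm_norm \<mu> (\<iota> h)"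
        unfolding cm_norm_def s_def using False by (intro SUP_upper2[of v]) auto
      then have "\<bar>v (\<iota> h)\<bar> / s \<le> norm h" unfolding cm by (simp add: ennreal_le_iff)
      then show ?thesis using s by (simp add: pos_divide_le_eq)
    qed
    moreover have "linear (\<lambda>h. v (\<iota> h))"
      using linear_compose[OF lin_\<iota> blinfun.bounded_linear_right[THEN bounded_linear.linear, of v]] by (simp add: o_def)
    ultimately show ?thesis unfolding bounded_linear_def bounded_linear_axioms_def by auto
  qed simp
  from someI_ex[OF Riesz_representation[OF this]] show ?thesis unfolding rep_def by blast
qed

lemma rep_unique: "(\<And>h. v (\<iota> h) = inner h k) \<Longrightarrow> rep v = k" for v :: "'w \<Rightarrow>\<^sub>L real"
  using rep[of v] by (metis inner_eq_zero_iff inner_diff_right right_minus_eq)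

text \<open>This is density of H in W in dual form. It makes the description in
  \<open>cm_functional\<close> unique and lets identities on W be checked on H only.\<close>

lemma functional_eqI: "(\<And>h. u (\<iota> h) = v (\<iota> h)) \<Longrightarrow> u = v" for u v :: "'w \<Rightarrow>\<^sub>L real"
  using cameron_martin_separates[OF aws, of "u - v"] by (simp add: blinfun.diff_left)

lemma cm_functional_eq: "(\<And>k. u (\<iota> k) = inner k h) \<Longrightarrow> cm_functional \<iota> h = u" for u :: "'w \<Rightarrow>\<^sub>L real"
  unfolding cm_functional_def by (rule the_equality) (auto intro!: functional_eqI)

lemma rep_H_star: "rep v \<in> H_star \<iota>" and cm_functional_rep: "cm_functional \<iota> (rep v) = v"
  using rep[of v] by (auto simp: H_star_def intro!: cm_functional_eq)

lemma cm_functional: "h \<in> H_star \<iota> \<Longrightarrow> cm_functional \<iota> h (\<iota> k) = inner k h"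
  and rep_cm_functional: "h \<in> H_star \<iota> \<Longrightarrow> rep (cm_functional \<iota> h) = h"
proof -
  assume "h \<in> H_star \<iota>"
  then obtain u :: "'w \<Rightarrow>\<^sub>L real" where u: "\<And>k. u (\<iota> k) = inner k h" unfolding H_star_def by blast
  then have "cm_functional \<iota> h = u" by (rule cm_functional_eq)
  then show "cm_functional \<iota> h (\<iota> k) = inner k h" "rep (cm_functional \<iota> h) = h"
    using u rep_unique[of u h] by simp_all
qed

abbreviation B :: "real \<Rightarrow> 's \<Rightarrow> 'w" where "B t x \<equiv> fst (X t x)"
abbreviation B0 :: "real \<Rightarrow> 's \<Rightarrow> 'c" where "B0 t x \<equiv> snd (X t x)"

lemma X_measurable: "t \<ge> 0 \<Longrightarrow> X t \<in> borel_measurable M"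
  and X_zero: "x \<in> space M \<Longrightarrow> X 0 x = 0"
  and X_continuous: "x \<in> space M \<Longrightarrow> continuous_on {0..} (\<lambda>t. X t x)"
  and X_indep: "0 \<le> \<tau> 0 \<Longrightarrow> incseq \<tau> \<Longrightarrow> indep_vars (\<lambda>_. borel) (\<lambda>j x. X (\<tau> (Suc j)) x - X (\<tau> j) x) {..<n::nat}"
  and X_gaussian: "0 \<le> s \<Longrightarrow> s < t \<Longrightarrow> gaussian_measure (distr M borel (\<lambda>x. X t x - X s x))"
proof -
  note b = bm[unfolded brownian_motion_def]
  note b1 = conjunct1[OF b] and b2 = conjunct1[OF conjunct2[OF b]]
    and b3 = conjunct1[OF conjunct2[OF conjunct2[OF b]]] and b4 = conjunct1[OF conjunct2[OF conjunct2[OF conjunct2[OF b]]]]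
  show "t \<ge> 0 \<Longrightarrow> X t \<in> borel_measurable M" using b1 by blast
  show "x \<in> space M \<Longrightarrow> X 0 x = 0" "x \<in> space M \<Longrightarrow> continuous_on {0..} (\<lambda>t. X t x)" using b2 by blast+
  show "0 \<le> \<tau> 0 \<Longrightarrow> incseq \<tau> \<Longrightarrow> indep_vars (\<lambda>_. borel) (\<lambda>j x. X (\<tau> (Suc j)) x - X (\<tau> j) x) {..<n::nat}"
    using b3[rule_format, of \<tau> n] by blast
  show "0 \<le> s \<Longrightarrow> s < t \<Longrightarrow> gaussian_measure (distr M borel (\<lambda>x. X t x - X s x))"
    using b4[rule_format, of s t] by blast
qed

lemma B_measurable: "t \<ge> 0 \<Longrightarrow> B t \<in> borel_measurable M"
  and B0_measurable: "t \<ge> 0 \<Longrightarrow> B0 t \<in> borel_measurable M"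
  by (rule measurable_compose[OF X_measurable borel_measurable_continuous_onI], assumption, intro continuous_intros)+

text \<open>The general continuous functional of the pair at time t, split into its two components;
  by \<open>functional_lf\<close> and \<open>lf_functional\<close> nothing is lost or
  gained.\<close>

definition lf :: "('w \<Rightarrow>\<^sub>L real) \<Rightarrow> 'c \<Rightarrow> real \<Rightarrow> 's \<Rightarrow> real" where
  "lf v a t x = v (B t x) + inner (B0 t x) a"

lemma functional_lf:
  fixes \<phi> :: "('w \<times> 'c) \<Rightarrow>\<^sub>L real"
  shows "\<exists>v a. \<forall>t x. \<phi> (X t x) = lf v a t x"
proof -
  have b1: "bounded_linear (\<lambda>w. \<phi> (w, 0))"
    by (intro bounded_linear_compose[OF blinfun.bounded_linear_right] bounded_linear_Pair bounded_linear_ident bounded_linear_zero)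
  have b2: "bounded_linear (\<lambda>c. \<phi> (0, c))"
    by (intro bounded_linear_compose[OF blinfun.bounded_linear_right] bounded_linear_Pair bounded_linear_ident bounded_linear_zero)
  obtain a where a: "\<And>c. \<phi> (0, c) = inner c a" using Riesz_representation[OF b2] by blast
  have "\<phi> p = Blinfun (\<lambda>w. \<phi> (w, 0)) (fst p) + inner (snd p) a" for p
  proof -
    have "\<phi> p = \<phi> ((fst p, 0) + (0, snd p))" by simp
    also have "\<dots> = \<phi> (fst p, 0) + \<phi> (0, snd p)" by (rule blinfun.add_right)
    finally show ?thesis by (simp add: a bounded_linear_Blinfun_apply[OF b1])
  qed
  then show ?thesis unfolding lf_def by blast
qed

lemma lf_functional: "\<exists>\<phi> :: ('w \<times> 'c) \<Rightarrow>\<^sub>L real. \<forall>t x. \<phi> (X t x) = lf v a t x"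
proof -
  have "bounded_linear (\<lambda>p. v (fst p) + inner (snd p) a)"
    by (intro bounded_linear_add bounded_linear_compose[OF blinfun.bounded_linear_right bounded_linear_fst]
        bounded_linear_compose[OF bounded_linear_inner_left bounded_linear_snd])
  then show ?thesis
    by (intro exI[of _ "Blinfun (\<lambda>p. v (fst p) + inner (snd p) a)"]) (simp add: bounded_linear_Blinfun_apply lf_def)
qed

lemma lf_cov:
  assumes "s \<ge> 0" "t \<ge> 0"
  shows "(\<E> x. lf v a s x * lf v' a' t x) = (inner (rep v) (rep v') + inner a a') * min s t"
proof -
  note b = bm[unfolded brownian_motion_def]
  from conjunct2[OF conjunct2[OF conjunct2[OF conjunct2[OF b]]], rule_format, OF rep_H_star[of v] rep_H_star[of v'] assms, of a a']
  show ?thesis unfolding cm_functional_rep lf_def inner_Pair .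
qed

lemma X_increment_functional:
  fixes \<phi> :: "('w \<times> 'c) \<Rightarrow>\<^sub>L real"
  assumes "0 \<le> s" "s \<le> t"
  shows "L2 M (\<lambda>x. \<phi> (X t x - X s x))" "(\<E> x. \<phi> (X t x - X s x)) = 0"
    "(CLINT x|M. iexp (\<phi> (X t x - X s x))) = complex_of_real (exp (- (\<E> x. (\<phi> (X t x - X s x))\<^sup>2) / 2))"
proof -
  have "L2 M (\<lambda>x. \<phi> (X t x - X s x)) \<and> (\<E> x. \<phi> (X t x - X s x)) = 0 \<and>
    (CLINT x|M. iexp (\<phi> (X t x - X s x))) = complex_of_real (exp (- (\<E> x. (\<phi> (X t x - X s x))\<^sup>2) / 2))"
  proof (cases "s = t")
    case False
    then have st: "s < t" using assms by simp
    note G = gaussian_measure_functional[OF X_gaussian[OF assms(1) st], of \<phi>]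
    have Xm: "X t \<in> borel_measurable M" "X s \<in> borel_measurable M" using assms X_measurable by auto
    have Dm[measurable]: "(\<lambda>x. X t x - X s x) \<in> borel_measurable M" by (rule borel_measurable_diff[OF Xm])
    have \<phi>[measurable]: "blinfun_apply \<phi> \<in> borel_measurable borel"
      by (intro borel_measurable_continuous_onI linear_continuous_on blinfun.bounded_linear_right)
    have "(\<E> x. (\<phi> (X t x - X s x))\<^sup>2) = (\<integral>w. (\<phi> w)\<^sup>2 \<partial>distr M borel (\<lambda>x. X t x - X s x))"
      by (rule integral_distr[symmetric]) measurable
    moreover have "(\<E> x. \<phi> (X t x - X s x)) = (\<integral>w. \<phi> w \<partial>distr M borel (\<lambda>x. X t x - X s x))"
      by (rule integral_distr[symmetric]) measurable
    moreover have "(CLINT x|M. iexp (\<phi> (X t x - X s x))) = (CLINT w|distr M borel (\<lambda>x. X t x - X s x). iexp (\<phi> w))"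
      by (rule integral_distr[symmetric]) measurable
    moreover have "integrable M (\<lambda>x. (\<phi> (X t x - X s x))\<^sup>2)"
      using G(1) integrable_distr_eq[OF Dm, of "\<lambda>w. (\<phi> w)\<^sup>2"] by (simp add: L2_def)
    ultimately show ?thesis using G by (simp add: L2_def)
  qed (simp add: prob_space blinfun.zero_right)
  then show "L2 M (\<lambda>x. \<phi> (X t x - X s x))" "(\<E> x. \<phi> (X t x - X s x)) = 0"
    "(CLINT x|M. iexp (\<phi> (X t x - X s x))) = complex_of_real (exp (- (\<E> x. (\<phi> (X t x - X s x))\<^sup>2) / 2))"
    by blast+
qed

text \<open>Independence of the last increment from the earlier ones makes characteristic functions
  multiply and kills the cross term in the variance, so the Gaussian identity survives each
  step.\<close>

lemma increment_sum_gaussian: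
  fixes \<psi> :: "nat \<Rightarrow> ('w \<times> 'c) \<Rightarrow>\<^sub>L real"
  assumes \<tau>: "0 \<le> \<tau> 0" "incseq \<tau>"
  defines "Z \<equiv> \<lambda>n x. \<Sum>j<n. \<psi> j (X (\<tau> (Suc j)) x - X (\<tau> j) x)"
  shows "L2 M (Z n) \<and> (\<E> x. Z n x) = 0 \<and> (CLINT x|M. iexp (Z n x)) = complex_of_real (exp (- (\<E> x. (Z n x)\<^sup>2) / 2))"
proof (induction n)
  case 0
  show ?case by (simp add: Z_def prob_space)
next
  case (Suc n)
  define D where "D j x = \<psi> j (X (\<tau> (Suc j)) x - X (\<tau> j) x)" for j x
  have \<tau>': "0 \<le> \<tau> j" "\<tau> j \<le> \<tau> (Suc j)" for j
    using \<tau> incseqD[OF \<tau>(2), of 0 j] incseqD[OF \<tau>(2), of j "Suc j"] by auto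
  note G = X_increment_functional[OF \<tau>', of "\<psi> n" n, folded D_def]
  have \<psi>m: "blinfun_apply (\<psi> j) \<in> borel_measurable borel" for j
    by (intro borel_measurable_continuous_onI linear_continuous_on blinfun.bounded_linear_right)
  have "indep_vars (\<lambda>_. borel) D {..<Suc n}" unfolding D_def[abs_def]
    by (rule indep_vars_compose2[OF X_indep[OF \<tau>] \<psi>m])
  then have "indep_vars (\<lambda>_. borel) D (insert n {..<n})" by (simp add: lessThan_Suc)
  then have "indep_var borel (D n) borel (\<lambda>x. \<Sum>j<n. D j x)" by (intro indep_vars_sum) auto
  then have ind: "indep_var borel (D n) borel (Z n)" by (simp add: Z_def D_def)
  have ZS: "Z (Suc n) x = D n x + Z n x" for x by (simp add: Z_def D_def add.commute)
  have L: "L2 M (Z n)" "(\<E> x. Z n x) = 0"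
    and cZ: "(CLINT x|M. iexp (Z n x)) = complex_of_real (exp (- (\<E> x. (Z n x)\<^sup>2) / 2))" using Suc by auto
  have LS: "L2 M (\<lambda>x. D n x + Z n x)" by (rule L2_add[OF G(1) L(1)])
  have iD: "integrable M (D n)" "integrable M (Z n)" using L2_integrable1[OF G(1)] L2_integrable1[OF L(1)] by auto
  have cross: "(\<E> x. D n x * Z n x) = 0"
    using indep_var_lebesgue_integral[OF ind iD] G(2) by simp
  have "(\<E> x. (D n x + Z n x)\<^sup>2) = (\<E> x. ((D n x)\<^sup>2 + 2 * (D n x * Z n x)) + (Z n x)\<^sup>2)"
    by (intro Bochner_Integration.integral_cong) (auto simp: power2_eq_square algebra_simps)
  also have "\<dots> = (\<E> x. (D n x)\<^sup>2) + (\<E> x. (Z n x)\<^sup>2)"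
    unfolding Bochner_Integration.integral_add[OF Bochner_Integration.integrable_add[OF L2_integrable[OF G(1)]
            integrable_mult_right[OF L2_mult_integrable[OF G(1) L(1)]]] L2_integrable[OF L(1)]]
          Bochner_Integration.integral_add[OF L2_integrable[OF G(1)] integrable_mult_right[OF L2_mult_integrable[OF G(1) L(1)]]]
          integral_mult_right_zero cross by simp
  finally have sq: "(\<E> x. (D n x + Z n x)\<^sup>2) = (\<E> x. (D n x)\<^sup>2) + (\<E> x. (Z n x)\<^sup>2)" .
  have ch: "(CLINT x|M. iexp (Y x)) = char (distr M borel Y) 1" if "L2 M Y" for Y
  proof -
    have [measurable]: "Y \<in> borel_measurable M" using that by (simp add: L2_def)
    show ?thesis unfolding char_def by (subst integral_distr) auto
  qed
  have "(CLINT x|M. iexp (D n x + Z n x)) = char (distr M borel (\<lambda>x. D n x + Z n x)) 1" by (rule ch[OF LS])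
  also have "\<dots> = char (distr M borel (D n)) 1 * char (distr M borel (Z n)) 1" by (rule char_distr_add[OF ind])
  also have "\<dots> = complex_of_real (exp (- (\<E> x. (D n x)\<^sup>2) / 2) * exp (- (\<E> x. (Z n x)\<^sup>2) / 2))"
    unfolding ch[OF G(1), symmetric] ch[OF L(1), symmetric] G(3) cZ by (rule of_real_mult[symmetric])
  also have "exp (- (\<E> x. (D n x)\<^sup>2) / 2) * exp (- (\<E> x. (Z n x)\<^sup>2) / 2) = exp (- (\<E> x. (D n x + Z n x)\<^sup>2) / 2)"
    unfolding sq exp_add[symmetric] by (simp add: field_simps)
  finally have c: "(CLINT x|M. iexp (D n x + Z n x)) = complex_of_real (exp (- (\<E> x. (D n x + Z n x)\<^sup>2) / 2))" .
  have "(\<E> x. D n x + Z n x) = 0" using iD G(2) L(2) by simp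
  with LS c show ?case unfolding ZS[abs_def] by blast
qed

text \<open>The linear span of all functionals of X at nonnegative times. Grouping by time, with one
  functional for each, keeps sums of two elements in the same shape.\<close>

definition V0 :: "('s \<Rightarrow> real) set" where
  "V0 = {Z. \<exists>S (\<phi> :: real \<Rightarrow> ('w \<times> 'c) \<Rightarrow>\<^sub>L real). finite S \<and> S \<subseteq> {0..} \<and> Z = (\<lambda>x. \<Sum>s\<in>S. \<phi> s (X s x))}"

text \<open>Summation by parts: a value of X is the sum of the increments before it, since X starts
  at 0. This start is known on \<open>space M\<close> only, hence the auxiliary variable Y that
  agrees with Z there.\<close>

lemma sum_over_times_gaussian:
  fixes \<phi> :: "real \<Rightarrow> ('w \<times> 'c) \<Rightarrow>\<^sub>L real"
  assumes S: "finite S" "S \<subseteq> {0..}"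
  defines "Z \<equiv> \<lambda>x. \<Sum>s\<in>S. \<phi> s (X s x)"
  shows "\<exists>Y. (\<forall>x\<in>space M. Z x = Y x) \<and> L2 M Y \<and> (CLINT x|M. iexp (Y x)) = complex_of_real (exp (- (\<E> x. (Y x)\<^sup>2) / 2))"
proof (cases "S = {}")
  case True
  then show ?thesis by (intro exI[of _ "\<lambda>_. 0"]) (simp add: Z_def prob_space)
next
  case False
  define l where "l = sorted_list_of_set S"
  define n where "n = length l"
  have l: "set l = S" "sorted l" "distinct l" using S by (auto simp: l_def)
  have n: "n > 0" using False l by (auto simp: n_def)
  \<comment> \<open>The sorted times are preceded by 0 and continued by their last member, which
    gives the infinite increasing sequence that the independence hypothesis speaks of.\<close>
  define \<tau> where "\<tau> i = (if i = 0 then 0 else l ! (min i n - 1))" for i :: nat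
  have lpos: "l ! i \<ge> 0" if "i < n" for i using that l(1) S nth_mem[of i l] by (auto simp: n_def)
  have "\<tau> 0 = 0" by (simp add: \<tau>_def)
  have inc: "incseq \<tau>"
  proof (rule incseq_SucI)
    fix i
    have "l ! (min i n - 1) \<le> l ! (min (Suc i) n - 1)"
      using n by (intro sorted_nth_mono[OF l(2)]) (auto simp: n_def[symmetric])
    then show "\<tau> i \<le> \<tau> (Suc i)" using lpos n by (cases "i = 0") (auto simp: \<tau>_def)
  qed
  have \<tau>S: "\<tau> (Suc i) = l ! i" if "i < n" for i using that by (simp add: \<tau>_def min_def)
  \<comment> \<open>The j-th increment enters the value at every time from the j-th on, so its
    coefficient collects all those functionals.\<close>
  define \<psi> where "\<psi> j = (\<Sum>i<n. if j \<le> i then \<phi> (l ! i) else 0)" for j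
  define D where "D j x = X (\<tau> (Suc j)) x - X (\<tau> j) x" for j x
  have "Z x = (\<Sum>j<n. \<psi> j (D j x))" if x: "x \<in> space M" for x
  proof -
    have tel: "X (\<tau> (Suc i)) x = (\<Sum>j<n. if j \<le> i then D j x else 0)" if "i < n" for i
    proof -
      have "(\<Sum>j<Suc i. X (\<tau> (Suc j)) x - X (\<tau> j) x) = X (\<tau> (Suc i)) x - X (\<tau> 0) x" by (rule sum_lessThan_telescope)
      then have "X (\<tau> (Suc i)) x = (\<Sum>j<Suc i. D j x)" using X_zero[OF x] \<open>\<tau> 0 = 0\<close> by (simp add: D_def)
      also have "\<dots> = (\<Sum>j\<in>{..<n} \<inter> {j. j \<le> i}. D j x)"
        using that by (intro sum.cong) auto
      also have "\<dots> = (\<Sum>j<n. if j \<le> i then D j x else 0)" by (simp add: sum.inter_restrict)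
      finally show ?thesis .
    qed
    have "bij_betw ((!) l) {..<n} S" using l by (intro bij_betw_nth) (auto simp: n_def)
    then have "Z x = (\<Sum>i<n. \<phi> (l ! i) (X (l ! i) x))" unfolding Z_def
      by (subst sum.reindex_bij_betw[symmetric]) auto
    also have "\<dots> = (\<Sum>i<n. \<phi> (l ! i) (\<Sum>j<n. if j \<le> i then D j x else 0))"
      using tel \<tau>S by (intro sum.cong) auto
    also have "\<dots> = (\<Sum>i<n. \<Sum>j<n. if j \<le> i then \<phi> (l ! i) (D j x) else 0)"
      by (intro sum.cong refl) (simp add: blinfun.sum_right if_distrib[of "blinfun_apply _"] blinfun.zero_right cong: if_cong)
    also have "\<dots> = (\<Sum>j<n. \<Sum>i<n. if j \<le> i then \<phi> (l ! i) (D j x) else 0)" by (rule sum.swap)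
    also have "\<dots> = (\<Sum>j<n. \<psi> j (D j x))" unfolding \<psi>_def
      by (intro sum.cong refl) (simp add: blinfun.sum_left if_distrib[of "\<lambda>f. blinfun_apply f _"] cong: if_cong)
    finally show ?thesis .
  qed
  moreover have "L2 M (\<lambda>x. \<Sum>j<n. \<psi> j (D j x)) \<and>
     (CLINT x|M. iexp (\<Sum>j<n. \<psi> j (D j x))) = complex_of_real (exp (- (\<E> x. (\<Sum>j<n. \<psi> j (D j x))\<^sup>2) / 2))"
    using increment_sum_gaussian[of \<tau> \<psi> n] inc \<open>\<tau> 0 = 0\<close> by (auto simp: D_def)
  ultimately show ?thesis by (intro exI[of _ "\<lambda>x. \<Sum>j<n. \<psi> j (D j x)"]) auto
qed

lemma gaussian_family_V0: "gaussian_family M V0"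
  unfolding gaussian_family_def
proof (intro conjI ballI allI)
  show "(\<lambda>x. 0) \<in> V0" unfolding V0_def by (intro CollectI exI[of _ "{}"]) auto
  fix Z assume "Z \<in> V0"
  then obtain S and \<phi> :: "real \<Rightarrow> ('w \<times> 'c) \<Rightarrow>\<^sub>L real" where S: "finite S" "S \<subseteq> {0..}" "Z = (\<lambda>x. \<Sum>s\<in>S. \<phi> s (X s x))"
    unfolding V0_def by blast
  obtain Y where Y: "\<forall>x\<in>space M. Z x = Y x" "L2 M Y"
    "(CLINT x|M. iexp (Y x)) = complex_of_real (exp (- (\<E> x. (Y x)\<^sup>2) / 2))"
    using sum_over_times_gaussian[OF S(1,2), of \<phi>] S(3) by blast
  have "Z \<in> borel_measurable M" using Y(1,2) measurable_cong[of M Z Y borel] by (simp add: L2_def)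
  moreover have "integrable M (\<lambda>x. (Z x)\<^sup>2)"
    using Y(1,2) Bochner_Integration.integrable_cong[of M M "\<lambda>x. (Z x)\<^sup>2" "\<lambda>x. (Y x)\<^sup>2"] by (simp add: L2_def)
  ultimately show "L2 M Z" by (simp add: L2_def)
  have "(\<E> x. (Z x)\<^sup>2) = (\<E> x. (Y x)\<^sup>2)" using Y(1) by (intro Bochner_Integration.integral_cong) auto
  moreover have "(CLINT x|M. iexp (Z x)) = (CLINT x|M. iexp (Y x))" using Y(1) by (intro Bochner_Integration.integral_cong) auto
  ultimately show "(CLINT x|M. iexp (Z x)) = complex_of_real (exp (- (\<E> x. (Z x)\<^sup>2) / 2))" using Y(3) by simp
next
  fix Z Y a b assume "Z \<in> V0" "Y \<in> V0"
  then obtain S S' and \<phi> \<phi>' :: "real \<Rightarrow> ('w \<times> 'c) \<Rightarrow>\<^sub>L real" where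
    S: "finite S" "S \<subseteq> {0..}" "Z = (\<lambda>x. \<Sum>s\<in>S. \<phi> s (X s x))" and
    S': "finite S'" "S' \<subseteq> {0..}" "Y = (\<lambda>x. \<Sum>s\<in>S'. \<phi>' s (X s x))"
    unfolding V0_def by blast
  define \<psi> where "\<psi> s = a *\<^sub>R (if s \<in> S then \<phi> s else 0) + b *\<^sub>R (if s \<in> S' then \<phi>' s else 0)" for s
  have "a * Z x + b * Y x = (\<Sum>s\<in>S \<union> S'. \<psi> s (X s x))" for x
  proof -
    have 1: "(\<Sum>s\<in>S \<union> S'. (if s \<in> S then \<phi> s else 0) (X s x)) = Z x"
      unfolding S(3) using S(1) S'(1) by (intro sum.mono_neutral_cong_right) auto
    have 2: "(\<Sum>s\<in>S \<union> S'. (if s \<in> S' then \<phi>' s else 0) (X s x)) = Y x"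
      unfolding S'(3) using S(1) S'(1) by (intro sum.mono_neutral_cong_right) auto
    show ?thesis unfolding \<psi>_def by (simp add: blinfun.add_left blinfun.scaleR_left sum.distrib sum_distrib_left[symmetric] 1 2)
  qed
  then show "(\<lambda>x. a * Z x + b * Y x) \<in> V0" unfolding V0_def using S(1,2) S'(1,2)
    by (intro CollectI exI[of _ "S \<union> S'"] exI[of _ \<psi>]) auto
qed

text \<open>The closure is essential: the Gaussian variable paired with a general A in H, as well as
  the slopes found in the limit of the Riemann sums, are only mean square limits of elements of
  \<open>V0\<close>.\<close>

definition V :: "('s \<Rightarrow> real) set" where "V = L2_closure M V0"

lemma gaussian_family_V: "gaussian_family M V"
  unfolding V_def by (rule gaussian_family_closure[OF gaussian_family_V0])

lemma V0_V: "V0 \<subseteq> V"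
  unfolding V_def by (rule L2_closure_superset) (rule gaussian_familyD(3)[OF gaussian_family_V0])

lemma V_limit:
  assumes "\<And>n. f n \<in> V" "L2 M Z" "(\<lambda>n. \<E> x. (f n x - Z x)\<^sup>2) \<longlonglongrightarrow> 0"
  shows "Z \<in> V"
  unfolding V_def using L2_closure_limit[OF assms(1)[unfolded V_def] gaussian_familyD(3)[OF gaussian_family_V0] assms(2,3)] .

lemmas V_L2 = gaussian_familyD(3)[OF gaussian_family_V]

lemma functional_V0: "t \<ge> 0 \<Longrightarrow> (\<lambda>x. \<phi> (X t x)) \<in> V0" for \<phi> :: "('w \<times> 'c) \<Rightarrow>\<^sub>L real"
  unfolding V0_def by (intro CollectI exI[of _ "{t}"] exI[of _ "\<lambda>_. \<phi>"]) auto

lemma lf_V0: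
  assumes "t \<ge> 0" shows "lf v a t \<in> V0"
proof -
  obtain \<phi> :: "('w \<times> 'c) \<Rightarrow>\<^sub>L real" where "\<And>t x. \<phi> (X t x) = lf v a t x" using lf_functional by blast
  with functional_V0[OF assms, of \<phi>] show ?thesis by simp
qed

lemma lf_V: "t \<ge> 0 \<Longrightarrow> lf v a t \<in> V" using lf_V0 V0_V by blast

lemma lf_L2: "t \<ge> 0 \<Longrightarrow> L2 M (lf v a t)" using lf_V V_L2 by blast

text \<open>The hypothesis of Fernique's estimate is verified with the increment Y from T to 2 T as
  independent copy of X T. Invariance of the law of the pair under rotation follows by comparing
  variances of functionals.\<close>

lemma X_norm_in_all_Lp:
  assumes T: "T > 0"
  shows "in_all_Lp M (\<lambda>x. norm (X T x))"
proof (rule Fernique_moments)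
  define Y where "Y x = X (2 * T) x - X T x" for x
  have T2: "0 \<le> T" "0 \<le> 2 * T" using T by auto
  have Xm[measurable]: "X T \<in> borel_measurable M" "X (2 * T) \<in> borel_measurable M" using X_measurable T by auto
  have Ym[measurable]: "Y \<in> borel_measurable M" unfolding Y_def[abs_def] by measurable
  show "(\<lambda>x. norm (X T x)) \<in> borel_measurable M" by measurable
  define \<tau> where "\<tau> i = (if i = 0 then 0 else if i = 1 then T else 2 * T)" for i :: nat
  have "indep_vars (\<lambda>_. borel) (\<lambda>j x. X (\<tau> (Suc j)) x - X (\<tau> j) x) {..<2::nat}"
    using T by (intro X_indep) (auto simp: \<tau>_def intro!: incseq_SucI)
  note iv = indep_varsD_finite[OF this]
  have ind: "prob {x\<in>space M. P (X T x) \<and> Q (Y x)} = prob {x\<in>space M. P (X T x)} * prob {x\<in>space M. Q (Y x)}"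
    if PQ: "{z. P z} \<in> sets borel" "{z. Q z} \<in> sets borel" for P Q
  proof -
    define A where "A i = (if i = 0 then {z. P z} else {z. Q z})" for i :: nat
    have two: "{..<2::nat} = {0, 1}" by auto
    have *: "prob (\<Inter>i\<in>{..<2::nat}. (\<lambda>x. X (\<tau> (Suc i)) x - X (\<tau> i) x) -` A i \<inter> space M)
       = (\<Prod>i\<in>{..<2::nat}. prob ((\<lambda>x. X (\<tau> (Suc i)) x - X (\<tau> i) x) -` A i \<inter> space M))"
    proof (rule iv)
      show "{..<2::nat} \<noteq> {}" unfolding two by simp
    qed (use PQ in \<open>auto simp: A_def\<close>)
    have 0: "(\<lambda>x. X (\<tau> (Suc 0)) x - X (\<tau> 0) x) -` A 0 \<inter> space M = {x\<in>space M. P (X T x)}"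
      using X_zero by (auto simp: \<tau>_def A_def)
    have 1: "(\<lambda>x. X (\<tau> (Suc 1)) x - X (\<tau> 1) x) -` A 1 \<inter> space M = {x\<in>space M. Q (Y x)}"
      by (auto simp: \<tau>_def A_def Y_def)
    have "{x\<in>space M. P (X T x)} \<inter> {x\<in>space M. Q (Y x)} = {x\<in>space M. P (X T x) \<and> Q (Y x)}" by auto
    then show ?thesis using * unfolding two by (simp only: INT_insert INT_empty Int_UNIV_right 0 1) (simp add: 0 1[simplified])
  qed
  have q: "(\<E> x. \<phi> (X s x) * \<phi>' (X t x)) = (\<E> x. \<phi> (X 1 x) * \<phi>' (X 1 x)) * min s t" if "s \<ge> 0" "t \<ge> 0"
    for \<phi> \<phi>' :: "('w \<times> 'c) \<Rightarrow>\<^sub>L real" and s t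
  proof -
    obtain v a where v: "\<And>t x. \<phi> (X t x) = lf v a t x" using functional_lf by blast
    obtain v' a' where v': "\<And>t x. \<phi>' (X t x) = lf v' a' t x" using functional_lf by blast
    show ?thesis unfolding v v' using that by (simp add: lf_cov)
  qed
  have L: "L2 M (\<lambda>x. \<phi> (X t x))" if "t \<ge> 0" for \<phi> :: "('w \<times> 'c) \<Rightarrow>\<^sub>L real" and t
    using functional_V0[OF that] gaussian_familyD(3)[OF gaussian_family_V0] by blast
  define Q where "Q \<phi> = (\<E> x. (\<phi> (X 1 x))\<^sup>2)" for \<phi> :: "('w \<times> 'c) \<Rightarrow>\<^sub>L real"
  \<comment> \<open>The hypotheses give covariances at fixed times, so the variable is rewritten
    through X T and X (2 T). The outcome depends on the two functionals only through Q \<phi> + Q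
    \<phi>', which a rotation preserves by the parallelogram identity.\<close>
  have var: "(\<E> x. (\<phi> (X T x) + \<phi>' (Y x))\<^sup>2) = T * (Q \<phi> + Q \<phi>')" for \<phi> \<phi>' :: "('w \<times> 'c) \<Rightarrow>\<^sub>L real"
  proof -
    define a b where "a x = \<phi> (X T x) - \<phi>' (X T x)" and "b x = \<phi>' (X (2 * T) x)" for x
    have a_eq: "a x = (\<phi> - \<phi>') (X T x)" for x by (simp add: a_def blinfun.diff_left)
    have La: "L2 M a" "L2 M b" unfolding a_eq[abs_def] b_def by (intro L T2)+
    have "(\<E> x. (\<phi> (X T x) + \<phi>' (Y x))\<^sup>2) = (\<E> x. ((a x)\<^sup>2 + 2 * (a x * b x)) + (b x)\<^sup>2)"
      by (intro Bochner_Integration.integral_cong)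
         (auto simp: a_def b_def Y_def blinfun.diff_right power2_eq_square algebra_simps)
    also have "\<dots> = (\<E> x. (a x)\<^sup>2) + 2 * (\<E> x. a x * b x) + (\<E> x. (b x)\<^sup>2)"
      unfolding Bochner_Integration.integral_add[OF Bochner_Integration.integrable_add[OF L2_integrable[OF La(1)]
            integrable_mult_right[OF L2_mult_integrable[OF La]]] L2_integrable[OF La(2)]]
          Bochner_Integration.integral_add[OF L2_integrable[OF La(1)] integrable_mult_right[OF L2_mult_integrable[OF La]]]
          integral_mult_right_zero ..
    also have "(\<E> x. (a x)\<^sup>2) = T * (\<E> x. ((\<phi> - \<phi>') (X 1 x))\<^sup>2)"
      unfolding a_eq power2_eq_square using q[OF T2(1) T2(1), of "\<phi> - \<phi>'" "\<phi> - \<phi>'"] by simp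
    also have "(\<E> x. a x * b x) = T * (\<E> x. (\<phi> - \<phi>') (X 1 x) * \<phi>' (X 1 x))"
      unfolding a_eq b_def using q[OF T2, of "\<phi> - \<phi>'" \<phi>'] T by (simp add: min_def)
    also have "(\<E> x. (b x)\<^sup>2) = 2 * T * (\<E> x. (\<phi>' (X 1 x))\<^sup>2)"
      unfolding b_def power2_eq_square using q[OF T2(2) T2(2), of \<phi>' \<phi>'] by simp
    finally have *: "(\<E> x. (\<phi> (X T x) + \<phi>' (Y x))\<^sup>2) = T * ((\<E> x. ((\<phi> - \<phi>') (X 1 x))\<^sup>2) +
       2 * (\<E> x. (\<phi> - \<phi>') (X 1 x) * \<phi>' (X 1 x)) + 2 * (\<E> x. (\<phi>' (X 1 x))\<^sup>2))" by (simp add: algebra_simps)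
    define c d where "c x = \<phi> (X 1 x)" and "d x = \<phi>' (X 1 x)" for x
    have Lc: "L2 M c" "L2 M d" unfolding c_def[abs_def] d_def[abs_def] by (intro L; simp)+
    have i: "integrable M (\<lambda>x. (c x)\<^sup>2)" "integrable M (\<lambda>x. (d x)\<^sup>2)" "integrable M (\<lambda>x. c x * d x)"
      using L2_integrable[OF Lc(1)] L2_integrable[OF Lc(2)] L2_mult_integrable[OF Lc] by auto
    have "(\<E> x. ((\<phi> - \<phi>') (X 1 x))\<^sup>2) = (\<E> x. ((c x)\<^sup>2 + (d x)\<^sup>2) - 2 * (c x * d x))"
      by (intro Bochner_Integration.integral_cong) (auto simp: c_def d_def blinfun.diff_left power2_eq_square algebra_simps)
    then have 1: "(\<E> x. ((\<phi> - \<phi>') (X 1 x))\<^sup>2) = (\<E> x. (c x)\<^sup>2) + (\<E> x. (d x)\<^sup>2) - 2 * (\<E> x. c x * d x)"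
      using i by simp
    have "(\<E> x. (\<phi> - \<phi>') (X 1 x) * \<phi>' (X 1 x)) = (\<E> x. c x * d x - (d x)\<^sup>2)"
      by (intro Bochner_Integration.integral_cong) (auto simp: c_def d_def blinfun.diff_left power2_eq_square algebra_simps)
    then have 2: "(\<E> x. (\<phi> - \<phi>') (X 1 x) * \<phi>' (X 1 x)) = (\<E> x. c x * d x) - (\<E> x. (d x)\<^sup>2)"
      using i by simp
    show ?thesis unfolding * 1 2 by (simp add: Q_def c_def d_def)
  qed
  have V0_lin: "(\<lambda>x. \<phi> (X T x) + \<phi>' (Y x)) \<in> V0" for \<phi> \<phi>' :: "('w \<times> 'c) \<Rightarrow>\<^sub>L real"
  proof -
    have "(\<lambda>x. \<phi> (X T x) + (\<phi>' (X (2 * T) x) - \<phi>' (X T x))) \<in> V0"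
      by (intro gaussian_family_add[OF gaussian_family_V0] gaussian_family_diff[OF gaussian_family_V0] functional_V0 T2)
    then show ?thesis by (simp add: Y_def blinfun.diff_right)
  qed
  have split: "\<phi> p = Blinfun (\<lambda>e. \<phi> (e, 0)) (fst p) + Blinfun (\<lambda>e. \<phi> (0, e)) (snd p)"
    for \<phi> :: "(('w \<times> 'c) \<times> ('w \<times> 'c)) \<Rightarrow>\<^sub>L real" and p
  proof -
    have b: "bounded_linear (\<lambda>e. \<phi> (e, 0))" "bounded_linear (\<lambda>e. \<phi> (0, e))"
      by (intro bounded_linear_compose[OF blinfun.bounded_linear_right] bounded_linear_Pair bounded_linear_ident bounded_linear_zero)+
    have "\<phi> p = \<phi> ((fst p, 0) + (0, snd p))" by simp
    also have "\<dots> = \<phi> (fst p, 0) + \<phi> (0, snd p)" by (rule blinfun.add_right)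
    finally show ?thesis by (simp add: bounded_linear_Blinfun_apply b)
  qed
  define r where "r = 1 / sqrt (2::real)"
  have r: "r * r = 1/2" by (simp add: r_def)
  define U where "U x = (r *\<^sub>R (X T x + Y x), r *\<^sub>R (X T x - Y x))" for x
  have law: "distr M borel (\<lambda>x. (X T x, Y x)) = distr M borel U"
  proof (rule gaussian_law_eq[OF gaussian_family_V0])
    fix \<phi> :: "(('w \<times> 'c) \<times> ('w \<times> 'c)) \<Rightarrow>\<^sub>L real"
    define a b where "a = Blinfun (\<lambda>e. \<phi> (e, 0))" and "b = Blinfun (\<lambda>e. \<phi> (0, e))"
    have sp: "\<phi> p = a (fst p) + b (snd p)" for p unfolding a_def b_def by (rule split)
    have U: "\<phi> (U x) = (r *\<^sub>R (a + b)) (X T x) + (r *\<^sub>R (a - b)) (Y x)" for x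
      unfolding sp U_def by (simp add: blinfun.add_left blinfun.add_right blinfun.diff_left blinfun.diff_right
          blinfun.scaleR_left blinfun.scaleR_right algebra_simps)
    show "(\<lambda>x. \<phi> (X T x, Y x)) \<in> V0" unfolding sp using V0_lin[of a b] by simp
    show "(\<lambda>x. \<phi> (U x)) \<in> V0" unfolding U by (rule V0_lin)
    have QR: "Q (r *\<^sub>R (a + b)) + Q (r *\<^sub>R (a - b)) = Q a + Q b"
    proof -
      have ia: "integrable M (\<lambda>x. (c (X 1 x))\<^sup>2)" for c :: "('w \<times> 'c) \<Rightarrow>\<^sub>L real" using L2_integrable[OF L[of 1 c]] by simp
      have "Q (r *\<^sub>R (a + b)) + Q (r *\<^sub>R (a - b)) = (\<E> x. ((r *\<^sub>R (a + b)) (X 1 x))\<^sup>2 + ((r *\<^sub>R (a - b)) (X 1 x))\<^sup>2)"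
        unfolding Q_def by (rule Bochner_Integration.integral_add[OF ia ia, symmetric])
      also have "\<dots> = (\<E> x. (a (X 1 x))\<^sup>2 + (b (X 1 x))\<^sup>2)"
      proof (intro Bochner_Integration.integral_cong refl)
        fix x
        have "(r * (s + t))\<^sup>2 + (r * (s - t))\<^sup>2 = s\<^sup>2 + t\<^sup>2" for s t :: real
        proof -
          have "(r * (s + t))\<^sup>2 + (r * (s - t))\<^sup>2 = (r * r) * (2 * (s\<^sup>2 + t\<^sup>2))" by (simp add: power2_eq_square algebra_simps)
          then show ?thesis unfolding r by simp
        qed
        then show "((r *\<^sub>R (a + b)) (X 1 x))\<^sup>2 + ((r *\<^sub>R (a - b)) (X 1 x))\<^sup>2 = (a (X 1 x))\<^sup>2 + (b (X 1 x))\<^sup>2"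
          by (simp add: blinfun.scaleR_left blinfun.add_left blinfun.diff_left)
      qed
      also have "\<dots> = Q a + Q b" unfolding Q_def by (rule Bochner_Integration.integral_add[OF ia ia])
      finally show ?thesis .
    qed
    have "(\<E> x. (\<phi> (U x))\<^sup>2) = T * (Q a + Q b)" unfolding U var QR ..
    moreover have "(\<E> x. (\<phi> (X T x, Y x))\<^sup>2) = T * (Q a + Q b)" unfolding sp fst_conv snd_conv var ..
    ultimately show "(\<E> x. (\<phi> (X T x, Y x))\<^sup>2) = (\<E> x. (\<phi> (U x))\<^sup>2)" by simp
  qed
  have lawY: "distr M borel (X T) = distr M borel Y"
  proof (rule gaussian_law_eq[OF gaussian_family_V0])
    fix \<phi> :: "('w \<times> 'c) \<Rightarrow>\<^sub>L real"
    have Q0: "Q 0 = 0" by (simp add: Q_def)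
    show "(\<lambda>x. \<phi> (X T x)) \<in> V0" using V0_lin[of \<phi> 0] by simp
    show "(\<lambda>x. \<phi> (Y x)) \<in> V0" using V0_lin[of 0 \<phi>] by simp
    show "(\<E> x. (\<phi> (X T x))\<^sup>2) = (\<E> x. (\<phi> (Y x))\<^sup>2)" using var[of \<phi> 0] var[of 0 \<phi>] by (simp add: Q0)
  qed
  have eqY: "prob {x\<in>space M. P (X T x)} = prob {x\<in>space M. P (Y x)}" if "{z. P z} \<in> sets borel" for P
  proof -
    have "measure (distr M borel (X T)) {z. P z} = measure (distr M borel Y) {z. P z}" by (simp add: lawY)
    then show ?thesis using that by (simp add: measure_distr vimage_def Int_def conj_commute)
  qed
  fix s t :: real assume s: "0 \<le> s"
  define c where "c = (t - s) / sqrt 2"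
  have b1: "{z :: 'w \<times> 'c. norm z \<le> s} \<in> sets borel" "{z :: 'w \<times> 'c. norm z > t} \<in> sets borel" "{z :: 'w \<times> 'c. norm z > c} \<in> sets borel"
    by measurable
  have Um[measurable]: "U \<in> borel_measurable M" unfolding U_def[abs_def] by (intro borel_measurable_Pair borel_measurable_scaleR) measurable
  have XYm: "(\<lambda>x. (X T x, Y x)) \<in> borel_measurable M" by (rule borel_measurable_Pair[OF Xm(1) Ym])
  have "open {p :: ('w \<times> 'c) \<times> ('w \<times> 'c). t < norm (fst p)}" "closed {p :: ('w \<times> 'c) \<times> ('w \<times> 'c). norm (snd p) \<le> s}"
    by (intro open_Collect_less closed_Collect_le continuous_intros)+
  then have "{p :: ('w \<times> 'c) \<times> ('w \<times> 'c). t < norm (fst p)} \<inter> {p. norm (snd p) \<le> s} \<in> sets borel"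
    by (intro sets.Int borel_open borel_closed)
  then have S: "{p :: ('w \<times> 'c) \<times> ('w \<times> 'c). t < norm (fst p) \<and> norm (snd p) \<le> s} \<in> sets borel"
    by (simp add: Collect_conj_eq)
  have "prob {x\<in>space M. norm (X T x) \<le> s} * prob {x\<in>space M. norm (X T x) > t}
      = prob {x\<in>space M. norm (X T x) > t \<and> norm (Y x) \<le> s}"
    using ind[OF b1(2) b1(1)] eqY[OF b1(1)] by (simp add: mult.commute)
  also have "\<dots> = measure (distr M borel (\<lambda>x. (X T x, Y x))) {p. norm (fst p) > t \<and> norm (snd p) \<le> s}"
    using measure_distr[OF XYm S] by (simp add: vimage_def Int_def conj_ac)
  also have "\<dots> = measure (distr M borel U) {p. norm (fst p) > t \<and> norm (snd p) \<le> s}" by (simp add: law)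
  also have "\<dots> = prob {x\<in>space M. norm (fst (U x)) > t \<and> norm (snd (U x)) \<le> s}"
    using measure_distr[OF Um S] by (simp add: vimage_def Int_def conj_ac)
  also have "\<dots> \<le> prob {x\<in>space M. norm (X T x) > c \<and> norm (Y x) > c}"
  proof (rule finite_measure_mono)
    \<comment> \<open>Sum and difference of the components of U are sqrt 2 times X T and sqrt 2
      times Y; both have norm larger than t - s by the triangle inequality.\<close>
    show "{x\<in>space M. norm (fst (U x)) > t \<and> norm (snd (U x)) \<le> s} \<subseteq> {x\<in>space M. norm (X T x) > c \<and> norm (Y x) > c}"
    proof safe
      fix x assume 1: "t < norm (fst (U x))" and 2: "norm (snd (U x)) \<le> s"
      have s2: "sqrt 2 * c = t - s" by (simp add: c_def)
      have "fst (U x) + snd (U x) = (r * 2) *\<^sub>R X T x" unfolding scaleR_scaleR[symmetric] scaleR_2 by (simp add: U_def scaleR_add_right[symmetric])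
      moreover have "r * 2 = sqrt 2" by (simp add: r_def real_div_sqrt)
      ultimately have "norm (fst (U x) + snd (U x)) = sqrt 2 * norm (X T x)" by simp
      moreover have "norm (fst (U x)) - norm (snd (U x)) \<le> norm (fst (U x) + snd (U x))" by (rule norm_diff_ineq)
      ultimately have "sqrt 2 * c < sqrt 2 * norm (X T x)" using 1 2 s2 by linarith
      then show "c < norm (X T x)" by simp
      have "fst (U x) - snd (U x) = (r * 2) *\<^sub>R Y x" unfolding scaleR_scaleR[symmetric] scaleR_2 by (simp add: U_def scaleR_diff_right[symmetric])
      then have "norm (fst (U x) - snd (U x)) = sqrt 2 * norm (Y x)" using \<open>r * 2 = sqrt 2\<close> by simp
      moreover have "norm (fst (U x)) - norm (snd (U x)) \<le> norm (fst (U x) - snd (U x))" by (rule norm_triangle_ineq2)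
      ultimately have "sqrt 2 * c < sqrt 2 * norm (Y x)" using 1 2 s2 by linarith
      then show "c < norm (Y x)" by simp
    qed
  qed measurable
  also have "\<dots> = (prob {x\<in>space M. norm (X T x) > c})\<^sup>2"
    using ind[OF b1(3) b1(3)] eqY[OF b1(3)] by (simp add: power2_eq_square)
  finally show "prob {x\<in>space M. norm (X T x) \<le> s} * prob {x\<in>space M. norm (X T x) > t}
      \<le> (prob {x\<in>space M. norm (X T x) > (t - s) / sqrt 2})\<^sup>2" by (simp add: c_def)
qed simp

end

subsection \<open>Elementary stochastic integrals\<close>

lemma (in prob_space) gaussian_moments:
  assumes V: "gaussian_family M V" and Z: "Z \<in> V"
  shows "(\<E> x. (Z x) ^ i) = sqrt (\<E> x. (Z x)\<^sup>2) ^ i * (\<integral>y. y ^ i \<partial>std_normal_distribution)"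
proof -
  have L: "L2 M Z" using gaussian_familyD(3)[OF V Z] .
  then have [measurable]: "Z \<in> borel_measurable M" by (simp add: L2_def)
  interpret N: prob_space std_normal_distribution by (rule prob_space_normal_density) simp
  define s where "s = (\<E> x. (Z x)\<^sup>2)"
  show ?thesis
  proof (cases "s = 0")
    case True
    then have "AE x in M. (Z x)\<^sup>2 = 0"
      unfolding s_def using integral_nonneg_eq_0_iff_AE[OF L2_integrable[OF L]] by simp
    then have "AE x in M. (Z x) ^ i = 0 ^ i" by eventually_elim simp
    then have "(\<E> x. (Z x) ^ i) = (\<E> x. 0 ^ i)" by (intro integral_cong_AE) auto
    also have "\<dots> = 0 ^ i" by (simp add: prob_space)
    finally show ?thesis using True N.prob_space by (cases "i = 0") (simp_all add: s_def[symmetric])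
  next
    case False
    then have s: "s > 0" unfolding s_def by (simp add: order_less_le)
    define Y where "Y x = (1 / sqrt s) * Z x" for x
    have Y: "Y \<in> V" unfolding Y_def[abs_def] by (rule gaussian_family_cmult[OF V Z])
    have [measurable]: "Y \<in> borel_measurable M" unfolding Y_def by measurable
    have "(\<E> x. (Y x)\<^sup>2) = 1" unfolding Y_def using s by (simp add: power_mult_distrib s_def power_divide)
    note law = gaussian_std_law[OF V Y this]
    have "(\<E> x. (Z x) ^ i) = (\<E> x. sqrt s ^ i * (Y x) ^ i)"
      using s by (simp add: Y_def power_mult_distrib power_divide)
    also have "\<dots> = sqrt s ^ i * (\<E> x. (Y x) ^ i)" by simp
    also have "(\<E> x. (Y x) ^ i) = (\<integral>y. y ^ i \<partial>distr M borel Y)"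
      by (rule integral_distr[symmetric]) auto
    finally show ?thesis unfolding law s_def .
  qed
qed

lemma std_normal_odd_moment:
  assumes "odd i"
  shows "(\<integral>y. y ^ i \<partial>std_normal_distribution) = 0"
proof -
  obtain k where "i = 2 * k + 1" using assms by (elim oddE)
  then show ?thesis using integral_std_normal_moment_odd[of k]
    by (subst integral_density) (auto simp: mult.commute)
qed

section \<open>Filtration, independent increments and elementary stochastic integrals\<close>

context wiener_bm
begin

abbreviation \<F> :: "real \<Rightarrow> 's measure" where "\<F> \<equiv> natural_filtration M X"

lemma space_filtration[simp]: "space (\<F> a) = space M"
  unfolding natural_filtration_def by (rule space_measure_of) auto

lemma sets_F: "sets (\<F> a) = sigma_sets (space M) {X r -` A \<inter> space M | r A. r \<in> {0..a} \<and> A \<in> sets borel}"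
  unfolding natural_filtration_def by (rule sets_measure_of) auto

lemma F_mono:
  assumes "a \<le> b" shows "sets (\<F> a) \<subseteq> sets (\<F> b)"
proof -
  have "{0..a} \<subseteq> {0..b}" using assms by auto
  then show ?thesis unfolding sets_F by (intro sigma_sets_mono') blast
qed

lemma measurable_F_mono: "Y \<in> borel_measurable (\<F> a) \<Longrightarrow> a \<le> b \<Longrightarrow> Y \<in> borel_measurable (\<F> b)"
  using F_mono[of a b] by (auto simp: measurable_def)

lemma X_measurable_F: "0 \<le> r \<Longrightarrow> r \<le> a \<Longrightarrow> X r \<in> borel_measurable (\<F> a)"
  by (rule measurableI) (auto simp: sets_F)

lemma lf_measurable_F:
  assumes "0 \<le> r" "r \<le> a"
  shows "lf v c r \<in> borel_measurable (\<F> a)"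
proof -
  obtain \<phi> :: "('w \<times> 'c) \<Rightarrow>\<^sub>L real" where \<phi>: "\<And>t x. \<phi> (X t x) = lf v c t x" using lf_functional by blast
  have "blinfun_apply \<phi> \<in> borel_measurable borel"
    by (intro borel_measurable_continuous_onI linear_continuous_on blinfun.bounded_linear_right)
  from measurable_compose[OF X_measurable_F[OF assms] this] show ?thesis unfolding \<phi> .
qed

lemma measurable_from_F:
  assumes "a \<ge> 0" "Y \<in> measurable (\<F> a) N"
  shows "Y \<in> measurable M N"
proof -
  have "sets (\<F> a) \<subseteq> sets M" unfolding sets_F
    by (rule sets.sigma_sets_subset) (auto intro: measurable_sets[OF X_measurable])
  then show ?thesis using assms(2) by (auto simp: measurable_def)
qed

definition dB :: "('w \<Rightarrow>\<^sub>L real) \<Rightarrow> real \<Rightarrow> real \<Rightarrow> 's \<Rightarrow> real" where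
  "dB u s t x = lf u 0 t x - lf u 0 s x"

lemma dB_eq: "dB u s t x = u (B t x - B s x)"
  by (simp add: dB_def lf_def blinfun.diff_right)

lemma dB_V: "0 \<le> s \<Longrightarrow> 0 \<le> t \<Longrightarrow> dB u s t \<in> V"
  unfolding dB_def[abs_def] by (intro gaussian_family_diff[OF gaussian_family_V] lf_V)

lemma dB_variance:
  assumes "0 \<le> s" "s \<le> t"
  shows "(\<E> x. (dB u s t x)\<^sup>2) = (norm (rep u))\<^sup>2 * (t - s)"
proof -
  have t: "0 \<le> t" using assms by simp
  note L = lf_L2[OF t, of u 0] lf_L2[OF assms(1), of u 0]
  have "(\<E> x. (dB u s t x)\<^sup>2) = (\<E> x. (lf u 0 t x * lf u 0 t x - 2 * (lf u 0 s x * lf u 0 t x)) + lf u 0 s x * lf u 0 s x)"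
    by (intro Bochner_Integration.integral_cong) (auto simp: dB_def power2_eq_square algebra_simps)
  also have "\<dots> = (\<E> x. lf u 0 t x * lf u 0 t x) - 2 * (\<E> x. lf u 0 s x * lf u 0 t x) + (\<E> x. lf u 0 s x * lf u 0 s x)"
    using L2_mult_integrable[OF L(1) L(1)] L2_mult_integrable[OF L(2) L(1)] L2_mult_integrable[OF L(2) L(2)] by simp
  also have "\<dots> = (norm (rep u))\<^sup>2 * (t - s)"
    using assms t by (simp add: lf_cov power2_norm_eq_inner algebra_simps)
  finally show ?thesis .
qed

text \<open>The independence result for Gaussian families concerns real variables; this passes from
  the Banach-valued past to the scalar functionals that generate it.\<close>

lemma F_subset_gen:
  "sets (\<F> a) \<subseteq> sets (gen_sigma M {(\<lambda>x. blinfun_apply \<phi> (X r x)) | (\<phi> :: ('w \<times> 'c) \<Rightarrow>\<^sub>L real) r. 0 \<le> r \<and> r \<le> a})"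
  (is "_ \<subseteq> sets (gen_sigma M ?S)")
proof -
  have "X r \<in> borel_measurable (gen_sigma M ?S)" if "0 \<le> r" "r \<le> a" for r
    by (rule borel_measurable_if_functionals, rule measurable_gen_sigma, rule CollectI, intro exI conjI, rule refl)
       (use that in auto)
  note m = this
  have "{X r -` A \<inter> space M | r A. r \<in> {0..a} \<and> A \<in> sets borel} \<subseteq> sets (gen_sigma M ?S)"
  proof
    fix Y assume "Y \<in> {X r -` A \<inter> space M | r A. r \<in> {0..a} \<and> A \<in> sets borel}"
    then obtain r A where "Y = X r -` A \<inter> space M" "0 \<le> r" "r \<le> a" "A \<in> sets borel" by auto
    then show "Y \<in> sets (gen_sigma M ?S)" using measurable_sets[OF m, of r A] by simp
  qed
  then have "sigma_sets (space (gen_sigma M ?S)) {X r -` A \<inter> space M | r A. r \<in> {0..a} \<and> A \<in> sets borel} \<subseteq> sets (gen_sigma M ?S)"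
    by (rule sets.sigma_sets_subset)
  then show ?thesis unfolding sets_F by simp
qed

text \<open>The increment is orthogonal to every functional of the past because the covariance is
  proportional to the minimum of the times; for Gaussian families this is independence.\<close>

lemma increment_indep:
  assumes a: "0 \<le> a" "a \<le> s" "s \<le> t" and Y: "Y \<in> borel_measurable (\<F> a)"
  shows "indep_var borel (dB u s t) borel Y"
proof -
  define S where "S = {(\<lambda>x. blinfun_apply \<phi> (X r x)) | (\<phi> :: ('w \<times> 'c) \<Rightarrow>\<^sub>L real) r. 0 \<le> r \<and> r \<le> a}"
  have dV0: "dB u s t \<in> V0" unfolding dB_def[abs_def]
    using a by (intro gaussian_family_diff[OF gaussian_family_V0] lf_V0) auto
  have ind: "indep_set (sigma_sets (space M) {dB u s t -` A \<inter> space M | A. A \<in> sets borel}) (sets (gen_sigma M S))"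
  proof (rule gaussian_orthogonal_indep[OF gaussian_family_V0 dV0])
    show "S \<subseteq> V0" unfolding S_def using functional_V0 by blast
    fix Z assume "Z \<in> S"
    then obtain \<phi> :: "('w \<times> 'c) \<Rightarrow>\<^sub>L real" and r where Z: "Z = (\<lambda>x. \<phi> (X r x))" and r: "0 \<le> r" "r \<le> a"
      unfolding S_def by blast
    obtain v c where v: "\<And>t x. \<phi> (X t x) = lf v c t x" using functional_lf by blast
    have st: "0 \<le> s" "0 \<le> t" using a by auto
    have "(\<E> x. dB u s t x * Z x) = (\<E> x. lf u 0 t x * lf v c r x - lf u 0 s x * lf v c r x)"
      unfolding Z v dB_def by (simp add: left_diff_distrib)
    also have "\<dots> = (\<E> x. lf u 0 t x * lf v c r x) - (\<E> x. lf u 0 s x * lf v c r x)"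
      by (intro Bochner_Integration.integral_diff L2_mult_integrable lf_L2 st r)
    also have "\<dots> = 0" using a r st by (simp add: lf_cov)
    finally show "(\<E> x. dB u s t x * Z x) = 0" .
  qed
  have YM: "Y \<in> borel_measurable M" using measurable_from_F[OF a(1) Y] .
  have dM: "dB u s t \<in> borel_measurable M" using dV0 gaussian_familyD(3)[OF gaussian_family_V0] by (auto simp: L2_def)
  have "sigma_sets (space M) {Y -` A \<inter> space M | A. A \<in> sets borel} \<subseteq> sets (\<F> a)"
    using sets.sigma_sets_subset[of "{Y -` A \<inter> space M | A. A \<in> sets borel}" "\<F> a"] measurable_sets[OF Y] by auto
  also have "\<dots> \<subseteq> sets (gen_sigma M S)" unfolding S_def by (rule F_subset_gen)
  finally have sub: "sigma_sets (space M) {Y -` A \<inter> space M | A. A \<in> sets borel} \<subseteq> sets (gen_sigma M S)" .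
  have "indep_set (sigma_sets (space M) {dB u s t -` A \<inter> space M | A. A \<in> sets borel}) (sigma_sets (space M) {Y -` A \<inter> space M | A. A \<in> sets borel})"
    unfolding indep_set_def
    by (rule indep_sets_mono_sets[OF ind[unfolded indep_set_def]]) (use sub in \<open>auto split: bool.split\<close>)
  then show ?thesis unfolding indep_var_eq using dM YM by blast
qed

lemma increment_moment:
  assumes a: "0 \<le> a" "a \<le> s" "s \<le> t" and Y: "Y \<in> borel_measurable (\<F> a)" "in_all_Lp M Y"
  shows "(\<E> x. Y x * (dB u s t x) ^ i) = (\<E> x. Y x) * (\<E> x. (dB u s t x) ^ i)"
proof -
  have "indep_var borel ((\<lambda>y. y ^ i) \<circ> dB u s t) borel ((\<lambda>y. y) \<circ> Y)"
    by (rule indep_var_compose[OF increment_indep[OF a Y(1)]]) auto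
  then have ind: "indep_var borel (\<lambda>x. (dB u s t x) ^ i) borel Y" by (simp add: o_def)
  have "in_all_Lp M (\<lambda>x. (dB u s t x) ^ i)"
    using a by (intro in_all_Lp_power gaussian_in_all_Lp[OF gaussian_family_V] dB_V) auto
  from indep_var_lebesgue_integral[OF ind in_all_LpD(3)[OF this] in_all_LpD(3)[OF Y(2)]]
  show ?thesis by (simp add: mult.commute)
qed

lemma dB_in_all_Lp: "0 \<le> s \<Longrightarrow> 0 \<le> t \<Longrightarrow> in_all_Lp M (dB u s t)"
  by (intro gaussian_in_all_Lp[OF gaussian_family_V] dB_V)

lemma dB_measurable_F: "0 \<le> s \<Longrightarrow> s \<le> t \<Longrightarrow> t \<le> a \<Longrightarrow> dB u s t \<in> borel_measurable (\<F> a)"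
  unfolding dB_def[abs_def] by (intro borel_measurable_diff lf_measurable_F) auto

lemma increment_zero_mean:
  assumes a: "0 \<le> s" "s \<le> t" and Y: "Y \<in> borel_measurable (\<F> s)" "in_all_Lp M Y"
  shows "(\<E> x. Y x * dB u s t x) = 0"
proof -
  have "0 \<le> t" using a by simp
  from gaussian_moments[OF gaussian_family_V dB_V[OF a(1) this], of u 1]
  have "(\<E> x. (dB u s t x) ^ 1) = 0" using std_normal_odd_moment[of 1] by simp
  then show ?thesis using increment_moment[OF a(1) order_refl a(2) Y, of u 1] by simp
qed

text \<open>Any product in which one increment lies after all other factors has mean zero. Splitting
  both increments at the ends of the overlap leaves only the square over the overlap, whose mean is
  proportional to its length.\<close>

lemma elementary_covariance_ordered:
  assumes i: "0 \<le> a" "a \<le> b" "\<eta> \<in> borel_measurable (\<F> a)" "in_all_Lp M \<eta>"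
    and j: "a \<le> a'" "a' \<le> b'" "\<eta>' \<in> borel_measurable (\<F> a')" "in_all_Lp M \<eta>'"
  shows "(\<E> x. (\<eta> x * dB u a b x) * (\<eta>' x * dB u a' b' x))
    = (norm (rep u))\<^sup>2 * measure lborel ({a<..b} \<inter> {a'<..b'}) * (\<E> x. \<eta> x * \<eta>' x)"
proof -
  have a': "0 \<le> a'" "0 \<le> b" "0 \<le> b'" using i j by auto
  have \<eta>a': "\<eta> \<in> borel_measurable (\<F> a')" using measurable_F_mono[OF i(3) j(1)] .
  show ?thesis
  proof (cases "b \<le> a'")
    case True
    have "(\<E> x. (\<eta> x * dB u a b x * \<eta>' x) * dB u a' b' x) = 0"
      by (intro increment_zero_mean a' j(2) borel_measurable_times in_all_Lp_mult \<eta>a' j(3,4) i(4) dB_in_all_Lp dB_measurable_F i(1,2) True)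
    moreover have "(\<lambda>x. (\<eta> x * dB u a b x) * (\<eta>' x * dB u a' b' x)) = (\<lambda>x. (\<eta> x * dB u a b x * \<eta>' x) * dB u a' b' x)"
      by (simp only: mult.assoc)
    moreover have "{a<..b} \<inter> {a'<..b'} = {}" using True by auto
    ultimately show ?thesis by (simp only: measure_empty mult_zero_left mult_zero_right)
  next
    case False
    then have ab: "a' \<le> b" by simp
    \<comment> \<open>The overlap is the interval from a' to m. The piece from m to m' belongs to
      whichever interval ends later, so both cases share one formula.\<close>
    define m where "m = min b b'"
    define m' where "m' = max b b'"
    have m: "a' \<le> m" "m \<le> m'" "0 \<le> m" "0 \<le> m'" using ab j(2) a' by (auto simp: m_def m'_def)
    have s1: "dB u a b x = dB u a a' x + dB u a' b x" for x by (simp add: dB_def)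
    have s2: "dB u a' b x * dB u a' b' x = (dB u a' m x)\<^sup>2 + dB u a' m x * dB u m m' x" for x
      by (cases "b \<le> b'") (auto simp: m_def m'_def dB_def power2_eq_square algebra_simps)
    have Z1: "(\<E> x. (\<eta> x * dB u a a' x * \<eta>' x) * dB u a' b' x) = 0"
      by (intro increment_zero_mean a' j(2) borel_measurable_times in_all_Lp_mult \<eta>a' j(3,4) i(4) dB_in_all_Lp dB_measurable_F i(1) j(1) order_refl)
    have Z2: "(\<E> x. (\<eta> x * \<eta>' x * dB u a' m x) * dB u m m' x) = 0"
      by (intro increment_zero_mean m borel_measurable_times in_all_Lp_mult i(4) j(4) dB_in_all_Lp dB_measurable_F a' order_refl
          measurable_F_mono[OF \<eta>a' m(1)] measurable_F_mono[OF j(3) m(1)])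
    have Z3: "(\<E> x. (\<eta> x * \<eta>' x) * (dB u a' m x)\<^sup>2) = (\<E> x. \<eta> x * \<eta>' x) * ((norm (rep u))\<^sup>2 * (m - a'))"
      unfolding dB_variance[OF a'(1) m(1), symmetric]
      by (intro increment_moment[OF a'(1) order_refl m(1)] borel_measurable_times in_all_Lp_mult \<eta>a' j(3,4) i(4))
    have "(\<E> x. (\<eta> x * dB u a b x) * (\<eta>' x * dB u a' b' x)) =
      (\<E> x. ((\<eta> x * dB u a a' x * \<eta>' x) * dB u a' b' x + (\<eta> x * \<eta>' x * dB u a' m x) * dB u m m' x) + (\<eta> x * \<eta>' x) * (dB u a' m x)\<^sup>2)"
    proof (intro Bochner_Integration.integral_cong refl)
      fix x
      have "(\<eta> x * dB u a b x) * (\<eta>' x * dB u a' b' x) = \<eta> x * \<eta>' x * (dB u a a' x * dB u a' b' x) + \<eta> x * \<eta>' x * (dB u a' b x * dB u a' b' x)"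
        unfolding s1 by (simp add: algebra_simps)
      then show "(\<eta> x * dB u a b x) * (\<eta>' x * dB u a' b' x) =
         ((\<eta> x * dB u a a' x * \<eta>' x) * dB u a' b' x + (\<eta> x * \<eta>' x * dB u a' m x) * dB u m m' x) + (\<eta> x * \<eta>' x) * (dB u a' m x)\<^sup>2"
        unfolding s2 by (simp add: algebra_simps)
    qed
    also have "\<dots> = (\<E> x. (\<eta> x * dB u a a' x * \<eta>' x) * dB u a' b' x) + (\<E> x. (\<eta> x * \<eta>' x * dB u a' m x) * dB u m m' x)
        + (\<E> x. (\<eta> x * \<eta>' x) * (dB u a' m x)\<^sup>2)"
    proof -
      have 1: "integrable M (\<lambda>x. (\<eta> x * dB u a a' x * \<eta>' x) * dB u a' b' x)"
        by (intro in_all_LpD(3) in_all_Lp_mult i(4) j(4) dB_in_all_Lp i(1) a')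
      have 2: "integrable M (\<lambda>x. (\<eta> x * \<eta>' x * dB u a' m x) * dB u m m' x)"
        by (intro in_all_LpD(3) in_all_Lp_mult i(4) j(4) dB_in_all_Lp m a')
      have 3: "integrable M (\<lambda>x. (\<eta> x * \<eta>' x) * (dB u a' m x)\<^sup>2)"
        by (intro in_all_LpD(3) in_all_Lp_mult in_all_Lp_power i(4) j(4) dB_in_all_Lp m a')
      show ?thesis unfolding Bochner_Integration.integral_add[OF Bochner_Integration.integrable_add[OF 1 2] 3]
          Bochner_Integration.integral_add[OF 1 2] ..
    qed
    also have "\<dots> = (norm (rep u))\<^sup>2 * (m - a') * (\<E> x. \<eta> x * \<eta>' x)" unfolding Z1 Z2 Z3 by simp
    also have "{a<..b} \<inter> {a'<..b'} = {a'<..m}" using j(1) by (auto simp: m_def)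
    then have "m - a' = measure lborel ({a<..b} \<inter> {a'<..b'})" using m by simp
    finally show ?thesis .
  qed
qed

lemma elementary_covariance:
  assumes i: "0 \<le> a" "a \<le> b" "\<eta> \<in> borel_measurable (\<F> a)" "in_all_Lp M \<eta>"
    and j: "0 \<le> a'" "a' \<le> b'" "\<eta>' \<in> borel_measurable (\<F> a')" "in_all_Lp M \<eta>'"
  shows "(\<E> x. (\<eta> x * dB u a b x) * (\<eta>' x * dB u a' b' x))
    = (norm (rep u))\<^sup>2 * measure lborel ({a<..b} \<inter> {a'<..b'}) * (\<E> x. \<eta> x * \<eta>' x)"
proof (cases "a \<le> a'")
  case True
  show ?thesis by (rule elementary_covariance_ordered[OF i True j(2-4)])
next
  case False
  then have "a' \<le> a" by simp
  note sym = elementary_covariance_ordered[OF j this i(2-4), of u]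
  have "(\<lambda>x. (\<eta> x * dB u a b x) * (\<eta>' x * dB u a' b' x)) = (\<lambda>x. (\<eta>' x * dB u a' b' x) * (\<eta> x * dB u a b x))"
    "(\<lambda>x. \<eta> x * \<eta>' x) = (\<lambda>x. \<eta>' x * \<eta> x)" by (intro ext mult.commute)+
  then show ?thesis unfolding Int_commute[of "{a<..b}"] using sym by (simp only:)
qed

text \<open>The Ito isometry for arbitrary, possibly overlapping intervals. Two step processes on
  unrelated partitions can thus be subtracted without a common refinement; the overlaps are
  accounted for by the covariance formula.\<close>

lemma elementary_isometry:
  fixes a b :: "'i \<Rightarrow> real" and \<eta> :: "'i \<Rightarrow> 's \<Rightarrow> real"
  assumes K: "finite K" and a: "\<And>i. i \<in> K \<Longrightarrow> 0 \<le> a i" "\<And>i. i \<in> K \<Longrightarrow> a i \<le> b i"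
    and \<eta>: "\<And>i. i \<in> K \<Longrightarrow> \<eta> i \<in> borel_measurable (\<F> (a i))" "\<And>i. i \<in> K \<Longrightarrow> in_all_Lp M (\<eta> i)"
  shows "ennreal (\<E> x. (\<Sum>i\<in>K. \<eta> i x * dB u (a i) (b i) x)\<^sup>2)
    = ennreal ((norm (rep u))\<^sup>2) * (\<integral>\<^sup>+x. \<integral>\<^sup>+s. ennreal ((\<Sum>i\<in>K. indicator {a i<..b i} s * \<eta> i x)\<^sup>2) \<partial>lborel \<partial>M)"
proof -
  define len where "len i j = measure lborel ({a i<..b i} \<inter> {a j<..b j})" for i j
  have b: "0 \<le> b i" if "i \<in> K" for i using a[OF that] by simp
  have \<eta>ij: "integrable M (\<lambda>x. \<eta> i x * \<eta> j x)" if "i \<in> K" "j \<in> K" for i j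
    by (intro in_all_LpD(3) in_all_Lp_mult \<eta>(2) that)
  have "(\<E> x. (\<Sum>i\<in>K. \<eta> i x * dB u (a i) (b i) x)\<^sup>2)
     = (\<E> x. (\<Sum>i\<in>K. \<Sum>j\<in>K. (\<eta> i x * dB u (a i) (b i) x) * (\<eta> j x * dB u (a j) (b j) x)))"
    unfolding power2_eq_square sum_product ..
  also have "\<dots> = (\<Sum>i\<in>K. \<Sum>j\<in>K. (\<E> x. (\<eta> i x * dB u (a i) (b i) x) * (\<eta> j x * dB u (a j) (b j) x)))"
  proof (subst Bochner_Integration.integral_sum)
    fix i assume i: "i \<in> K"
    show "integrable M (\<lambda>x. \<Sum>j\<in>K. (\<eta> i x * dB u (a i) (b i) x) * (\<eta> j x * dB u (a j) (b j) x))"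
      by (intro in_all_LpD(3) in_all_Lp_sum in_all_Lp_mult \<eta>(2) dB_in_all_Lp a(1) b i)
  next
    show "(\<Sum>i\<in>K. \<E> x. (\<Sum>j\<in>K. (\<eta> i x * dB u (a i) (b i) x) * (\<eta> j x * dB u (a j) (b j) x))) =
       (\<Sum>i\<in>K. \<Sum>j\<in>K. \<E> x. (\<eta> i x * dB u (a i) (b i) x) * (\<eta> j x * dB u (a j) (b j) x))"
      by (intro sum.cong refl Bochner_Integration.integral_sum in_all_LpD(3) in_all_Lp_mult \<eta>(2) dB_in_all_Lp a(1) b)
  qed
  also have "\<dots> = (\<Sum>i\<in>K. \<Sum>j\<in>K. (norm (rep u))\<^sup>2 * len i j * (\<E> x. \<eta> i x * \<eta> j x))"
    unfolding len_def by (intro sum.cong refl elementary_covariance a \<eta>)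
  also have "\<dots> = (norm (rep u))\<^sup>2 * (\<Sum>i\<in>K. \<Sum>j\<in>K. len i j * (\<E> x. \<eta> i x * \<eta> j x))"
    by (simp add: sum_distrib_left mult.assoc)
  finally have L: "(\<E> x. (\<Sum>i\<in>K. \<eta> i x * dB u (a i) (b i) x)\<^sup>2) = (norm (rep u))\<^sup>2 * (\<Sum>i\<in>K. \<Sum>j\<in>K. len i j * (\<E> x. \<eta> i x * \<eta> j x))" .
  define E where "E x = (\<Sum>i\<in>K. \<Sum>j\<in>K. len i j * (\<eta> i x * \<eta> j x))" for x
  have inner: "(\<integral>\<^sup>+s. ennreal ((\<Sum>i\<in>K. indicator {a i<..b i} s * \<eta> i x)\<^sup>2) \<partial>lborel) = ennreal (E x) \<and> 0 \<le> E x" for x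
  proof -
    have eq: "(\<Sum>i\<in>K. indicator {a i<..b i} s * \<eta> i x)\<^sup>2
        = (\<Sum>i\<in>K. \<Sum>j\<in>K. indicator ({a i<..b i} \<inter> {a j<..b j}) s * (\<eta> i x * \<eta> j x))" for s
      unfolding power2_eq_square sum_product by (intro sum.cong refl) (simp add: indicator_inter_arith del: Int_greaterThanAtMost)
    have fin: "emeasure lborel ({a i<..b i} \<inter> {a j<..b j}) < \<infinity>" for i j
      by (rule le_less_trans[OF emeasure_mono[of _ "{a i..b i}"]]) (auto simp: emeasure_lborel_Icc_eq)
    have ii: "integrable lborel (\<lambda>s. indicator ({a i<..b i} \<inter> {a j<..b j}) s * (\<eta> i x * \<eta> j x))" for i j
      using fin[of i j] by (intro integrable_mult_left integrable_real_indicator) auto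
    have int: "integrable lborel (\<lambda>s. \<Sum>i\<in>K. \<Sum>j\<in>K. indicator ({a i<..b i} \<inter> {a j<..b j}) s * (\<eta> i x * \<eta> j x))"
      by (intro Bochner_Integration.integrable_sum ii)
    have val: "(\<integral>s. (\<Sum>i\<in>K. indicator {a i<..b i} s * \<eta> i x)\<^sup>2 \<partial>lborel) = E x"
      unfolding eq E_def len_def
      by (simp only: Bochner_Integration.integral_sum[OF Bochner_Integration.integrable_sum[OF ii]] Bochner_Integration.integral_sum[OF ii])
         (simp add: mult.commute)
    have "(\<integral>\<^sup>+s. ennreal ((\<Sum>i\<in>K. indicator {a i<..b i} s * \<eta> i x)\<^sup>2) \<partial>lborel) = ennreal (\<integral>s. (\<Sum>i\<in>K. indicator {a i<..b i} s * \<eta> i x)\<^sup>2 \<partial>lborel)"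
      using int unfolding eq[symmetric] by (intro nn_integral_eq_integral) auto
    moreover have "0 \<le> (\<integral>s. (\<Sum>i\<in>K. indicator {a i<..b i} s * \<eta> i x)\<^sup>2 \<partial>lborel)" by simp
    ultimately show ?thesis unfolding val by simp
  qed
  have Ei: "integrable M E" unfolding E_def[abs_def]
    by (intro Bochner_Integration.integrable_sum integrable_mult_right \<eta>ij)
  have "(\<integral>\<^sup>+x. \<integral>\<^sup>+s. ennreal ((\<Sum>i\<in>K. indicator {a i<..b i} s * \<eta> i x)\<^sup>2) \<partial>lborel \<partial>M) = (\<integral>\<^sup>+x. ennreal (E x) \<partial>M)"
    using inner by simp
  also have "\<dots> = ennreal (\<E> x. E x)" using Ei inner by (intro nn_integral_eq_integral) auto
  also have "(\<E> x. E x) = (\<Sum>i\<in>K. \<Sum>j\<in>K. len i j * (\<E> x. \<eta> i x * \<eta> j x))"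
  proof -
    have "(\<E> x. E x) = (\<Sum>i\<in>K. \<E> x. (\<Sum>j\<in>K. len i j * (\<eta> i x * \<eta> j x)))" unfolding E_def
      by (intro Bochner_Integration.integral_sum Bochner_Integration.integrable_sum integrable_mult_right \<eta>ij)
    also have "\<dots> = (\<Sum>i\<in>K. \<Sum>j\<in>K. \<E> x. len i j * (\<eta> i x * \<eta> j x))"
      by (intro sum.cong refl Bochner_Integration.integral_sum integrable_mult_right \<eta>ij)
    finally show ?thesis by simp
  qed
  finally show ?thesis unfolding L by (simp add: ennreal_mult')
qed

text \<open>A discrete Gronwall argument. Expanding the power of S(n+1) binomially, the increment
  contributes nothing to first order because its mean is zero, and all higher terms are of the order
  of the mesh; the bound is therefore independent of N.\<close>

lemma martingale_moment_bound:
  fixes u v :: "'w \<Rightarrow>\<^sub>L real" and p :: nat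
  assumes T: "T > 0"
  shows "\<exists>C. \<forall>N>0. (\<E> x. (\<Sum>j<N. lf v 0 (real j * T / real N) x * dB u (real j * T / real N) (real (Suc j) * T / real N) x) ^ (2 * p)) \<le> C"
proof -
  define m where "m = 2 * p"
  define \<kappa> where "\<kappa> = (norm (rep u))\<^sup>2"
  define c where "c i = (\<integral>y. y ^ i \<partial>std_normal_distribution)" for i :: nat
  \<comment> \<open>A dominates the m-th moment of the integrand at every grid time, by scaling a
    standard normal moment.\<close>
  define A where "A = (sqrt ((norm (rep v))\<^sup>2 * T)) ^ m * \<bar>c m\<bar>"
  define Q where "Q = (\<Sum>i\<le>m. of_nat (m choose i) * (\<kappa> * (1 + \<kappa> * T) ^ m * \<bar>c i\<bar>))"
  have \<kappa>: "\<kappa> \<ge> 0" by (simp add: \<kappa>_def)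
  have A0: "A \<ge> 0" unfolding A_def using T by (intro mult_nonneg_nonneg zero_le_power real_sqrt_ge_zero) auto
  have Q0: "Q \<ge> 0" unfolding Q_def using \<kappa> T by (intro sum_nonneg mult_nonneg_nonneg zero_le_power) auto
  have "(\<E> x. (\<Sum>j<N. lf v 0 (real j * T / real N) x * dB u (real j * T / real N) (real (Suc j) * T / real N) x) ^ m) \<le> (1 + A) * exp (Q * T)"
    if N: "N > 0" for N
  proof -
    define \<delta> where "\<delta> = T / real N"
    define t where "t j = real j * T / real N" for j :: nat
    have \<delta>: "\<delta> > 0" "\<delta> \<le> T" using T N by (auto simp: \<delta>_def field_simps)
    have t0: "0 \<le> t j" for j using T by (simp add: t_def)
    have tS: "t (Suc j) = t j + \<delta>" for j by (simp add: t_def \<delta>_def add_divide_distrib distrib_right)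
    have tT: "t j \<le> T" if "j \<le> N" for j using that T N by (simp add: t_def pos_divide_le_eq mult.commute)
    define a where "a j = lf v 0 (t j)" for j
    define D where "D j = dB u (t j) (t (Suc j))" for j
    define S where "S n x = (\<Sum>j<n. a j x * D j x)" for n x
    have aL: "in_all_Lp M (a j)" for j unfolding a_def by (intro gaussian_in_all_Lp[OF gaussian_family_V] lf_V t0)
    have DL: "in_all_Lp M (D j)" for j unfolding D_def by (intro dB_in_all_Lp t0)
    have SL: "in_all_Lp M (S n)" for n unfolding S_def[abs_def] by (intro in_all_Lp_sum in_all_Lp_mult aL DL)
    have t_mono: "t i \<le> t j" if "i \<le> j" for i j
      unfolding t_def using that T by (intro divide_right_mono mult_right_mono) auto
    have aF: "a j \<in> borel_measurable (\<F> (t n))" if "j \<le> n" for j n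
      unfolding a_def by (intro lf_measurable_F t0 t_mono that)
    have SF: "S n \<in> borel_measurable (\<F> (t n))" for n unfolding S_def[abs_def] D_def
    proof (intro borel_measurable_sum borel_measurable_times)
      fix j assume "j \<in> {..<n}"
      then have "j \<le> n" "Suc j \<le> n" by auto
      then show "a j \<in> borel_measurable (\<F> (t n))" "dB u (t j) (t (Suc j)) \<in> borel_measurable (\<F> (t n))"
        by (auto intro!: aF dB_measurable_F t0 t_mono)
    qed
    have a_mom: "(\<E> x. (a j x) ^ m) \<le> A" if "j \<le> N" for j
    proof -
      have v: "(\<E> x. (lf v 0 (t j) x)\<^sup>2) = (norm (rep v))\<^sup>2 * t j"
        using t0 by (simp add: power2_eq_square[of "lf _ _ _ _"] lf_cov power2_norm_eq_inner)
      have "(\<E> x. (a j x) ^ m) = sqrt ((norm (rep v))\<^sup>2 * t j) ^ m * c m"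
        unfolding a_def c_def using gaussian_moments[OF gaussian_family_V lf_V[OF t0], of v 0 j m] v by simp
      also have "\<dots> \<le> sqrt ((norm (rep v))\<^sup>2 * t j) ^ m * \<bar>c m\<bar>"
        by (intro mult_left_mono zero_le_power real_sqrt_ge_zero mult_nonneg_nonneg t0) auto
      also have "\<dots> \<le> sqrt ((norm (rep v))\<^sup>2 * T) ^ m * \<bar>c m\<bar>"
        by (intro mult_right_mono power_mono real_sqrt_le_mono mult_left_mono tT[OF that] real_sqrt_ge_zero mult_nonneg_nonneg t0) auto
      finally show ?thesis by (simp add: A_def)
    qed
    \<comment> \<open>Odd moments vanish, and for even i \<ge> 2 two of the i factors sqrt (\<kappa>
      \<delta>) supply the power \<delta>, the others being bounded by 1 + \<kappa> T.\<close>
    have D_mom: "\<bar>\<E> x. (D j x) ^ i\<bar> \<le> \<delta> * (\<kappa> * (1 + \<kappa> * T) ^ m * \<bar>c i\<bar>)" if i: "1 \<le> i" "i \<le> m" for i j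
    proof -
      have var: "(\<E> x. (D j x)\<^sup>2) = \<kappa> * \<delta>"
        using dB_variance[OF t0 t_mono[of j "Suc j"], of u] by (simp add: D_def \<kappa>_def tS)
      have mom: "(\<E> x. (D j x) ^ i) = sqrt (\<kappa> * \<delta>) ^ i * c i"
        unfolding c_def var[symmetric] unfolding D_def by (rule gaussian_moments[OF gaussian_family_V dB_V[OF t0 t0]])
      show ?thesis
      proof (cases "odd i")
        case True
        then have "c i = 0" unfolding c_def by (rule std_normal_odd_moment)
        then show ?thesis unfolding mom using \<delta> \<kappa> T by simp
      next
        case False
        then have i2: "2 \<le> i" using i by (cases "i = 1") auto
        have kd: "0 \<le> \<kappa> * \<delta>" using \<kappa> \<delta> by simp
        have "sqrt (\<kappa> * \<delta>) \<le> 1 + \<kappa> * T"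
        proof -
          have "sqrt (\<kappa> * \<delta>) \<le> 1 + \<kappa> * \<delta>"
          proof (rule real_le_lsqrt)
            have "y \<le> (1 + y)\<^sup>2" if "0 \<le> y" for y :: real
            proof -
              have "(1 + y)\<^sup>2 = 1 + 2 * y + y * y" by (simp add: power2_eq_square algebra_simps)
              then show ?thesis using that mult_nonneg_nonneg[OF that that] by linarith
            qed
            then show "\<kappa> * \<delta> \<le> (1 + \<kappa> * \<delta>)\<^sup>2" using kd .
          qed (use kd in auto)
          also have "\<dots> \<le> 1 + \<kappa> * T" using \<kappa> \<delta> by (simp add: mult_left_mono)
          finally show ?thesis .
        qed
        then have "sqrt (\<kappa> * \<delta>) ^ (i - 2) \<le> (1 + \<kappa> * T) ^ (i - 2)" using kd by (intro power_mono) auto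
        also have "\<dots> \<le> (1 + \<kappa> * T) ^ m" using \<kappa> T i by (intro power_increasing) auto
        finally have pw: "sqrt (\<kappa> * \<delta>) ^ (i - 2) \<le> (1 + \<kappa> * T) ^ m" .
        have "sqrt (\<kappa> * \<delta>) ^ i = sqrt (\<kappa> * \<delta>) ^ 2 * sqrt (\<kappa> * \<delta>) ^ (i - 2)"
          by (simp only: power_add[symmetric] le_add_diff_inverse[OF i2])
        also have "\<dots> = \<kappa> * \<delta> * sqrt (\<kappa> * \<delta>) ^ (i - 2)" using kd by simp
        also have "\<dots> \<le> \<kappa> * \<delta> * (1 + \<kappa> * T) ^ m" using pw kd by (intro mult_left_mono)
        finally have "sqrt (\<kappa> * \<delta>) ^ i \<le> \<kappa> * \<delta> * (1 + \<kappa> * T) ^ m" .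
        then have "sqrt (\<kappa> * \<delta>) ^ i * \<bar>c i\<bar> \<le> (\<kappa> * \<delta> * (1 + \<kappa> * T) ^ m) * \<bar>c i\<bar>" by (rule mult_right_mono) simp
        moreover have "\<bar>sqrt (\<kappa> * \<delta>) ^ i * c i\<bar> = sqrt (\<kappa> * \<delta>) ^ i * \<bar>c i\<bar>"
          using kd by (simp add: abs_mult power_abs)
        ultimately show ?thesis unfolding mom by (simp add: mult_ac)
      qed
    qed
    \<comment> \<open>Adding A on both sides makes the recursion homogeneous: the mixed moments of S
      n and the integrand are bounded by the same quantity.\<close>
    have step: "(\<E> x. (S (Suc n) x) ^ m) + A \<le> (1 + Q * \<delta>) * ((\<E> x. (S n x) ^ m) + A)" if n: "n < N" for n
    proof -
      define E where "E = (\<E> x. (S n x) ^ m) + A"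
      have Em0: "0 \<le> (\<E> x. (S n x) ^ m)" unfolding m_def by (simp add: power_mult)
      have E0: "E \<ge> 0" using Em0 A0 by (simp add: E_def)
      have mix: "\<bar>\<E> x. (S n x) ^ (m - i) * (a n x) ^ i\<bar> \<le> E" if i: "i \<le> m" for i
      proof -
        have Li: "in_all_Lp M (\<lambda>x. (S n x) ^ (m - i) * (a n x) ^ i)" by (intro in_all_Lp_mult in_all_Lp_power SL aL)
        have "\<bar>\<E> x. (S n x) ^ (m - i) * (a n x) ^ i\<bar> \<le> (\<E> x. \<bar>(S n x) ^ (m - i) * (a n x) ^ i\<bar>)" by (rule integral_abs_bound)
        also have "\<dots> \<le> (\<E> x. (S n x) ^ m + (a n x) ^ m)"
        proof (rule integral_mono)
          show "integrable M (\<lambda>x. \<bar>(S n x) ^ (m - i) * (a n x) ^ i\<bar>)" using in_all_LpD(3)[OF Li] by simp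
          show "integrable M (\<lambda>x. (S n x) ^ m + (a n x) ^ m)"
            by (intro in_all_LpD(3) in_all_Lp_add in_all_Lp_power SL aL)
          fix x
          define y z where "y = \<bar>S n x\<bar>" and "z = \<bar>a n x\<bar>"
          have yz: "0 \<le> y" "0 \<le> z" by (auto simp: y_def z_def)
          have "y ^ (m - i) * z ^ i \<le> max y z ^ (m - i) * max y z ^ i"
            using yz by (intro mult_mono power_mono) auto
          also have "\<dots> = max y z ^ m" using i by (simp flip: power_add)
          also have "\<dots> \<le> y ^ m + z ^ m" using yz by (cases "y \<le> z") (auto simp: max_def)
          finally show "\<bar>(S n x) ^ (m - i) * (a n x) ^ i\<bar> \<le> (S n x) ^ m + (a n x) ^ m"
            by (simp add: y_def z_def abs_mult power_abs m_def power_mult power_even_abs)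
        qed
        also have "\<dots> = (\<E> x. (S n x) ^ m) + (\<E> x. (a n x) ^ m)"
          by (intro Bochner_Integration.integral_add in_all_LpD(3) in_all_Lp_power SL aL)
        also have "\<dots> \<le> E" using a_mom[of n] n by (simp add: E_def)
        finally show ?thesis .
      qed
      define G where "G i = (\<E> x. (S n x) ^ (m - i) * (a n x) ^ i)" for i
      define H where "H i = (\<E> x. (D n x) ^ i)" for i
      have "(\<E> x. (S (Suc n) x) ^ m) = (\<E> x. (\<Sum>i\<le>m. of_nat (m choose i) * (((S n x) ^ (m - i) * (a n x) ^ i) * (D n x) ^ i)))"
      proof (intro Bochner_Integration.integral_cong refl)
        fix x
        have "(S (Suc n) x) ^ m = (a n x * D n x + S n x) ^ m" by (simp add: S_def add.commute)
        also have "\<dots> = (\<Sum>i\<le>m. of_nat (m choose i) * (a n x * D n x) ^ i * (S n x) ^ (m - i))" by (rule binomial_ring)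
        finally show "(S (Suc n) x) ^ m = (\<Sum>i\<le>m. of_nat (m choose i) * (((S n x) ^ (m - i) * (a n x) ^ i) * (D n x) ^ i))"
          by (simp add: power_mult_distrib mult_ac)
      qed
      also have "\<dots> = (\<Sum>i\<le>m. \<E> x. of_nat (m choose i) * (((S n x) ^ (m - i) * (a n x) ^ i) * (D n x) ^ i))"
        by (intro Bochner_Integration.integral_sum integrable_mult_right in_all_LpD(3) in_all_Lp_mult in_all_Lp_power SL aL DL)
      also have "\<dots> = (\<Sum>i\<le>m. of_nat (m choose i) * (G i * H i))"
      proof (intro sum.cong refl)
        fix i
        have "(\<E> x. ((S n x) ^ (m - i) * (a n x) ^ i) * (D n x) ^ i) = G i * H i"
          unfolding G_def H_def D_def
          by (rule increment_moment[OF t0 order_refl t_mono])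
             (auto intro!: borel_measurable_times borel_measurable_power SF aF in_all_Lp_mult in_all_Lp_power SL aL)
        then show "(\<E> x. of_nat (m choose i) * (((S n x) ^ (m - i) * (a n x) ^ i) * (D n x) ^ i)) = of_nat (m choose i) * (G i * H i)" by simp
      qed
      also have "\<dots> \<le> (\<Sum>i\<le>m. (if i = 0 then (\<E> x. (S n x) ^ m) else 0) + of_nat (m choose i) * (\<kappa> * (1 + \<kappa> * T) ^ m * \<bar>c i\<bar>) * \<delta> * E)"
      proof (intro sum_mono)
        fix i assume i: "i \<in> {..m}"
        define R where "R = of_nat (m choose i) * (\<kappa> * (1 + \<kappa> * T) ^ m * \<bar>c i\<bar>) * \<delta> * E"
        have R0: "R \<ge> 0" unfolding R_def using \<kappa> T \<delta> E0 by (intro mult_nonneg_nonneg zero_le_power) auto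
        show "of_nat (m choose i) * (G i * H i) \<le> (if i = 0 then (\<E> x. (S n x) ^ m) else 0) + of_nat (m choose i) * (\<kappa> * (1 + \<kappa> * T) ^ m * \<bar>c i\<bar>) * \<delta> * E"
        proof (cases "i = 0")
          case True
          then show ?thesis using R0 by (simp add: G_def H_def prob_space R_def)
        next
          case False
          have "G i * H i \<le> \<bar>G i\<bar> * \<bar>H i\<bar>" by (metis abs_ge_self abs_mult)
          also have "\<dots> \<le> E * (\<delta> * (\<kappa> * (1 + \<kappa> * T) ^ m * \<bar>c i\<bar>))"
            using mix[of i] D_mom[of i n] i False E0 unfolding G_def H_def by (intro mult_mono) auto
          finally have "of_nat (m choose i) * (G i * H i) \<le> of_nat (m choose i) * (E * (\<delta> * (\<kappa> * (1 + \<kappa> * T) ^ m * \<bar>c i\<bar>)))"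
            by (rule mult_left_mono) simp
          then show ?thesis using False by (simp add: mult_ac)
        qed
      qed
      also have "\<dots> = (\<E> x. (S n x) ^ m) + Q * \<delta> * E"
        unfolding sum.distrib Q_def sum_distrib_right[symmetric] by simp
      finally show ?thesis by (simp add: E_def algebra_simps)
    qed
    have iter: "(\<E> x. (S n x) ^ m) + A \<le> (1 + Q * \<delta>) ^ n * (1 + A)" if "n \<le> N" for n
      using that
    proof (induction n)
      case 0
      \<comment> \<open>The empty sum contributes 0^m, which equals 1 when m = 0.\<close>
      have "(\<E> x. (S 0 x) ^ m) \<le> 1" by (simp add: S_def prob_space power_0_left)
      then show ?case by simp
    next
      case (Suc n)
      have "(\<E> x. (S (Suc n) x) ^ m) + A \<le> (1 + Q * \<delta>) * ((\<E> x. (S n x) ^ m) + A)" using Suc step by simp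
      also have "\<dots> \<le> (1 + Q * \<delta>) * ((1 + Q * \<delta>) ^ n * (1 + A))"
        using Suc Q0 \<delta> by (intro mult_left_mono) auto
      finally show ?case by (simp add: mult_ac)
    qed
    have "(\<E> x. (S N x) ^ m) \<le> (1 + Q * \<delta>) ^ N * (1 + A)" using iter[of N] A0 by simp
    also have "(1 + Q * \<delta>) ^ N \<le> exp (Q * \<delta>) ^ N"
      using Q0 \<delta> exp_ge_add_one_self[of "Q * \<delta>"] by (intro power_mono) auto
    also have "exp (Q * \<delta>) ^ N = exp (Q * T)" using N by (simp add: exp_of_nat_mult[symmetric] \<delta>_def)
    finally show ?thesis using A0 by (simp add: S_def a_def D_def t_def mult.commute mult_right_mono)
  qed
  then show ?thesis unfolding m_def by blast
qed

end

subsection \<open>The Ito integral as a limit of Riemann sums\<close>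

lemma measurable_norm_comp: "f \<in> borel_measurable N \<Longrightarrow> (\<lambda>x. norm (f x)) \<in> borel_measurable N"
  by measurable

section \<open>Continuity of the inclusion and finite-rank projections\<close>

context wiener_bm
begin

text \<open>The norm of \<open>rep u\<close> is the standard deviation of u (B 1), and the norm of X
  1 has a second moment by Fernique's estimate.\<close>

lemma rep_norm_le:
  fixes u :: "'w \<Rightarrow>\<^sub>L real"
  assumes "\<And>z. \<bar>u z\<bar> \<le> norm z"
  shows "(norm (rep u))\<^sup>2 \<le> (\<E> x. (norm (X 1 x))\<^sup>2)"
proof -
  have "(norm (rep u))\<^sup>2 = (\<E> x. (lf u 0 1 x)\<^sup>2)"
    by (simp add: power2_eq_square[of "lf _ _ _ _"] lf_cov power2_norm_eq_inner)
  also have "\<dots> \<le> (\<E> x. (norm (X 1 x))\<^sup>2)"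
  proof (rule integral_mono)
    show "integrable M (\<lambda>x. (lf u 0 1 x)\<^sup>2)" by (rule L2_integrable[OF lf_L2]) simp
    show "integrable M (\<lambda>x. (norm (X 1 x))\<^sup>2)" by (rule L2_integrable[OF in_all_LpD(4)[OF X_norm_in_all_Lp]]) simp
    fix x
    have "\<bar>lf u 0 1 x\<bar> \<le> norm (X 1 x)"
      using assms[of "B 1 x"] norm_fst_le[of "B 1 x" "B0 1 x"] by (simp add: lf_def)
    then have "\<bar>lf u 0 1 x\<bar>\<^sup>2 \<le> (norm (X 1 x))\<^sup>2" by (intro power_mono) auto
    then show "(lf u 0 1 x)\<^sup>2 \<le> (norm (X 1 x))\<^sup>2" by simp
  qed
  finally show ?thesis .
qed

text \<open>Duality: a norming functional at \<iota> h is tested against h through its representing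
  vector, whose norm is bounded uniformly.\<close>

lemma \<iota>_bounded: "\<exists>K\<ge>0. \<forall>h. norm (\<iota> h) \<le> K * norm h"
proof -
  define K where "K = sqrt (\<E> x. (norm (X 1 x))\<^sup>2)"
  have "norm (\<iota> h) \<le> K * norm h" for h
  proof -
    obtain u :: "'w \<Rightarrow>\<^sub>L real" where u: "\<And>z. \<bar>u z\<bar> \<le> norm z" "u (\<iota> h) = norm (\<iota> h)"
      using norming_functional[of "\<iota> h"] by auto
    have "norm (rep u) = sqrt ((norm (rep u))\<^sup>2)" by simp
    also have "\<dots> \<le> K" unfolding K_def by (intro real_sqrt_le_mono rep_norm_le u(1))
    finally have r: "norm (rep u) \<le> K" .
    have "norm (\<iota> h) = inner h (rep u)" using u(2) rep[of u h] by simp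
    also have "\<dots> \<le> norm h * norm (rep u)" by (rule norm_cauchy_schwarz)
    also have "\<dots> \<le> norm h * K" using r by (intro mult_left_mono) auto
    finally show ?thesis by (simp add: mult.commute)
  qed
  moreover have "K \<ge> 0" by (simp add: K_def)
  ultimately show ?thesis by blast
qed

lemma \<iota>_bounded_linear: "bounded_linear \<iota>"
proof -
  obtain K where "\<And>h. norm (\<iota> h) \<le> K * norm h" using \<iota>_bounded by blast
  then show ?thesis using lin_\<iota> unfolding bounded_linear_def bounded_linear_axioms_def
    by (intro conjI exI[of _ K]) (auto simp: mult.commute)
qed

text \<open>With an orthonormal basis Fs of the range, the projection has coefficients inner h f,
  and these extend continuously to W because the range lies in \<open>H_star\<close>. The explicit
  formula reduces vector-valued integrals to finitely many scalar ones.\<close>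

lemma projection_expansion:
  fixes P :: "'w \<Rightarrow>\<^sub>L 'w"
  assumes p: "cm_projection \<iota> p" and P: "\<And>h. P (\<iota> h) = \<iota> (p h)"
  shows "\<exists>Fs. finite Fs \<and> Fs \<subseteq> H_star \<iota> \<and> (\<forall>w. P w = (\<Sum>f\<in>Fs. cm_functional \<iota> f w *\<^sub>R \<iota> f))"
proof -
  obtain E where E: "finite E" "range p = span E" using p unfolding cm_projection_def by blast
  have pp: "\<And>h. p (p h) = p h" and sym: "\<And>h k. inner (p h) k = inner h (p k)" and ran: "range p \<subseteq> H_star \<iota>"
    using p unfolding cm_projection_def by blast+
  obtain Fs where \<F>: "finite Fs" "span Fs = span E"
    and on: "\<And>b c. b \<in> Fs \<Longrightarrow> c \<in> Fs \<Longrightarrow> inner b c = (if b = c then 1 else 0)"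
    using orthonormal_basis_of_span[OF E(1)] by blast
  have Fr: "Fs \<subseteq> range p" using span_superset[of Fs] \<F>(2) E(2) by simp
  have FH: "Fs \<subseteq> H_star \<iota>" using Fr ran by blast
  have pF: "p f = f" if "f \<in> Fs" for f using that Fr pp by force
  have exp: "p h = (\<Sum>f\<in>Fs. inner h f *\<^sub>R f)" for h
  proof -
    have "p h \<in> span Fs" using \<F>(2) E(2) by (metis rangeI)
    from orthonormal_expansion[OF \<F>(1) on this] have "p h = (\<Sum>f\<in>Fs. inner (p h) f *\<^sub>R f)" .
    then show ?thesis using sym pF by (simp cong: sum.cong)
  qed
  have lin: "bounded_linear \<iota>" by (rule \<iota>_bounded_linear)
  have "P w = (\<Sum>f\<in>Fs. cm_functional \<iota> f w *\<^sub>R \<iota> f)" for w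
  proof (rule eq_if_functionals_eq)
    fix v :: "'w \<Rightarrow>\<^sub>L real"
    \<comment> \<open>Composed with v, both sides are continuous functionals on W that agree on the
      image of H, and this determines them.\<close>
    define u1 where "u1 = v o\<^sub>L P"
    define u2 where "u2 = (\<Sum>f\<in>Fs. v (\<iota> f) *\<^sub>R cm_functional \<iota> f)"
    have "u1 = u2"
    proof (rule functional_eqI)
      fix h
      have "u1 (\<iota> h) = v (\<iota> (\<Sum>f\<in>Fs. inner h f *\<^sub>R f))" by (simp add: u1_def P exp)
      also have "\<dots> = (\<Sum>f\<in>Fs. inner h f * v (\<iota> f))"
        by (simp add: bounded_linear.linear[OF lin, THEN linear_sum] bounded_linear.linear[OF lin, THEN linear_cmul] blinfun.sum_right blinfun.scaleR_right)
      also have "\<dots> = u2 (\<iota> h)" unfolding u2_def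
        using FH by (simp add: blinfun.sum_left blinfun.scaleR_left cm_functional subset_iff mult.commute cong: sum.cong)
      finally show "u1 (\<iota> h) = u2 (\<iota> h)" .
    qed
    then have "u1 w = u2 w" by simp
    then show "v (P w) = v (\<Sum>f\<in>Fs. cm_functional \<iota> f w *\<^sub>R \<iota> f)"
      by (simp add: u1_def u2_def blinfun.sum_left blinfun.sum_right blinfun.scaleR_left blinfun.scaleR_right mult.commute)
  qed
  with \<F>(1) FH show ?thesis by blast
qed

end

locale heis_bm = wiener_bm M \<iota> \<mu> X
  for M :: "'s measure" and \<iota> :: "'h::{real_inner,complete_space} \<Rightarrow> 'w::{banach,second_countable_topology}"
    and \<mu> and X :: "real \<Rightarrow> 's \<Rightarrow> 'w \<times> 'c::{real_inner,banach,second_countable_topology}" +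
  fixes \<omega> :: "'w \<Rightarrow> 'w \<Rightarrow> 'c" and I :: "real \<Rightarrow> 's \<Rightarrow> 'c" and T :: real and EC :: "'c set"
  assumes bil: "bounded_bilinear \<omega>" and skew: "\<omega> v w = - \<omega> w v"
    and wi: "wiener_ito_integral M \<iota> \<omega> X I" and T: "T > 0"
    and EC: "finite EC" "span EC = UNIV" "\<And>b c. b \<in> EC \<Longrightarrow> c \<in> EC \<Longrightarrow> inner b c = (if b = c then 1 else 0)"
begin

interpretation om: bounded_bilinear \<omega> by (rule bil)

lemma \<omega>_self: "\<omega> w w = 0"
proof -
  have "2 *\<^sub>R \<omega> w w = 0" using skew[of w w] by (simp add: scaleR_2 eq_neg_iff_add_eq_0)
  then show ?thesis by simp
qed

lemma C_expansion: "c = (\<Sum>e\<in>EC. inner c e *\<^sub>R e)"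
proof -
  have "c \<in> span EC" unfolding EC(2) by simp
  from orthonormal_expansion[OF EC(1) EC(3) this] show ?thesis .
qed

section \<open>Dyadic partitions of the time interval and step approximation of the path\<close>

definition tt :: "nat \<Rightarrow> nat \<Rightarrow> real" where "tt k j = real j * T / 2 ^ k"

lemma tt_nonneg: "0 \<le> tt k j" and tt_Suc: "tt k (Suc j) = tt k j + T / 2 ^ k"
  and tt_mono: "i \<le> j \<Longrightarrow> tt k i \<le> tt k j" and tt_le: "j \<le> 2 ^ k \<Longrightarrow> tt k j \<le> T"
  and tt_less: "tt k i < tt k j \<Longrightarrow> i < j"
proof -
  show "0 \<le> tt k j" using T by (simp add: tt_def)
  show "tt k (Suc j) = tt k j + T / 2 ^ k" by (simp add: tt_def add_divide_distrib distrib_right)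
  show m: "tt k i \<le> tt k j" if "i \<le> j" for i j
    unfolding tt_def using that T by (intro divide_right_mono mult_right_mono) auto
  have "tt k (2 ^ k) = T" by (simp add: tt_def)
  then show "j \<le> 2 ^ k \<Longrightarrow> tt k j \<le> T" using m[of j "2 ^ k"] by simp
  show "tt k i < tt k j \<Longrightarrow> i < j" using m[of j i] by (meson leD not_le_imp_less)
qed

lemma tt_cell:
  assumes "0 < s" "s \<le> T"
  shows "\<exists>j<2 ^ k. tt k j < s \<and> s \<le> tt k (Suc j)"
proof -
  define m where "m = (LEAST i. s \<le> tt k i)"
  have ex: "s \<le> tt k (2 ^ k)" using assms by (simp add: tt_def)
  have m: "s \<le> tt k m" unfolding m_def by (rule LeastI[of "\<lambda>i. s \<le> tt k i", OF ex])
  have m2: "m \<le> 2 ^ k" unfolding m_def by (rule Least_le[of "\<lambda>i. s \<le> tt k i", OF ex])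
  have "m \<noteq> 0" using m assms(1) by (auto simp: tt_def intro: ccontr)
  then obtain j where j: "m = Suc j" by (cases m) auto
  have "\<not> s \<le> tt k j" using not_less_Least[of j "\<lambda>i. s \<le> tt k i"] j by (simp add: m_def)
  then show ?thesis using m m2 j by (intro exI[of _ j]) auto
qed

definition Bstep :: "nat \<Rightarrow> real \<Rightarrow> 's \<Rightarrow> 'w" where
  "Bstep k s x = (\<Sum>j<2 ^ k. indicator {tt k j<..tt k (Suc j)} s *\<^sub>R B (tt k j) x)"

lemma Bstep_cell:
  assumes j: "j < 2 ^ k" "tt k j < s" "s \<le> tt k (Suc j)"
  shows "Bstep k s x = B (tt k j) x"
proof -
  have "indicator {tt k i<..tt k (Suc i)} s *\<^sub>R B (tt k i) x = (if i = j then B (tt k j) x else 0)" for i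
  proof (cases "s \<in> {tt k i<..tt k (Suc i)}")
    case True
    then have "tt k i < tt k (Suc j)" "tt k j < tt k (Suc i)" using j by auto
    then have "i = j" using tt_less[of k i "Suc j"] tt_less[of k j "Suc i"] by simp
    then show ?thesis using True by simp
  next
    case False
    then show ?thesis using j by auto
  qed
  then show ?thesis unfolding Bstep_def using j(1) by simp
qed

lemma Bstep_outside:
  assumes "s \<le> 0 \<or> s > T"
  shows "Bstep k s x = 0"
  unfolding Bstep_def
proof (rule sum.neutral, rule ballI)
  fix j assume "j \<in> {..<2 ^ k :: nat}"
  then have "tt k (Suc j) \<le> T" "0 \<le> tt k j" by (auto intro: tt_le tt_nonneg)
  then show "indicator {tt k j<..tt k (Suc j)} s *\<^sub>R B (tt k j) x = 0" using assms by auto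
qed

text \<open>Nothing is known about X at negative times, so the path is cut off outside [0, T]. The
  result is the pointwise limit of the step paths on the whole line and hence jointly
  measurable.\<close>

definition Bt :: "real \<Rightarrow> 's \<Rightarrow> 'w" where "Bt s x = indicator {0..T} s *\<^sub>R B s x"

lemma Bstep_tendsto:
  assumes x: "x \<in> space M"
  shows "(\<lambda>k. Bstep k s x) \<longlonglongrightarrow> Bt s x"
proof (cases "0 < s \<and> s \<le> T")
  case False
  have "Bstep k s x = 0" for k using False by (intro Bstep_outside) auto
  moreover have "Bt s x = 0" using False X_zero[OF x] by (cases "s = 0") (auto simp: Bt_def)
  ultimately show ?thesis by simp
next
  case True
  then have "\<exists>j. \<forall>k. j k < 2 ^ k \<and> tt k (j k) < s \<and> s \<le> tt k (Suc (j k))"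
    using tt_cell[of s] by (intro choice allI) blast
  then obtain j where j: "\<And>k. j k < 2 ^ k" "\<And>k. tt k (j k) < s" "\<And>k. s \<le> tt k (Suc (j k))" by blast
  have "(\<lambda>k. tt k (j k)) \<longlonglongrightarrow> s"
  proof (rule tendsto_sandwich)
    show "\<forall>\<^sub>F k in sequentially. s - T * (1 / 2) ^ k \<le> tt k (j k)"
      using j(3) by (auto simp: tt_Suc power_divide algebra_simps)
    show "\<forall>\<^sub>F k in sequentially. tt k (j k) \<le> s" by (intro always_eventually allI less_imp_le j(2))
    have "(\<lambda>k. s - T * (1 / 2) ^ k) \<longlonglongrightarrow> s - T * 0" by (intro tendsto_intros LIMSEQ_power_zero) simp
    then show "(\<lambda>k. s - T * (1 / 2) ^ k) \<longlonglongrightarrow> s" by simp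
  qed simp
  then have "(\<lambda>k. X (tt k (j k)) x) \<longlonglongrightarrow> X s x"
    using True tt_nonneg by (intro continuous_on_tendsto_compose[OF X_continuous[OF x]]) auto
  then have "(\<lambda>k. B (tt k (j k)) x) \<longlonglongrightarrow> B s x" by (rule tendsto_fst)
  moreover have "Bstep k s x = B (tt k (j k)) x" for k by (rule Bstep_cell[OF j(1,2,3)])
  ultimately show ?thesis using True by (simp add: Bt_def)
qed

lemma Bstep_measurable: "(\<lambda>p. Bstep k (snd p) (fst p)) \<in> borel_measurable (M \<Otimes>\<^sub>M lborel)"
  unfolding Bstep_def
proof (intro borel_measurable_sum borel_measurable_scaleR)
  fix j
  show "(\<lambda>p. B (tt k j) (fst p)) \<in> borel_measurable (M \<Otimes>\<^sub>M lborel)"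
    by (rule measurable_compose[OF measurable_fst B_measurable[OF tt_nonneg]])
  show "(\<lambda>p. indicator {tt k j<..tt k (Suc j)} (snd p) :: real) \<in> borel_measurable (M \<Otimes>\<^sub>M lborel)"
    by measurable
qed

lemma Bt_measurable: "(\<lambda>p. Bt (snd p) (fst p)) \<in> borel_measurable (M \<Otimes>\<^sub>M lborel)"
proof (rule borel_measurable_LIMSEQ_metric)
  show "(\<lambda>p. Bstep k (snd p) (fst p)) \<in> borel_measurable (M \<Otimes>\<^sub>M lborel)" for k by (rule Bstep_measurable)
  fix p :: "'s \<times> real" assume "p \<in> space (M \<Otimes>\<^sub>M lborel)"
  then have "fst p \<in> space M" by (auto simp: space_pair_measure)
  then show "(\<lambda>k. Bstep k (snd p) (fst p)) \<longlonglongrightarrow> Bt (snd p) (fst p)" by (rule Bstep_tendsto)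
qed

end

section \<open>Riemann sums for the stochastic integral of one projected process\<close>

locale heis_proj = heis_bm M \<iota> \<mu> X \<omega> I T EC
  for M :: "'s measure" and \<iota> :: "'h::{real_inner,complete_space} \<Rightarrow> 'w::{banach,second_countable_topology}"
    and \<mu> and X :: "real \<Rightarrow> 's \<Rightarrow> 'w \<times> 'c::{real_inner,banach,second_countable_topology}"
    and \<omega> I T EC +
  fixes P :: "'w \<Rightarrow>\<^sub>L 'w" and Fs :: "'h set" and J :: "real \<Rightarrow> 's \<Rightarrow> 'c"
  assumes Fs: "finite Fs" "Fs \<subseteq> H_star \<iota>"
    and P_exp: "P w = (\<Sum>f\<in>Fs. cm_functional \<iota> f w *\<^sub>R \<iota> f)"
    and ito: "ito_integral M (natural_filtration M X) \<omega> (\<lambda>t x. P (fst (X t x))) (\<lambda>t x. P (fst (X t x))) J"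
begin

interpretation om: bounded_bilinear \<omega> by (rule bil)

interpretation PM: pair_sigma_finite M lborel by unfold_locales

definition S :: "nat \<Rightarrow> 's \<Rightarrow> 'c" where
  "S k x = (\<Sum>j<2 ^ k. \<omega> (P (B (tt k j) x)) (P (B (tt k (Suc j)) x - B (tt k j) x)))"

lemma \<omega>_P_expand:
  "inner (\<omega> w (P (B t x - B s x))) e = (\<Sum>f\<in>Fs. inner (\<omega> w (\<iota> f)) e * dB (cm_functional \<iota> f) s t x)"
  by (simp add: P_exp om.sum_right om.scaleR_right inner_sum_left dB_eq mult.commute)

text \<open>Finite rank turns the integral into finitely many scalar integrals, each controlled by
  the isometry; the constant depends on the projection, but not on the process. The index type has
  two summands so that one sum can hold a simple process and a Riemann partition side by side. The
  integrands need only moments, as the Riemann integrand is unbounded.\<close>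

lemma integral_bound:
  "\<exists>C\<ge>0. \<forall>K a b \<eta>. finite (K :: (nat + nat) set) \<longrightarrow> (\<forall>i\<in>K. 0 \<le> a i \<and> a i \<le> b i \<and> \<eta> i \<in> borel_measurable (\<F> (a i)) \<and> in_all_Lp M (\<lambda>x. norm (\<eta> i x))) \<longrightarrow>
     ennreal (\<E> x. (\<Sum>i\<in>K. inner (\<omega> (\<eta> i x) (P (B (b i) x - B (a i) x))) e)\<^sup>2)
     \<le> ennreal C * (\<integral>\<^sup>+x. \<integral>\<^sup>+s. ennreal ((norm (\<Sum>i\<in>K. indicator {a i<..b i} s *\<^sub>R \<eta> i x))\<^sup>2) \<partial>lborel \<partial>M)"
proof -
  obtain K\<omega> where K\<omega>: "K\<omega> > 0" "\<And>a b. norm (\<omega> a b) \<le> norm a * norm b * K\<omega>" using om.pos_bounded by blast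
  define \<kappa> where "\<kappa> f = norm (\<iota> f) * K\<omega> * norm e" for f
  have \<kappa>0: "\<kappa> f \<ge> 0" for f using K\<omega>(1) by (simp add: \<kappa>_def)
  have \<kappa>: "\<bar>inner (\<omega> w (\<iota> f)) e\<bar> \<le> \<kappa> f * norm w" for w f
  proof -
    have "\<bar>inner (\<omega> w (\<iota> f)) e\<bar> \<le> norm (\<omega> w (\<iota> f)) * norm e" by (rule Cauchy_Schwarz_ineq2)
    also have "\<dots> \<le> (norm w * norm (\<iota> f) * K\<omega>) * norm e" using K\<omega>(2) by (intro mult_right_mono) auto
    finally show ?thesis by (simp add: \<kappa>_def mult_ac)
  qed
  define C where "C = real (card Fs) * (\<Sum>f\<in>Fs. (norm (rep (cm_functional \<iota> f)))\<^sup>2 * (\<kappa> f)\<^sup>2)"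
  have C0: "C \<ge> 0" unfolding C_def by (intro mult_nonneg_nonneg sum_nonneg) auto
  show ?thesis
  proof (intro exI[of _ C] conjI C0 allI impI)
    fix K :: "(nat + nat) set" and a b :: "nat + nat \<Rightarrow> real" and \<eta> :: "nat + nat \<Rightarrow> 's \<Rightarrow> 'w"
    assume K: "finite K" and A: "\<forall>i\<in>K. 0 \<le> a i \<and> a i \<le> b i \<and> \<eta> i \<in> borel_measurable (\<F> (a i)) \<and> in_all_Lp M (\<lambda>x. norm (\<eta> i x))"
    have a: "0 \<le> a i" "a i \<le> b i" and \<eta>\<F>: "\<eta> i \<in> borel_measurable (\<F> (a i))" and \<eta>L: "in_all_Lp M (\<lambda>x. norm (\<eta> i x))"
      if "i \<in> K" for i using A that by blast+
    have \<eta>M: "\<eta> i \<in> borel_measurable M" if "i \<in> K" for i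
      by (rule measurable_from_F[OF a(1)[OF that] \<eta>\<F>[OF that]])
    define \<zeta> where "\<zeta> f i x = inner (\<omega> (\<eta> i x) (\<iota> f)) e" for f i x
    have cont: "continuous_on UNIV (\<lambda>w. inner (\<omega> w (\<iota> f)) e)" for f
      by (intro continuous_intros linear_continuous_on om.bounded_linear_left)
    have \<zeta>\<F>: "\<zeta> f i \<in> borel_measurable (\<F> (a i))" if "i \<in> K" for f i
      unfolding \<zeta>_def by (rule measurable_compose[OF \<eta>\<F>[OF that] borel_measurable_continuous_onI[OF cont]])
    have \<zeta>L: "in_all_Lp M (\<zeta> f i)" if "i \<in> K" for f i
    proof (rule in_all_Lp_bound[OF in_all_Lp_mult[OF in_all_Lp_const \<eta>L[OF that]]])
      show "\<zeta> f i \<in> borel_measurable M" by (rule measurable_from_F[OF a(1)[OF that] \<zeta>\<F>[OF that]])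
      show "AE x in M. \<bar>\<zeta> f i x\<bar> \<le> \<bar>\<kappa> f * norm (\<eta> i x)\<bar>"
        using \<kappa> \<kappa>0 by (simp add: \<zeta>_def abs_mult)
    qed
    define H where "H s x = (\<Sum>i\<in>K. indicator {a i<..b i} s *\<^sub>R \<eta> i x)" for s x
    have Hm: "(\<lambda>p. H (snd p) (fst p)) \<in> borel_measurable (M \<Otimes>\<^sub>M lborel)" unfolding H_def
    proof (intro borel_measurable_sum borel_measurable_scaleR)
      fix i assume i: "i \<in> K"
      show "(\<lambda>p. \<eta> i (fst p)) \<in> borel_measurable (M \<Otimes>\<^sub>M lborel)"
        by (rule measurable_compose[OF measurable_fst \<eta>M[OF i]])
      show "(\<lambda>p. indicator {a i<..b i} (snd p) :: real) \<in> borel_measurable (M \<Otimes>\<^sub>M lborel)" by measurable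
    qed
    have Hnm: "(\<lambda>p. ennreal ((norm (H (snd p) (fst p)))\<^sup>2)) \<in> borel_measurable (M \<Otimes>\<^sub>M lborel)"
      using Hm by measurable
    define G where "G = (\<integral>\<^sup>+x. \<integral>\<^sup>+s. ennreal ((norm (H s x))\<^sup>2) \<partial>lborel \<partial>M)"
    have G: "G = (\<integral>\<^sup>+p. ennreal ((norm (H (snd p) (fst p)))\<^sup>2) \<partial>(M \<Otimes>\<^sub>M lborel))"
      unfolding G_def using lborel.nn_integral_fst[OF Hnm] by simp
    define Y where "Y f x = (\<Sum>i\<in>K. \<zeta> f i x * dB (cm_functional \<iota> f) (a i) (b i) x)" for f x
    have bi: "0 \<le> b i" if "i \<in> K" for i using a[OF that] by simp
    have YL: "L2 M (Y f)" for f unfolding Y_def[abs_def]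
      by (intro in_all_LpD(4) in_all_Lp_sum in_all_Lp_mult \<zeta>L dB_in_all_Lp a(1) bi)
    have Yf: "ennreal (\<E> x. (Y f x)\<^sup>2) \<le> ennreal ((norm (rep (cm_functional \<iota> f)))\<^sup>2 * (\<kappa> f)\<^sup>2) * G" for f
    proof -
      have "ennreal (\<E> x. (Y f x)\<^sup>2) = ennreal ((norm (rep (cm_functional \<iota> f)))\<^sup>2) *
          (\<integral>\<^sup>+x. \<integral>\<^sup>+s. ennreal ((\<Sum>i\<in>K. indicator {a i<..b i} s * \<zeta> f i x)\<^sup>2) \<partial>lborel \<partial>M)"
        unfolding Y_def by (rule elementary_isometry[OF K a \<zeta>\<F> \<zeta>L])
      also have "\<dots> \<le> ennreal ((norm (rep (cm_functional \<iota> f)))\<^sup>2) *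
          (\<integral>\<^sup>+x. \<integral>\<^sup>+s. ennreal ((\<kappa> f)\<^sup>2) * ennreal ((norm (H s x))\<^sup>2) \<partial>lborel \<partial>M)"
      proof (intro mult_left_mono nn_integral_mono)
        fix x s
        have "(\<Sum>i\<in>K. indicator {a i<..b i} s * \<zeta> f i x) = inner (\<omega> (H s x) (\<iota> f)) e"
          unfolding H_def \<zeta>_def by (simp add: om.sum_left om.scaleR_left inner_sum_left)
        then have "\<bar>\<Sum>i\<in>K. indicator {a i<..b i} s * \<zeta> f i x\<bar>\<^sup>2 \<le> (\<kappa> f * norm (H s x))\<^sup>2"
          using \<kappa>[of "H s x" f] by (intro power_mono) auto
        then show "ennreal ((\<Sum>i\<in>K. indicator {a i<..b i} s * \<zeta> f i x)\<^sup>2) \<le> ennreal ((\<kappa> f)\<^sup>2) * ennreal ((norm (H s x))\<^sup>2)"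
          by (simp add: ennreal_mult[symmetric] power_mult_distrib ennreal_leI)
      qed simp
      also have "(\<integral>\<^sup>+x. \<integral>\<^sup>+s. ennreal ((\<kappa> f)\<^sup>2) * ennreal ((norm (H s x))\<^sup>2) \<partial>lborel \<partial>M)
          = (\<integral>\<^sup>+p. ennreal ((\<kappa> f)\<^sup>2) * ennreal ((norm (H (snd p) (fst p)))\<^sup>2) \<partial>(M \<Otimes>\<^sub>M lborel))"
        using lborel.nn_integral_fst[OF borel_measurable_times_ennreal[OF borel_measurable_const Hnm], of "ennreal ((\<kappa> f)\<^sup>2)"] by simp
      also have "\<dots> = ennreal ((\<kappa> f)\<^sup>2) * G" unfolding G by (rule nn_integral_cmult[OF Hnm])
      finally show ?thesis by (simp add: ennreal_mult mult.assoc)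
    qed
    have "(\<E> x. (\<Sum>i\<in>K. inner (\<omega> (\<eta> i x) (P (B (b i) x - B (a i) x))) e)\<^sup>2) = (\<E> x. (\<Sum>f\<in>Fs. Y f x)\<^sup>2)"
      unfolding \<omega>_P_expand Y_def \<zeta>_def by (subst sum.swap) simp
    also have "\<dots> \<le> real (card Fs) * (\<Sum>f\<in>Fs. (\<E> x. (Y f x)\<^sup>2))"
      by (rule L2_sum_square_le[OF Fs(1) YL])
    finally have "ennreal (\<E> x. (\<Sum>i\<in>K. inner (\<omega> (\<eta> i x) (P (B (b i) x - B (a i) x))) e)\<^sup>2)
        \<le> ennreal (real (card Fs)) * (\<Sum>f\<in>Fs. ennreal (\<E> x. (Y f x)\<^sup>2))"
      by (simp add: ennreal_leI ennreal_mult[symmetric] sum_nonneg)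
    also have "\<dots> \<le> ennreal (real (card Fs)) * (\<Sum>f\<in>Fs. ennreal ((norm (rep (cm_functional \<iota> f)))\<^sup>2 * (\<kappa> f)\<^sup>2) * G)"
      by (intro mult_left_mono sum_mono Yf) simp
    also have "\<dots> = ennreal C * G"
    proof -
      have "(\<Sum>f\<in>Fs. ennreal ((norm (rep (cm_functional \<iota> f)))\<^sup>2 * (\<kappa> f)\<^sup>2))
          = ennreal (\<Sum>f\<in>Fs. (norm (rep (cm_functional \<iota> f)))\<^sup>2 * (\<kappa> f)\<^sup>2)"
        by (rule sum_ennreal) simp
      then show ?thesis unfolding C_def sum_distrib_right[symmetric]
        by (simp only: ennreal_mult sum_nonneg mult.assoc of_nat_0_le_iff zero_le_power2 mult_nonneg_nonneg)
    qed
    finally show "ennreal (\<E> x. (\<Sum>i\<in>K. inner (\<omega> (\<eta> i x) (P (B (b i) x - B (a i) x))) e)\<^sup>2)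
     \<le> ennreal C * (\<integral>\<^sup>+x. \<integral>\<^sup>+s. ennreal ((norm (\<Sum>i\<in>K. indicator {a i<..b i} s *\<^sub>R \<eta> i x))\<^sup>2) \<partial>lborel \<partial>M)"
      unfolding G_def H_def .
  qed
qed

lemma P_continuous: "continuous_on UNIV (blinfun_apply P)"
  by (intro linear_continuous_on blinfun.bounded_linear_right)

lemma P_measurable: "f \<in> borel_measurable N \<Longrightarrow> (\<lambda>x. P (f x)) \<in> borel_measurable N"
  by (rule measurable_compose[OF _ borel_measurable_continuous_onI[OF P_continuous]])

lemma P_increment_energy:
  "\<exists>D\<ge>0. \<forall>s t. 0 \<le> s \<longrightarrow> s \<le> t \<longrightarrow> (\<integral>\<^sup>+x. ennreal ((norm (P (B t x) - P (B s x)))\<^sup>2) \<partial>M) \<le> ennreal (D * (t - s))"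
proof -
  define D where "D = real (card Fs) * (\<Sum>f\<in>Fs. (norm (\<iota> f))\<^sup>2 * (norm (rep (cm_functional \<iota> f)))\<^sup>2)"
  have D0: "D \<ge> 0" unfolding D_def by (intro mult_nonneg_nonneg sum_nonneg) auto
  have "(\<integral>\<^sup>+x. ennreal ((norm (P (B t x) - P (B s x)))\<^sup>2) \<partial>M) \<le> ennreal (D * (t - s))" if st: "0 \<le> s" "s \<le> t" for s t
  proof -
    have t0: "0 \<le> t" using st by simp
    define Y where "Y f x = norm (\<iota> f) * dB (cm_functional \<iota> f) s t x" for f x
    have YL: "L2 M (Y f)" for f unfolding Y_def[abs_def] by (intro L2_cmult in_all_LpD(4) dB_in_all_Lp st(1) t0)
    have int: "integrable M (\<lambda>x. real (card Fs) * (\<Sum>f\<in>Fs. (Y f x)\<^sup>2))"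
      by (intro integrable_mult_right Bochner_Integration.integrable_sum L2_integrable[OF YL])
    have "(\<integral>\<^sup>+x. ennreal ((norm (P (B t x) - P (B s x)))\<^sup>2) \<partial>M) \<le> (\<integral>\<^sup>+x. ennreal (real (card Fs) * (\<Sum>f\<in>Fs. (Y f x)\<^sup>2)) \<partial>M)"
    proof (intro nn_integral_mono ennreal_leI)
      fix x
      have "P (B t x) - P (B s x) = (\<Sum>f\<in>Fs. dB (cm_functional \<iota> f) s t x *\<^sub>R \<iota> f)"
        unfolding blinfun.diff_right[symmetric] by (simp only: P_exp dB_eq)
      then have "norm (P (B t x) - P (B s x)) \<le> (\<Sum>f\<in>Fs. \<bar>Y f x\<bar>)"
        using norm_sum[of "\<lambda>f. dB (cm_functional \<iota> f) s t x *\<^sub>R \<iota> f" Fs] by (simp add: Y_def abs_mult mult.commute)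
      then have "(norm (P (B t x) - P (B s x)))\<^sup>2 \<le> (\<Sum>f\<in>Fs. 1 * \<bar>Y f x\<bar>)\<^sup>2" by (intro power_mono) auto
      also have "\<dots> \<le> (\<Sum>f\<in>Fs. 1\<^sup>2) * (\<Sum>f\<in>Fs. \<bar>Y f x\<bar>\<^sup>2)" by (rule Cauchy_Schwarz_ineq_sum)
      finally show "(norm (P (B t x) - P (B s x)))\<^sup>2 \<le> real (card Fs) * (\<Sum>f\<in>Fs. (Y f x)\<^sup>2)" by simp
    qed
    also have "\<dots> = ennreal (\<E> x. real (card Fs) * (\<Sum>f\<in>Fs. (Y f x)\<^sup>2))"
      by (intro nn_integral_eq_integral int AE_I2 mult_nonneg_nonneg sum_nonneg) auto
    also have "(\<E> x. real (card Fs) * (\<Sum>f\<in>Fs. (Y f x)\<^sup>2)) = real (card Fs) * (\<Sum>f\<in>Fs. \<E> x. (Y f x)\<^sup>2)"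
      by (simp add: Bochner_Integration.integral_sum[OF L2_integrable[OF YL]])
    also have "\<dots> = D * (t - s)"
      unfolding D_def Y_def by (simp add: power_mult_distrib dB_variance[OF st] sum_distrib_right sum_distrib_left mult_ac)
    finally show ?thesis .
  qed
  with D0 show ?thesis by blast
qed

text \<open>On each cell the mean square increment of the projected process is at most a constant
  times the cell length T / 2^k; integration over [0, T] gives the rate.\<close>

lemma Riemann_energy:
  "\<exists>D\<ge>0. \<forall>k. (\<integral>\<^sup>+x. \<integral>\<^sup>+s. ennreal ((norm (P (Bt s x) - P (Bstep k s x)))\<^sup>2) \<partial>lborel \<partial>M) \<le> ennreal (D / 2 ^ k)"
proof -
  obtain D where D: "D \<ge> 0" "\<And>s t. 0 \<le> s \<Longrightarrow> s \<le> t \<Longrightarrow> (\<integral>\<^sup>+x. ennreal ((norm (P (B t x) - P (B s x)))\<^sup>2) \<partial>M) \<le> ennreal (D * (t - s))"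
    using P_increment_energy by blast
  have "(\<integral>\<^sup>+x. \<integral>\<^sup>+s. ennreal ((norm (P (Bt s x) - P (Bstep k s x)))\<^sup>2) \<partial>lborel \<partial>M) \<le> ennreal ((D * T * T) / 2 ^ k)" for k
  proof -
    define f where "f p = ennreal ((norm (P (Bt (snd p) (fst p)) - P (Bstep k (snd p) (fst p))))\<^sup>2)" for p
    have f: "f \<in> borel_measurable (M \<Otimes>\<^sub>M lborel)" unfolding f_def
      by (intro measurable_compose[OF _ measurable_ennreal] borel_measurable_power measurable_norm_comp borel_measurable_diff
          P_measurable Bt_measurable Bstep_measurable)
    have "(\<integral>\<^sup>+x. \<integral>\<^sup>+s. ennreal ((norm (P (Bt s x) - P (Bstep k s x)))\<^sup>2) \<partial>lborel \<partial>M) = (\<integral>\<^sup>+x. \<integral>\<^sup>+s. f (x, s) \<partial>lborel \<partial>M)"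
      by (simp add: f_def)
    also have "\<dots> = (\<integral>\<^sup>+s. \<integral>\<^sup>+x. f (x, s) \<partial>M \<partial>lborel)" using PM.nn_integral_snd[of f] lborel.nn_integral_fst[OF f] f by simp
    also have "\<dots> \<le> (\<integral>\<^sup>+s. ennreal (D * (T / 2 ^ k)) * indicator {0..T} s \<partial>lborel)"
    proof (rule nn_integral_mono)
      fix s
      show "(\<integral>\<^sup>+x. f (x, s) \<partial>M) \<le> ennreal (D * (T / 2 ^ k)) * indicator {0..T} s"
      proof (cases "0 < s \<and> s \<le> T")
        case True
        then obtain j where j: "j < 2 ^ k" "tt k j < s" "s \<le> tt k (Suc j)" using tt_cell[of s k] by blast
        have "(\<integral>\<^sup>+x. f (x, s) \<partial>M) = (\<integral>\<^sup>+x. ennreal ((norm (P (B s x) - P (B (tt k j) x)))\<^sup>2) \<partial>M)"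
          using True by (simp add: f_def Bt_def Bstep_cell[OF j])
        also have "\<dots> \<le> ennreal (D * (s - tt k j))" using D(2)[OF tt_nonneg] j by simp
        also have "\<dots> \<le> ennreal (D * (T / 2 ^ k))" using j D(1) by (intro ennreal_leI mult_left_mono) (auto simp: tt_Suc)
        finally show ?thesis using True by simp
      next
        case False
        have "f (x, s) = 0" if x: "x \<in> space M" for x
        proof -
          have "Bstep k s x = 0" using False by (intro Bstep_outside) auto
          moreover have "Bt s x = 0" using False X_zero[OF x] by (cases "s = 0") (auto simp: Bt_def)
          ultimately show ?thesis by (simp add: f_def)
        qed
        then have "(\<integral>\<^sup>+x. f (x, s) \<partial>M) = (\<integral>\<^sup>+x. 0 \<partial>M)" by (intro nn_integral_cong) auto
        then show ?thesis by simp
      qed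
    qed
    also have "\<dots> = ennreal (D * (T / 2 ^ k)) * ennreal T"
      using T by (simp add: nn_integral_cmult_indicator)
    also have "\<dots> = ennreal ((D * T * T) / 2 ^ k)" using D(1) T by (simp add: ennreal_mult[symmetric])
    finally show ?thesis .
  qed
  then show ?thesis using D(1) T by (intro exI[of _ "D * T * T"]) auto
qed

lemma S_component: "inner (S k x) e = (\<Sum>j<2 ^ k. inner (\<omega> (P (B (tt k j) x)) (P (B (tt k (Suc j)) x - B (tt k j) x))) e)"
  by (simp add: S_def inner_sum_left)

lemma P_B_in_all_Lp:
  assumes "0 \<le> t"
  shows "in_all_Lp M (\<lambda>x. norm (P (B t x)))"
proof (rule in_all_Lp_bound)
  show "in_all_Lp M (\<lambda>x. \<Sum>f\<in>Fs. \<bar>lf (cm_functional \<iota> f) 0 t x\<bar> * norm (\<iota> f))"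
    by (intro in_all_Lp_sum in_all_Lp_mult in_all_Lp_const in_all_Lp_abs gaussian_in_all_Lp[OF gaussian_family_V] lf_V assms)
  show "(\<lambda>x. norm (P (B t x))) \<in> borel_measurable M"
    by (intro measurable_norm_comp P_measurable B_measurable assms)
  have "norm (P (B t x)) \<le> (\<Sum>f\<in>Fs. \<bar>lf (cm_functional \<iota> f) 0 t x\<bar> * norm (\<iota> f))" for x
    unfolding P_exp using norm_sum[of "\<lambda>f. cm_functional \<iota> f (B t x) *\<^sub>R \<iota> f" Fs] by (simp add: lf_def)
  then show "AE x in M. \<bar>norm (P (B t x))\<bar> \<le> \<bar>\<Sum>f\<in>Fs. \<bar>lf (cm_functional \<iota> f) 0 t x\<bar> * norm (\<iota> f)\<bar>"
    by (intro AE_I2) (simp add: order_trans[OF _ abs_ge_self])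
qed

lemma \<omega>_component_in_all_Lp:
  assumes w: "in_all_Lp M (\<lambda>x. norm (w x))" "w \<in> borel_measurable M" and st: "0 \<le> s" "0 \<le> t"
  shows "in_all_Lp M (\<lambda>x. inner (\<omega> (w x) (P (B t x - B s x))) e)"
proof -
  obtain K where K: "K > 0" "\<And>a b. norm (\<omega> a b) \<le> norm a * norm b * K" using om.pos_bounded by blast
  have "in_all_Lp M (\<lambda>x. inner (\<omega> (w x) (\<iota> f)) e)" for f
  proof (rule in_all_Lp_bound[OF in_all_Lp_mult[OF w(1) in_all_Lp_const[of "norm (\<iota> f) * K * norm e"]]])
    have "continuous_on UNIV (\<lambda>w. inner (\<omega> w (\<iota> f)) e)"
      by (intro continuous_intros linear_continuous_on om.bounded_linear_left)
    from measurable_compose[OF w(2) borel_measurable_continuous_onI[OF this]]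
    show "(\<lambda>x. inner (\<omega> (w x) (\<iota> f)) e) \<in> borel_measurable M" .
    have "\<bar>inner (\<omega> a (\<iota> f)) e\<bar> \<le> norm a * (norm (\<iota> f) * K * norm e)" for a
    proof -
      have "\<bar>inner (\<omega> a (\<iota> f)) e\<bar> \<le> norm (\<omega> a (\<iota> f)) * norm e" by (rule Cauchy_Schwarz_ineq2)
      also have "\<dots> \<le> (norm a * norm (\<iota> f) * K) * norm e" using K(2) by (intro mult_right_mono) auto
      finally show ?thesis by (simp add: mult_ac)
    qed
    then show "AE x in M. \<bar>inner (\<omega> (w x) (\<iota> f)) e\<bar> \<le> \<bar>norm (w x) * (norm (\<iota> f) * K * norm e)\<bar>"
      by (intro AE_I2) (rule order_trans[OF _ abs_ge_self])
  qed
  then show ?thesis unfolding \<omega>_P_expand by (intro in_all_Lp_sum in_all_Lp_mult dB_in_all_Lp st)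
qed

lemma S_in_all_Lp: "in_all_Lp M (\<lambda>x. inner (S k x) e)"
  unfolding S_component
  by (intro in_all_Lp_sum \<omega>_component_in_all_Lp P_B_in_all_Lp P_measurable B_measurable tt_nonneg)

lemma J_measurable: "J T \<in> borel_measurable M"
  using ito T by (simp add: ito_integral_def)

text \<open>The Riemann sums are compared with the l-th simple integral in the definition of J. The
  difference is one elementary integral, so its size is controlled by the distance of the
  integrands, which splits at the true path: one part tends to 0 with l, the other is the Riemann
  energy. Letting l grow for fixed k leaves only the latter.\<close>

lemma Riemann_sums_converge:
  assumes e: "norm e \<le> 1"
  shows "\<exists>D\<ge>0. \<forall>k. (\<integral>\<^sup>+x. ennreal ((inner (S k x) e - inner (J T x) e)\<^sup>2) \<partial>M) \<le> ennreal (D / 2 ^ k)"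
proof -
  obtain C where CB: "C \<ge> 0 \<and> (\<forall>K a b \<eta>. finite (K :: (nat + nat) set) \<longrightarrow> (\<forall>i\<in>K. 0 \<le> a i \<and> a i \<le> b i \<and> \<eta> i \<in> borel_measurable (\<F> (a i)) \<and> in_all_Lp M (\<lambda>x. norm (\<eta> i x))) \<longrightarrow>
     ennreal (\<E> x. (\<Sum>i\<in>K. inner (\<omega> (\<eta> i x) (P (B (b i) x - B (a i) x))) e)\<^sup>2)
     \<le> ennreal C * (\<integral>\<^sup>+x. \<integral>\<^sup>+s. ennreal ((norm (\<Sum>i\<in>K. indicator {a i<..b i} s *\<^sub>R \<eta> i x))\<^sup>2) \<partial>lborel \<partial>M))"
    using integral_bound[of e] by (elim exE)
  note C = conjunct1[OF CB] and bound = conjunct2[OF CB, rule_format]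
  obtain D where DB: "D \<ge> 0 \<and> (\<forall>k. (\<integral>\<^sup>+x. \<integral>\<^sup>+s. ennreal ((norm (P (Bt s x) - P (Bstep k s x)))\<^sup>2) \<partial>lborel \<partial>M) \<le> ennreal (D / 2 ^ k))"
    using Riemann_energy by (elim exE)
  note D = conjunct1[OF DB] conjunct2[OF DB, rule_format]
  obtain n :: "nat \<Rightarrow> nat" and \<tau> :: "nat \<Rightarrow> nat \<Rightarrow> real" and \<eta> :: "nat \<Rightarrow> nat \<Rightarrow> 's \<Rightarrow> 'w" where
    ad: "\<And>l. adapted_simple M \<F> (n l) (\<tau> l) (\<eta> l)"
    and lim1: "(\<lambda>l. \<integral>\<^sup>+x. (\<integral>\<^sup>+s\<in>{0..T}. ennreal ((norm (simple_process (n l) (\<tau> l) (\<eta> l) s x - P (B s x)))\<^sup>2) \<partial>lborel) \<partial>M) \<longlonglongrightarrow> 0"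
    and lim2: "(\<lambda>l. \<integral>\<^sup>+x. ennreal ((norm (simple_integral \<omega> (n l) (\<tau> l) (\<eta> l) (\<lambda>t x. P (B t x)) T x - J T x))\<^sup>2) \<partial>M) \<longlonglongrightarrow> 0"
  proof -
    from ito[unfolded ito_integral_def, THEN conjunct2, THEN conjunct2, rule_format, OF T] obtain n \<tau> \<eta> where *: "(\<forall>k. adapted_simple M \<F> (n k) (\<tau> k) (\<eta> k)) \<and>
        (\<lambda>k. \<integral>\<^sup>+x. (\<integral>\<^sup>+s\<in>{0..T}. ennreal ((norm (simple_process (n k) (\<tau> k) (\<eta> k) s x - P (B s x)))\<^sup>2)
               \<partial>lborel) \<partial>M) \<longlonglongrightarrow> 0 \<and>
        (\<forall>t\<in>{0..T}.
          (\<lambda>k. \<integral>\<^sup>+x. ennreal ((norm (simple_integral \<omega> (n k) (\<tau> k) (\<eta> k) (\<lambda>t x. P (B t x)) t x - J t x))\<^sup>2) \<partial>M)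
            \<longlonglongrightarrow> 0)" by (elim exE)
    have "T \<in> {0..T}" using T by simp
    then show thesis using that[of n \<tau> \<eta>] * by blast
  qed
  let ?sq = "\<lambda>k x. ennreal ((inner (S k x) e - inner (J T x) e)\<^sup>2)" and ?si = "\<lambda>l x. simple_integral \<omega> (n l) (\<tau> l) (\<eta> l) (\<lambda>t x. P (B t x)) T x"
    and ?pr = "\<lambda>l x. \<integral>\<^sup>+s\<in>{0..T}. ennreal ((norm (simple_process (n l) (\<tau> l) (\<eta> l) s x - P (B s x)))\<^sup>2) \<partial>lborel"
  have Jm[measurable]: "(\<lambda>x. inner (J T x) e) \<in> borel_measurable M"
    by (intro borel_measurable_inner J_measurable borel_measurable_const)
  have main: "(\<integral>\<^sup>+x. ?sq k x \<partial>M)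
     \<le> (2 * (\<integral>\<^sup>+x. ennreal ((norm (?si l x - J T x))\<^sup>2) \<partial>M)
       + ennreal (4 * C) * (\<integral>\<^sup>+x. ?pr l x \<partial>M))
       + ennreal (4 * C) * ennreal (D / 2 ^ k)" for k l
  proof -
    have \<tau>0: "0 \<le> \<tau> l 0" and \<tau>i: "incseq (\<tau> l)" and \<eta>\<F>: "\<And>j. j < n l \<Longrightarrow> \<eta> l j \<in> borel_measurable (\<F> (\<tau> l j))"
      and \<eta>b: "\<And>j. j < n l \<Longrightarrow> \<exists>K. \<forall>x\<in>space M. norm (\<eta> l j x) \<le> K"
      using ad[of l] unfolding adapted_simple_def by blast+
    have \<tau>n: "0 \<le> \<tau> l j" for j using incseqD[OF \<tau>i, of 0 j] \<tau>0 by simp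
    have \<tau>S: "\<tau> l j \<le> \<tau> l (Suc j)" for j using incseqD[OF \<tau>i, of j "Suc j"] by simp
    have \<eta>M: "\<eta> l j \<in> borel_measurable M" if "j < n l" for j by (rule measurable_from_F[OF \<tau>n \<eta>\<F>[OF that]])
    have \<eta>L: "in_all_Lp M (\<lambda>x. norm (\<eta> l j x))" if j: "j < n l" for j
    proof -
      obtain K where K: "\<And>x. x \<in> space M \<Longrightarrow> norm (\<eta> l j x) \<le> K" using \<eta>b[OF j] by blast
      show ?thesis
      proof (rule in_all_Lp_bound[OF in_all_Lp_const[of K]])
        show "(\<lambda>x. norm (\<eta> l j x)) \<in> borel_measurable M" by (intro measurable_norm_comp \<eta>M[OF j])
        show "AE x in M. \<bar>norm (\<eta> l j x)\<bar> \<le> \<bar>K\<bar>" using K by (intro AE_I2) (simp add: order_trans[OF _ abs_ge_self])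
      qed
    qed
    \<comment> \<open>Cells that start after T are dropped and the remaining ones are cut at T. This
      alters neither the integral up to T nor the integrand on [0, T], and it keeps the endpoints in
      order.\<close>
    define A where "A = {j. j < n l \<and> \<tau> l j \<le> T}"
    define K where "K = A <+> {..<2 ^ k :: nat}"
    define a where "a i = (case i of Inl j \<Rightarrow> \<tau> l j | Inr j \<Rightarrow> tt k j)" for i
    define b where "b i = (case i of Inl j \<Rightarrow> min T (\<tau> l (Suc j)) | Inr j \<Rightarrow> tt k (Suc j))" for i
    \<comment> \<open>The Riemann integrand enters with a minus sign, so the sum over K is the
      difference of the two integrals.\<close>
    define \<zeta> where "\<zeta> i = (case i of Inl j \<Rightarrow> \<eta> l j | Inr j \<Rightarrow> (\<lambda>x. P (- B (tt k j) x)))" for i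
    have A: "finite A" by (simp add: A_def)
    have K: "finite K" unfolding K_def using A by (intro finite_Plus) auto
    have PF: "(\<lambda>x. P (- B t x)) \<in> borel_measurable (\<F> t)" if "0 \<le> t" for t
    proof -
      have "B t \<in> borel_measurable (\<F> t)"
        by (rule measurable_compose[OF X_measurable_F[OF that order_refl] borel_measurable_continuous_onI]) (intro continuous_intros)
      then show ?thesis by (intro P_measurable borel_measurable_uminus)
    qed
    have adm: "0 \<le> a i \<and> a i \<le> b i \<and> \<zeta> i \<in> borel_measurable (\<F> (a i)) \<and> in_all_Lp M (\<lambda>x. norm (\<zeta> i x))" if "i \<in> K" for i
    proof (cases i)
      case (Inl j)
      then have "j < n l" "\<tau> l j \<le> T" using that by (auto simp: K_def A_def)
      then show ?thesis using Inl \<tau>n \<tau>S \<eta>\<F> \<eta>L by (simp add: a_def b_def \<zeta>_def)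
    next
      case (Inr j)
      have "in_all_Lp M (\<lambda>x. norm (P (- B (tt k j) x)))" using P_B_in_all_Lp[OF tt_nonneg] by (simp add: blinfun.minus_right)
      then show ?thesis using Inr tt_nonneg PF[OF tt_nonneg] tt_mono[of j "Suc j" k] by (simp add: a_def b_def \<zeta>_def)
    qed
    define H where "H s x = simple_process (n l) (\<tau> l) (\<eta> l) s x" for s x
    define SI where "SI x = ?si l x" for x
    let ?d = "\<lambda>x. inner (SI x) e - inner (S k x) e"
    have sum1: "(\<Sum>i\<in>K. inner (\<omega> (\<zeta> i x) (P (B (b i) x - B (a i) x))) e) = ?d x" for x
    proof -
      have "(\<Sum>j\<in>A. inner (\<omega> (\<eta> l j x) (P (B (min T (\<tau> l (Suc j))) x - B (\<tau> l j) x))) e)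
        = (\<Sum>j<n l. inner (\<omega> (\<eta> l j x) (P (B (min T (\<tau> l (Suc j))) x) - P (B (min T (\<tau> l j)) x))) e)"
      proof (rule sum.mono_neutral_cong_left)
        show "\<forall>j\<in>{..<n l} - A. inner (\<omega> (\<eta> l j x) (P (B (min T (\<tau> l (Suc j))) x) - P (B (min T (\<tau> l j)) x))) e = 0"
        proof
          fix j assume "j \<in> {..<n l} - A"
          then have "\<tau> l j > T" by (auto simp: A_def)
          then have "min T (\<tau> l (Suc j)) = T" "min T (\<tau> l j) = T" using \<tau>S[of j] by auto
          then show "inner (\<omega> (\<eta> l j x) (P (B (min T (\<tau> l (Suc j))) x) - P (B (min T (\<tau> l j)) x))) e = 0" by (simp add: om.zero_right)
        qed
      qed (auto simp: A_def blinfun.diff_right min_def)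
      moreover have "(\<Sum>j<2 ^ k. inner (\<omega> (P (- B (tt k j) x)) (P (B (tt k (Suc j)) x - B (tt k j) x))) e) = - inner (S k x) e"
        unfolding S_component by (simp add: blinfun.minus_right om.minus_left sum_negf)
      ultimately show ?thesis unfolding K_def SI_def simple_integral_def
        using A by (simp add: sum.Plus a_def b_def \<zeta>_def inner_sum_left)
    qed
    define Ht where "Ht s x = indicator {0..T} s *\<^sub>R H s x" for s x
    have sum2: "(\<Sum>i\<in>K. indicator {a i<..b i} s *\<^sub>R \<zeta> i x) = Ht s x - P (Bstep k s x)" for s x
    proof -
      have "(\<Sum>j\<in>A. indicator {\<tau> l j<..min T (\<tau> l (Suc j))} s *\<^sub>R \<eta> l j x)
        = (\<Sum>j<n l. indicator {0..T} s *\<^sub>R (indicator {\<tau> l j<..\<tau> l (Suc j)} s *\<^sub>R \<eta> l j x))"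
      proof (rule sum.mono_neutral_cong_left)
        show "\<forall>j\<in>{..<n l} - A. indicator {0..T} s *\<^sub>R (indicator {\<tau> l j<..\<tau> l (Suc j)} s *\<^sub>R \<eta> l j x) = 0"
          by (auto simp: A_def indicator_def)
        show "indicator {\<tau> l j<..min T (\<tau> l (Suc j))} s *\<^sub>R \<eta> l j x =
            indicator {0..T} s *\<^sub>R (indicator {\<tau> l j<..\<tau> l (Suc j)} s *\<^sub>R \<eta> l j x)" for j
          using \<tau>n[of j] by (auto simp: indicator_def)
      qed (auto simp: A_def)
      moreover have "(\<Sum>j<2 ^ k. indicator {tt k j<..tt k (Suc j)} s *\<^sub>R P (- B (tt k j) x)) = - P (Bstep k s x)"
        by (simp add: Bstep_def blinfun.sum_right blinfun.minus_right blinfun.scaleR_right sum_negf)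
      moreover have "(\<Sum>i\<in>K. indicator {a i<..b i} s *\<^sub>R \<zeta> i x) =
          (\<Sum>j\<in>A. indicator {\<tau> l j<..min T (\<tau> l (Suc j))} s *\<^sub>R \<eta> l j x) +
          (\<Sum>j<2 ^ k. indicator {tt k j<..tt k (Suc j)} s *\<^sub>R P (- B (tt k j) x))"
        unfolding K_def sum.Plus[OF A finite_lessThan] by (simp only: o_def a_def b_def \<zeta>_def sum.case)
      ultimately show ?thesis unfolding Ht_def H_def simple_process_def by (simp only: scaleR_sum_right add_uminus_conv_diff)
    qed
    have Htm: "(\<lambda>p. Ht (snd p) (fst p)) \<in> borel_measurable (M \<Otimes>\<^sub>M lborel)" unfolding Ht_def H_def simple_process_def
    proof (intro borel_measurable_scaleR borel_measurable_sum)
      fix j assume j: "j \<in> {..<n l}"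
      show "(\<lambda>p. \<eta> l j (fst p)) \<in> borel_measurable (M \<Otimes>\<^sub>M lborel)"
        using j by (intro measurable_compose[OF measurable_fst \<eta>M]) auto
    qed measurable
    define f1 where "f1 p = ennreal ((norm (Ht (snd p) (fst p) - P (Bt (snd p) (fst p))))\<^sup>2)" for p
    define f2 where "f2 p = ennreal ((norm (P (Bt (snd p) (fst p)) - P (Bstep k (snd p) (fst p))))\<^sup>2)" for p
    have f1m: "f1 \<in> borel_measurable (M \<Otimes>\<^sub>M lborel)" unfolding f1_def
      by (intro measurable_compose[OF _ measurable_ennreal] borel_measurable_power measurable_norm_comp borel_measurable_diff
          P_measurable Bt_measurable Htm)
    have f2m: "f2 \<in> borel_measurable (M \<Otimes>\<^sub>M lborel)" unfolding f2_def
      by (intro measurable_compose[OF _ measurable_ennreal] borel_measurable_power measurable_norm_comp borel_measurable_diff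
          P_measurable Bt_measurable Bstep_measurable)
    let ?i1 = "\<integral>\<^sup>+p. f1 p \<partial>(M \<Otimes>\<^sub>M lborel)" and ?i2 = "\<integral>\<^sup>+p. f2 p \<partial>(M \<Otimes>\<^sub>M lborel)"
    have i1: "?i1 = (\<integral>\<^sup>+x. (\<integral>\<^sup>+s\<in>{0..T}. ennreal ((norm (H s x - P (B s x)))\<^sup>2) \<partial>lborel) \<partial>M)"
      unfolding lborel.nn_integral_fst[OF f1m, symmetric]
      by (intro nn_integral_cong) (auto simp: f1_def Ht_def Bt_def indicator_def)
    have i2: "?i2 \<le> ennreal (D / 2 ^ k)"
      unfolding lborel.nn_integral_fst[OF f2m, symmetric] using D(2)[of k] by (simp add: f2_def)
    have "ennreal (\<E> x. (?d x)\<^sup>2)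
      \<le> ennreal C * (\<integral>\<^sup>+x. \<integral>\<^sup>+s. ennreal ((norm (Ht s x - P (Bstep k s x)))\<^sup>2) \<partial>lborel \<partial>M)"
      unfolding sum1[symmetric] sum2[symmetric] by (rule bound[of K a b \<zeta>, OF K adm])
    also have "\<dots> \<le> ennreal C * (\<integral>\<^sup>+x. \<integral>\<^sup>+s. (2 * f1 (x, s) + 2 * f2 (x, s)) \<partial>lborel \<partial>M)"
    proof (intro mult_left_mono nn_integral_mono)
      fix x s
      define y z where "y = norm (Ht s x - P (Bt s x))" and "z = norm (P (Bt s x) - P (Bstep k s x))"
      have "norm (Ht s x - P (Bstep k s x)) \<le> y + z" unfolding y_def z_def
        using norm_triangle_ineq[of "Ht s x - P (Bt s x)" "P (Bt s x) - P (Bstep k s x)"] by simp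
      then have "(norm (Ht s x - P (Bstep k s x)))\<^sup>2 \<le> (y + z)\<^sup>2" by (intro power_mono) auto
      also have "\<dots> \<le> 2 * y\<^sup>2 + 2 * z\<^sup>2" using sum_squares_bound[of y z] by (simp add: power2_sum)
      finally have "ennreal ((norm (Ht s x - P (Bstep k s x)))\<^sup>2) \<le> ennreal (2 * y\<^sup>2 + 2 * z\<^sup>2)" by (rule ennreal_leI)
      also have "\<dots> = 2 * f1 (x, s) + 2 * f2 (x, s)"
        unfolding f1_def f2_def y_def z_def by (simp add: ennreal_plus ennreal_mult)
      finally show "ennreal ((norm (Ht s x - P (Bstep k s x)))\<^sup>2) \<le> 2 * f1 (x, s) + 2 * f2 (x, s)" .
    qed simp
    also have "(\<integral>\<^sup>+x. \<integral>\<^sup>+s. (2 * f1 (x, s) + 2 * f2 (x, s)) \<partial>lborel \<partial>M) = (\<integral>\<^sup>+p. 2 * f1 p + 2 * f2 p \<partial>(M \<Otimes>\<^sub>M lborel))"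
      by (rule lborel.nn_integral_fst[of "\<lambda>p. 2 * f1 p + 2 * f2 p"]) (use f1m f2m in measurable)
    also have "\<dots> = 2 * ?i1 + 2 * ?i2"
      using f1m f2m by (simp add: nn_integral_add nn_integral_cmult)
    finally have e1: "ennreal (\<E> x. (?d x)\<^sup>2)
      \<le> ennreal C * (2 * ?i1 + 2 * ennreal (D / 2 ^ k))"
      by (rule order_trans) (intro mult_left_mono add_left_mono i2, auto)
    have SIL: "in_all_Lp M (\<lambda>x. inner (SI x) e)"
    proof -
      have "in_all_Lp M (\<lambda>x. \<Sum>j<n l. inner (\<omega> (\<eta> l j x) (P (B (min T (\<tau> l (Suc j))) x - B (min T (\<tau> l j)) x))) e)"
        using T \<tau>n by (intro in_all_Lp_sum \<omega>_component_in_all_Lp \<eta>L \<eta>M) auto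
      then show ?thesis by (simp add: SI_def simple_integral_def inner_sum_left blinfun.diff_right)
    qed
    have SSm: "(\<lambda>x. inner (SI x) e) \<in> borel_measurable M" "(\<lambda>x. inner (S k x) e) \<in> borel_measurable M"
      using in_all_LpD(1)[OF SIL] in_all_LpD(1)[OF S_in_all_Lp] by auto
    have L2d: "L2 M (\<lambda>x. ?d x)" by (intro L2_diff in_all_LpD(4) SIL S_in_all_Lp)
    have e2: "(\<integral>\<^sup>+x. ennreal ((?d x)\<^sup>2) \<partial>M) = ennreal (\<E> x. (?d x)\<^sup>2)"
      by (intro nn_integral_eq_integral L2_integrable[OF L2d]) auto
    have "(\<integral>\<^sup>+x. ?sq k x \<partial>M)
      \<le> (\<integral>\<^sup>+x. 2 * ennreal ((norm (SI x - J T x))\<^sup>2) + 2 * ennreal ((?d x)\<^sup>2) \<partial>M)"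
    proof (intro nn_integral_mono)
      fix x
      define y z where "y = inner (SI x) e - inner (J T x) e" and "z = ?d x"
      have "\<bar>y\<bar> \<le> norm (SI x - J T x) * norm e"
        unfolding y_def inner_diff_left[symmetric] by (rule Cauchy_Schwarz_ineq2)
      also have "\<dots> \<le> norm (SI x - J T x)" using e mult_left_mono[OF e, of "norm (SI x - J T x)"] by simp
      finally have "\<bar>y\<bar>\<^sup>2 \<le> (norm (SI x - J T x))\<^sup>2" by (intro power_mono) auto
      moreover have "(inner (S k x) e - inner (J T x) e)\<^sup>2 \<le> 2 * y\<^sup>2 + 2 * z\<^sup>2"
      proof -
        have "(y - z)\<^sup>2 \<le> 2 * y\<^sup>2 + 2 * z\<^sup>2" using sum_squares_bound[of y "- z"] by (simp add: power2_diff)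
        then show ?thesis by (simp add: y_def z_def)
      qed
      ultimately have "(inner (S k x) e - inner (J T x) e)\<^sup>2 \<le> 2 * (norm (SI x - J T x))\<^sup>2 + 2 * z\<^sup>2" by simp
      then have "?sq k x \<le> ennreal (2 * (norm (SI x - J T x))\<^sup>2 + 2 * z\<^sup>2)" by (rule ennreal_leI)
      also have "\<dots> = 2 * ennreal ((norm (SI x - J T x))\<^sup>2) + 2 * ennreal (z\<^sup>2)" by (simp add: ennreal_plus ennreal_mult)
      finally show "?sq k x
        \<le> 2 * ennreal ((norm (SI x - J T x))\<^sup>2) + 2 * ennreal ((?d x)\<^sup>2)" by (simp add: z_def)
    qed
    also have "\<dots> = 2 * (\<integral>\<^sup>+x. ennreal ((norm (SI x - J T x))\<^sup>2) \<partial>M) + 2 * (\<integral>\<^sup>+x. ennreal ((?d x)\<^sup>2) \<partial>M)"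
    proof -
      have SIm: "SI \<in> borel_measurable M" unfolding SI_def simple_integral_def
      proof (intro borel_measurable_sum)
        fix j assume "j \<in> {..<n l}"
        then have 1: "\<eta> l j \<in> borel_measurable M" by (intro \<eta>M) auto
        have 2: "(\<lambda>x. P (B (min T (\<tau> l (Suc j))) x) - P (B (min T (\<tau> l j)) x)) \<in> borel_measurable M"
          using T \<tau>n by (intro borel_measurable_diff P_measurable B_measurable) auto
        show "(\<lambda>x. \<omega> (\<eta> l j x) (P (B (min T (\<tau> l (Suc j))) x) - P (B (min T (\<tau> l j)) x))) \<in> borel_measurable M"
          by (rule borel_measurable_continuous_Pair[OF 1 2]) (intro om.continuous_on continuous_intros)
      qed
      have m1: "(\<lambda>x. ennreal ((norm (SI x - J T x))\<^sup>2)) \<in> borel_measurable M"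
        using SIm J_measurable by measurable
      have m2: "(\<lambda>x. ennreal ((?d x)\<^sup>2)) \<in> borel_measurable M"
        using SSm by measurable
      show ?thesis using m1 m2 by (simp add: nn_integral_add nn_integral_cmult)
    qed
    also have "\<dots> \<le> 2 * (\<integral>\<^sup>+x. ennreal ((norm (SI x - J T x))\<^sup>2) \<partial>M)
       + 2 * (ennreal C * (2 * ?i1 + 2 * ennreal (D / 2 ^ k)))"
      unfolding e2 by (intro add_left_mono mult_left_mono e1) auto
    also have "\<dots> = (2 * (\<integral>\<^sup>+x. ennreal ((norm (SI x - J T x))\<^sup>2) \<partial>M) + ennreal (4 * C) * ?i1)
       + ennreal (4 * C) * ennreal (D / 2 ^ k)"
    proof -
      have "ennreal (4 * C) = 4 * ennreal C" using C by (simp add: ennreal_mult)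
      then show ?thesis by (simp add: distrib_left mult_ac add_ac)
    qed
    finally show ?thesis unfolding i1 SI_def H_def .
  qed
  \<comment> \<open>Passing to the limit in l in \<open>main\<close>: the approximation errors
    vanish and the constant 4 C D remains.\<close>
  have "(\<integral>\<^sup>+x. ?sq k x \<partial>M) \<le> ennreal (4 * C * D / 2 ^ k)" for k
  proof -
    have "(\<lambda>l. (2 * (\<integral>\<^sup>+x. ennreal ((norm (?si l x - J T x))\<^sup>2) \<partial>M)
       + ennreal (4 * C) * (\<integral>\<^sup>+x. ?pr l x \<partial>M))
       + ennreal (4 * C) * ennreal (D / 2 ^ k)) \<longlonglongrightarrow> (2 * 0 + ennreal (4 * C) * 0) + ennreal (4 * C) * ennreal (D / 2 ^ k)"
      by (intro tendsto_add tendsto_const ennreal_tendsto_cmult lim1 lim2) auto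
    from LIMSEQ_le_const[OF this] main[of k]
    have "(\<integral>\<^sup>+x. ?sq k x \<partial>M) \<le> (2 * 0 + ennreal (4 * C) * 0) + ennreal (4 * C) * ennreal (D / 2 ^ k)"
      by blast
    then show ?thesis using C D(1) by (simp add: ennreal_mult[symmetric])
  qed
  moreover have "4 * C * D \<ge> 0" using C D(1) by simp
  ultimately show ?thesis by blast
qed

end

section \<open>Moments of mean square limits\<close>

lemma (in prob_space) L2_of_nn_bound:
  assumes [measurable]: "f \<in> borel_measurable M" and c: "0 \<le> c" "(\<integral>\<^sup>+x. ennreal ((f x)\<^sup>2) \<partial>M) \<le> ennreal c"
  shows "L2 M f" "(\<E> x. (f x)\<^sup>2) \<le> c"
proof -
  have i: "integrable M (\<lambda>x. (f x)\<^sup>2)"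
  proof (rule integrableI_bounded)
    show "(\<integral>\<^sup>+x. ennreal (norm ((f x)\<^sup>2)) \<partial>M) < \<infinity>" using c by (simp add: le_less_trans[OF _ ennreal_less_top])
  qed measurable
  then show "L2 M f" by (simp add: L2_def)
  have "ennreal (\<E> x. (f x)\<^sup>2) = (\<integral>\<^sup>+x. ennreal ((f x)\<^sup>2) \<partial>M)" using i by (intro nn_integral_eq_integral[symmetric]) auto
  then have "ennreal (\<E> x. (f x)\<^sup>2) \<le> ennreal c" using c(2) by (simp only:)
  then show "(\<E> x. (f x)\<^sup>2) \<le> c" by (simp only: ennreal_le_iff[OF c(1)])
qed

text \<open>Fatou's lemma along an almost surely convergent subsequence transfers uniform bounds on
  even moments; these dominate all others.\<close>

lemma (in prob_space) in_all_Lp_L2_limit: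
  assumes Z: "\<And>n. in_all_Lp M (Z n)" and Y: "L2 M Y" and lim: "(\<lambda>n. \<E> x. (Z n x - Y x)\<^sup>2) \<longlonglongrightarrow> 0"
    and bd: "\<And>p. \<exists>C. \<forall>n. (\<E> x. (Z n x) ^ (2 * p)) \<le> C"
  shows "in_all_Lp M Y"
  unfolding in_all_Lp_iff
proof (intro conjI allI)
  show Ym[measurable]: "Y \<in> borel_measurable M" using Y by (simp add: L2_def)
  have Zm[measurable]: "Z n \<in> borel_measurable M" for n using in_all_LpD(1)[OF Z] .
  fix p
  obtain r where r: "strict_mono r" "AE x in M. (\<lambda>n. Z (r n) x) \<longlonglongrightarrow> Y x"
    using L2_limit_AE_subseq[OF in_all_LpD(4)[OF Z] Y lim] by blast
  obtain C where C: "\<And>n. (\<E> x. (Z n x) ^ (2 * p)) \<le> C" using bd[of p] by blast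
  have "(\<integral>\<^sup>+x. ennreal (Y x ^ (2 * p)) \<partial>M) = (\<integral>\<^sup>+x. liminf (\<lambda>n. ennreal (Z (r n) x ^ (2 * p))) \<partial>M)"
  proof (rule nn_integral_cong_AE)
    show "AE x in M. ennreal (Y x ^ (2 * p)) = liminf (\<lambda>n. ennreal (Z (r n) x ^ (2 * p)))"
      using r(2)
    proof eventually_elim
      case (elim x)
      have "(\<lambda>n. ennreal (Z (r n) x ^ (2 * p))) \<longlonglongrightarrow> ennreal (Y x ^ (2 * p))" by (intro tendsto_ennrealI tendsto_power elim)
      then show ?case by (rule lim_imp_Liminf[OF sequentially_bot, symmetric])
    qed
  qed
  also have "\<dots> \<le> liminf (\<lambda>n. \<integral>\<^sup>+x. ennreal (Z (r n) x ^ (2 * p)) \<partial>M)" by (rule nn_integral_liminf) measurable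
  also have "\<dots> \<le> liminf (\<lambda>n. ennreal C)"
  proof (intro Liminf_mono always_eventually allI)
    fix n
    have "(\<integral>\<^sup>+x. ennreal (Z (r n) x ^ (2 * p)) \<partial>M) = ennreal (\<E> x. Z (r n) x ^ (2 * p))"
      by (intro nn_integral_eq_integral in_all_LpD(3) in_all_Lp_power Z AE_I2) (simp add: power_mult)
    also have "\<dots> \<le> ennreal C" by (intro ennreal_leI C)
    finally show "(\<integral>\<^sup>+x. ennreal (Z (r n) x ^ (2 * p)) \<partial>M) \<le> ennreal C" .
  qed
  also have "\<dots> = ennreal C" by (simp add: Liminf_const)
  finally have fin: "(\<integral>\<^sup>+x. ennreal (Y x ^ (2 * p)) \<partial>M) < \<infinity>" by (rule le_less_trans) simp
  have i: "integrable M (\<lambda>x. 1 + Y x ^ (2 * p))"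
  proof (intro Bochner_Integration.integrable_add integrable_const integrableI_bounded)
    have "norm (Y x ^ (2 * p)) = Y x ^ (2 * p)" for x by (simp add: power_mult)
    then show "(\<integral>\<^sup>+x. ennreal (norm (Y x ^ (2 * p))) \<partial>M) < \<infinity>" using fin by (simp only:)
  qed measurable
  show "integrable M (\<lambda>x. \<bar>Y x\<bar> ^ p)"
  proof (rule Bochner_Integration.integrable_bound[OF i])
    have "y ^ p \<le> 1 + y ^ (2 * p)" if "y \<ge> 0" for y :: real
    proof (cases "y \<le> 1")
      case True
      then have "y ^ p \<le> 1" using that by (intro power_le_one)
      moreover have "0 \<le> y ^ (2 * p)" using that by simp
      ultimately show ?thesis by linarith
    next
      case False
      then have "y ^ p \<le> y ^ (2 * p)" by (intro power_increasing) auto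
      then show ?thesis by simp
    qed
    from this[of "\<bar>Y _\<bar>"] show "AE x in M. norm (\<bar>Y x\<bar> ^ p) \<le> norm (1 + Y x ^ (2 * p))"
      by (intro AE_I2) (simp add: power_mult)
  qed measurable
qed

text \<open>The sum is at most card K times its largest term. The summand 1 covers the empty sum
  with exponent 0.\<close>

lemma power_sum_le:
  fixes y :: "'i \<Rightarrow> real"
  assumes "finite K"
  shows "(\<Sum>i\<in>K. y i) ^ (2 * p) \<le> 1 + real (card K) ^ (2 * p) * (\<Sum>i\<in>K. y i ^ (2 * p))"
proof (cases "K = {}")
  case False
  define m where "m = Max ((\<lambda>i. \<bar>y i\<bar>) ` K)"
  have "m \<in> (\<lambda>i. \<bar>y i\<bar>) ` K" unfolding m_def using assms False by (intro Max_in) auto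
  then obtain j where j: "j \<in> K" "m = \<bar>y j\<bar>" by auto
  have "\<bar>y i\<bar> \<le> m" if "i \<in> K" for i unfolding m_def using assms that by (intro Max_ge) auto
  then have "(\<Sum>i\<in>K. \<bar>y i\<bar>) \<le> real (card K) * m"
    using sum_bounded_above[of K "\<lambda>i. \<bar>y i\<bar>" m] by simp
  with sum_abs[of y K] have "\<bar>\<Sum>i\<in>K. y i\<bar> \<le> real (card K) * m" by (rule order_trans)
  then have "\<bar>\<Sum>i\<in>K. y i\<bar> ^ (2 * p) \<le> (real (card K) * m) ^ (2 * p)" by (intro power_mono) auto
  also have "\<dots> = real (card K) ^ (2 * p) * y j ^ (2 * p)" using j by (simp add: power_mult_distrib power_mult)
  also have "y j ^ (2 * p) \<le> (\<Sum>i\<in>K. y i ^ (2 * p))" using assms j by (intro member_le_sum) (auto simp: power_mult)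
  finally have "\<bar>\<Sum>i\<in>K. y i\<bar> ^ (2 * p) \<le> real (card K) ^ (2 * p) * (\<Sum>i\<in>K. y i ^ (2 * p))"
    by (simp add: mult_left_mono)
  then show ?thesis by (simp add: power_mult)
qed (simp add: power_0_left)

context heis_proj
begin

interpretation om: bounded_bilinear \<omega> by (rule bil)

text \<open>Each basis vector f of the projection contributes a scalar discrete integral whose
  integrand is the functional w \<mapsto> inner (\<omega> (P w) (\<iota> f)) e of B, so the Gronwall
  bound applies termwise.\<close>

lemma S_moment_bound: "\<exists>C. \<forall>k. (\<E> x. (inner (S k x) e) ^ (2 * p)) \<le> C"
proof -
  define v where "v f = Blinfun (\<lambda>w. inner (\<omega> (P w) (\<iota> f)) e)" for f
  have v: "v f w = inner (\<omega> (P w) (\<iota> f)) e" for f w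
    unfolding v_def
    by (subst bounded_linear_Blinfun_apply)
       (intro bounded_linear_compose[OF bounded_linear_inner_left] bounded_linear_compose[OF om.bounded_linear_left] blinfun.bounded_linear_right, rule refl)
  define Y where "Y k f x = (\<Sum>j<2 ^ k. lf (v f) 0 (tt k j) x * dB (cm_functional \<iota> f) (tt k j) (tt k (Suc j)) x)" for k f x
  have YL: "in_all_Lp M (Y k f)" for k f unfolding Y_def[abs_def]
    by (intro in_all_Lp_sum in_all_Lp_mult gaussian_in_all_Lp[OF gaussian_family_V] lf_V dB_in_all_Lp tt_nonneg)
  have "\<exists>C. \<forall>k. (\<E> x. (Y k f x) ^ (2 * p)) \<le> C" for f
  proof -
    obtain C where C: "\<And>N. N > 0 \<Longrightarrow> (\<E> x. (\<Sum>j<N. lf (v f) 0 (real j * T / real N) x * dB (cm_functional \<iota> f) (real j * T / real N) (real (Suc j) * T / real N) x) ^ (2 * p)) \<le> C"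
      using martingale_moment_bound[OF T, of "v f" "cm_functional \<iota> f" p] by blast
    have "(\<E> x. (Y k f x) ^ (2 * p)) \<le> C" for k using C[of "2 ^ k"] by (simp add: Y_def tt_def)
    then show ?thesis by blast
  qed
  then obtain C where C: "\<And>f k. (\<E> x. (Y k f x) ^ (2 * p)) \<le> C f" by metis
  have S: "inner (S k x) e = (\<Sum>f\<in>Fs. Y k f x)" for k x
    unfolding S_component \<omega>_P_expand Y_def lf_def v by (subst sum.swap) simp
  have "(\<E> x. (inner (S k x) e) ^ (2 * p)) \<le> 1 + real (card Fs) ^ (2 * p) * (\<Sum>f\<in>Fs. C f)" for k
  proof -
    have iY: "integrable M (\<lambda>x. Y k f x ^ (2 * p))" for f by (intro in_all_LpD(3) in_all_Lp_power YL)
    have "(\<E> x. (inner (S k x) e) ^ (2 * p)) \<le> (\<E> x. 1 + real (card Fs) ^ (2 * p) * (\<Sum>f\<in>Fs. Y k f x ^ (2 * p)))"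
    proof (rule integral_mono)
      show "integrable M (\<lambda>x. (inner (S k x) e) ^ (2 * p))" by (intro in_all_LpD(3) in_all_Lp_power S_in_all_Lp)
      show "integrable M (\<lambda>x. 1 + real (card Fs) ^ (2 * p) * (\<Sum>f\<in>Fs. Y k f x ^ (2 * p)))"
        by (intro Bochner_Integration.integrable_add integrable_const integrable_mult_right Bochner_Integration.integrable_sum iY)
      show "(inner (S k x) e) ^ (2 * p) \<le> 1 + real (card Fs) ^ (2 * p) * (\<Sum>f\<in>Fs. Y k f x ^ (2 * p))" for x
        unfolding S by (rule power_sum_le[OF Fs(1)])
    qed
    also have "\<dots> = 1 + real (card Fs) ^ (2 * p) * (\<Sum>f\<in>Fs. (\<E> x. Y k f x ^ (2 * p)))"
      using iY by (subst Bochner_Integration.integral_add) (auto simp: prob_space)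
    also have "\<dots> \<le> 1 + real (card Fs) ^ (2 * p) * (\<Sum>f\<in>Fs. C f)"
      by (intro add_left_mono mult_left_mono sum_mono C) simp
    finally show ?thesis .
  qed
  then show ?thesis by blast
qed

lemma J_approx:
  assumes e: "norm e \<le> 1"
  shows "in_all_Lp M (\<lambda>x. inner (J T x) e)"
    and "(\<lambda>k. \<E> x. (inner (S k x) e - inner (J T x) e)\<^sup>2) \<longlonglongrightarrow> 0"
proof -
  obtain D where D: "D \<ge> 0" "\<And>k. (\<integral>\<^sup>+x. ennreal ((inner (S k x) e - inner (J T x) e)\<^sup>2) \<partial>M) \<le> ennreal (D / 2 ^ k)"
    using Riemann_sums_converge[OF e] by blast
  have Jm: "(\<lambda>x. inner (J T x) e) \<in> borel_measurable M"
    by (intro borel_measurable_inner J_measurable borel_measurable_const)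
  have m: "(\<lambda>x. inner (S k x) e - inner (J T x) e) \<in> borel_measurable M" for k
    by (intro borel_measurable_diff Jm in_all_LpD(1) S_in_all_Lp)
  have Dk: "0 \<le> D / 2 ^ k" for k using D(1) by simp
  note L = L2_of_nn_bound[OF m Dk D(2)]
  have JL: "L2 M (\<lambda>x. inner (J T x) e)"
    using L2_diff[OF in_all_LpD(4)[OF S_in_all_Lp[of 0 e]] L(1)[of 0]] by simp
  show lim: "(\<lambda>k. \<E> x. (inner (S k x) e - inner (J T x) e)\<^sup>2) \<longlonglongrightarrow> 0"
  proof (rule tendsto_sandwich[OF _ _ tendsto_const])
    show "\<forall>\<^sub>F k in sequentially. (\<E> x. (inner (S k x) e - inner (J T x) e)\<^sup>2) \<le> D * (1 / 2) ^ k"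
      using L(2) by (intro always_eventually allI) (simp add: power_divide)
    show "(\<lambda>k. D * (1 / 2) ^ k) \<longlonglongrightarrow> 0"
      by (intro tendsto_mult_right_zero LIMSEQ_power_zero) simp
  qed simp
  show "in_all_Lp M (\<lambda>x. inner (J T x) e)"
    by (rule in_all_Lp_L2_limit[OF S_in_all_Lp JL lim S_moment_bound])
qed

end

context heis_bm
begin

interpretation om: bounded_bilinear \<omega> by (rule bil)

text \<open>The Riemann sum is a function of a path, because it is evaluated both at B and at B with
  one Gaussian direction removed.\<close>

definition RS :: "('w \<Rightarrow>\<^sub>L 'w) \<Rightarrow> nat \<Rightarrow> (real \<Rightarrow> 'w) \<Rightarrow> 'c" where
  "RS P k b = (\<Sum>j<2 ^ k. \<omega> (P (b (tt k j))) (P (b (tt k (Suc j)) - b (tt k j))))"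

lemma norm_EC: "e \<in> EC \<Longrightarrow> norm e = 1"
  using EC(3)[of e e] by (simp add: norm_eq_sqrt_inner)

lemma I_measurable: "I T \<in> borel_measurable M"
  using wi T by (simp add: wiener_ito_integral_def)

text \<open>Two limits, in the mesh and in the projection, are merged into one diagonal sequence
  that converges in mean square for all components at once. This sequence is the only access to I in
  what follows.\<close>

lemma I_approximation:
  shows "e \<in> EC \<Longrightarrow> in_all_Lp M (\<lambda>x. inner (I T x) e)"
    and "\<exists>p P kk. cm_projection_sequence \<iota> p P \<and> (\<forall>n. n \<le> kk n) \<and>
      (\<forall>n. \<forall>e\<in>EC. in_all_Lp M (\<lambda>x. inner (RS (P n) (kk n) (\<lambda>t. B t x)) e)) \<and>
      (\<forall>e\<in>EC. (\<lambda>n. \<E> x. (inner (RS (P n) (kk n) (\<lambda>t. B t x)) e - inner (I T x) e)\<^sup>2) \<longlonglongrightarrow> 0)"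
proof -
  obtain p P J where ps: "cm_projection_sequence \<iota> p P"
    and ito: "\<And>n. ito_integral M \<F> \<omega> (\<lambda>t x. P n (B t x)) (\<lambda>t x. P n (B t x)) (J n)"
    and lim: "\<And>T r. T > 0 \<Longrightarrow> r \<ge> 1 \<Longrightarrow> (\<lambda>n. \<integral>\<^sup>+x. (SUP t\<in>{0..T}. ennreal (norm (J n t x - I t x) powr r)) \<partial>M) \<longlonglongrightarrow> 0"
  proof -
    from wi have "\<exists>p P J. cm_projection_sequence \<iota> p P \<and>
        (\<forall>n. ito_integral M \<F> \<omega> (\<lambda>t x. P n (B t x)) (\<lambda>t x. P n (B t x)) (J n)) \<and>
        (\<forall>T>0. \<forall>r\<ge>1. (\<lambda>n. \<integral>\<^sup>+x. (SUP t\<in>{0..T}. ennreal (norm (J n t x - I t x) powr r)) \<partial>M) \<longlonglongrightarrow> 0)"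
      unfolding wiener_ito_integral_def by (elim conjE)
    then obtain p P J where *: "cm_projection_sequence \<iota> p P \<and>
        (\<forall>n. ito_integral M \<F> \<omega> (\<lambda>t x. P n (B t x)) (\<lambda>t x. P n (B t x)) (J n)) \<and>
        (\<forall>T>0. \<forall>r\<ge>1. (\<lambda>n. \<integral>\<^sup>+x. (SUP t\<in>{0..T}. ennreal (norm (J n t x - I t x) powr r)) \<partial>M) \<longlonglongrightarrow> 0)"
      by (elim exE)
    show thesis by (rule that[of p P J]) (use * in \<open>simp_all\<close>)
  qed
  have "\<exists>Fs. finite Fs \<and> Fs \<subseteq> H_star \<iota> \<and> (\<forall>w. P n w = (\<Sum>f\<in>Fs. cm_functional \<iota> f w *\<^sub>R \<iota> f))" for n
    using ps by (intro projection_expansion[of "p n"]) (simp_all add: cm_projection_sequence_def)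
  then obtain Fs where Fs: "\<And>n. finite (Fs n)" "\<And>n. Fs n \<subseteq> H_star \<iota>"
    "\<And>n w. P n w = (\<Sum>f\<in>Fs n. cm_functional \<iota> f w *\<^sub>R \<iota> f)" by metis
  have hp: "heis_proj M \<iota> \<mu> X \<omega> I T EC (P n) (Fs n) (J n)" for n
    by (rule heis_proj.intro[OF heis_bm_axioms]) (rule heis_proj_axioms.intro[OF Fs(1,2,3) ito])
  have S: "heis_proj.S X \<omega> T (P n) k x = RS (P n) k (\<lambda>t. B t x)" for n k x
    unfolding heis_proj.S_def[OF hp] RS_def ..
  have JL: "in_all_Lp M (\<lambda>x. inner (J n T x) e)" if "e \<in> EC" for n e
    by (rule heis_proj.J_approx(1)[OF hp]) (simp add: norm_EC[OF that])
  let ?r = "\<lambda>n k e x. inner (RS (P n) k (\<lambda>t. B t x)) e"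
  have Jlim: "(\<lambda>k. \<E> x. (?r n k e x - inner (J n T x) e)\<^sup>2) \<longlonglongrightarrow> 0" if "e \<in> EC" for n e
    using heis_proj.J_approx(2)[OF hp, of e n] norm_EC[OF that] unfolding S by simp
  have SL: "in_all_Lp M (\<lambda>x. ?r n k e x)" for n k e
    using heis_proj.S_in_all_Lp[OF hp, of n k e] unfolding S .
  have Jm: "J n T \<in> borel_measurable M" for n by (rule heis_proj.J_measurable[OF hp])
  have lim': "(\<lambda>n. \<integral>\<^sup>+x. ennreal (norm (J n T x - I T x) powr r) \<partial>M) \<longlonglongrightarrow> 0" if "r \<ge> 1" for r
  proof (rule tendsto_sandwich[OF _ _ tendsto_const lim[OF T that]])
    show "\<forall>\<^sub>F n in sequentially. (\<integral>\<^sup>+x. ennreal (norm (J n T x - I T x) powr r) \<partial>M)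
      \<le> (\<integral>\<^sup>+x. (SUP t\<in>{0..T}. ennreal (norm (J n t x - I t x) powr r)) \<partial>M)"
      using T by (intro always_eventually allI nn_integral_mono SUP_upper) auto
  qed simp
  \<comment> \<open>For each exponent r a single n already suffices: J n has all moments and differs
    from I by a variable with finite r-th moment.\<close>
  have fin: "\<exists>n. (\<integral>\<^sup>+x. ennreal (norm (J n T x - I T x) powr r) \<partial>M) < 1" if "r \<ge> 1" for r
  proof -
    have "\<forall>\<^sub>F n in sequentially. (\<integral>\<^sup>+x. ennreal (norm (J n T x - I T x) powr r) \<partial>M) < 1"
      by (rule order_tendstoD(2)[OF lim'[OF that]]) simp
    then show ?thesis by (auto simp: eventually_sequentially)
  qed
  have IL: "in_all_Lp M (\<lambda>x. inner (I T x) e)" if e: "e \<in> EC" for e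
    unfolding in_all_Lp_def
  proof (intro conjI allI impI)
    show Im: "(\<lambda>x. inner (I T x) e) \<in> borel_measurable M" by (intro borel_measurable_inner I_measurable borel_measurable_const)
    fix r :: real assume r: "1 \<le> r"
    obtain n where n: "(\<integral>\<^sup>+x. ennreal (norm (J n T x - I T x) powr r) \<partial>M) < 1" using fin[OF r] by blast
    have i1: "integrable M (\<lambda>x. norm (J n T x - I T x) powr r)"
    proof (rule integrableI_bounded)
      show "(\<lambda>x. norm (J n T x - I T x) powr r) \<in> borel_measurable M" using Jm I_measurable by measurable
      show "(\<integral>\<^sup>+x. ennreal (norm (norm (J n T x - I T x) powr r)) \<partial>M) < \<infinity>"
        using n by (simp add: less_trans[OF _ ennreal_one_less_top] order.strict_trans)
    qed
    have i2: "integrable M (\<lambda>x. \<bar>inner (J n T x) e\<bar> powr r)" using JL[OF e] r by (simp add: in_all_Lp_def)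
    show "integrable M (\<lambda>x. \<bar>inner (I T x) e\<bar> powr r)"
    proof (rule Bochner_Integration.integrable_bound)
      show "integrable M (\<lambda>x. 2 powr r * (\<bar>inner (J n T x) e\<bar> powr r + norm (J n T x - I T x) powr r))" using i1 i2 by simp
      show "(\<lambda>x. \<bar>inner (I T x) e\<bar> powr r) \<in> borel_measurable M" using Im by measurable
      show "AE x in M. norm (\<bar>inner (I T x) e\<bar> powr r) \<le> norm (2 powr r * (\<bar>inner (J n T x) e\<bar> powr r + norm (J n T x - I T x) powr r))"
      proof (rule AE_I2)
        fix x
        define y z where "y = \<bar>inner (J n T x) e\<bar>" and "z = norm (J n T x - I T x)"
        have yz: "0 \<le> y" "0 \<le> z" by (auto simp: y_def z_def)
        have "\<bar>inner (J n T x - I T x) e\<bar> \<le> z * norm e" unfolding z_def by (rule Cauchy_Schwarz_ineq2)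
        then have "\<bar>inner (I T x) e\<bar> \<le> y + z" using norm_EC[OF e] by (simp add: y_def inner_diff_left)
        also have "\<dots> \<le> 2 * max y z" by simp
        finally have "\<bar>inner (I T x) e\<bar> powr r \<le> (2 * max y z) powr r" using r by (intro powr_mono2) auto
        also have "\<dots> = 2 powr r * max y z powr r" by (rule powr_mult)
        also have "max y z powr r \<le> y powr r + z powr r" by (cases "y \<le> z") (auto simp: max_def)
        finally have "\<bar>inner (I T x) e\<bar> powr r \<le> 2 powr r * (y powr r + z powr r)" by (simp add: mult_left_mono)
        then show "norm (\<bar>inner (I T x) e\<bar> powr r) \<le> norm (2 powr r * (\<bar>inner (J n T x) e\<bar> powr r + norm (J n T x - I T x) powr r))"
          by (simp add: y_def z_def)
      qed
    qed
  qed
  then show "e \<in> EC \<Longrightarrow> in_all_Lp M (\<lambda>x. inner (I T x) e)" .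
  have JIlim: "(\<lambda>n. \<E> x. (inner (J n T x) e - inner (I T x) e)\<^sup>2) \<longlonglongrightarrow> 0" if e: "e \<in> EC" for e
  proof -
    have d: "L2 M (\<lambda>x. inner (J n T x) e - inner (I T x) e)" for n by (intro L2_diff in_all_LpD(4) JL IL e)
    have le: "ennreal (\<E> x. (inner (J n T x) e - inner (I T x) e)\<^sup>2) \<le> (\<integral>\<^sup>+x. ennreal (norm (J n T x - I T x) powr 2) \<partial>M)" for n
    proof -
      have "ennreal (\<E> x. (inner (J n T x) e - inner (I T x) e)\<^sup>2) = (\<integral>\<^sup>+x. ennreal ((inner (J n T x) e - inner (I T x) e)\<^sup>2) \<partial>M)"
        by (intro nn_integral_eq_integral[symmetric] L2_integrable[OF d]) auto
      also have "\<dots> \<le> (\<integral>\<^sup>+x. ennreal (norm (J n T x - I T x) powr 2) \<partial>M)"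
      proof (intro nn_integral_mono ennreal_leI)
        fix x
        have "\<bar>inner (J n T x - I T x) e\<bar> \<le> norm (J n T x - I T x) * norm e" by (rule Cauchy_Schwarz_ineq2)
        then have "\<bar>inner (J n T x - I T x) e\<bar>\<^sup>2 \<le> (norm (J n T x - I T x))\<^sup>2" using norm_EC[OF e] by (intro power_mono) auto
        also have "(norm (J n T x - I T x))\<^sup>2 = norm (J n T x - I T x) powr 2" by simp
        finally show "(inner (J n T x) e - inner (I T x) e)\<^sup>2 \<le> norm (J n T x - I T x) powr 2" by (simp add: inner_diff_left)
      qed
      finally show ?thesis .
    qed
    have "(\<lambda>n. ennreal (\<E> x. (inner (J n T x) e - inner (I T x) e)\<^sup>2)) \<longlonglongrightarrow> ennreal 0"
      unfolding ennreal_0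
      by (rule tendsto_sandwich[OF _ _ tendsto_const lim'[of 2]]) (use le in \<open>auto intro: always_eventually\<close>)
    then show ?thesis by (subst (asm) tendsto_ennreal_iff) auto
  qed
  \<comment> \<open>Finiteness of the basis of C allows one mesh for all components.\<close>
  have "\<exists>k\<ge>n. \<forall>e\<in>EC. (\<E> x. (?r n k e x - inner (J n T x) e)\<^sup>2) < 1 / Suc n" for n
  proof -
    have "\<forall>\<^sub>F k in sequentially. \<forall>e\<in>EC. (\<E> x. (?r n k e x - inner (J n T x) e)\<^sup>2) < 1 / Suc n"
      by (intro eventually_ball_finite EC(1) ballI order_tendstoD(2)[OF Jlim]) auto
    with eventually_ge_at_top[of n] have "\<forall>\<^sub>F k in sequentially. n \<le> k \<and> (\<forall>e\<in>EC. (\<E> x. (?r n k e x - inner (J n T x) e)\<^sup>2) < 1 / Suc n)"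
      by (rule eventually_conj)
    from eventually_happens'[OF sequentially_bot this] show ?thesis .
  qed
  then have "\<forall>n. \<exists>k. n \<le> k \<and> (\<forall>e\<in>EC. (\<E> x. (?r n k e x - inner (J n T x) e)\<^sup>2) < 1 / Suc n)"
    by (rule allI)
  from choice[OF this] obtain kk where kk': "\<forall>n. n \<le> kk n \<and> (\<forall>e\<in>EC. (\<E> x. (?r n (kk n) e x - inner (J n T x) e)\<^sup>2) < 1 / Suc n)"
    by (elim exE)
  note kk = conjunct1[OF spec[OF kk']] and kk2 = bspec[OF conjunct2[OF spec[OF kk']]]
  have "(\<lambda>n. \<E> x. (?r n (kk n) e x - inner (I T x) e)\<^sup>2) \<longlonglongrightarrow> 0" if e: "e \<in> EC" for e
  proof (rule tendsto_sandwich[OF _ _ tendsto_const])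
    show "\<forall>\<^sub>F n in sequentially. (\<E> x. (?r n (kk n) e x - inner (I T x) e)\<^sup>2)
       \<le> 2 * (1 / Suc n) + 2 * (\<E> x. (inner (J n T x) e - inner (I T x) e)\<^sup>2)"
    proof (intro always_eventually allI)
      fix n
      have "(\<E> x. ((?r n (kk n) e x - inner (J n T x) e) + (inner (J n T x) e - inner (I T x) e))\<^sup>2)
       \<le> 2 * (\<E> x. (?r n (kk n) e x - inner (J n T x) e)\<^sup>2) + 2 * (\<E> x. (inner (J n T x) e - inner (I T x) e)\<^sup>2)"
        by (intro L2_square_le L2_diff in_all_LpD(4) SL JL IL e)
      then show "(\<E> x. (?r n (kk n) e x - inner (I T x) e)\<^sup>2)
       \<le> 2 * (1 / Suc n) + 2 * (\<E> x. (inner (J n T x) e - inner (I T x) e)\<^sup>2)" using kk2[OF e, of n] by simp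
    qed
    show "(\<lambda>n. 2 * (1 / Suc n) + 2 * (\<E> x. (inner (J n T x) e - inner (I T x) e)\<^sup>2)) \<longlonglongrightarrow> 0"
      using tendsto_add[OF tendsto_mult_right_zero[OF LIMSEQ_Suc[OF lim_1_over_n], of 2] tendsto_mult_right_zero[OF JIlim[OF e], of 2]] by simp
  qed simp
  then show "\<exists>p P kk. cm_projection_sequence \<iota> p P \<and> (\<forall>n. n \<le> kk n) \<and>
      (\<forall>n. \<forall>e\<in>EC. in_all_Lp M (\<lambda>x. inner (RS (P n) (kk n) (\<lambda>t. B t x)) e)) \<and>
      (\<forall>e\<in>EC. (\<lambda>n. \<E> x. (inner (RS (P n) (kk n) (\<lambda>t. B t x)) e - inner (I T x) e)\<^sup>2) \<longlonglongrightarrow> 0)"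
    using ps kk SL by (intro exI[of _ p] exI[of _ P] exI[of _ kk] conjI allI ballI) simp_all
qed

subsection \<open>Splitting off one Gaussian direction\<close>

text \<open>The information carried by the part of the Gaussian space orthogonal to \<Theta>; it is
  independent of \<Theta>.\<close>

definition orth :: "('s \<Rightarrow> real) \<Rightarrow> 's measure" where
  "orth \<Theta> = gen_sigma M {\<zeta> \<in> V. (\<E> x. \<Theta> x * \<zeta> x) = 0}"

lemma space_orth[simp]: "space (orth \<Theta>) = space M"
  by (simp add: orth_def)

lemma measurable_orth: "\<zeta> \<in> V \<Longrightarrow> (\<E> x. \<Theta> x * \<zeta> x) = 0 \<Longrightarrow> \<zeta> \<in> borel_measurable (orth \<Theta>)"
  unfolding orth_def by (rule measurable_gen_sigma) simp

lemma measurable_from_orth: "f \<in> measurable (orth \<Theta>) N \<Longrightarrow> f \<in> measurable M N"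
  unfolding orth_def by (rule measurable_from_gen_sigma[rotated]) (use V_L2 in \<open>auto simp: L2_def\<close>)

text \<open>The sigma-algebra need not contain the null sets of M, so an almost sure limit is
  replaced by a measurable version, the everywhere defined \<open>lim\<close>.\<close>

lemma AE_limit_orth:
  assumes f: "\<And>n. f n \<in> borel_measurable (orth \<Theta>)" and lim: "AE x in M. (\<lambda>n. f n x) \<longlonglongrightarrow> (g x :: real)"
  shows "\<exists>g'\<in>borel_measurable (orth \<Theta>). AE x in M. g x = g' x"
proof
  show "(\<lambda>x. lim (\<lambda>n. f n x)) \<in> borel_measurable (orth \<Theta>)" using f by (rule borel_measurable_lim_metric)
  show "AE x in M. g x = lim (\<lambda>n. f n x)" using lim by eventually_elim (rule limI[symmetric])
qed

text \<open>A need not belong to \<open>H_star\<close>, so the variable paired with it is built from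
  p n A, which does. Variances of differences are T times squared distances in H, which makes the
  approximations Cauchy.\<close>

lemma wiener_functional:
  "\<exists>\<Theta>\<in>V. (\<E> x. (\<Theta> x)\<^sup>2) = T * (norm A)\<^sup>2 \<and> (\<forall>v a s. 0 \<le> s \<longrightarrow> s \<le> T \<longrightarrow> (\<E> x. \<Theta> x * lf v a s x) = s * inner A (rep v))"
proof -
  obtain p P kk where ps: "cm_projection_sequence \<iota> p P" using I_approximation(2) by blast
  have pA: "(\<lambda>n. p n A) \<longlonglongrightarrow> A" and pH: "p n A \<in> H_star \<iota>" for n
    using ps unfolding cm_projection_sequence_def cm_projection_def by blast+
  define \<theta> where "\<theta> n = lf (cm_functional \<iota> (p n A)) 0 T" for n
  have T0: "0 \<le> T" using T by simp
  have \<theta>V: "\<theta> n \<in> V" for n unfolding \<theta>_def by (rule lf_V[OF T0])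
  have L: "L2 M (\<theta> n)" for n by (rule V_L2[OF \<theta>V])
  have rp: "rep (cm_functional \<iota> (p n A)) = p n A" for n by (rule rep_cm_functional[OF pH])
  have d: "(\<E> x. (\<theta> m x - \<theta> n x)\<^sup>2) = T * (norm (p m A - p n A))\<^sup>2" for m n
  proof -
    have "(\<E> x. (\<theta> m x - \<theta> n x)\<^sup>2) = (\<E> x. (\<theta> m x * \<theta> m x - 2 * (\<theta> m x * \<theta> n x)) + \<theta> n x * \<theta> n x)"
      by (intro Bochner_Integration.integral_cong) (auto simp: power2_eq_square algebra_simps)
    also have "\<dots> = (\<E> x. \<theta> m x * \<theta> m x) - 2 * (\<E> x. \<theta> m x * \<theta> n x) + (\<E> x. \<theta> n x * \<theta> n x)"
      using L2_mult_integrable[OF L[of m] L[of m]] L2_mult_integrable[OF L[of m] L[of n]] L2_mult_integrable[OF L[of n] L[of n]] by simp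
    also have "\<dots> = T * (norm (p m A - p n A))\<^sup>2"
      using T0 unfolding \<theta>_def by (simp add: lf_cov rp power2_norm_eq_inner inner_diff inner_commute algebra_simps)
    finally show ?thesis .
  qed
  have "\<exists>N. \<forall>m\<ge>N. \<forall>n\<ge>N. (\<E> x. (\<theta> m x - \<theta> n x)\<^sup>2) < e" if e: "e > 0" for e
  proof -
    have "Cauchy (\<lambda>n. p n A)" using pA by (rule LIMSEQ_imp_Cauchy)
    moreover have "sqrt (e / T) > 0" using e T by simp
    ultimately obtain N where N: "\<And>m n. m \<ge> N \<Longrightarrow> n \<ge> N \<Longrightarrow> norm (p m A - p n A) < sqrt (e / T)"
      unfolding Cauchy_iff by blast
    have "T * (norm (p m A - p n A))\<^sup>2 < e" if "m \<ge> N" "n \<ge> N" for m n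
    proof -
      have "(norm (p m A - p n A))\<^sup>2 < (sqrt (e / T))\<^sup>2" using N[OF that] by (intro power_strict_mono) auto
      then show ?thesis using e T by (simp add: field_simps)
    qed
    then show ?thesis unfolding d by blast
  qed
  from L2_Cauchy_limit[OF L this] obtain \<Theta> where \<Theta>: "L2 M \<Theta>" "(\<lambda>n. \<E> x. (\<theta> n x - \<Theta> x)\<^sup>2) \<longlonglongrightarrow> 0" by blast
  have \<Theta>V: "\<Theta> \<in> V" by (rule V_limit[OF \<theta>V \<Theta>])
  have "(\<lambda>n. \<E> x. (\<theta> n x)\<^sup>2) \<longlonglongrightarrow> (\<E> x. (\<Theta> x)\<^sup>2)" by (rule L2_limit_moments(2)[OF L \<Theta> \<Theta>(1)])
  moreover have "(\<E> x. (\<theta> n x)\<^sup>2) = T * (norm (p n A))\<^sup>2" for n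
    using T0 unfolding \<theta>_def by (simp add: power2_eq_square[of "lf _ _ _ _"] lf_cov rp power2_norm_eq_inner)
  moreover have "(\<lambda>n. T * (norm (p n A))\<^sup>2) \<longlonglongrightarrow> T * (norm A)\<^sup>2" by (intro tendsto_intros pA)
  ultimately have sq: "(\<E> x. (\<Theta> x)\<^sup>2) = T * (norm A)\<^sup>2" using LIMSEQ_unique by auto
  have cov: "(\<E> x. \<Theta> x * lf v a s x) = s * inner A (rep v)" if s: "0 \<le> s" "s \<le> T" for v a s
  proof -
    have "(\<lambda>n. \<E> x. \<theta> n x * lf v a s x) \<longlonglongrightarrow> (\<E> x. \<Theta> x * lf v a s x)"
      by (rule L2_limit_moments(1)[OF L \<Theta> lf_L2[OF s(1)]])
    moreover have "(\<E> x. \<theta> n x * lf v a s x) = s * inner (p n A) (rep v)" for n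
      using s T0 unfolding \<theta>_def by (simp add: lf_cov rp)
    moreover have "(\<lambda>n. s * inner (p n A) (rep v)) \<longlonglongrightarrow> s * inner A (rep v)" by (intro tendsto_intros pA)
    ultimately show ?thesis using LIMSEQ_unique by auto
  qed
  show ?thesis using \<Theta>V sq cov by blast
qed

end

section \<open>Affine dependence of the endpoint on one Gaussian variable\<close>

context heis_bm
begin

interpretation om: bounded_bilinear \<omega> by (rule bil)

lemmas V_in_all_Lp = gaussian_in_all_Lp[OF gaussian_family_V]

lemma orth_IBP:
  assumes \<Theta>: "\<Theta> \<in> V" "(\<E> x. (\<Theta> x)\<^sup>2) = 1"
    and d: "diff_along M (orth \<Theta>) \<Theta> z z'" and z: "in_all_Lp M z" "in_all_Lp M z'"
  shows "(\<E> x. z' x) = (\<E> x. \<Theta> x * z x)"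
proof (rule integration_by_parts_along[OF _ gaussian_std_law[OF gaussian_family_V \<Theta>] _ _ space_orth d])
  show "distr M borel \<Theta> \<Otimes>\<^sub>M distr M (orth \<Theta>) (\<lambda>x. x) = distr M (borel \<Otimes>\<^sub>M orth \<Theta>) (\<lambda>x. (\<Theta> x, x))"
    unfolding orth_def by (rule gaussian_orthogonal_product_law[OF gaussian_family_V \<Theta>(1)]) auto
  show "\<Theta> \<in> borel_measurable M" using V_L2[OF \<Theta>(1)] by (simp add: L2_def)
  show "(\<lambda>x. x) \<in> measurable M (orth \<Theta>)" by (rule measurable_from_orth[of _ \<Theta>]) simp
  show "z \<in> borel_measurable M" "z' \<in> borel_measurable M" by (rule in_all_LpD(1)[OF z(1)], rule in_all_LpD(1)[OF z(2)])
  show "integrable M z" "integrable M z'" by (rule in_all_LpD(3)[OF z(1)], rule in_all_LpD(3)[OF z(2)])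
  show "integrable M (\<lambda>x. \<Theta> x * z x)" by (rule in_all_LpD(3)[OF in_all_Lp_mult[OF V_in_all_Lp[OF \<Theta>(1)] z(1)]])
qed

text \<open>Integration by parts in \<Theta> shows that \<Theta> u l has mean zero and that
  (\<Theta> l)^2 has the mean of l^2, since u and l do not depend on \<Theta>.\<close>

lemma orth_pythagoras:
  assumes \<Theta>: "\<Theta> \<in> V" "(\<E> x. (\<Theta> x)\<^sup>2) = 1"
    and m: "u \<in> borel_measurable (orth \<Theta>)" "l \<in> borel_measurable (orth \<Theta>)" and L: "in_all_Lp M u" "in_all_Lp M l"
  shows "(\<E> x. (u x + \<Theta> x * l x)\<^sup>2) = (\<E> x. (u x)\<^sup>2) + (\<E> x. (l x)\<^sup>2)"
proof -
  note T = V_in_all_Lp[OF \<Theta>(1)]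
  have ul: "in_all_Lp M (\<lambda>x. u x * l x)" and ll: "in_all_Lp M (\<lambda>x. l x * l x)" and uu: "in_all_Lp M (\<lambda>x. u x * u x)"
    by (intro in_all_Lp_mult L)+
  have d0: "diff_along M (orth \<Theta>) \<Theta> r (\<lambda>_. 0)" if "r \<in> borel_measurable (orth \<Theta>)" for r
    by (rule diff_along_affine[OF that]) simp
  have d1: "diff_along M (orth \<Theta>) \<Theta> \<Theta> (\<lambda>_. 1)"
    by (rule diff_along_affine[where r = "\<lambda>_. 0"]) auto
  have 1: "(\<E> x. \<Theta> x * (u x * l x)) = 0"
    using orth_IBP[OF \<Theta> d0[OF borel_measurable_times[OF m]] ul in_all_Lp_const] by simp
  have "diff_along M (orth \<Theta>) \<Theta> (\<lambda>x. \<Theta> x * (l x * l x)) (\<lambda>x. 1 * (l x * l x) + \<Theta> x * 0)"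
    by (rule diff_along_mult[OF d1 d0[OF borel_measurable_times[OF m(2) m(2)]]])
  then have "diff_along M (orth \<Theta>) \<Theta> (\<lambda>x. \<Theta> x * (l x * l x)) (\<lambda>x. l x * l x)" by simp
  from orth_IBP[OF \<Theta> this in_all_Lp_mult[OF T ll] ll]
  have 2: "(\<E> x. \<Theta> x * (\<Theta> x * (l x * l x))) = (\<E> x. l x * l x)" by simp
  have i: "integrable M (\<lambda>x. u x * u x)" "integrable M (\<lambda>x. \<Theta> x * (u x * l x))" "integrable M (\<lambda>x. \<Theta> x * (\<Theta> x * (l x * l x)))"
    by (intro in_all_LpD(3) in_all_Lp_mult L T)+
  have "(\<E> x. (u x + \<Theta> x * l x)\<^sup>2) = (\<E> x. (u x * u x + 2 * (\<Theta> x * (u x * l x))) + \<Theta> x * (\<Theta> x * (l x * l x)))"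
    by (intro Bochner_Integration.integral_cong) (auto simp: power2_eq_square algebra_simps)
  also have "\<dots> = (\<E> x. u x * u x) + 2 * (\<E> x. \<Theta> x * (u x * l x)) + (\<E> x. \<Theta> x * (\<Theta> x * (l x * l x)))"
    using i by simp
  finally show ?thesis unfolding 1 2 by (simp add: power2_eq_square)
qed

text \<open>Convergence of \<open>f\<^sub>n + \<Theta> l\<^sub>n\<close> forces convergence of both components, by orthogonality.\<close>

lemma split_limit:
  assumes \<Theta>: "\<Theta> \<in> V" "(\<E> x. (\<Theta> x)\<^sup>2) = 1"
    and f: "\<And>n. f n \<in> borel_measurable (orth \<Theta>)" "\<And>n. in_all_Lp M (f n)"
    and l: "\<And>n. l n \<in> V" "\<And>n. (\<E> x. \<Theta> x * l n x) = 0"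
    and Z: "\<And>n x. Z n x = f n x + \<Theta> x * l n x"
    and G: "L2 M G" and lim: "(\<lambda>n. \<E> x. (Z n x - G x)\<^sup>2) \<longlonglongrightarrow> 0"
  shows "\<exists>l\<in>V. (\<E> x. \<Theta> x * l x) = 0 \<and> (\<exists>q\<in>borel_measurable (orth \<Theta>). AE x in M. G x = q x + \<Theta> x * l x)"
proof -
  note T = V_in_all_Lp[OF \<Theta>(1)] and lL = V_in_all_Lp[OF l(1)]
  have ZL: "in_all_Lp M (Z n)" for n unfolding Z[abs_def] by (intro in_all_Lp_add in_all_Lp_mult f T lL)
  have diffL: "in_all_Lp M (\<lambda>x. a x - b x)" if "in_all_Lp M a" "in_all_Lp M b" for a b
    using in_all_Lp_add[OF that(1) in_all_Lp_mult[OF in_all_Lp_const[of "-1"] that(2)]] by simp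
  have key: "(\<E> x. (f m x - f n x)\<^sup>2) + (\<E> x. (l m x - l n x)\<^sup>2) = (\<E> x. (Z m x - Z n x)\<^sup>2)" for m n
  proof -
    have "(\<E> x. ((f m x - f n x) + \<Theta> x * (l m x - l n x))\<^sup>2) = (\<E> x. (f m x - f n x)\<^sup>2) + (\<E> x. (l m x - l n x)\<^sup>2)"
      by (intro orth_pythagoras \<Theta> borel_measurable_diff f measurable_orth l diffL lL)
    moreover have "(\<E> x. (Z m x - Z n x)\<^sup>2) = (\<E> x. ((f m x - f n x) + \<Theta> x * (l m x - l n x))\<^sup>2)"
      unfolding Z by (simp add: algebra_simps)
    ultimately show ?thesis by simp
  qed
  have Cau: "\<exists>N. \<forall>m\<ge>N. \<forall>n\<ge>N. (\<E> x. (f m x - f n x)\<^sup>2) < e \<and> (\<E> x. (l m x - l n x)\<^sup>2) < e" if e: "e > 0" for e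
  proof -
    have "\<forall>\<^sub>F n in sequentially. (\<E> x. (Z n x - G x)\<^sup>2) < e / 4" by (rule order_tendstoD(2)[OF lim]) (use e in simp)
    then obtain N where N: "\<And>n. n \<ge> N \<Longrightarrow> (\<E> x. (Z n x - G x)\<^sup>2) < e / 4" unfolding eventually_sequentially by blast
    have "(\<E> x. (f m x - f n x)\<^sup>2) < e \<and> (\<E> x. (l m x - l n x)\<^sup>2) < e" if mn: "m \<ge> N" "n \<ge> N" for m n
    proof -
      have "(\<E> x. ((Z m x - G x) + (G x - Z n x))\<^sup>2) \<le> 2 * (\<E> x. (Z m x - G x)\<^sup>2) + 2 * (\<E> x. (G x - Z n x)\<^sup>2)"
        by (intro L2_square_le L2_diff in_all_LpD(4) ZL G)
      moreover have "(\<E> x. (G x - Z n x)\<^sup>2) = (\<E> x. (Z n x - G x)\<^sup>2)" by (simp add: power2_commute)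
      ultimately have "(\<E> x. (Z m x - Z n x)\<^sup>2) < e" using N[OF mn(1)] N[OF mn(2)] by simp
      moreover have "(\<E> x. (f m x - f n x)\<^sup>2) \<ge> 0" "(\<E> x. (l m x - l n x)\<^sup>2) \<ge> 0" by simp_all
      ultimately show ?thesis using key[of m n] by linarith
    qed
    then show ?thesis by blast
  qed
  obtain g where g: "L2 M g" "(\<lambda>n. \<E> x. (f n x - g x)\<^sup>2) \<longlonglongrightarrow> 0"
    using L2_Cauchy_limit[of f] in_all_LpD(4)[OF f(2)] Cau by meson
  obtain h where h: "L2 M h" "(\<lambda>n. \<E> x. (l n x - h x)\<^sup>2) \<longlonglongrightarrow> 0"
    using L2_Cauchy_limit[of l] in_all_LpD(4)[OF lL] Cau by meson
  have hV: "h \<in> V" by (rule V_limit[OF l(1) h])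
  have "(\<lambda>n. \<E> x. l n x * \<Theta> x) \<longlonglongrightarrow> (\<E> x. h x * \<Theta> x)"
    by (rule L2_limit_moments(1)[OF in_all_LpD(4)[OF lL] h in_all_LpD(4)[OF T]])
  then have h0: "(\<E> x. \<Theta> x * h x) = 0" using l(2) LIMSEQ_unique[OF _ tendsto_const[of 0]] by (simp add: mult.commute)
  \<comment> \<open>Three nested subsequences give almost sure convergence of the sum and of both
    components simultaneously.\<close>
  obtain r1 where r1: "strict_mono r1" "AE x in M. (\<lambda>n. Z (r1 n) x) \<longlonglongrightarrow> G x"
    using L2_limit_AE_subseq[OF in_all_LpD(4)[OF ZL] G lim] by blast
  have sub: "(\<lambda>n. a (r n)) \<longlonglongrightarrow> b" if "a \<longlonglongrightarrow> b" "strict_mono r" for a :: "nat \<Rightarrow> real" and r b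
    using LIMSEQ_subseq_LIMSEQ[OF that] by (simp add: o_def)
  obtain r2 where r2: "strict_mono r2" "AE x in M. (\<lambda>n. f (r1 (r2 n)) x) \<longlonglongrightarrow> g x"
    using L2_limit_AE_subseq[OF in_all_LpD(4)[OF f(2)] g(1) sub[OF g(2) r1(1)]] by blast
  have r12: "strict_mono (\<lambda>n. r1 (r2 n))" using strict_mono_o[OF r1(1) r2(1)] by (simp add: o_def)
  obtain r3 where r3: "strict_mono r3" "AE x in M. (\<lambda>n. l (r1 (r2 (r3 n))) x) \<longlonglongrightarrow> h x"
    using L2_limit_AE_subseq[OF in_all_LpD(4)[OF lL] h(1) sub[OF h(2) r12]] by blast
  obtain q where q: "q \<in> borel_measurable (orth \<Theta>)" "AE x in M. g x = q x"
    using AE_limit_orth[OF f(1) r2(2)] by blast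
  have "AE x in M. G x = q x + \<Theta> x * h x"
    using r1(2) r2(2) r3(2) q(2)
  proof eventually_elim
    case (elim x)
    have "(\<lambda>n. Z (r1 (r2 (r3 n))) x) \<longlonglongrightarrow> G x" using sub[OF sub[OF elim(1) r2(1)] r3(1)] .
    moreover have "(\<lambda>n. f (r1 (r2 (r3 n))) x + \<Theta> x * l (r1 (r2 (r3 n))) x) \<longlonglongrightarrow> g x + \<Theta> x * h x"
      by (intro tendsto_intros sub[OF elim(2) r3(1)] elim(3))
    ultimately show ?case using LIMSEQ_unique elim(4) by (auto simp: Z)
  qed
  with hV h0 q(1) show ?thesis by blast
qed

abbreviation \<xi> :: "'s \<Rightarrow> 'w \<times> 'c" where "\<xi> \<equiv> heis_brownian X I T"

text \<open>The endpoint is affine in \<Theta> with derivative (D, L), where D is a fixed vector and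
  L is random but independent of \<Theta>.\<close>

definition splits :: "('s \<Rightarrow> real) \<Rightarrow> 'w \<Rightarrow> ('s \<Rightarrow> 'c) \<Rightarrow> bool" where
  "splits \<Theta> D L \<longleftrightarrow> \<Theta> \<in> V \<and> (\<E> x. (\<Theta> x)\<^sup>2) = 1 \<and> L \<in> borel_measurable (orth \<Theta>) \<and>
     (\<exists>R\<in>borel_measurable (orth \<Theta>). \<exists>q\<in>borel_measurable (orth \<Theta>).
        AE x in M. fst (\<xi> x) = R x + \<Theta> x *\<^sub>R D \<and> snd (\<xi> x) = q x + \<Theta> x *\<^sub>R L x)"

lemma orth_measurableI:
  fixes Y :: "'s \<Rightarrow> 'a::{real_normed_vector, second_countable_topology}"
  assumes "\<And>u :: 'a \<Rightarrow>\<^sub>L real. (\<lambda>x. u (Y x)) \<in> V" "\<And>u :: 'a \<Rightarrow>\<^sub>L real. (\<E> x. \<Theta> x * u (Y x)) = 0"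
  shows "Y \<in> borel_measurable (orth \<Theta>)"
  by (rule borel_measurable_if_functionals, rule measurable_orth) (rule assms)+

lemma inner_functional: "\<exists>a. \<forall>c. u c = inner c a" for u :: "'c \<Rightarrow>\<^sub>L real"
  using Riesz_representation[OF blinfun.bounded_linear_right[of u]] .

lemma lf_zero_left: "lf 0 a t x = inner (B0 t x) a" and lf_zero_right: "lf v 0 t x = v (B t x)"
  by (simp_all add: lf_def)

lemma rep_zero: "rep 0 = 0" by (rule rep_unique) simp

text \<open>The family of paths and the sigma-algebra are arbitrary, so that the statement serves B
  as well as the remainder R.\<close>

lemma RS_measurable:
  assumes R: "\<And>t. 0 \<le> t \<Longrightarrow> t \<le> T \<Longrightarrow> R t \<in> borel_measurable N"
  shows "(\<lambda>x. inner (RS P k (\<lambda>t. R t x)) e) \<in> borel_measurable N"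
proof -
  have Pm: "(\<lambda>x. P (f x)) \<in> borel_measurable N" if "f \<in> borel_measurable N" for f
    by (rule measurable_compose[OF that]) (intro borel_measurable_continuous_onI linear_continuous_on blinfun.bounded_linear_right)
  have om: "(\<lambda>x. \<omega> (f x) (g x)) \<in> borel_measurable N" if "f \<in> borel_measurable N" "g \<in> borel_measurable N" for f g
    by (rule borel_measurable_continuous_Pair[OF that]) (intro om.continuous_on continuous_intros)
  show ?thesis unfolding RS_def
    by (intro borel_measurable_inner borel_measurable_sum om Pm borel_measurable_diff R borel_measurable_const tt_nonneg tt_le) auto
qed

text \<open>In a central direction only B0 depends on \<Theta>. The path B is orthogonal to
  \<Theta>, and so is everything built from it, in particular the approximating sums of I.\<close>

lemma central_split:
  assumes e: "e \<in> EC"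
  shows "\<exists>\<Theta>. splits \<Theta> 0 (\<lambda>_. sqrt T *\<^sub>R e)"
proof -
  have T0: "0 \<le> T" using T by simp
  define \<Theta> where "\<Theta> x = (1 / sqrt T) * lf 0 e T x" for x
  have cov: "(\<E> x. \<Theta> x * lf v a t x) = (1 / sqrt T) * (inner e a * t)" if "0 \<le> t" "t \<le> T" for v a t
  proof -
    have "(\<E> x. \<Theta> x * lf v a t x) = (1 / sqrt T) * (\<E> x. lf 0 e T x * lf v a t x)"
      unfolding \<Theta>_def mult.assoc by (rule integral_mult_right_zero)
    then show ?thesis using that by (simp add: lf_cov rep_zero)
  qed
  have \<Theta>V: "\<Theta> \<in> V" unfolding \<Theta>_def[abs_def] by (rule gaussian_family_cmult[OF gaussian_family_V lf_V[OF T0]])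
  have "(\<E> x. (\<Theta> x)\<^sup>2) = (1 / sqrt T) * (\<E> x. \<Theta> x * lf 0 e T x)"
    unfolding integral_mult_right_zero[symmetric] by (simp add: \<Theta>_def power2_eq_square mult_ac)
  also have "\<dots> = 1" using cov[of T 0 e] T EC(3)[OF e e] by (simp add: real_div_sqrt)
  finally have var: "(\<E> x. (\<Theta> x)\<^sup>2) = 1" .
  have Bm: "B t \<in> borel_measurable (orth \<Theta>)" if t: "0 \<le> t" "t \<le> T" for t
  proof (rule orth_measurableI)
    show "(\<lambda>x. u (B t x)) \<in> V" for u :: "'w \<Rightarrow>\<^sub>L real" using lf_V[OF t(1), of u 0] by (simp add: lf_def[abs_def])
    show "(\<E> x. \<Theta> x * u (B t x)) = 0" for u :: "'w \<Rightarrow>\<^sub>L real" using cov[OF t, of u 0] by (simp add: lf_zero_right)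
  qed
  \<comment> \<open>Since \<Theta> is the component of B0 T along e divided by sqrt T, subtracting
    sqrt T \<Theta> e removes exactly that component.\<close>
  define q0 where "q0 x = B0 T x - (\<Theta> x * sqrt T) *\<^sub>R e" for x
  have q0: "q0 \<in> borel_measurable (orth \<Theta>)"
  proof (rule orth_measurableI)
    fix u :: "'c \<Rightarrow>\<^sub>L real"
    obtain a where a: "\<And>c. u c = inner c a" using inner_functional by blast
    have "u (q0 x) = lf 0 (a - inner e a *\<^sub>R e) T x" for x
      using T by (simp add: q0_def a \<Theta>_def lf_zero_left inner_diff_left inner_diff_right inner_commute)
    then have *: "(\<lambda>x. u (q0 x)) = lf 0 (a - inner e a *\<^sub>R e) T" by auto
    show "(\<lambda>x. u (q0 x)) \<in> V" unfolding * by (rule lf_V[OF T0])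
    show "(\<E> x. \<Theta> x * u (q0 x)) = 0" unfolding fun_cong[OF *] using cov[of T 0 "a - inner e a *\<^sub>R e"] T EC(3)[OF e e]
      by (simp add: inner_diff_right)
  qed
  have "\<exists>g\<in>borel_measurable (orth \<Theta>). AE x in M. inner (I T x) b = g x" if b: "b \<in> EC" for b
  proof -
    obtain p P kk where L: "\<And>n. in_all_Lp M (\<lambda>x. inner (RS (P n) (kk n) (\<lambda>t. B t x)) b)"
      and lim: "(\<lambda>n. \<E> x. (inner (RS (P n) (kk n) (\<lambda>t. B t x)) b - inner (I T x) b)\<^sup>2) \<longlonglongrightarrow> 0"
      using I_approximation(2) b by blast
    from L2_limit_AE_subseq[OF in_all_LpD(4)[OF L] in_all_LpD(4)[OF I_approximation(1)[OF b]] lim]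
    obtain r where "AE x in M. (\<lambda>n. inner (RS (P (r n)) (kk (r n)) (\<lambda>t. B t x)) b) \<longlonglongrightarrow> inner (I T x) b" by blast
    from AE_limit_orth[OF RS_measurable[OF Bm] this] show ?thesis .
  qed
  then have "\<forall>b\<in>EC. \<exists>g. g \<in> borel_measurable (orth \<Theta>) \<and> (AE x in M. inner (I T x) b = g x)" by blast
  from bchoice[OF this] obtain g where g: "\<And>b. b \<in> EC \<Longrightarrow> g b \<in> borel_measurable (orth \<Theta>)"
    and gI: "\<And>b. b \<in> EC \<Longrightarrow> AE x in M. inner (I T x) b = g b x" by blast
  define q where "q x = q0 x + (1/2) *\<^sub>R (\<Sum>b\<in>EC. g b x *\<^sub>R b)" for x
  have qm: "q \<in> borel_measurable (orth \<Theta>)" unfolding q_def[abs_def]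
    by (intro borel_measurable_add q0 borel_measurable_scaleR borel_measurable_sum g borel_measurable_const)
  have "AE x in M. \<forall>b\<in>EC. inner (I T x) b = g b x" by (rule AE_finite_allI[OF EC(1) gI])
  then have ae: "AE x in M. fst (\<xi> x) = B T x + \<Theta> x *\<^sub>R 0 \<and> snd (\<xi> x) = q x + \<Theta> x *\<^sub>R (sqrt T *\<^sub>R e)"
  proof eventually_elim
    case (elim x)
    have "I T x = (\<Sum>b\<in>EC. g b x *\<^sub>R b)" using C_expansion[of "I T x"] elim by (simp cong: sum.cong)
    then show ?case by (simp add: heis_brownian_def q_def q0_def)
  qed
  have "splits \<Theta> 0 (\<lambda>_. sqrt T *\<^sub>R e)"
    unfolding splits_def by (intro conjI \<Theta>V var borel_measurable_const bexI[OF _ Bm[OF T0 order_refl]] bexI[OF _ qm] ae)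
  then show ?thesis by blast
qed

text \<open>Substituting B t = R t + t \<Theta> D into a Riemann sum leaves no quadratic term
  because \<omega> vanishes on equal arguments. The linear coefficient is a Gaussian variable
  orthogonal to \<Theta>, so \<open>split_limit\<close> carries the decomposition over to I.\<close>

lemma wiener_split:
  assumes A: "A \<noteq> 0"
  shows "\<exists>\<Theta> L. splits \<Theta> ((sqrt T / norm A) *\<^sub>R \<iota> A) L \<and> (\<forall>e\<in>EC. (\<lambda>x. inner (L x) e) \<in> V)"
proof -
  have T0: "0 \<le> T" using T by simp
  obtain \<Theta>0 where \<Theta>0: "\<Theta>0 \<in> V" "(\<E> x. (\<Theta>0 x)\<^sup>2) = T * (norm A)\<^sup>2"
    "\<And>v a s. 0 \<le> s \<Longrightarrow> s \<le> T \<Longrightarrow> (\<E> x. \<Theta>0 x * lf v a s x) = s * inner A (rep v)"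
    using wiener_functional[of A] by blast
  \<comment> \<open>The variance of \<Theta>0 is T norm(A)^2, so this factor normalises it; then the
    covariance of \<Theta> with v (B s) is s v(D), and the endpoint moves by T D = (sqrt T / norm A)
    \<iota> A.\<close>
  define \<kappa> where "\<kappa> = 1 / (sqrt T * norm A)"
  have \<kappa>: "\<kappa> > 0" "\<kappa>\<^sup>2 * (T * (norm A)\<^sup>2) = 1" "T * \<kappa> = sqrt T / norm A"
    using T A by (auto simp: \<kappa>_def field_simps power_mult_distrib)
  define D where "D = \<kappa> *\<^sub>R \<iota> A"
  define \<Theta> where "\<Theta> x = \<kappa> * \<Theta>0 x" for x
  have \<Theta>V: "\<Theta> \<in> V" unfolding \<Theta>_def[abs_def] by (rule gaussian_family_cmult[OF gaussian_family_V \<Theta>0(1)])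
  have var: "(\<E> x. (\<Theta> x)\<^sup>2) = 1" using \<kappa>(2) \<Theta>0(2) by (simp add: \<Theta>_def power_mult_distrib)
  have cov: "(\<E> x. \<Theta> x * lf v a s x) = s * v D" if "0 \<le> s" "s \<le> T" for v a s
  proof -
    have "(\<E> x. \<Theta> x * lf v a s x) = \<kappa> * (\<E> x. \<Theta>0 x * lf v a s x)"
      unfolding \<Theta>_def mult.assoc by (rule integral_mult_right_zero)
    then show ?thesis using \<Theta>0(3)[OF that] by (simp add: D_def blinfun.scaleR_right rep)
  qed
  have covT: "(\<E> x. \<Theta> x * (lf v a s x - c * \<Theta> x)) = s * v D - c" if s: "0 \<le> s" "s \<le> T" for v a s c
  proof -
    have "(\<E> x. \<Theta> x * (lf v a s x - c * \<Theta> x)) = (\<E> x. \<Theta> x * lf v a s x - c * (\<Theta> x)\<^sup>2)"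
      by (simp add: power2_eq_square algebra_simps)
    also have "\<dots> = (\<E> x. \<Theta> x * lf v a s x) - c * (\<E> x. (\<Theta> x)\<^sup>2)"
      using L2_mult_integrable[OF V_L2[OF \<Theta>V] lf_L2[OF s(1), of v a]] L2_integrable[OF V_L2[OF \<Theta>V]] by simp
    finally show ?thesis using cov[OF s] var by simp
  qed
  define R where "R t x = B t x - (t * \<Theta> x) *\<^sub>R D" for t x
  have Rm: "R t \<in> borel_measurable (orth \<Theta>)" if t: "0 \<le> t" "t \<le> T" for t
  proof (rule orth_measurableI)
    fix u :: "'w \<Rightarrow>\<^sub>L real"
    have *: "(\<lambda>x. u (R t x)) = (\<lambda>x. lf u 0 t x - (t * u D) * \<Theta> x)"
      by (auto simp: R_def lf_def blinfun.diff_right blinfun.scaleR_right)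
    show "(\<lambda>x. u (R t x)) \<in> V" unfolding *
      by (intro gaussian_family_diff[OF gaussian_family_V] gaussian_family_cmult[OF gaussian_family_V] lf_V t \<Theta>V)
    show "(\<E> x. \<Theta> x * u (R t x)) = 0" unfolding fun_cong[OF *] covT[OF t] by simp
  qed
  have B0m: "B0 T \<in> borel_measurable (orth \<Theta>)"
  proof (rule orth_measurableI)
    fix u :: "'c \<Rightarrow>\<^sub>L real"
    obtain a where a: "\<And>c. u c = inner c a" using inner_functional by blast
    have *: "(\<lambda>x. u (B0 T x)) = lf 0 a T" by (auto simp: a lf_zero_left)
    show "(\<lambda>x. u (B0 T x)) \<in> V" unfolding * by (rule lf_V[OF T0])
    show "(\<E> x. \<Theta> x * u (B0 T x)) = 0" unfolding fun_cong[OF *] using cov[OF T0 order_refl, of 0 a] by simp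
  qed
  have comp: "\<exists>l\<in>V. (\<E> x. \<Theta> x * l x) = 0 \<and> (\<exists>q\<in>borel_measurable (orth \<Theta>). AE x in M. inner (I T x) e = q x + \<Theta> x * l x)"
    if e: "e \<in> EC" for e
  proof -
    obtain p P kk where L: "\<And>n. in_all_Lp M (\<lambda>x. inner (RS (P n) (kk n) (\<lambda>t. B t x)) e)"
      and lim: "(\<lambda>n. \<E> x. (inner (RS (P n) (kk n) (\<lambda>t. B t x)) e - inner (I T x) e)\<^sup>2) \<longlonglongrightarrow> 0"
      using I_approximation(2) e by blast
    define \<delta> where "\<delta> n = T / 2 ^ kk n" for n
    define v where "v n = Blinfun (\<lambda>w. inner (\<omega> (P n w) (P n D)) e)" for n
    have v: "v n w = inner (\<omega> (P n w) (P n D)) e" for n w unfolding v_def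
      by (subst bounded_linear_Blinfun_apply)
         (auto intro!: bounded_linear_compose[OF bounded_linear_inner_left] bounded_linear_compose[OF om.bounded_linear_left]
           blinfun.bounded_linear_right)
    \<comment> \<open>Two uses: the slope is orthogonal to \<Theta>, and it is the same whether
      computed from B or from the remainder R.\<close>
    have vD: "v n D = 0" for n by (simp add: v \<omega>_self)
    \<comment> \<open>The coefficient of \<Theta>: the first term moves the increment in direction D
      by the cell length, the second moves the left endpoint by t D, with the sign changed by skew
      symmetry.\<close>
    define l where "l n x = (\<Sum>j<2 ^ kk n. \<delta> n * lf (v n) 0 (tt (kk n) j) x
        - tt (kk n) j * (lf (v n) 0 (tt (kk n) (Suc j)) x - lf (v n) 0 (tt (kk n) j) x))" for n x
    have lV: "l n \<in> V" for n unfolding l_def[abs_def]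
      by (intro gaussian_family_sum[OF gaussian_family_V] gaussian_family_diff[OF gaussian_family_V]
          gaussian_family_cmult[OF gaussian_family_V] lf_V tt_nonneg)
    have l0: "(\<E> x. \<Theta> x * l n x) = 0" for n
    proof -
      have i: "integrable M (\<lambda>x. \<Theta> x * lf (v n) 0 (tt (kk n) j) x)" for j
        by (intro L2_mult_integrable V_L2[OF \<Theta>V] lf_L2 tt_nonneg)
      have z: "(\<E> x. \<Theta> x * lf (v n) 0 (tt (kk n) j) x) = 0" if "j \<le> 2 ^ kk n" for j
        using cov[OF tt_nonneg tt_le[OF that], of "v n" 0] by (simp add: vD)
      have "(\<E> x. \<Theta> x * l n x) = (\<E> x. (\<Sum>j<2 ^ kk n. \<delta> n * (\<Theta> x * lf (v n) 0 (tt (kk n) j) x)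
        - tt (kk n) j * (\<Theta> x * lf (v n) 0 (tt (kk n) (Suc j)) x - \<Theta> x * lf (v n) 0 (tt (kk n) j) x)))"
        unfolding l_def sum_distrib_left by (intro Bochner_Integration.integral_cong sum.cong) (auto simp: algebra_simps)
      also have "\<dots> = (\<Sum>j<2 ^ kk n. \<E> x. \<delta> n * (\<Theta> x * lf (v n) 0 (tt (kk n) j) x)
        - tt (kk n) j * (\<Theta> x * lf (v n) 0 (tt (kk n) (Suc j)) x - \<Theta> x * lf (v n) 0 (tt (kk n) j) x))"
        using i by (intro Bochner_Integration.integral_sum) simp
      also have "\<dots> = 0" using i z by (intro sum.neutral ballI) simp
      finally show ?thesis .
    qed
    define Z where "Z n x = inner (RS (P n) (kk n) (\<lambda>t. B t x)) e" for n x
    define f where "f n x = inner (RS (P n) (kk n) (\<lambda>t. R t x)) e" for n x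
    have Zf: "Z n x = f n x + \<Theta> x * l n x" for n x
    proof -
      define a where "a = P n D"
      have "inner (\<omega> (P n (B (tt (kk n) j) x)) (P n (B (tt (kk n) (Suc j)) x - B (tt (kk n) j) x))) e
        = inner (\<omega> (P n (R (tt (kk n) j) x)) (P n (R (tt (kk n) (Suc j)) x - R (tt (kk n) j) x))) e
          + \<Theta> x * (\<delta> n * lf (v n) 0 (tt (kk n) j) x - tt (kk n) j * (lf (v n) 0 (tt (kk n) (Suc j)) x - lf (v n) 0 (tt (kk n) j) x))" for j
      proof -
        define r r' where "r = P n (B (tt (kk n) j) x)" and "r' = P n (B (tt (kk n) j + \<delta> n) x)"
        have sk: "\<omega> a r = - \<omega> r a" "\<omega> a r' = - \<omega> r' a" by (rule skew)+
        show ?thesis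
          unfolding R_def lf_zero_right v blinfun.diff_right blinfun.scaleR_right tt_Suc[of "kk n" j] \<delta>_def[of n, symmetric]
          unfolding r_def[symmetric] r'_def[symmetric] a_def[symmetric]
          by (simp add: om.diff_left om.diff_right om.add_left om.add_right om.scaleR_left om.scaleR_right \<omega>_self sk inner_diff_left inner_add_left algebra_simps)
      qed
      then show ?thesis unfolding Z_def f_def l_def RS_def inner_sum_left sum_distrib_left sum.distrib[symmetric] by simp
    qed
    have fm: "f n \<in> borel_measurable (orth \<Theta>)" for n unfolding f_def[abs_def] by (rule RS_measurable[OF Rm])
    have ZL: "in_all_Lp M (Z n)" for n using L unfolding Z_def[abs_def] .
    have "in_all_Lp M (\<lambda>x. Z n x + (-1) * (\<Theta> x * l n x))" for n
      by (intro in_all_Lp_add in_all_Lp_mult in_all_Lp_const ZL V_in_all_Lp \<Theta>V lV)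
    then have fL: "in_all_Lp M (f n)" for n by (simp add: Zf)
    show ?thesis
      by (rule split_limit[OF \<Theta>V var fm fL lV l0 Zf in_all_LpD(4)[OF I_approximation(1)[OF e]]]) (use lim in \<open>simp add: Z_def\<close>)
  qed
  then have "\<forall>e\<in>EC. \<exists>l. l \<in> V \<and> (\<E> x. \<Theta> x * l x) = 0 \<and> (\<exists>q\<in>borel_measurable (orth \<Theta>). AE x in M. inner (I T x) e = q x + \<Theta> x * l x)"
    by blast
  from bchoice[OF this] obtain l where l: "\<And>e. e \<in> EC \<Longrightarrow> l e \<in> V" "\<And>e. e \<in> EC \<Longrightarrow> (\<E> x. \<Theta> x * l e x) = 0"
    and ex: "\<And>e. e \<in> EC \<Longrightarrow> \<exists>q\<in>borel_measurable (orth \<Theta>). AE x in M. inner (I T x) e = q x + \<Theta> x * l e x" by blast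
  have "\<forall>e\<in>EC. \<exists>q. q \<in> borel_measurable (orth \<Theta>) \<and> (AE x in M. inner (I T x) e = q x + \<Theta> x * l e x)" using ex by blast
  from bchoice[OF this] obtain g where g: "\<And>e. e \<in> EC \<Longrightarrow> g e \<in> borel_measurable (orth \<Theta>)"
    and gI: "\<And>e. e \<in> EC \<Longrightarrow> AE x in M. inner (I T x) e = g e x + \<Theta> x * l e x" by blast
  \<comment> \<open>The factor 1/2 is the one in front of the stochastic integral in the
    endpoint.\<close>
  define L where "L x = (\<Sum>e\<in>EC. (1/2 * l e x) *\<^sub>R e)" for x
  define q where "q x = B0 T x + (1/2) *\<^sub>R (\<Sum>e\<in>EC. g e x *\<^sub>R e)" for x
  have lm: "l e \<in> borel_measurable (orth \<Theta>)" if "e \<in> EC" for e by (rule measurable_orth[OF l(1)[OF that] l(2)[OF that]])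
  have Lm: "L \<in> borel_measurable (orth \<Theta>)" unfolding L_def[abs_def]
    by (intro borel_measurable_sum borel_measurable_scaleR borel_measurable_times lm borel_measurable_const)
  have qm: "q \<in> borel_measurable (orth \<Theta>)" unfolding q_def[abs_def]
    by (intro borel_measurable_add B0m borel_measurable_scaleR borel_measurable_sum g borel_measurable_const)
  have "AE x in M. \<forall>e\<in>EC. inner (I T x) e = g e x + \<Theta> x * l e x" by (rule AE_finite_allI[OF EC(1) gI])
  then have ae: "AE x in M. fst (\<xi> x) = R T x + \<Theta> x *\<^sub>R ((sqrt T / norm A) *\<^sub>R \<iota> A) \<and> snd (\<xi> x) = q x + \<Theta> x *\<^sub>R L x"
  proof eventually_elim
    case (elim x)
    have "I T x = (\<Sum>e\<in>EC. (g e x + \<Theta> x * l e x) *\<^sub>R e)" using C_expansion[of "I T x"] elim by (simp cong: sum.cong)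
    also have "\<dots> = (\<Sum>e\<in>EC. g e x *\<^sub>R e) + (2 * \<Theta> x) *\<^sub>R L x"
      by (simp add: L_def scaleR_add_left sum.distrib scaleR_sum_right)
    finally have "I T x = (\<Sum>e\<in>EC. g e x *\<^sub>R e) + (2 * \<Theta> x) *\<^sub>R L x" .
    moreover have "R T x + \<Theta> x *\<^sub>R ((sqrt T / norm A) *\<^sub>R \<iota> A) = B T x"
      by (simp add: R_def D_def \<kappa>(3)[symmetric] mult_ac)
    ultimately show ?case by (simp add: heis_brownian_def q_def scaleR_add_right)
  qed
  have "splits \<Theta> ((sqrt T / norm A) *\<^sub>R \<iota> A) L"
    unfolding splits_def using \<Theta>V var Lm Rm[OF T0 order_refl] qm ae by blast
  moreover have "(\<lambda>x. inner (L x) e) \<in> V" if e: "e \<in> EC" for e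
  proof -
    have "inner (L x) e = 1/2 * l e x" for x
    proof -
      have "inner (L x) e = (\<Sum>b\<in>EC. if b = e then 1/2 * l b x else 0)"
        unfolding L_def inner_sum_left by (intro sum.cong) (auto simp: EC(3) e)
      then show ?thesis using e EC(1) by simp
    qed
    then have "(\<lambda>x. inner (L x) e) = (\<lambda>x. 1/2 * l e x)" by (rule ext)
    then show ?thesis using gaussian_family_cmult[OF gaussian_family_V l(1)[OF e], of "1/2"] by (simp only:)
  qed
  ultimately show ?thesis by blast
qed

end

subsection \<open>Derivatives of multilinear forms along affine vector fields\<close>

definition affine_map :: "('a::real_normed_vector \<Rightarrow> 'b::real_normed_vector) \<Rightarrow> bool" where
  "affine_map X \<longleftrightarrow> bounded_linear (\<lambda>g. X g - X 0)"

lemma affine_map_diff: "affine_map X \<Longrightarrow> X y - X x = X (y - x) - X 0"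
  using linear_diff[OF bounded_linear.linear, of "\<lambda>g. X g - X 0" y x] by (simp add: affine_map_def)

text \<open>The derivative of an affine field X in the direction Y g is X (Y g) - X 0. Derivatives
  of affine fields along affine fields are thus affine again.\<close>

lemma affine_map_compose:
  assumes "affine_map X" "affine_map Y"
  shows "affine_map (\<lambda>g. X (Y g) - X 0)"
proof -
  have "X (Y g) - X 0 - (X (Y 0) - X 0) = X (Y g - Y 0) - X 0" for g
    using affine_map_diff[OF assms(1), of "Y g" "Y 0"] by simp
  then show ?thesis
    using bounded_linear_compose[OF assms[unfolded affine_map_def]] by (simp add: affine_map_def)
qed

lemma bounded_multilinear_formD:
  assumes "bounded_multilinear_form n A"
  shows "length vs = n \<Longrightarrow> j < n \<Longrightarrow> linear (\<lambda>v. A (vs[j := v]))"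
    and "\<exists>K\<ge>0. \<forall>vs. length vs = n \<longrightarrow> \<bar>A vs\<bar> \<le> K * prod_list (map norm vs)"
proof -
  show "length vs = n \<Longrightarrow> j < n \<Longrightarrow> linear (\<lambda>v. A (vs[j := v]))"
    using assms by (simp add: bounded_multilinear_form_def)
  obtain K where K: "\<And>vs. length vs = n \<Longrightarrow> \<bar>A vs\<bar> \<le> K * prod_list (map norm vs)"
    using assms by (auto simp: bounded_multilinear_form_def)
  have "\<bar>A vs\<bar> \<le> \<bar>K\<bar> * prod_list (map norm vs)" if "length vs = n" for vs
  proof -
    have "0 \<le> prod_list (map norm vs)" by (rule prod_list_nonneg) auto
    then show ?thesis using K[OF that] mult_right_mono[OF abs_ge_self[of K]] by (meson order_trans)
  qed
  then show "\<exists>K\<ge>0. \<forall>vs. length vs = n \<longrightarrow> \<bar>A vs\<bar> \<le> K * prod_list (map norm vs)"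
    by (intro exI[of _ "\<bar>K\<bar>"]) auto
qed

lemma bounded_multilinear_form_eval:
  assumes A: "bounded_multilinear_form (Suc n) A"
  shows "bounded_multilinear_form n (\<lambda>vs. A (w # vs))"
proof -
  obtain K where K: "K \<ge> 0" "\<And>vs. length vs = Suc n \<Longrightarrow> \<bar>A vs\<bar> \<le> K * prod_list (map norm vs)"
    using bounded_multilinear_formD(2)[OF A] by blast
  have "linear (\<lambda>v. A (w # vs[j := v]))" if "length vs = n" "j < n" for vs j
    using bounded_multilinear_formD(1)[OF A, of "w # vs" "Suc j"] that by simp
  moreover have "\<bar>A (w # vs)\<bar> \<le> (K * norm w) * prod_list (map norm vs)" if "length vs = n" for vs
    using K(2)[of "w # vs"] that by (simp add: mult.assoc)
  ultimately show ?thesis unfolding bounded_multilinear_form_def by blast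
qed

lemma bounded_multilinear_form_add:
  assumes "bounded_multilinear_form n A" "bounded_multilinear_form n A'"
  shows "bounded_multilinear_form n (\<lambda>vs. A vs + A' vs)"
proof -
  obtain K K' where K: "\<And>vs. length vs = n \<Longrightarrow> \<bar>A vs\<bar> \<le> K * prod_list (map norm vs)"
    "\<And>vs. length vs = n \<Longrightarrow> \<bar>A' vs\<bar> \<le> K' * prod_list (map norm vs)"
    using bounded_multilinear_formD(2)[OF assms(1)] bounded_multilinear_formD(2)[OF assms(2)] by blast
  have "\<bar>A vs + A' vs\<bar> \<le> (K + K') * prod_list (map norm vs)" if "length vs = n" for vs
    using K(1)[OF that] K(2)[OF that] by (simp add: distrib_right)
  moreover have "linear (\<lambda>v. A (vs[j := v]) + A' (vs[j := v]))" if "length vs = n" "j < n" for vs j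
    by (intro linear_compose_add bounded_multilinear_formD(1)[OF assms(1)] bounded_multilinear_formD(1)[OF assms(2)] that)
  ultimately show ?thesis unfolding bounded_multilinear_form_def by blast
qed

lemma bounded_multilinear_form_eval_second:
  assumes A: "bounded_multilinear_form (Suc (Suc n)) A"
  shows "bounded_multilinear_form (Suc n) (\<lambda>vs. A (hd vs # w # tl vs))"
proof -
  obtain K where K: "K \<ge> 0" "\<And>vs. length vs = Suc (Suc n) \<Longrightarrow> \<bar>A vs\<bar> \<le> K * prod_list (map norm vs)"
    using bounded_multilinear_formD(2)[OF A] by blast
  have "linear (\<lambda>v. A (hd (vs[j := v]) # w # tl (vs[j := v])))" if vs: "length vs = Suc n" "j < Suc n" for vs j
  proof -
    obtain u us where u: "vs = u # us" "length us = n" using vs(1) by (cases vs) auto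
    show ?thesis
    proof (cases j)
      case 0
      then show ?thesis using bounded_multilinear_formD(1)[OF A, of "u # w # us" 0] u by simp
    next
      case (Suc i)
      then show ?thesis using bounded_multilinear_formD(1)[OF A, of "u # w # us" "Suc (Suc i)"] u vs by simp
    qed
  qed
  moreover have "\<bar>A (hd vs # w # tl vs)\<bar> \<le> (K * norm w) * prod_list (map norm vs)" if "length vs = Suc n" for vs
    using K(2)[of "hd vs # w # tl vs"] that by (cases vs) (auto simp: mult_ac)
  ultimately show ?thesis unfolding bounded_multilinear_form_def by blast
qed

lemma bounded_multilinear_form_compose_first:
  assumes A: "bounded_multilinear_form (Suc n) A" and L: "bounded_linear L"
  shows "bounded_multilinear_form (Suc n) (\<lambda>vs. A (L (hd vs) # tl vs))"
proof -
  obtain K where K: "K \<ge> 0" "\<And>vs. length vs = Suc n \<Longrightarrow> \<bar>A vs\<bar> \<le> K * prod_list (map norm vs)"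
    using bounded_multilinear_formD(2)[OF A] by blast
  obtain c where c: "\<And>v. norm (L v) \<le> norm v * c" using bounded_linear.bounded[OF L] by blast
  have "linear (\<lambda>v. A (L (hd (vs[j := v])) # tl (vs[j := v])))" if vs: "length vs = Suc n" "j < Suc n" for vs j
  proof -
    obtain u us where u: "vs = u # us" "length us = n" using vs(1) by (cases vs) auto
    show ?thesis
    proof (cases j)
      case 0
      have "linear (\<lambda>v. A (v # us))" using bounded_multilinear_formD(1)[OF A, of "u # us" 0] u by simp
      from linear_compose[OF bounded_linear.linear[OF L] this] show ?thesis using 0 u by (simp add: o_def)
    next
      case (Suc i)
      then show ?thesis using bounded_multilinear_formD(1)[OF A, of "L u # us" "Suc i"] u vs by simp
    qed
  qed
  moreover have "\<bar>A (L (hd vs) # tl vs)\<bar> \<le> (K * c) * prod_list (map norm vs)" if len: "length vs = Suc n" for vs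
  proof -
    obtain u us where u: "vs = u # us" "length us = n" using len by (cases vs) auto
    have p: "0 \<le> prod_list (map norm us)" by (rule prod_list_nonneg) auto
    have "\<bar>A (L u # us)\<bar> \<le> K * (norm (L u) * prod_list (map norm us))" using K(2)[of "L u # us"] u by simp
    also have "\<dots> \<le> K * ((norm u * c) * prod_list (map norm us))"
      by (intro mult_left_mono mult_right_mono c p K(1))
    finally show ?thesis by (simp add: u mult_ac)
  qed
  ultimately show ?thesis unfolding bounded_multilinear_form_def by blast
qed

definition form_derivative ::
  "nat \<Rightarrow> ('a::real_normed_vector \<Rightarrow> 'a list \<Rightarrow> real) \<Rightarrow> ('a \<Rightarrow> 'a list \<Rightarrow> real) \<Rightarrow> bool" where
  "form_derivative n \<Psi> \<Psi>' \<longleftrightarrow> (\<forall>x. bounded_multilinear_form n (\<Psi> x)) \<and> (\<forall>x. bounded_multilinear_form (Suc n) (\<Psi>' x)) \<and>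
     (\<forall>x. \<forall>e>0. \<exists>d>0. \<forall>y. norm (y - x) < d \<longrightarrow> (\<forall>vs. length vs = n \<longrightarrow>
        \<bar>\<Psi> y vs - \<Psi> x vs - \<Psi>' x ((y - x) # vs)\<bar> \<le> e * norm (y - x) * prod_list (map norm vs)))"

text \<open>The product rule for a form whose first slot is filled by an affine field: either the
  form or the inserted field is differentiated.\<close>

lemma form_derivative_eval:
  fixes X :: "'a::real_normed_vector \<Rightarrow> 'a"
  assumes \<Psi>: "form_derivative (Suc n) \<Psi> \<Psi>'" and X: "affine_map X"
  shows "form_derivative n (\<lambda>x vs. \<Psi> x (X x # vs))
    (\<lambda>x vs. \<Psi>' x (hd vs # X x # tl vs) + \<Psi> x ((X (hd vs) - X 0) # tl vs))"
proof -
  have ml: "bounded_multilinear_form (Suc n) (\<Psi> x)" "bounded_multilinear_form (Suc (Suc n)) (\<Psi>' x)" for x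
    using \<Psi> by (auto simp: form_derivative_def)
  have est: "\<exists>d>0. \<forall>y. norm (y - x) < d \<longrightarrow> (\<forall>vs. length vs = Suc n \<longrightarrow>
        \<bar>\<Psi> y vs - \<Psi> x vs - \<Psi>' x ((y - x) # vs)\<bar> \<le> e * norm (y - x) * prod_list (map norm vs))" if "e > 0" for x e
    using \<Psi> that by (simp add: form_derivative_def)
  obtain c where c: "c > 0" "\<And>v. norm (X v - X 0) \<le> norm v * c"
    using bounded_linear.pos_bounded[OF X[unfolded affine_map_def]] by blast
  have "\<exists>d>0. \<forall>y. norm (y - x) < d \<longrightarrow> (\<forall>vs. length vs = n \<longrightarrow>
        \<bar>\<Psi> y (X y # vs) - \<Psi> x (X x # vs) - (\<Psi>' x ((y - x) # X x # vs) + \<Psi> x ((X (y - x) - X 0) # vs))\<bar>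
          \<le> e * norm (y - x) * prod_list (map norm vs))" if e: "e > 0" for x e
  proof -
    obtain K where K: "K \<ge> 0" "\<And>vs. length vs = Suc (Suc n) \<Longrightarrow> \<bar>\<Psi>' x vs\<bar> \<le> K * prod_list (map norm vs)"
      using bounded_multilinear_formD(2)[OF ml(2)[of x]] by blast
    define s where "s = norm (X x) + c"
    \<comment> \<open>For norm (y - x) \<le> 1 the number s bounds norm (X y), so the first error
      takes half of e.\<close>
    define e1 where "e1 = e / (2 * s)"
    have "s > 0" using c(1) by (simp add: s_def add_nonneg_pos)
    then have e1: "e1 > 0" "e1 * (norm (X x) + c) = e / 2" using e unfolding s_def[symmetric] by (simp_all add: e1_def)
    obtain d1 where d1: "d1 > 0" "\<And>y vs. norm (y - x) < d1 \<Longrightarrow> length vs = Suc n \<Longrightarrow>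
        \<bar>\<Psi> y vs - \<Psi> x vs - \<Psi>' x ((y - x) # vs)\<bar> \<le> e1 * norm (y - x) * prod_list (map norm vs)"
      using est[OF e1(1), of x] by blast
    \<comment> \<open>The last entry makes the second-order error, of size K c norm (y - x)^2, at
      most the other half; the added 1 avoids a zero denominator.\<close>
    define d where "d = min (min d1 1) (e / (2 * (K * c + 1)))"
    have Kc: "K * c \<ge> 0" using K(1) c(1) by simp
    have d0: "d > 0" using d1(1) e Kc by (simp add: d_def)
    have "\<bar>\<Psi> y (X y # vs) - \<Psi> x (X x # vs) - (\<Psi>' x ((y - x) # X x # vs) + \<Psi> x ((X (y - x) - X 0) # vs))\<bar>
          \<le> e * norm (y - x) * prod_list (map norm vs)" if y: "norm (y - x) < d" and vs: "length vs = n" for y vs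
    proof -
      define p w where "p = prod_list (map norm vs)" and "w = X (y - x) - X 0"
      have p: "p \<ge> 0" unfolding p_def by (rule prod_list_nonneg) auto
      have Xy: "X y = X x + w" using affine_map_diff[OF X, of y x] by (simp add: w_def algebra_simps)
      have w: "norm w \<le> norm (y - x) * c" unfolding w_def by (rule c(2))
      have le: "norm (y - x) < d1" "norm (y - x) \<le> 1" "norm (y - x) \<le> e / (2 * (K * c + 1))" using y by (auto simp: d_def)
      have lin1: "linear (\<lambda>v. \<Psi> x (v # vs))" using bounded_multilinear_formD(1)[OF ml(1), of "X x # vs" 0 x] vs by simp
      have lin2: "linear (\<lambda>v. \<Psi>' x ((y - x) # v # vs))"
        using bounded_multilinear_formD(1)[OF ml(2), of "(y - x) # X x # vs" "Suc 0" x] vs by simp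
      have 1: "\<bar>\<Psi> y (X y # vs) - \<Psi> x (X y # vs) - \<Psi>' x ((y - x) # X y # vs)\<bar> \<le> e / 2 * (norm (y - x) * p)"
      proof -
        have "norm (y - x) * c \<le> 1 * c" using le(2) c(1) by (intro mult_right_mono) auto
        then have "norm (X y) \<le> norm (X x) + c" using norm_triangle_ineq[of "X x" w] w unfolding Xy by linarith
        then have "e1 * norm (y - x) * (norm (X y) * p) \<le> e1 * norm (y - x) * ((norm (X x) + c) * p)"
          using e1(1) p by (intro mult_left_mono mult_right_mono) auto
        also have "\<dots> = (e1 * (norm (X x) + c)) * (norm (y - x) * p)" by (simp add: mult_ac)
        finally show ?thesis using d1(2)[OF le(1), of "X y # vs"] vs unfolding e1(2) by (simp add: p_def)
      qed
      have 2: "\<bar>\<Psi>' x ((y - x) # w # vs)\<bar> \<le> e / 2 * (norm (y - x) * p)"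
      proof -
        have "\<bar>\<Psi>' x ((y - x) # w # vs)\<bar> \<le> K * (norm (y - x) * (norm w * p))" using K(2)[of "(y - x) # w # vs"] vs by (simp add: p_def)
        also have "\<dots> \<le> K * (norm (y - x) * ((norm (y - x) * c) * p))"
          using K(1) p w by (intro mult_left_mono mult_right_mono) auto
        also have "\<dots> = (norm (y - x) * (K * c)) * (norm (y - x) * p)" by (simp add: mult_ac)
        also have "\<dots> \<le> (e / 2) * (norm (y - x) * p)"
        proof (rule mult_right_mono)
          have "norm (y - x) * (K * c) \<le> e / (2 * (K * c + 1)) * (K * c)" using le(3) Kc by (rule mult_right_mono)
          also have "\<dots> \<le> e / 2" using e Kc by (simp add: field_simps)
          finally show "norm (y - x) * (K * c) \<le> e / 2" .
        qed (use p in simp)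
        finally show ?thesis .
      qed
      \<comment> \<open>The total error is the differentiability error of the form at the argument X
        y, plus a second-order term that pairs y - x with the change w of the field.\<close>
      have eq: "\<Psi> y (X y # vs) - \<Psi> x (X x # vs) - (\<Psi>' x ((y - x) # X x # vs) + \<Psi> x (w # vs))
        = (\<Psi> y (X y # vs) - \<Psi> x (X y # vs) - \<Psi>' x ((y - x) # X y # vs)) + \<Psi>' x ((y - x) # w # vs)"
        unfolding Xy linear_add[OF lin1] linear_add[OF lin2] by simp
      then have "\<bar>\<Psi> y (X y # vs) - \<Psi> x (X x # vs) - (\<Psi>' x ((y - x) # X x # vs) + \<Psi> x (w # vs))\<bar> \<le> e * norm (y - x) * p"
        unfolding eq using order_trans[OF abs_triangle_ineq add_mono[OF 1 2]] by (simp add: mult_ac)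
      then show ?thesis by (simp add: p_def w_def)
    qed
    with d0 show ?thesis by blast
  qed
  moreover have "bounded_multilinear_form n (\<lambda>vs. \<Psi> x (X x # vs))" for x by (rule bounded_multilinear_form_eval[OF ml(1)])
  moreover have "bounded_multilinear_form (Suc n) (\<lambda>vs. \<Psi>' x (hd vs # X x # tl vs) + \<Psi> x ((X (hd vs) - X 0) # tl vs))" for x
    by (intro bounded_multilinear_form_add bounded_multilinear_form_eval_second ml bounded_multilinear_form_compose_first
        X[unfolded affine_map_def])
  ultimately show ?thesis unfolding form_derivative_def by simp
qed

text \<open>Fields are inserted one at a time. Each insertion lowers the order of the form by one
  and preserves \<open>form_derivative\<close>, so the induction is over all forms at once and ends
  with an ordinary derivative.\<close>

lemma form_derivative_has_derivative:
  fixes Xs :: "('a::real_normed_vector \<Rightarrow> 'a) list"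
  assumes "form_derivative (length Xs) \<Psi> \<Psi>'" "\<forall>X\<in>set Xs. affine_map X"
  shows "((\<lambda>g. \<Psi> g (map (\<lambda>X. X g) Xs)) has_derivative
    (\<lambda>v. \<Psi>' x (v # map (\<lambda>X. X x) Xs) + (\<Sum>i<length Xs. \<Psi> x ((map (\<lambda>X. X x) Xs)[i := (Xs ! i) v - (Xs ! i) 0])))) (at x)"
  using assms
proof (induction Xs arbitrary: \<Psi> \<Psi>')
  case Nil
  have ml: "bounded_multilinear_form (Suc 0) (\<Psi>' x)" using Nil by (simp add: form_derivative_def)
  obtain K where K: "\<And>vs. length vs = Suc 0 \<Longrightarrow> \<bar>\<Psi>' x vs\<bar> \<le> K * prod_list (map norm vs)"
    using bounded_multilinear_formD(2)[OF ml] by blast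
  have "linear (\<lambda>v. \<Psi>' x [v])" using bounded_multilinear_formD(1)[OF ml, of "[0]" 0] by simp
  moreover have "\<bar>\<Psi>' x [v]\<bar> \<le> norm v * K" for v using K[of "[v]"] by (simp add: mult.commute)
  ultimately have "bounded_linear (\<lambda>v. \<Psi>' x [v])" unfolding bounded_linear_def bounded_linear_axioms_def by auto
  moreover have "\<forall>e>0. \<exists>d>0. \<forall>y. norm (y - x) < d \<longrightarrow> norm (\<Psi> y [] - \<Psi> x [] - \<Psi>' x [y - x]) \<le> e * norm (y - x)"
  proof (intro allI impI)
    fix e :: real assume e: "e > 0"
    from conjunct2[OF conjunct2[OF Nil.prems(1)[unfolded form_derivative_def]], THEN spec[of _ x], THEN spec[of _ e], THEN mp, OF e]
    obtain d where d: "d > 0" "\<forall>y. norm (y - x) < d \<longrightarrow> (\<forall>vs. length vs = length ([] :: ('a \<Rightarrow> 'a) list) \<longrightarrow>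
        \<bar>\<Psi> y vs - \<Psi> x vs - \<Psi>' x ((y - x) # vs)\<bar> \<le> e * norm (y - x) * prod_list (map norm vs))"
      by (elim exE conjE) (rule that)
    have "norm (\<Psi> y [] - \<Psi> x [] - \<Psi>' x [y - x]) \<le> e * norm (y - x)" if y: "norm (y - x) < d" for y
      using d(2)[THEN spec[of _ y], THEN mp, OF y, THEN spec[of _ "[]"], THEN mp] by simp
    with d(1) show "\<exists>d>0. \<forall>y. norm (y - x) < d \<longrightarrow> norm (\<Psi> y [] - \<Psi> x [] - \<Psi>' x [y - x]) \<le> e * norm (y - x)"
      by (intro exI[of _ d] conjI allI impI)
  qed
  ultimately have "((\<lambda>g. \<Psi> g []) has_derivative (\<lambda>v. \<Psi>' x [v])) (at x)"
    unfolding has_derivative_at_alt by (rule conjI)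
  then show ?case by simp
next
  case (Cons X Xs)
  define \<Phi> where "\<Phi> = (\<lambda>x vs. \<Psi> x (X x # vs))"
  define \<Phi>' where "\<Phi>' = (\<lambda>x vs. \<Psi>' x (hd vs # X x # tl vs) + \<Psi> x ((X (hd vs) - X 0) # tl vs))"
  have "form_derivative (length Xs) \<Phi> \<Phi>'"
    unfolding \<Phi>_def \<Phi>'_def by (rule form_derivative_eval) (use Cons.prems in auto)
  then have "((\<lambda>g. \<Phi> g (map (\<lambda>X. X g) Xs)) has_derivative
    (\<lambda>v. \<Phi>' x (v # map (\<lambda>X. X x) Xs) + (\<Sum>i<length Xs. \<Phi> x ((map (\<lambda>X. X x) Xs)[i := (Xs ! i) v - (Xs ! i) 0])))) (at x)"
    by (rule Cons.IH) (use Cons.prems in simp)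
  then show ?case
    unfolding \<Phi>_def \<Phi>'_def list.size list.map add_0_right add_Suc_right sum.lessThan_Suc_shift list_update.simps nth_Cons_0 nth_Cons_Suc
      list.sel nat.case add.assoc .
qed

text \<open>Right-invariant fields have nonconstant, affine coefficients, so iterated derivatives
  involve higher Frechet derivatives in affine directions together with terms from differentiating
  those directions. This class contains them all.\<close>

inductive_set jet_functions :: "(nat \<Rightarrow> 'a::real_normed_vector \<Rightarrow> 'a list \<Rightarrow> real) \<Rightarrow> ('a \<Rightarrow> real) set" for D where
  eval: "\<forall>X\<in>set Xs. affine_map X \<Longrightarrow> (\<lambda>g. D (length Xs) g (map (\<lambda>X. X g) Xs)) \<in> jet_functions D"
| zero: "(\<lambda>_. 0) \<in> jet_functions D"
| add: "F \<in> jet_functions D \<Longrightarrow> G \<in> jet_functions D \<Longrightarrow> (\<lambda>g. F g + G g) \<in> jet_functions D"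

lemma jet_functions_sum:
  "(\<And>i. i \<in> A \<Longrightarrow> F i \<in> jet_functions D) \<Longrightarrow> (\<lambda>g. \<Sum>i\<in>A. F i g) \<in> jet_functions D"
  by (induction A rule: infinite_finite_induct) (auto intro: jet_functions.zero jet_functions.add)

lemma jet_functions_derivative:
  assumes D: "\<And>n. form_derivative n (D n) (D (Suc n))" and F: "F \<in> jet_functions D"
  shows "\<exists>F'. (\<forall>x. (F has_derivative F' x) (at x)) \<and> (\<forall>X. affine_map X \<longrightarrow> (\<lambda>x. F' x (X x)) \<in> jet_functions D)"
  using F
proof induction
  case (eval Xs)
  define F' where "F' x v = D (Suc (length Xs)) x (v # map (\<lambda>X. X x) Xs)
    + (\<Sum>i<length Xs. D (length Xs) x ((map (\<lambda>X. X x) Xs)[i := (Xs ! i) v - (Xs ! i) 0]))" for x v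
  have "(\<lambda>x. F' x (X x)) \<in> jet_functions D" if X: "affine_map X" for X
    unfolding F'_def
  proof (intro jet_functions.add jet_functions_sum)
    show "(\<lambda>x. D (Suc (length Xs)) x (X x # map (\<lambda>X. X x) Xs)) \<in> jet_functions D"
      using jet_functions.eval[of "X # Xs" D] eval X by simp
    fix i assume i: "i \<in> {..<length Xs}"
    define Ys where "Ys = Xs[i := \<lambda>x. (Xs ! i) (X x) - (Xs ! i) 0]"
    have "affine_map (\<lambda>x. (Xs ! i) (X x) - (Xs ! i) 0)" using eval X i by (intro affine_map_compose) auto
    then have "\<forall>Y\<in>set Ys. affine_map Y" using eval set_update_subset_insert[of Xs i] unfolding Ys_def by blast
    from jet_functions.eval[OF this, of D]
    show "(\<lambda>x. D (length Xs) x ((map (\<lambda>X. X x) Xs)[i := (Xs ! i) (X x) - (Xs ! i) 0])) \<in> jet_functions D"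
      by (simp add: Ys_def map_update)
  qed
  moreover have "((\<lambda>g. D (length Xs) g (map (\<lambda>X. X g) Xs)) has_derivative F' x) (at x)" for x
    unfolding F'_def[abs_def] by (rule form_derivative_has_derivative[OF D eval])
  ultimately show ?case by (intro exI[of _ F'] conjI allI impI)
next
  case zero
  show ?case by (rule exI[of _ "\<lambda>_ _. 0"]) (auto intro: jet_functions.zero)
next
  case (add F G)
  then obtain F' G' where *: "\<And>x. (F has_derivative F' x) (at x)" "\<And>X. affine_map X \<Longrightarrow> (\<lambda>x. F' x (X x)) \<in> jet_functions D"
    "\<And>x. (G has_derivative G' x) (at x)" "\<And>X. affine_map X \<Longrightarrow> (\<lambda>x. G' x (X x)) \<in> jet_functions D" by blast
  show ?case
    by (rule exI[of _ "\<lambda>x v. F' x v + G' x v"]) (auto intro!: has_derivative_add jet_functions.add *)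
qed

lemma deriv_along_line:
  fixes F :: "'a::real_normed_vector \<Rightarrow> real"
  assumes "(F has_derivative F') (at g)"
  shows "deriv (\<lambda>\<epsilon>. F (g + \<epsilon> *\<^sub>R v)) 0 = F' v"
proof (rule DERIV_imp_deriv)
  have 1: "((\<lambda>\<epsilon>::real. g + \<epsilon> *\<^sub>R v) has_derivative (\<lambda>\<epsilon>. \<epsilon> *\<^sub>R v)) (at 0)"
    by (auto intro!: derivative_eq_intros)
  have "(F has_derivative F') (at (g + 0 *\<^sub>R v))" using assms by simp
  from has_derivative_compose[OF 1 this]
  have "((\<lambda>\<epsilon>. F (g + \<epsilon> *\<^sub>R v)) has_derivative (\<lambda>\<epsilon>. F' (\<epsilon> *\<^sub>R v))) (at 0)" .
  moreover have "(\<lambda>\<epsilon>. F' (\<epsilon> *\<^sub>R v)) = (*) (F' v)"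
    using linear_cmul[OF has_derivative_linear[OF assms]] by (auto simp: mult.commute)
  ultimately show "((\<lambda>\<epsilon>. F (g + \<epsilon> *\<^sub>R v)) has_real_derivative F' v) (at 0)" by (simp add: has_field_derivative_def)
qed

subsection \<open>Invariant vector fields\<close>

lemma polynomially_bounded_iff:
  "polynomially_bounded F \<longleftrightarrow> (\<exists>K\<ge>0. \<exists>n::nat. \<forall>g. \<bar>F g\<bar> \<le> K * (1 + (norm (fst g) + norm (snd g))) ^ n)"
proof
  assume "polynomially_bounded F"
  then obtain K M :: real where F: "\<And>g. \<bar>F g\<bar> \<le> K * (1 + (norm (fst g) + norm (snd g))) powr M"
    unfolding polynomially_bounded_def by blast
  have "\<bar>F g\<bar> \<le> \<bar>K\<bar> * (1 + (norm (fst g) + norm (snd g))) ^ nat \<lceil>\<bar>M\<bar>\<rceil>" for g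
  proof -
    define N where "N = 1 + (norm (fst g) + norm (snd g))"
    have N: "N \<ge> 1" by (simp add: N_def)
    have "N powr M \<le> N powr real (nat \<lceil>\<bar>M\<bar>\<rceil>)" using N by (intro powr_mono) linarith+
    also have "\<dots> = N ^ nat \<lceil>\<bar>M\<bar>\<rceil>" using N by (intro powr_realpow) simp
    finally have "\<bar>K\<bar> * N powr M \<le> \<bar>K\<bar> * N ^ nat \<lceil>\<bar>M\<bar>\<rceil>" by (rule mult_left_mono) simp
    moreover have "K * N powr M \<le> \<bar>K\<bar> * N powr M" by (rule mult_right_mono) auto
    ultimately show ?thesis using F[of g] by (simp add: N_def)
  qed
  then show "\<exists>K\<ge>0. \<exists>n::nat. \<forall>g. \<bar>F g\<bar> \<le> K * (1 + (norm (fst g) + norm (snd g))) ^ n"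
    by (intro exI[of _ "\<bar>K\<bar>"] conjI exI[of _ "nat \<lceil>\<bar>M\<bar>\<rceil>"]) auto
next
  assume "\<exists>K\<ge>0. \<exists>n::nat. \<forall>g. \<bar>F g\<bar> \<le> K * (1 + (norm (fst g) + norm (snd g))) ^ n"
  then obtain K n where F: "\<And>g. \<bar>F g\<bar> \<le> K * (1 + (norm (fst g) + norm (snd g))) ^ n" by blast
  have "(1 + (norm (fst g) + norm (snd g))) ^ n = (1 + (norm (fst g) + norm (snd g))) powr real n" for g
    by (rule powr_realpow[symmetric]) (simp add: add_pos_nonneg)
  then show "polynomially_bounded F" using F unfolding polynomially_bounded_def by metis
qed

lemma polynomially_bounded_mult:
  assumes "polynomially_bounded F" "polynomially_bounded G"
  shows "polynomially_bounded (\<lambda>g. F g * G g)"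
proof -
  obtain K n L m where *: "K \<ge> 0" "\<And>g. \<bar>F g\<bar> \<le> K * (1 + (norm (fst g) + norm (snd g))) ^ n"
    "L \<ge> 0" "\<And>g. \<bar>G g\<bar> \<le> L * (1 + (norm (fst g) + norm (snd g))) ^ m"
    using assms unfolding polynomially_bounded_iff by blast
  have "\<bar>F g * G g\<bar> \<le> (K * L) * (1 + (norm (fst g) + norm (snd g))) ^ (n + m)" for g
    using mult_mono[OF *(2)[of g] *(4)[of g]] *(1) by (simp add: abs_mult power_add mult_ac)
  moreover have "K * L \<ge> 0" using * by simp
  ultimately show ?thesis unfolding polynomially_bounded_iff by blast
qed

lemma polynomially_bounded_add:
  assumes "polynomially_bounded F" "polynomially_bounded G"
  shows "polynomially_bounded (\<lambda>g. F g + G g)"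
proof -
  obtain K n L m where *: "K \<ge> 0" "\<And>g. \<bar>F g\<bar> \<le> K * (1 + (norm (fst g) + norm (snd g))) ^ n"
    "L \<ge> 0" "\<And>g. \<bar>G g\<bar> \<le> L * (1 + (norm (fst g) + norm (snd g))) ^ m"
    using assms unfolding polynomially_bounded_iff by blast
  have "\<bar>F g + G g\<bar> \<le> (K + L) * (1 + (norm (fst g) + norm (snd g))) ^ max n m" for g
  proof -
    define N where "N = 1 + (norm (fst g) + norm (snd g))"
    have N: "1 \<le> N" by (simp add: N_def)
    have "K * N ^ n \<le> K * N ^ max n m" "L * N ^ m \<le> L * N ^ max n m"
      using * N by (auto intro!: mult_left_mono power_increasing)
    then show ?thesis using *(2)[of g] *(4)[of g] unfolding N_def[symmetric] distrib_right by linarith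
  qed
  moreover have "K + L \<ge> 0" using * by simp
  ultimately show ?thesis unfolding polynomially_bounded_iff by blast
qed

lemma polynomially_bounded_const: "polynomially_bounded (\<lambda>_. c)"
  unfolding polynomially_bounded_iff by (rule exI[of _ "\<bar>c\<bar>"]) (auto intro!: exI[of _ 0])

context heis_bm
begin

interpretation om: bounded_bilinear \<omega> by (rule bil)

abbreviation hat :: "'h \<times> 'c \<Rightarrow> ('w \<times> 'c \<Rightarrow> real) \<Rightarrow> 'w \<times> 'c \<Rightarrow> real" where
  "hat h \<equiv> hat_field \<omega> (cm_embed \<iota> h)"

text \<open>The value at g of the right-invariant field of h: the derivative at 0 of \<epsilon> h
  times g, which is exactly affine in \<epsilon>.\<close>

definition fld :: "'h \<times> 'c \<Rightarrow> 'w \<times> 'c \<Rightarrow> 'w \<times> 'c" where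
  "fld h g = (\<iota> (fst h), snd h + (1/2) *\<^sub>R \<omega> (\<iota> (fst h)) (fst g))"

lemma affine_fld: "affine_map (fld h)"
proof -
  have "fld h g - fld h 0 = (0, (1/2) *\<^sub>R \<omega> (\<iota> (fst h)) (fst g))" for g by (simp add: fld_def om.zero_right)
  moreover have "bounded_linear (\<lambda>g::'w \<times> 'c. (0 :: 'w, (1/2) *\<^sub>R \<omega> (\<iota> (fst h)) (fst g)))"
    by (intro bounded_linear_Pair bounded_linear_zero bounded_linear_const_scaleR
        bounded_linear_compose[OF om.bounded_linear_right bounded_linear_fst])
  ultimately show ?thesis by (simp add: affine_map_def)
qed

lemma hat_eq:
  assumes "(F has_derivative F') (at g)"
  shows "hat h F g = F' (fld h g)"
proof -
  have "heis_mult \<omega> (\<epsilon> *\<^sub>R cm_embed \<iota> h) g = g + \<epsilon> *\<^sub>R fld h g" for \<epsilon>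
    by (simp add: heis_mult_def cm_embed_def fld_def prod_eq_iff om.scaleR_left scaleR_add_right add_ac)
  then show ?thesis unfolding hat_field_def using deriv_along_line[OF assms] by simp
qed

text \<open>In central directions the fields are constant, so a central derivative can be expressed
  by the right-invariant derivatives for which bounds are assumed.\<close>

lemma derivative_central:
  assumes "(F has_derivative F') (at g)"
  shows "F' (0, c) = (\<Sum>e\<in>EC. inner c e * hat (0, e) F g)"
proof -
  have lin: "linear F'" by (rule has_derivative_linear[OF assms])
  have "fld (0, e) g = (0, e)" for e by (simp add: fld_def linear_0[OF lin_\<iota>] om.zero_left)
  then have h: "hat (0, e) F g = F' (0, e)" for e using hat_eq[OF assms, of "(0, e)"] by simp
  have "(0 :: 'w, c) = (\<Sum>e\<in>EC. inner c e *\<^sub>R (0, e))"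
    using C_expansion[of c] by (simp add: prod_eq_iff fst_sum snd_sum)
  then have "F' (0, c) = F' (\<Sum>e\<in>EC. inner c e *\<^sub>R (0, e))" by simp
  also have "\<dots> = (\<Sum>e\<in>EC. inner c e * hat (0, e) F g)"
    unfolding linear_sum[OF lin] linear_cmul[OF lin] h by simp
  finally show ?thesis .
qed

text \<open>The two invariant fields differ only in the sign of their term in \<omega>, hence by the
  central vector \<omega> (fst g) (\<iota> (fst h)).\<close>

lemma tilde_eq:
  assumes F: "(F has_derivative F') (at g)"
  shows "tilde_field \<omega> (cm_embed \<iota> h) F g = hat h F g + (\<Sum>e\<in>EC. inner (\<omega> (fst g) (\<iota> (fst h))) e * hat (0, e) F g)"
proof -
  define v where "v = (\<iota> (fst h), snd h + (1/2) *\<^sub>R \<omega> (fst g) (\<iota> (fst h)))"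
  have "heis_mult \<omega> g (\<epsilon> *\<^sub>R cm_embed \<iota> h) = g + \<epsilon> *\<^sub>R v" for \<epsilon>
    by (simp add: heis_mult_def cm_embed_def v_def prod_eq_iff om.scaleR_right scaleR_add_right add_ac)
  then have t: "tilde_field \<omega> (cm_embed \<iota> h) F g = F' v" unfolding tilde_field_def using deriv_along_line[OF F] by simp
  have "v = fld h g + (0, \<omega> (fst g) (\<iota> (fst h)))"
  proof -
    define a where "a = \<omega> (fst g) (\<iota> (fst h))"
    have "\<omega> (\<iota> (fst h)) (fst g) = - a" unfolding a_def by (rule skew)
    moreover have "(1/2) *\<^sub>R a = a - (1/2) *\<^sub>R a" using scaleR_left.add[of "1/2" "1/2" a] by (simp add: eq_diff_eq)
    ultimately show ?thesis unfolding v_def fld_def a_def[symmetric] by (simp add: prod_eq_iff)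
  qed
  then have "F' v = F' (fld h g) + F' (0, \<omega> (fst g) (\<iota> (fst h)))" using linear_add[OF has_derivative_linear[OF F]] by simp
  then show ?thesis unfolding t hat_eq[OF F] derivative_central[OF F] .
qed

text \<open>The requirements of one integration by parts. They are not inherited by
  \<open>hat h F\<close>; for iteration they are derived from membership in
  \<open>field_algebra\<close>.\<close>

definition nice :: "('w \<times> 'c \<Rightarrow> real) \<Rightarrow> bool" where
  "nice F \<longleftrightarrow> (\<forall>g. F differentiable (at g)) \<and> polynomially_bounded F \<and>
     (\<forall>h. continuous_on UNIV (hat h F) \<and> polynomially_bounded (hat h F))"

text \<open>Iterated right-invariant derivatives with polynomial coefficients. The coefficients are
  those that left-invariant fields produce, so the class absorbs both kinds of fields.\<close>

inductive_set field_algebra :: "('w \<times> 'c \<Rightarrow> real) \<Rightarrow> ('w \<times> 'c \<Rightarrow> real) set" for f where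
  iter: "iter_hat \<omega> \<iota> ks f \<in> field_algebra f"
| cmult: "F \<in> field_algebra f \<Longrightarrow> (\<lambda>g. c * F g) \<in> field_algebra f"
| mult: "F \<in> field_algebra f \<Longrightarrow> (\<lambda>g. inner (\<omega> (fst g) w) e * F g) \<in> field_algebra f"
| add: "F \<in> field_algebra f \<Longrightarrow> G \<in> field_algebra f \<Longrightarrow> (\<lambda>g. F g + G g) \<in> field_algebra f"

lemma field_algebra_sum:
  "finite A \<Longrightarrow> (\<And>i. i \<in> A \<Longrightarrow> F i \<in> field_algebra f) \<Longrightarrow> (\<lambda>g. \<Sum>i\<in>A. F i g) \<in> field_algebra f"
  by (induction A rule: finite_induct)
    (auto intro: field_algebra.add field_algebra.cmult[OF field_algebra.iter, of 0 "[]" f, simplified])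

lemma frechet_smooth_form_derivative:
  assumes "frechet_smooth f"
  shows "\<exists>D. (\<forall>n. form_derivative n (D n) (D (Suc n))) \<and> (\<forall>x. D 0 x [] = f x)"
  using assms unfolding frechet_smooth_def
proof (elim exE conjE)
  fix D :: "nat \<Rightarrow> 'a \<Rightarrow> 'a list \<Rightarrow> real"
  assume D: "\<forall>x. D 0 x [] = f x" "\<forall>n x. bounded_multilinear_form n (D n x)"
    "\<forall>n x. \<forall>e>0. \<exists>d>0. \<forall>y. norm (y - x) < d \<longrightarrow> (\<forall>vs. length vs = n \<longrightarrow>
              \<bar>D n y vs - D n x vs - D (Suc n) x ((y - x) # vs)\<bar> \<le> e * norm (y - x) * prod_list (map norm vs))"
  show ?thesis
  proof (rule exI[of _ D], intro conjI allI D(1)[rule_format])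
    show "form_derivative n (D n) (D (Suc n))" for n
      unfolding form_derivative_def by (rule conjI[OF spec[OF D(2)] conjI[OF spec[OF D(2)] spec[OF D(3)]]])
  qed
qed

lemma iter_hat_jet:
  assumes D: "\<And>n. form_derivative n (D n) (D (Suc n))" and f: "\<And>x. D 0 x [] = f x"
  shows "iter_hat \<omega> \<iota> ks f \<in> jet_functions D"
proof (induction ks)
  case Nil
  then show ?case using jet_functions.eval[of "[]" D] f by (simp add: iter_hat_def)
next
  case (Cons k ks)
  from jet_functions_derivative[OF D this] obtain F' where
    F': "\<And>x. (iter_hat \<omega> \<iota> ks f has_derivative F' x) (at x)" "(\<lambda>x. F' x (fld k x)) \<in> jet_functions D"
    using affine_fld by blast
  have "iter_hat \<omega> \<iota> (k # ks) f = hat k (iter_hat \<omega> \<iota> ks f)" by (simp add: iter_hat_def)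
  also have "\<dots> = (\<lambda>x. F' x (fld k x))" using hat_eq[OF F'(1)] by blast
  finally show ?case using F'(2) by simp
qed

text \<open>Differentiability is carried through the induction because \<open>hat_field\<close> is a
  \<open>deriv\<close>, to which the sum and product rules apply only where the functions are
  differentiable.\<close>

lemma field_algebra_closed:
  assumes f: "frechet_smooth f" and pb: "\<forall>ks. polynomially_bounded (iter_hat \<omega> \<iota> ks f)" and F: "F \<in> field_algebra f"
  shows "(\<forall>g. F differentiable (at g)) \<and> polynomially_bounded F \<and> (\<forall>h. hat h F \<in> field_algebra f)"
  using F
proof induction
  case (iter ks)
  obtain D where D: "\<And>n. form_derivative n (D n) (D (Suc n))" "\<And>x. D 0 x [] = f x"
    using frechet_smooth_form_derivative[OF f] by (elim exE conjE) (rule that, erule spec, erule spec)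
  from jet_functions_derivative[OF D(1) iter_hat_jet[OF D]]
  have "iter_hat \<omega> \<iota> ks f differentiable (at g)" for g unfolding differentiable_def by blast
  moreover have "hat h (iter_hat \<omega> \<iota> ks f) \<in> field_algebra f" for h
    using field_algebra.iter[of "h # ks" f] by (simp add: iter_hat_def)
  ultimately show ?case using pb by blast
next
  case (cmult F c)
  have "\<forall>g. \<exists>F'. (F has_derivative F') (at g)" using cmult.IH by (simp add: differentiable_def)
  from choice[OF this] obtain F' where F': "\<And>g. (F has_derivative F' g) (at g)" by blast
  have d: "((\<lambda>g. c * F g) has_derivative (\<lambda>v. c * F' g v)) (at g)" for g by (intro has_derivative_mult_right F')
  have "hat h (\<lambda>g. c * F g) = (\<lambda>g. c * hat h F g)" for h by (rule ext) (simp only: hat_eq[OF d] hat_eq[OF F'])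
  moreover have "(\<lambda>g. c * F g) differentiable (at g)" for g unfolding differentiable_def by (rule exI, rule d)
  moreover have "polynomially_bounded (\<lambda>g. c * F g)"
    by (rule polynomially_bounded_mult[OF polynomially_bounded_const conjunct1[OF conjunct2[OF cmult.IH]]])
  moreover have "(\<lambda>g. c * hat h F g) \<in> field_algebra f" for h
    by (rule field_algebra.cmult) (rule spec[OF conjunct2[OF conjunct2[OF cmult.IH]]])
  ultimately show ?case by (simp only:) simp
next
  case (mult F w e)
  have "\<forall>g. \<exists>F'. (F has_derivative F') (at g)" using mult.IH by (simp add: differentiable_def)
  from choice[OF this] obtain F' where F': "\<And>g. (F has_derivative F' g) (at g)" by blast
  have bl: "bounded_linear (\<lambda>g::'w \<times> 'c. inner (\<omega> (fst g) w) e)"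
    by (intro bounded_linear_compose[OF bounded_linear_inner_left] bounded_linear_compose[OF om.bounded_linear_left bounded_linear_fst])
  have d: "((\<lambda>g. inner (\<omega> (fst g) w) e * F g) has_derivative (\<lambda>v. inner (\<omega> (fst g) w) e * F' g v + inner (\<omega> (fst v) w) e * F g)) (at g)" for g
    by (rule has_derivative_mult[OF bounded_linear.has_derivative[OF bl has_derivative_ident] F'])
  \<comment> \<open>The coefficient is linear in g, so its derivative along the field is a constant
    and the product rule stays inside the class.\<close>
  have h: "hat h (\<lambda>g. inner (\<omega> (fst g) w) e * F g) = (\<lambda>g. inner (\<omega> (fst g) w) e * hat h F g + inner (\<omega> (\<iota> (fst h)) w) e * F g)" for h
    by (rule ext) (simp only: hat_eq[OF d] hat_eq[OF F'], simp add: fld_def)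
  have "polynomially_bounded (\<lambda>g::'w \<times> 'c. inner (\<omega> (fst g) w) e)"
  proof -
    obtain K where K: "K > 0" "\<And>g::'w \<times> 'c. norm (inner (\<omega> (fst g) w) e) \<le> norm g * K" using bounded_linear.pos_bounded[OF bl] by blast
    have "\<bar>inner (\<omega> (fst g) w) e\<bar> \<le> K * (1 + (norm (fst g) + norm (snd g))) ^ 1" for g :: "'w \<times> 'c"
    proof -
      have "norm g \<le> 1 + (norm (fst g) + norm (snd g))" using norm_Pair_le[of "fst g" "snd g"] by simp
      then have "norm g * K \<le> (1 + (norm (fst g) + norm (snd g))) * K" using K(1) by (intro mult_right_mono) auto
      then show ?thesis using K(2)[of g] by (simp add: mult.commute)
    qed
    then show ?thesis unfolding polynomially_bounded_iff using K(1) less_imp_le by blast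
  qed
  moreover have "(\<lambda>g. inner (\<omega> (fst g) w) e * hat h F g + inner (\<omega> (\<iota> (fst h)) w) e * F g) \<in> field_algebra f" for h
    by (intro field_algebra.add field_algebra.mult field_algebra.cmult mult.hyps)
      (rule spec[OF conjunct2[OF conjunct2[OF mult.IH]]])
  moreover have "(\<lambda>g. inner (\<omega> (fst g) w) e * F g) differentiable (at g)" for g unfolding differentiable_def by (rule exI, rule d)
  ultimately show ?case unfolding h
    using polynomially_bounded_mult[OF _ conjunct1[OF conjunct2[OF mult.IH]]] by (intro conjI allI)
next
  case (add F G)
  have "\<forall>g. \<exists>F'. (F has_derivative F') (at g)" using add.IH by (simp add: differentiable_def)
  from choice[OF this] obtain F' where F': "\<And>g. (F has_derivative F' g) (at g)" by blast
  have "\<forall>g. \<exists>G'. (G has_derivative G') (at g)" using add.IH by (simp add: differentiable_def)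
  from choice[OF this] obtain G' where G': "\<And>g. (G has_derivative G' g) (at g)" by blast
  have d: "((\<lambda>g. F g + G g) has_derivative (\<lambda>v. F' g v + G' g v)) (at g)" for g by (intro has_derivative_add F' G')
  have "hat h (\<lambda>g. F g + G g) = (\<lambda>g. hat h F g + hat h G g)" for h by (rule ext) (simp only: hat_eq[OF d] hat_eq[OF F'] hat_eq[OF G'])
  moreover have "(\<lambda>g. F g + G g) differentiable (at g)" for g unfolding differentiable_def by (rule exI, rule d)
  moreover have "polynomially_bounded (\<lambda>g. F g + G g)"
    by (rule polynomially_bounded_add[OF conjunct1[OF conjunct2[OF add.IH(1)]] conjunct1[OF conjunct2[OF add.IH(2)]]])
  moreover have "(\<lambda>g. hat h F g + hat h G g) \<in> field_algebra f" for h
    by (rule field_algebra.add[OF spec[OF conjunct2[OF conjunct2[OF add.IH(1)]]] spec[OF conjunct2[OF conjunct2[OF add.IH(2)]]]])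
  ultimately show ?case by (simp only:) simp
qed

lemma field_algebra_nice:
  assumes "frechet_smooth f" "\<forall>ks. polynomially_bounded (iter_hat \<omega> \<iota> ks f)" "F \<in> field_algebra f"
  shows "nice F"
proof -
  note c = field_algebra_closed[OF assms(1,2)]
  have "continuous_on UNIV G" if "G \<in> field_algebra f" for G
    by (intro continuous_at_imp_continuous_on ballI differentiable_imp_continuous_within spec[OF conjunct1[OF c[OF that]]])
  then show ?thesis unfolding nice_def
    using c[OF assms(3)] conjunct1[OF conjunct2[OF c]] by (intro conjI allI) blast+
qed

lemma iter_tilde_field_algebra:
  assumes "frechet_smooth f" "\<forall>ks. polynomially_bounded (iter_hat \<omega> \<iota> ks f)"
  shows "iter_tilde \<omega> \<iota> hs f \<in> field_algebra f"
proof (induction hs)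
  case Nil
  then show ?case using field_algebra.iter[of "[]" f] by (simp add: iter_tilde_def iter_hat_def)
next
  case (Cons h hs)
  define F where "F = iter_tilde \<omega> \<iota> hs f"
  have F: "F \<in> field_algebra f" using Cons by (simp add: F_def)
  note c = field_algebra_closed[OF assms F]
  have "iter_tilde \<omega> \<iota> (h # hs) f = tilde_field \<omega> (cm_embed \<iota> h) F" by (simp add: iter_tilde_def F_def)
  also have "\<dots> = (\<lambda>g. hat h F g + (\<Sum>e\<in>EC. inner (\<omega> (fst g) (\<iota> (fst h))) e * hat (0, e) F g))"
  proof
    fix g
    obtain F' where "(F has_derivative F') (at g)" using c unfolding differentiable_def by blast
    from tilde_eq[OF this] show "tilde_field \<omega> (cm_embed \<iota> h) F g = hat h F g + (\<Sum>e\<in>EC. inner (\<omega> (fst g) (\<iota> (fst h))) e * hat (0, e) F g)" .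
  qed
  also have "\<dots> \<in> field_algebra f"
    by (intro field_algebra.add field_algebra_sum EC(1) field_algebra.mult) (rule spec[OF conjunct2[OF conjunct2[OF c]]])+
  finally show ?case .
qed

end

subsection \<open>Integration by parts for the invariant vector fields\<close>

context heis_bm
begin

interpretation om: bounded_bilinear \<omega> by (rule bil)

inductive_set weights :: "('s \<Rightarrow> real) set" where
  const: "(\<lambda>_. c) \<in> weights"
| gaussian: "\<zeta> \<in> V \<Longrightarrow> \<zeta> \<in> weights"
| add: "y \<in> weights \<Longrightarrow> z \<in> weights \<Longrightarrow> (\<lambda>x. y x + z x) \<in> weights"
| mult: "y \<in> weights \<Longrightarrow> z \<in> weights \<Longrightarrow> (\<lambda>x. y x * z x) \<in> weights"

lemma weights_in_all_Lp: "z \<in> weights \<Longrightarrow> in_all_Lp M z"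
  by (induction rule: weights.induct) (simp_all add: in_all_Lp_const V_in_all_Lp in_all_Lp_add in_all_Lp_mult)

text \<open>A Gaussian variable is its covariance c with \<Theta> times \<Theta> plus an orthogonal
  remainder, so its derivative is the constant c; sums and products follow by the usual
  rules.\<close>

lemma weights_diff_along:
  assumes \<Theta>: "\<Theta> \<in> V" "(\<E> x. (\<Theta> x)\<^sup>2) = 1" and z: "z \<in> weights"
  shows "\<exists>z'\<in>weights. diff_along M (orth \<Theta>) \<Theta> z z'"
  using z
proof induction
  case (const c)
  show ?case by (rule bexI[of _ "\<lambda>_. 0"], rule diff_along_const, rule weights.const)
next
  case (gaussian \<zeta>)
  define c where "c = (\<E> x. \<Theta> x * \<zeta> x)"
  define r where "r x = \<zeta> x - c * \<Theta> x" for x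
  have rV: "r \<in> V" unfolding r_def[abs_def]
    by (intro gaussian_family_diff[OF gaussian_family_V] gaussian_family_cmult[OF gaussian_family_V] gaussian \<Theta>)
  have "(\<E> x. \<Theta> x * r x) = (\<E> x. \<Theta> x * \<zeta> x - c * (\<Theta> x)\<^sup>2)"
    by (simp add: r_def power2_eq_square algebra_simps)
  also have "\<dots> = c - c * 1"
    using L2_mult_integrable[OF V_L2[OF \<Theta>(1)] V_L2[OF gaussian]] L2_integrable[OF V_L2[OF \<Theta>(1)]] \<Theta>(2) by (simp add: c_def)
  finally have "r \<in> borel_measurable (orth \<Theta>)" by (intro measurable_orth rV) simp
  then have "diff_along M (orth \<Theta>) \<Theta> \<zeta> (\<lambda>_. c)" by (rule diff_along_affine) (simp add: r_def)
  then show ?case by (rule bexI[OF _ weights.const])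
next
  case (add y z)
  then obtain y' z' where w: "y' \<in> weights" "z' \<in> weights" and d: "diff_along M (orth \<Theta>) \<Theta> y y'" "diff_along M (orth \<Theta>) \<Theta> z z'" by blast
  show ?case by (rule bexI[OF _ weights.add[OF w]], rule diff_along_add[OF d])
next
  case (mult y z)
  then obtain y' z' where w: "y' \<in> weights" "z' \<in> weights" and d: "diff_along M (orth \<Theta>) \<Theta> y y'" "diff_along M (orth \<Theta>) \<Theta> z z'" by blast
  show ?case by (rule bexI[OF _ weights.add[OF weights.mult[OF w(1) mult.hyps(2)] weights.mult[OF mult.hyps(1) w(2)]]], rule diff_along_mult[OF d])
qed

lemma \<xi>_measurable: "\<xi> \<in> borel_measurable M"
proof -
  have "(\<lambda>x. (B T x, B0 T x + (1/2) *\<^sub>R I T x)) \<in> borel_measurable M"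
    using T by (intro borel_measurable_Pair borel_measurable_add borel_measurable_scaleR borel_measurable_const
        B_measurable B0_measurable I_measurable) auto
  then show ?thesis by (simp add: heis_brownian_def[abs_def])
qed

lemma \<xi>_norm_in_all_Lp: "in_all_Lp M (\<lambda>x. 1 + (norm (fst (\<xi> x)) + norm (snd (\<xi> x))))"
proof (rule in_all_Lp_bound)
  let ?N = "\<lambda>x. 1 + (norm (fst (\<xi> x)) + norm (snd (\<xi> x)))" and ?U = "\<lambda>x. 1 + (norm (X T x) + (norm (X T x) + (\<Sum>e\<in>EC. \<bar>inner (I T x) e\<bar>)))"
  note N = X_norm_in_all_Lp[OF T]
  show "in_all_Lp M (\<lambda>x. ?U x)"
    by (intro in_all_Lp_add in_all_Lp_const N in_all_Lp_sum in_all_Lp_abs I_approximation(1))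
  have m: "(\<lambda>x. fst (\<xi> x)) \<in> borel_measurable M" "(\<lambda>x. snd (\<xi> x)) \<in> borel_measurable M"
    by (rule measurable_compose[OF \<xi>_measurable borel_measurable_continuous_onI], intro continuous_intros)+
  show "(\<lambda>x. ?N x) \<in> borel_measurable M"
    by (intro borel_measurable_add borel_measurable_const measurable_norm_comp m)
  have le: "?N x \<le> ?U x" for x
  proof -
    have "norm (I T x) = norm (\<Sum>e\<in>EC. inner (I T x) e *\<^sub>R e)" using C_expansion[of "I T x"] by simp
    also have "\<dots> \<le> (\<Sum>e\<in>EC. norm (inner (I T x) e *\<^sub>R e))" by (rule norm_sum)
    also have "\<dots> = (\<Sum>e\<in>EC. \<bar>inner (I T x) e\<bar>)" by (intro sum.cong) (auto simp: norm_EC)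
    finally have 1: "norm (I T x) \<le> (\<Sum>e\<in>EC. \<bar>inner (I T x) e\<bar>)" .
    have "norm (B0 T x + (1/2) *\<^sub>R I T x) \<le> norm (B0 T x) + norm ((1/2) *\<^sub>R I T x)" by (rule norm_triangle_ineq)
    moreover have "norm ((1/2) *\<^sub>R I T x) = norm (I T x) / 2" by simp
    moreover have "norm (B T x) \<le> norm (X T x)" "norm (B0 T x) \<le> norm (X T x)"
      using norm_fst_le[of "B T x" "B0 T x"] norm_snd_le[of "B0 T x" "B T x"] by simp_all
    ultimately show ?thesis using 1 norm_ge_zero[of "I T x"] unfolding heis_brownian_def fst_conv snd_conv by linarith
  qed
  show "AE x in M. \<bar>?N x\<bar> \<le> \<bar>?U x\<bar>"
  proof (rule AE_I2)
    fix x
    have "0 \<le> ?N x" by (intro add_nonneg_nonneg) auto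
    then show "\<bar>?N x\<bar> \<le> \<bar>?U x\<bar>"
      using le[of x] by linarith
  qed
qed

lemma polynomially_bounded_in_all_Lp:
  assumes c: "continuous_on UNIV F" and pb: "polynomially_bounded F"
  shows "in_all_Lp M (\<lambda>x. F (\<xi> x))"
proof -
  obtain K n where K: "K \<ge> 0" "\<And>g. \<bar>F g\<bar> \<le> K * (1 + (norm (fst g) + norm (snd g))) ^ n"
    using pb unfolding polynomially_bounded_iff by blast
  show ?thesis
  proof (rule in_all_Lp_bound[OF in_all_Lp_mult[OF in_all_Lp_const in_all_Lp_power[OF \<xi>_norm_in_all_Lp]]])
    show "(\<lambda>x. F (\<xi> x)) \<in> borel_measurable M" by (rule measurable_compose[OF \<xi>_measurable borel_measurable_continuous_onI[OF c]])
    show "AE x in M. \<bar>F (\<xi> x)\<bar> \<le> \<bar>K * (1 + (norm (fst (\<xi> x)) + norm (snd (\<xi> x)))) ^ n\<bar>"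
      by (rule AE_I2) (rule order_trans[OF K(2) abs_ge_self])
  qed
qed

lemma nice_derivative: "nice F \<Longrightarrow> \<exists>F'. (F has_derivative F') (at g)"
  unfolding nice_def differentiable_def by blast

lemma nice_continuous: "nice F \<Longrightarrow> continuous_on UNIV F"
  by (intro continuous_at_imp_continuous_on ballI differentiable_imp_continuous_within)
    (unfold differentiable_def, rule nice_derivative)

lemma nice_in_all_Lp:
  assumes "nice F"
  shows "in_all_Lp M (\<lambda>x. F (\<xi> x))" "in_all_Lp M (\<lambda>x. hat h F (\<xi> x))"
proof -
  show "in_all_Lp M (\<lambda>x. F (\<xi> x))" using assms
    by (intro polynomially_bounded_in_all_Lp nice_continuous) (simp_all add: nice_def)
  have "continuous_on UNIV (hat h F)" "polynomially_bounded (hat h F)" using assms unfolding nice_def by blast+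
  then show "in_all_Lp M (\<lambda>x. hat h F (\<xi> x))" by (rule polynomially_bounded_in_all_Lp)
qed

text \<open>The order of quantifiers matters: the new weight may depend on the old one but not on F,
  as the final weights must not depend on f. Since Q takes F and the sample point, random
  coefficients are allowed.\<close>

definition ibp :: "(('w \<times> 'c \<Rightarrow> real) \<Rightarrow> 's \<Rightarrow> real) \<Rightarrow> bool" where
  "ibp Q \<longleftrightarrow> (\<forall>F. nice F \<longrightarrow> in_all_Lp M (Q F)) \<and>
     (\<forall>z\<in>weights. \<exists>z'\<in>weights. \<forall>F. nice F \<longrightarrow> (\<E> x. Q F x * z x) = (\<E> x. F (\<xi> x) * z' x))"

lemma ibpD:
  assumes "ibp Q"
  shows "nice F \<Longrightarrow> in_all_Lp M (Q F)"
    and "z \<in> weights \<Longrightarrow> \<exists>z'\<in>weights. \<forall>F. nice F \<longrightarrow> (\<E> x. Q F x * z x) = (\<E> x. F (\<xi> x) * z' x)"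
  using assms unfolding ibp_def by blast+

lemma ibpI:
  assumes "\<And>F. nice F \<Longrightarrow> in_all_Lp M (Q F)"
    and "\<And>z. z \<in> weights \<Longrightarrow> \<exists>z'\<in>weights. \<forall>F. nice F \<longrightarrow> (\<E> x. Q F x * z x) = (\<E> x. F (\<xi> x) * z' x)"
  shows "ibp Q"
  unfolding ibp_def using assms by (intro conjI allI impI ballI)

lemma ibp_cong:
  assumes Q: "ibp Q" and eq: "\<And>F x. nice F \<Longrightarrow> Q' F x = Q F x"
  shows "ibp Q'"
proof -
  have e: "Q' F = Q F" if "nice F" for F using eq[OF that] by (rule ext)
  show ?thesis
  proof (rule ibpI)
    show "nice F \<Longrightarrow> in_all_Lp M (Q' F)" for F using ibpD(1)[OF Q, of F] e[of F] by simp
    fix z assume "z \<in> weights"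
    from ibpD(2)[OF Q this] obtain z' where z': "z' \<in> weights"
      "\<forall>F. nice F \<longrightarrow> (\<E> x. Q F x * z x) = (\<E> x. F (\<xi> x) * z' x)" by (elim bexE) (rule that)
    show "\<exists>z'\<in>weights. \<forall>F. nice F \<longrightarrow> (\<E> x. Q' F x * z x) = (\<E> x. F (\<xi> x) * z' x)"
      by (rule bexI[OF _ z'(1)]) (use z'(2) in \<open>simp add: e\<close>)
  qed
qed

lemma ibp_zero: "ibp (\<lambda>_ _. 0)"
  by (rule ibpI) (auto intro!: in_all_Lp_const bexI[OF _ weights.const[of 0]])

lemma ibp_add:
  assumes Q: "ibp Q" and Q': "ibp Q'"
  shows "ibp (\<lambda>F x. Q F x + Q' F x)"
proof (rule ibpI)
  show "nice F \<Longrightarrow> in_all_Lp M (\<lambda>x. Q F x + Q' F x)" for F by (intro in_all_Lp_add ibpD(1)[OF Q] ibpD(1)[OF Q'])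
  fix z assume z: "z \<in> weights"
  from ibpD(2)[OF Q z] obtain y where y: "y \<in> weights"
    "\<forall>F. nice F \<longrightarrow> (\<E> x. Q F x * z x) = (\<E> x. F (\<xi> x) * y x)" by (elim bexE) (rule that)
  from ibpD(2)[OF Q' z] obtain y' where y': "y' \<in> weights"
    "\<forall>F. nice F \<longrightarrow> (\<E> x. Q' F x * z x) = (\<E> x. F (\<xi> x) * y' x)" by (elim bexE) (rule that)
  show "\<exists>z'\<in>weights. \<forall>F. nice F \<longrightarrow> (\<E> x. (Q F x + Q' F x) * z x) = (\<E> x. F (\<xi> x) * z' x)"
  proof (rule bexI[OF _ weights.add[OF y(1) y'(1)]], intro allI impI)
    fix F assume n: "nice F"
    note i = in_all_LpD(3)[OF in_all_Lp_mult[OF ibpD(1)[OF Q n] weights_in_all_Lp[OF z]]]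
      in_all_LpD(3)[OF in_all_Lp_mult[OF ibpD(1)[OF Q' n] weights_in_all_Lp[OF z]]]
      in_all_LpD(3)[OF in_all_Lp_mult[OF nice_in_all_Lp(1)[OF n] weights_in_all_Lp[OF y(1)]]]
      in_all_LpD(3)[OF in_all_Lp_mult[OF nice_in_all_Lp(1)[OF n] weights_in_all_Lp[OF y'(1)]]]
    have "(\<E> x. (Q F x + Q' F x) * z x) = (\<E> x. Q F x * z x) + (\<E> x. Q' F x * z x)"
      unfolding distrib_right by (rule Bochner_Integration.integral_add[OF i(1,2)])
    also have "\<dots> = (\<E> x. F (\<xi> x) * y x) + (\<E> x. F (\<xi> x) * y' x)" using y(2) y'(2) n by simp
    also have "\<dots> = (\<E> x. F (\<xi> x) * (y x + y' x))"
      unfolding distrib_left by (rule Bochner_Integration.integral_add[OF i(3,4), symmetric])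
    finally show "(\<E> x. (Q F x + Q' F x) * z x) = (\<E> x. F (\<xi> x) * (y x + y' x))" .
  qed
qed

lemma ibp_weight:
  assumes y: "y \<in> weights" and Q: "ibp Q"
  shows "ibp (\<lambda>F x. y x * Q F x)"
proof (rule ibpI)
  show "nice F \<Longrightarrow> in_all_Lp M (\<lambda>x. y x * Q F x)" for F by (intro in_all_Lp_mult ibpD(1)[OF Q] weights_in_all_Lp[OF y])
  fix z assume z: "z \<in> weights"
  have "(\<E> x. y x * Q F x * z x) = (\<E> x. Q F x * (y x * z x))" for F by (simp add: mult_ac)
  then show "\<exists>z'\<in>weights. \<forall>F. nice F \<longrightarrow> (\<E> x. y x * Q F x * z x) = (\<E> x. F (\<xi> x) * z' x)"
    using ibpD(2)[OF Q weights.mult[OF y z]] by (simp only:)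
qed

lemma ibp_sum:
  assumes "finite A" "\<And>i. i \<in> A \<Longrightarrow> ibp (Q i)"
  shows "ibp (\<lambda>F x. \<Sum>i\<in>A. Q i F x)"
  using assms
proof (induction A rule: finite_induct)
  case empty
  show ?case by (rule ibp_cong[OF ibp_zero]) simp
next
  case (insert i A)
  have "ibp (\<lambda>F x. Q i F x + (\<Sum>i\<in>A. Q i F x))" by (intro ibp_add insert.IH insert.prems) auto
  then show ?case by (rule ibp_cong) (simp add: insert.hyps)
qed

text \<open>It is a continuous functional of B T, hence Gaussian.\<close>

lemma omega_weight: "(\<lambda>x. inner (\<omega> w (fst (\<xi> x))) e) \<in> weights"
proof -
  define v where "v = Blinfun (\<lambda>b. inner (\<omega> w b) e)"
  have v: "v b = inner (\<omega> w b) e" for b unfolding v_def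
    by (subst bounded_linear_Blinfun_apply) (auto intro!: bounded_linear_compose[OF bounded_linear_inner_left] om.bounded_linear_right)
  have "lf v 0 T \<in> weights" using T by (intro weights.gaussian lf_V) simp
  then show ?thesis by (simp add: lf_def[abs_def] v heis_brownian_def)
qed

text \<open>The derivative of F at the endpoint with respect to \<Theta> is that of F in the
  direction (\<iota> A, L). This direction is the right-invariant field of (A, 0) plus the central
  vector L - (1/2) \<omega> (\<iota> A) (B T).\<close>

lemma splits_ibp:
  assumes sp: "splits \<Theta> (\<iota> A) L" and Lw: "\<And>e. e \<in> EC \<Longrightarrow> (\<lambda>x. inner (L x) e) \<in> weights"
  shows "ibp (\<lambda>F x. hat (A, 0) F (\<xi> x) +
    (\<Sum>e\<in>EC. (inner (L x) e + (-1/2) * inner (\<omega> (\<iota> A) (fst (\<xi> x))) e) * hat (0, e) F (\<xi> x)))"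
proof -
  define Q where "Q F x = hat (A, 0) F (\<xi> x) +
    (\<Sum>e\<in>EC. (inner (L x) e + (-1/2) * inner (\<omega> (\<iota> A) (fst (\<xi> x))) e) * hat (0, e) F (\<xi> x))" for F x
  obtain R q where \<Theta>: "\<Theta> \<in> V" "(\<E> x. (\<Theta> x)\<^sup>2) = 1" and m: "L \<in> borel_measurable (orth \<Theta>)" "R \<in> borel_measurable (orth \<Theta>)" "q \<in> borel_measurable (orth \<Theta>)"
    and ae: "AE x in M. fst (\<xi> x) = R x + \<Theta> x *\<^sub>R \<iota> A \<and> snd (\<xi> x) = q x + \<Theta> x *\<^sub>R L x"
    using sp unfolding splits_def by (elim conjE bexE) (rule that)
  have ww: "(\<lambda>x. inner (L x) e + (-1/2) * inner (\<omega> (\<iota> A) (fst (\<xi> x))) e) \<in> weights" if "e \<in> EC" for e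
    by (intro weights.add weights.mult weights.const omega_weight Lw that)
  have QL: "in_all_Lp M (Q F)" if "nice F" for F unfolding Q_def[abs_def]
    by (intro in_all_Lp_add in_all_Lp_sum in_all_Lp_mult nice_in_all_Lp(2)[OF that] weights_in_all_Lp[OF ww])
  \<comment> \<open>The endpoint with the value of \<Theta> replaced by a free real
    variable.\<close>
  define \<Gamma> where "\<Gamma> p = (R (snd p) + fst p *\<^sub>R \<iota> A, q (snd p) + fst p *\<^sub>R L (snd p))" for p :: "real \<times> 's"
  have mm: "(\<lambda>p :: real \<times> 's. fst p) \<in> borel_measurable (borel \<Otimes>\<^sub>M orth \<Theta>)" by (rule measurable_fst)
  note ms = measurable_compose[OF measurable_snd]
  have f1: "(\<lambda>p. R (snd p) + fst p *\<^sub>R \<iota> A) \<in> borel_measurable (borel \<Otimes>\<^sub>M orth \<Theta>)"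
    by (intro borel_measurable_add borel_measurable_scaleR borel_measurable_const mm ms[OF m(2)])
  have f2: "(\<lambda>p. q (snd p) + fst p *\<^sub>R L (snd p)) \<in> borel_measurable (borel \<Otimes>\<^sub>M orth \<Theta>)"
    by (intro borel_measurable_add borel_measurable_scaleR mm ms[OF m(1)] ms[OF m(3)])
  have \<Gamma>m: "\<Gamma> \<in> borel_measurable (borel \<Otimes>\<^sub>M orth \<Theta>)" unfolding \<Gamma>_def[abs_def] by (rule borel_measurable_Pair[OF f1 f2])
  define Z' where "Z' F p = hat (A, 0) F (\<Gamma> p) +
    (\<Sum>e\<in>EC. (inner (L (snd p)) e + (-1/2) * inner (\<omega> (\<iota> A) (fst (\<Gamma> p))) e) * hat (0, e) F (\<Gamma> p))" for F p
  have d: "diff_along M (orth \<Theta>) \<Theta> (\<lambda>x. F (\<xi> x)) (Q F)" if n: "nice F" for F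
    unfolding diff_along_def
  proof (rule exI[of _ "\<lambda>p. F (\<Gamma> p)"], rule exI[of _ "Z' F"], intro conjI ballI allI)
    have hc: "continuous_on UNIV (hat h F)" for h using n unfolding nice_def by blast
    have cm: "(\<lambda>p. \<psi> (\<Gamma> p)) \<in> borel_measurable (borel \<Otimes>\<^sub>M orth \<Theta>)" if "continuous_on UNIV \<psi>" for \<psi> :: "'w \<times> 'c \<Rightarrow> real"
      by (rule measurable_compose[OF \<Gamma>m borel_measurable_continuous_onI[OF that]])
    show "(\<lambda>p. F (\<Gamma> p)) \<in> borel_measurable (borel \<Otimes>\<^sub>M orth \<Theta>)" by (rule cm[OF nice_continuous[OF n]])
    have oc: "continuous_on UNIV (\<lambda>g::'w \<times> 'c. inner (\<omega> (\<iota> A) (fst g)) e)" for e by (intro continuous_intros om.continuous_on)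
    show "Z' F \<in> borel_measurable (borel \<Otimes>\<^sub>M orth \<Theta>)" unfolding Z'_def[abs_def]
      by (intro borel_measurable_add borel_measurable_sum borel_measurable_times borel_measurable_const borel_measurable_inner
          cm[OF hc] cm[OF oc] ms[OF m(1)])
    fix x assume "x \<in> space M"
    have \<Gamma>d: "((\<lambda>\<theta>. \<Gamma> (\<theta>, x)) has_derivative (\<lambda>t. t *\<^sub>R (\<iota> A, L x))) (at \<theta>)" for \<theta>
      unfolding \<Gamma>_def by (auto intro!: derivative_eq_intros)
    have \<Gamma>c: "continuous_on UNIV (\<lambda>\<theta>. \<Gamma> (\<theta>, x))" unfolding \<Gamma>_def by (simp, intro continuous_intros)
    show "((\<lambda>\<theta>. F (\<Gamma> (\<theta>, x))) has_real_derivative Z' F (\<theta>, x)) (at \<theta>)" for \<theta>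
    proof -
      define g where "g = \<Gamma> (\<theta>, x)"
      obtain F' where F': "(F has_derivative F') (at g)" using nice_derivative[OF n] by blast
      have lin: "linear F'" by (rule has_derivative_linear[OF F'])
      have "((\<lambda>\<theta>. F (\<Gamma> (\<theta>, x))) has_derivative (\<lambda>t. F' (t *\<^sub>R (\<iota> A, L x)))) (at \<theta>)"
        using has_derivative_compose[OF \<Gamma>d F'[unfolded g_def]] .
      moreover have "(\<lambda>t. F' (t *\<^sub>R (\<iota> A, L x))) = (*) (F' (\<iota> A, L x))"
        using linear_cmul[OF lin, of _ "(\<iota> A, L x)"] by (auto simp: mult.commute)
      moreover have "F' (\<iota> A, L x) = Z' F (\<theta>, x)"
      proof -
        have "(\<iota> A, L x) = fld (A, 0) g + (0, L x + (-1/2) *\<^sub>R \<omega> (\<iota> A) (fst g))" by (simp add: fld_def)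
        then have "F' (\<iota> A, L x) = F' (fld (A, 0) g) + F' (0, L x + (-1/2) *\<^sub>R \<omega> (\<iota> A) (fst g))"
          using linear_add[OF lin] by (simp only:)
        also have "\<dots> = Z' F (\<theta>, x)"
          unfolding derivative_central[OF F'] hat_eq[OF F', symmetric] Z'_def g_def[symmetric] snd_conv inner_add_left inner_scaleR_left ..
        finally show ?thesis .
      qed
      ultimately show ?thesis by (simp add: has_field_derivative_def)
    qed
    have cc: "continuous_on UNIV (\<lambda>\<theta>. \<psi> (\<Gamma> (\<theta>, x)))" if "continuous_on UNIV \<psi>" for \<psi> :: "'w \<times> 'c \<Rightarrow> real"
      by (rule continuous_on_compose2[OF that \<Gamma>c]) simp
    show "continuous_on UNIV (\<lambda>\<theta>. Z' F (\<theta>, x))" unfolding Z'_def snd_conv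
      by (intro continuous_on_add continuous_on_sum continuous_on_mult continuous_on_const cc[OF hc] cc[OF oc])
  next
    show "AE x in M. F (\<xi> x) = F (\<Gamma> (\<Theta> x, x)) \<and> Q F x = Z' F (\<Theta> x, x)"
      using ae
    proof eventually_elim
      case (elim x)
      then have "\<xi> x = \<Gamma> (\<Theta> x, x)" by (simp add: \<Gamma>_def prod_eq_iff)
      then show ?case by (simp add: Q_def Z'_def)
    qed
  qed
  have "ibp Q"
  proof (rule ibpI[OF QL])
    fix z assume z: "z \<in> weights"
    obtain y where y: "y \<in> weights" "diff_along M (orth \<Theta>) \<Theta> z y" using weights_diff_along[OF \<Theta> z] by blast
    \<comment> \<open>Integrating the derivative of F z by parts gives the mean of \<Theta> F z;
      moving the term with the derivative y of z to the other side produces this weight.\<close>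
    have w: "(\<lambda>x. \<Theta> x * z x + (-1) * y x) \<in> weights"
      by (intro weights.add weights.mult weights.gaussian weights.const z y \<Theta>)
    show "\<exists>z'\<in>weights. \<forall>F. nice F \<longrightarrow> (\<E> x. Q F x * z x) = (\<E> x. F (\<xi> x) * z' x)"
    proof (rule bexI[OF _ w], intro allI impI)
      fix F assume n: "nice F"
      note zL = weights_in_all_Lp[OF z] and yL = weights_in_all_Lp[OF y(1)] and nL = nice_in_all_Lp(1)[OF n]
      note i1 = in_all_Lp_mult[OF QL[OF n] zL] and i2 = in_all_Lp_mult[OF nL yL] and i3 = in_all_Lp_mult[OF nL zL]
      have "(\<E> x. Q F x * z x + F (\<xi> x) * y x) = (\<E> x. \<Theta> x * (F (\<xi> x) * z x))"
        by (rule orth_IBP[OF \<Theta> diff_along_mult[OF d[OF n] y(2)] i3 in_all_Lp_add[OF i1 i2]])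
      then have "(\<E> x. Q F x * z x) = (\<E> x. \<Theta> x * (F (\<xi> x) * z x)) - (\<E> x. F (\<xi> x) * y x)"
        using Bochner_Integration.integral_add[OF in_all_LpD(3)[OF i1] in_all_LpD(3)[OF i2]] by simp
      also have "\<dots> = (\<E> x. \<Theta> x * (F (\<xi> x) * z x) - F (\<xi> x) * y x)"
        by (rule Bochner_Integration.integral_diff[OF in_all_LpD(3)[OF in_all_Lp_mult[OF V_in_all_Lp[OF \<Theta>(1)] i3]] in_all_LpD(3)[OF i2], symmetric])
      also have "\<dots> = (\<E> x. F (\<xi> x) * (\<Theta> x * z x + (-1) * y x))"
        by (intro Bochner_Integration.integral_cong) (auto simp: algebra_simps)
      finally show "(\<E> x. Q F x * z x) = (\<E> x. F (\<xi> x) * (\<Theta> x * z x + (-1) * y x))" .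
    qed
  qed
  then show ?thesis unfolding Q_def[abs_def] .
qed

lemma hat_zero: "nice F \<Longrightarrow> hat (0, 0) F g = 0"
proof -
  assume "nice F"
  then obtain F' where F': "(F has_derivative F') (at g)" using nice_derivative by blast
  have "fld (0, 0) g = 0" by (simp add: fld_def linear_0[OF lin_\<iota>] om.zero_left zero_prod_def)
  then show ?thesis using hat_eq[OF F', of "(0, 0)"] linear_0[OF has_derivative_linear[OF F']] by simp
qed

text \<open>With A = 0 the field of (A, 0) and the correction by \<omega> vanish, and orthonormality
  reduces the sum to sqrt T times the wanted derivative.\<close>

lemma ibp_central:
  assumes e: "e \<in> EC"
  shows "ibp (\<lambda>F x. hat (0, e) F (\<xi> x))"
proof -
  let ?S = "\<lambda>F x. \<Sum>b\<in>EC. (inner (sqrt T *\<^sub>R e) b + (-1/2) * inner (\<omega> (\<iota> 0) (fst (\<xi> x))) b) * hat (0, b) F (\<xi> x)"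
  obtain \<Theta> where "splits \<Theta> 0 (\<lambda>_. sqrt T *\<^sub>R e)" using central_split[OF e] by blast
  then have s: "splits \<Theta> (\<iota> 0) (\<lambda>_. sqrt T *\<^sub>R e)" by (simp add: linear_0[OF lin_\<iota>])
  have "ibp (\<lambda>F x. 1 / sqrt T * (hat (0, 0) F (\<xi> x) +
    ?S F x))"
    by (intro ibp_weight weights.const splits_ibp[OF s])
  then show ?thesis
  proof (rule ibp_cong)
    fix F x assume n: "nice F"
    have "?S F x
      = (\<Sum>b\<in>EC. if b = e then sqrt T * hat (0, b) F (\<xi> x) else 0)"
      by (intro sum.cong) (auto simp: linear_0[OF lin_\<iota>] om.zero_left EC(3) e)
    then show "hat (0, e) F (\<xi> x) = 1 / sqrt T * (hat (0, 0) F (\<xi> x) +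
      ?S F x)"
      using e EC(1) T by (simp add: hat_zero[OF n])
  qed
qed

text \<open>The split produces the right-invariant derivative together with central derivatives.
  Those already admit integration by parts with any weight as coefficient, so they can be
  subtracted.\<close>

lemma ibp_wiener: "ibp (\<lambda>F x. hat (A, 0) F (\<xi> x))"
proof (cases "A = 0")
  case True
  show ?thesis by (rule ibp_cong[OF ibp_zero]) (simp add: True hat_zero)
next
  case False
  define \<kappa> where "\<kappa> = sqrt T / norm A"
  have \<kappa>: "\<kappa> > 0" using T False by (simp add: \<kappa>_def)
  obtain \<Theta> L where s0: "splits \<Theta> (\<kappa> *\<^sub>R \<iota> A) L" and L: "\<And>e. e \<in> EC \<Longrightarrow> (\<lambda>x. inner (L x) e) \<in> V"
    using wiener_split[OF False] unfolding \<kappa>_def by blast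
  have s: "splits \<Theta> (\<iota> (\<kappa> *\<^sub>R A)) L" using s0 by (simp add: linear_cmul[OF lin_\<iota>])
  have Lw: "(\<lambda>x. inner (L x) e) \<in> weights" if "e \<in> EC" for e by (rule weights.gaussian[OF L[OF that]])
  define y where "y e x = inner (L x) e + (-1/2) * inner (\<omega> (\<iota> (\<kappa> *\<^sub>R A)) (fst (\<xi> x))) e" for e x
  have yw: "(\<lambda>x. (-1) * y e x) \<in> weights" if "e \<in> EC" for e unfolding y_def
    by (intro weights.add weights.mult weights.const omega_weight Lw that)
  have "ibp (\<lambda>F x. 1 / \<kappa> * ((hat (\<kappa> *\<^sub>R A, 0) F (\<xi> x) + (\<Sum>e\<in>EC. y e x * hat (0, e) F (\<xi> x)))
      + (\<Sum>e\<in>EC. ((-1) * y e x) * hat (0, e) F (\<xi> x))))"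
    by (intro ibp_weight weights.const ibp_add ibp_sum EC(1) yw ibp_central splits_ibp[OF s Lw, folded y_def])
  then show ?thesis
  proof (rule ibp_cong)
    fix F x assume n: "nice F"
    obtain F' where F': "(F has_derivative F') (at (\<xi> x))" using nice_derivative[OF n] by blast
    have "fld (\<kappa> *\<^sub>R A, 0) (\<xi> x) = \<kappa> *\<^sub>R fld (A, 0) (\<xi> x)"
      by (simp add: fld_def linear_cmul[OF lin_\<iota>] om.scaleR_left)
    then have "hat (\<kappa> *\<^sub>R A, 0) F (\<xi> x) = \<kappa> * hat (A, 0) F (\<xi> x)"
      unfolding hat_eq[OF F'] using linear_cmul[OF has_derivative_linear[OF F']] by simp
    then show "hat (A, 0) F (\<xi> x) = 1 / \<kappa> * ((hat (\<kappa> *\<^sub>R A, 0) F (\<xi> x) + (\<Sum>e\<in>EC. y e x * hat (0, e) F (\<xi> x)))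
      + (\<Sum>e\<in>EC. ((-1) * y e x) * hat (0, e) F (\<xi> x)))"
      using \<kappa> by (simp add: sum_negf)
  qed
qed

lemma ibp_hat: "ibp (\<lambda>F x. hat h F (\<xi> x))"
proof -
  have "ibp (\<lambda>F x. hat (fst h, 0) F (\<xi> x) + (\<Sum>e\<in>EC. inner (snd h) e * hat (0, e) F (\<xi> x)))"
    by (intro ibp_add ibp_wiener ibp_sum EC(1) ibp_weight weights.const ibp_central)
  then show ?thesis
  proof (rule ibp_cong)
    fix F x assume n: "nice F"
    obtain F' where F': "(F has_derivative F') (at (\<xi> x))" using nice_derivative[OF n] by blast
    have "fld h (\<xi> x) = fld (fst h, 0) (\<xi> x) + (0, snd h)" by (simp add: fld_def)
    then have "F' (fld h (\<xi> x)) = F' (fld (fst h, 0) (\<xi> x)) + F' (0, snd h)"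
      using linear_add[OF has_derivative_linear[OF F']] by (simp only:)
    then show "hat h F (\<xi> x) = hat (fst h, 0) F (\<xi> x) + (\<Sum>e\<in>EC. inner (snd h) e * hat (0, e) F (\<xi> x))"
      unfolding hat_eq[OF F', symmetric] derivative_central[OF F'] .
  qed
qed

lemma ibp_tilde: "ibp (\<lambda>F x. tilde_field \<omega> (cm_embed \<iota> h) F (\<xi> x))"
proof -
  have "ibp (\<lambda>F x. hat h F (\<xi> x) + (\<Sum>e\<in>EC. ((-1) * inner (\<omega> (\<iota> (fst h)) (fst (\<xi> x))) e) * hat (0, e) F (\<xi> x)))"
    by (intro ibp_add ibp_hat ibp_sum EC(1) ibp_weight weights.mult weights.const omega_weight ibp_central)
  then show ?thesis
  proof (rule ibp_cong)
    fix F x assume n: "nice F"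
    obtain F' where F': "(F has_derivative F') (at (\<xi> x))" using nice_derivative[OF n] by blast
    have "inner (\<omega> (fst (\<xi> x)) (\<iota> (fst h))) e = (-1) * inner (\<omega> (\<iota> (fst h)) (fst (\<xi> x))) e" for e
      using skew[of "fst (\<xi> x)" "\<iota> (fst h)"] by (simp add: inner_minus_left)
    then show "tilde_field \<omega> (cm_embed \<iota> h) F (\<xi> x)
      = hat h F (\<xi> x) + (\<Sum>e\<in>EC. ((-1) * inner (\<omega> (\<iota> (fst h)) (fst (\<xi> x))) e) * hat (0, e) F (\<xi> x))"
      unfolding tilde_eq[OF F'] by (simp only:)
  qed
qed

text \<open>The outermost field is removed first: its function argument is the remaining iterated
  derivative, which is \<open>nice\<close>, and the weight it yields is passed on. Hence the
  induction runs over all weights, and one final weight serves the whole set S.\<close>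

lemma ibp_foldr:
  assumes E: "\<And>h. ibp (\<lambda>F x. E h F (\<xi> x))" and nice: "\<And>hs f. f \<in> S \<Longrightarrow> nice (foldr E hs f)" and z: "z \<in> weights"
  shows "\<exists>z'\<in>weights. \<forall>f\<in>S. (\<E> x. foldr E hs f (\<xi> x) * z x) = (\<E> x. f (\<xi> x) * z' x)"
  using z
proof (induction hs arbitrary: z)
  case Nil
  then show ?case by (intro bexI[of _ z]) simp_all
next
  case (Cons h hs)
  from ibpD(2)[OF E[of h] Cons.prems] obtain y where y: "y \<in> weights"
    "\<forall>F. nice F \<longrightarrow> (\<E> x. E h F (\<xi> x) * z x) = (\<E> x. F (\<xi> x) * y x)" by (elim bexE) (rule that)
  from Cons.IH[OF y(1)] obtain z' where z': "z' \<in> weights"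
    "\<forall>f\<in>S. (\<E> x. foldr E hs f (\<xi> x) * y x) = (\<E> x. f (\<xi> x) * z' x)" by (elim bexE) (rule that)
  show ?case
  proof (rule bexI[OF _ z'(1)], rule ballI)
    fix f assume f: "f \<in> S"
    have "(\<E> x. foldr E (h # hs) f (\<xi> x) * z x) = (\<E> x. E h (foldr E hs f) (\<xi> x) * z x)" by simp
    also have "\<dots> = (\<E> x. foldr E hs f (\<xi> x) * y x)" by (rule y(2)[THEN spec, THEN mp, OF nice[OF f]])
    also have "\<dots> = (\<E> x. f (\<xi> x) * z' x)" by (rule bspec[OF z'(2) f])
    finally show "(\<E> x. foldr E (h # hs) f (\<xi> x) * z x) = (\<E> x. f (\<xi> x) * z' x)" .
  qed
qed

lemma iterated_integration_by_parts:
  "\<exists>zt zh. in_all_Lp M zt \<and> in_all_Lp M zh \<and>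
    (\<forall>f. frechet_smooth f \<and> (\<forall>ks. polynomially_bounded (iter_hat \<omega> \<iota> ks f)) \<longrightarrow>
      integrable M (\<lambda>x. iter_tilde \<omega> \<iota> hs f (\<xi> x)) \<and> integrable M (\<lambda>x. f (\<xi> x) * zt x) \<and>
      integrable M (\<lambda>x. iter_hat \<omega> \<iota> hs f (\<xi> x)) \<and> integrable M (\<lambda>x. f (\<xi> x) * zh x) \<and>
      (\<E> x. iter_tilde \<omega> \<iota> hs f (\<xi> x)) = (\<E> x. f (\<xi> x) * zt x) \<and>
      (\<E> x. iter_hat \<omega> \<iota> hs f (\<xi> x)) = (\<E> x. f (\<xi> x) * zh x))"
proof -
  define S where "S = {f :: 'w \<times> 'c \<Rightarrow> real. frechet_smooth f \<and> (\<forall>ks. polynomially_bounded (iter_hat \<omega> \<iota> ks f))}"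
  have nt: "nice (iter_tilde \<omega> \<iota> hs f)" and nh: "nice (iter_hat \<omega> \<iota> hs f)" if "f \<in> S" for hs f
    using that field_algebra_nice[OF _ _ iter_tilde_field_algebra] field_algebra_nice[OF _ _ field_algebra.iter]
    unfolding S_def by blast+
  have nf: "nice f" if "f \<in> S" for f using nh[OF that, of "[]"] by (simp add: iter_hat_def)
  have one: "(\<lambda>_. 1) \<in> weights" by (rule weights.const)
  have "\<exists>z'\<in>weights. \<forall>f\<in>S. (\<E> x. iter_tilde \<omega> \<iota> hs f (\<xi> x) * 1) = (\<E> x. f (\<xi> x) * z' x)"
    unfolding iter_tilde_def by (rule ibp_foldr[OF ibp_tilde _ one]) (erule nt[unfolded iter_tilde_def])
  then obtain zt where zt: "zt \<in> weights" "\<forall>f\<in>S. (\<E> x. iter_tilde \<omega> \<iota> hs f (\<xi> x) * 1) = (\<E> x. f (\<xi> x) * zt x)"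
    by (elim bexE) (rule that)
  have "\<exists>z'\<in>weights. \<forall>f\<in>S. (\<E> x. iter_hat \<omega> \<iota> hs f (\<xi> x) * 1) = (\<E> x. f (\<xi> x) * z' x)"
    unfolding iter_hat_def by (rule ibp_foldr[OF ibp_hat _ one]) (erule nh[unfolded iter_hat_def])
  then obtain zh where zh: "zh \<in> weights" "\<forall>f\<in>S. (\<E> x. iter_hat \<omega> \<iota> hs f (\<xi> x) * 1) = (\<E> x. f (\<xi> x) * zh x)"
    by (elim bexE) (rule that)
  show ?thesis
  proof (rule exI[of _ zt], rule exI[of _ zh], intro conjI allI impI weights_in_all_Lp zt(1) zh(1))
    fix f :: "'w \<times> 'c \<Rightarrow> real"
    assume "frechet_smooth f \<and> (\<forall>ks. polynomially_bounded (iter_hat \<omega> \<iota> ks f))"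
    then have f: "f \<in> S" unfolding S_def mem_Collect_eq .
    show "integrable M (\<lambda>x. iter_tilde \<omega> \<iota> hs f (\<xi> x))" by (rule in_all_LpD(3)[OF nice_in_all_Lp(1)[OF nt[OF f]]])
    show "integrable M (\<lambda>x. iter_hat \<omega> \<iota> hs f (\<xi> x))" by (rule in_all_LpD(3)[OF nice_in_all_Lp(1)[OF nh[OF f]]])
    show "integrable M (\<lambda>x. f (\<xi> x) * zt x)" "integrable M (\<lambda>x. f (\<xi> x) * zh x)"
      by (rule in_all_LpD(3)[OF in_all_Lp_mult[OF nice_in_all_Lp(1)[OF nf[OF f]]]], rule weights_in_all_Lp, rule zt zh)+
    show "(\<E> x. iter_tilde \<omega> \<iota> hs f (\<xi> x)) = (\<E> x. f (\<xi> x) * zt x)" using bspec[OF zt(2) f] by simp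
    show "(\<E> x. iter_hat \<omega> \<iota> hs f (\<xi> x)) = (\<E> x. f (\<xi> x) * zh x)" using bspec[OF zh(2) f] by simp
  qed
qed

end

theorem theorem1p1:
  fixes \<iota> :: "'h::{real_inner,complete_space} \<Rightarrow> 'w::{banach,second_countable_topology}"
    and \<mu> :: "'w measure"
    and \<omega> :: "'w \<Rightarrow> 'w \<Rightarrow> 'c::{real_inner,banach,second_countable_topology}"
    and M :: "'s measure"
    and X :: "real \<Rightarrow> 's \<Rightarrow> 'w \<times> 'c"
    and I :: "real \<Rightarrow> 's \<Rightarrow> 'c"
    and T :: real
    and hs :: "('h \<times> 'c) list"
  assumes "abstract_wiener_space \<iota> \<mu>"
    and "\<exists>E :: 'c set. finite E \<and> span E = UNIV"
    and "bounded_bilinear \<omega>" and "\<And>v w. \<omega> v w = - \<omega> w v"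
    and "prob_space M"
    and "brownian_motion M \<iota> X"
    and "wiener_ito_integral M \<iota> \<omega> X I"
    and "T > 0"
  shows "\<exists>zt zh. in_all_Lp M zt \<and> in_all_Lp M zh \<and>
    (\<forall>f :: 'w \<times> 'c \<Rightarrow> real.
      frechet_smooth f \<and> (\<forall>ks. polynomially_bounded (iter_hat \<omega> \<iota> ks f)) \<longrightarrow>
        integrable M (\<lambda>x. iter_tilde \<omega> \<iota> hs f (heis_brownian X I T x)) \<and>
        integrable M (\<lambda>x. f (heis_brownian X I T x) * zt x) \<and>
        integrable M (\<lambda>x. iter_hat \<omega> \<iota> hs f (heis_brownian X I T x)) \<and>
        integrable M (\<lambda>x. f (heis_brownian X I T x) * zh x) \<and>
        prob_space.expectation M (\<lambda>x. iter_tilde \<omega> \<iota> hs f (heis_brownian X I T x))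
          = prob_space.expectation M (\<lambda>x. f (heis_brownian X I T x) * zt x) \<and>
        prob_space.expectation M (\<lambda>x. iter_hat \<omega> \<iota> hs f (heis_brownian X I T x))
          = prob_space.expectation M (\<lambda>x. f (heis_brownian X I T x) * zh x))"
proof -
  obtain E :: "'c set" where E: "finite E" "span E = UNIV" using assms(2) by blast
  obtain EC where EC: "finite EC" "span EC = span E"
    "\<And>b c. b \<in> EC \<Longrightarrow> c \<in> EC \<Longrightarrow> inner b c = (if b = c then 1 else 0)"
    using orthonormal_basis_of_span[OF E(1)] by blast
  interpret prob_space M by (rule assms(5))
  interpret heis_bm M \<iota> \<mu> X \<omega> I T EC
  proof (intro heis_bm.intro heis_bm_axioms.intro wiener_bm.intro wiener_bm_axioms.intro)
    show "prob_space M" "abstract_wiener_space \<iota> \<mu>" "brownian_motion M \<iota> X" "bounded_bilinear \<omega>"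
      "wiener_ito_integral M \<iota> \<omega> X I" "T > 0" by (rule assms)+
    show "\<omega> v w = - \<omega> w v" for v w by (rule assms(4))
    show "finite EC" "span EC = UNIV" using EC(1,2) E(2) by simp_all
    show "inner b c = (if b = c then 1 else 0)" if "b \<in> EC" "c \<in> EC" for b c using EC(3)[OF that] .
  qed
  show ?thesis by (rule iterated_integration_by_parts)
qed

end
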